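(* Let $X=L^p(0,1)$ with $1\le p<\infty$ and $p\neq2$. There is a sequence $(T_k)_{k\in\mathbb N}\subset\mathcal S(X)$ of strictly singular, non-compact operators with the following property. Put $S_k=\begin{bmatrix}T_k&0\\0&0\end{bmatrix}\in\mathcal S(X\oplus X)$ for $k\in\mathbb N$, and define \[ \mathcal I(S_1):=\{\lambda S_1+R:\lambda\in\mathbb K,\ R\in\mathcal K(X\oplus X)\},\qquad \mathcal I(S_k):=\{\lambda S_k+R:\lambda\in\mathbb K,\ R\in\mathcal I(S_{k-1})\},\ k\ge2. \] Then $\{\mathcal I(S_k):k\in\mathbb N\}$ is a countable increasing chain of non-trivial closed $\mathcal S(X\oplus X)$-subideals of $\mathcal L(X\oplus X)$, and $\mathcal I(S_k)$ and $\mathcal I(S_r)$ are not isomorphic as Banach algebras whenever $k\neq r$.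
   Context: $\mathbb K$ is the scalar field. $\mathcal L(E)$ is the algebra of bounded operators on a Banach space $E$, $\mathcal K(E)$ the compact operators and $\mathcal S(E)$ the strictly singular operators (closed ideals of $\mathcal L(E)$). Operators on $X\oplus X$ are written as $2\times2$ operator matrices $(U_{kl})$ with $U_{kl}=P_kUJ_l\in\mathcal L(X)$, $P_k,J_l$ the canonical projections and inclusions. For a closed ideal $\mathcal J$ of $\mathcal L(E)$, a closed $\mathcal J$-subideal of $\mathcal L(E)$ is a closed linear subspace $\mathcal I\subset\mathcal J$ such that $US,SU\in\mathcal I$ for all $S\in\mathcal I$, $U\in\mathcal J$; it is non-trivial if it is not an ideal of $\mathcal L(E)$. *)

theory Defs
  imports "HOL-Analysis.Analysis"
begin

record ('a, 'k) nspace =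
  nsp_carrier :: "'a set"
  nsp_add :: "'a \<Rightarrow> 'a \<Rightarrow> 'a"
  nsp_smul :: "'k \<Rightarrow> 'a \<Rightarrow> 'a"
  nsp_zero :: "'a"
  nsp_norm :: "'a \<Rightarrow> real"

definition nsp_minus :: "('a, 'k::real_normed_field) nspace \<Rightarrow> 'a \<Rightarrow> 'a \<Rightarrow> 'a" where
  "nsp_minus E x y = nsp_add E x (nsp_smul E (-1) y)"

primrec lsum :: "('a, 'k) nspace \<Rightarrow> (nat \<Rightarrow> 'k) \<Rightarrow> (nat \<Rightarrow> 'a) \<Rightarrow> nat \<Rightarrow> 'a" where
  "lsum E c f 0 = nsp_zero E"
| "lsum E c f (Suc n) = nsp_add E (lsum E c f n) (nsp_smul E (c n) (f n))"

definition lin_subspace :: "('a, 'k) nspace \<Rightarrow> 'a set \<Rightarrow> bool" where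
  "lin_subspace E M \<longleftrightarrow> M \<subseteq> nsp_carrier E \<and> nsp_zero E \<in> M \<and>
     (\<forall>x\<in>M. \<forall>y\<in>M. nsp_add E x y \<in> M) \<and> (\<forall>c. \<forall>x\<in>M. nsp_smul E c x \<in> M)"

definition closed_in_nsp :: "('a, 'k::real_normed_field) nspace \<Rightarrow> 'a set \<Rightarrow> bool" where
  "closed_in_nsp E M \<longleftrightarrow> (\<forall>x y. (\<forall>n. x n \<in> M) \<longrightarrow> y \<in> nsp_carrier E \<longrightarrow>
      (\<lambda>n. nsp_norm E (nsp_minus E (x n) y)) \<longlonglongrightarrow> 0 \<longrightarrow> y \<in> M)"

definition inf_dim :: "('a, 'k::real_normed_field) nspace \<Rightarrow> 'a set \<Rightarrow> bool" where
  "inf_dim E M \<longleftrightarrow> (\<forall>n. \<exists>f. (\<forall>i<n. f i \<in> M) \<and>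
      (\<forall>c. lsum E c f n = nsp_zero E \<longrightarrow> (\<forall>i<n. c i = 0)))"

definition nsp_cauchy :: "('a, 'k::real_normed_field) nspace \<Rightarrow> (nat \<Rightarrow> 'a) \<Rightarrow> bool" where
  "nsp_cauchy E y \<longleftrightarrow> (\<forall>e>0. \<exists>N. \<forall>m\<ge>N. \<forall>n\<ge>N. nsp_norm E (nsp_minus E (y m) (y n)) < e)"

definition bounded_op :: "('a, 'k) nspace \<Rightarrow> ('a \<Rightarrow> 'a) \<Rightarrow> bool" where
  "bounded_op E T \<longleftrightarrow> T \<in> extensional (nsp_carrier E) \<and>
     (\<forall>x\<in>nsp_carrier E. T x \<in> nsp_carrier E) \<and>
     (\<forall>x\<in>nsp_carrier E. \<forall>y\<in>nsp_carrier E. T (nsp_add E x y) = nsp_add E (T x) (T y)) \<and>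
     (\<forall>c. \<forall>x\<in>nsp_carrier E. T (nsp_smul E c x) = nsp_smul E c (T x)) \<and>
     (\<exists>C. \<forall>x\<in>nsp_carrier E. nsp_norm E (T x) \<le> C * nsp_norm E x)"

definition Lops :: "('a, 'k) nspace \<Rightarrow> ('a \<Rightarrow> 'a) set" where
  "Lops E = {T. bounded_op E T}"

definition op_comp :: "('a, 'k) nspace \<Rightarrow> ('a \<Rightarrow> 'a) \<Rightarrow> ('a \<Rightarrow> 'a) \<Rightarrow> ('a \<Rightarrow> 'a)" where
  "op_comp E T S = restrict (\<lambda>x. T (S x)) (nsp_carrier E)"

definition op_add :: "('a, 'k) nspace \<Rightarrow> ('a \<Rightarrow> 'a) \<Rightarrow> ('a \<Rightarrow> 'a) \<Rightarrow> ('a \<Rightarrow> 'a)" where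
  "op_add E T S = restrict (\<lambda>x. nsp_add E (T x) (S x)) (nsp_carrier E)"

definition op_smul :: "('a, 'k) nspace \<Rightarrow> 'k \<Rightarrow> ('a \<Rightarrow> 'a) \<Rightarrow> ('a \<Rightarrow> 'a)" where
  "op_smul E c T = restrict (\<lambda>x. nsp_smul E c (T x)) (nsp_carrier E)"

definition op_zero :: "('a, 'k) nspace \<Rightarrow> ('a \<Rightarrow> 'a)" where
  "op_zero E = restrict (\<lambda>x. nsp_zero E) (nsp_carrier E)"

definition op_norm :: "('a, 'k) nspace \<Rightarrow> ('a \<Rightarrow> 'a) \<Rightarrow> real" where
  "op_norm E T = Sup ((\<lambda>x. nsp_norm E (T x)) ` {x \<in> nsp_carrier E. nsp_norm E x \<le> 1})"

definition op_subspace :: "('a, 'k) nspace \<Rightarrow> ('a \<Rightarrow> 'a) set \<Rightarrow> bool" where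
  "op_subspace E I \<longleftrightarrow> op_zero E \<in> I \<and> (\<forall>T\<in>I. \<forall>S\<in>I. op_add E T S \<in> I) \<and>
     (\<forall>c. \<forall>T\<in>I. op_smul E c T \<in> I)"

definition op_closed :: "('a, 'k::real_normed_field) nspace \<Rightarrow> ('a \<Rightarrow> 'a) set \<Rightarrow> bool" where
  "op_closed E I \<longleftrightarrow> (\<forall>U T. (\<forall>n. U n \<in> I) \<longrightarrow> T \<in> Lops E \<longrightarrow>
     (\<lambda>n. op_norm E (op_add E (U n) (op_smul E (-1) T))) \<longlonglongrightarrow> 0 \<longrightarrow> T \<in> I)"

text \<open>Compact operators: the image of the unit ball is relatively compact, i.e. every
  bounded sequence has a subsequence whose image is Cauchy (the spaces considered are complete).\<close>
definition K_ops :: "('a, 'k::real_normed_field) nspace \<Rightarrow> ('a \<Rightarrow> 'a) set" where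
  "K_ops E = {T \<in> Lops E. \<forall>x::nat \<Rightarrow> 'a. (\<forall>n. x n \<in> nsp_carrier E \<and> nsp_norm E (x n) \<le> 1) \<longrightarrow>
      (\<exists>\<sigma>. strict_mono \<sigma> \<and> nsp_cauchy E (\<lambda>n. T (x (\<sigma> n))))}"

definition SS_ops :: "('a, 'k::real_normed_field) nspace \<Rightarrow> ('a \<Rightarrow> 'a) set" where
  "SS_ops E = {T \<in> Lops E. \<forall>M. lin_subspace E M \<and> closed_in_nsp E M \<and> inf_dim E M \<longrightarrow>
      \<not> (\<exists>\<delta>>0. \<forall>x\<in>M. \<delta> * nsp_norm E x \<le> nsp_norm E (T x))}"

definition is_ideal :: "('a, 'k) nspace \<Rightarrow> ('a \<Rightarrow> 'a) set \<Rightarrow> bool" where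
  "is_ideal E I \<longleftrightarrow> I \<subseteq> Lops E \<and> op_subspace E I \<and>
     (\<forall>S\<in>I. \<forall>U\<in>Lops E. op_comp E U S \<in> I \<and> op_comp E S U \<in> I)"

definition closed_subideal :: "('a, 'k::real_normed_field) nspace \<Rightarrow> ('a \<Rightarrow> 'a) set \<Rightarrow> ('a \<Rightarrow> 'a) set \<Rightarrow> bool" where
  "closed_subideal E J I \<longleftrightarrow> I \<subseteq> J \<and> op_subspace E I \<and> op_closed E I \<and>
     (\<forall>S\<in>I. \<forall>U\<in>J. op_comp E U S \<in> I \<and> op_comp E S U \<in> I)"

definition banach_alg_iso :: "('a, 'k) nspace \<Rightarrow> ('a \<Rightarrow> 'a) set \<Rightarrow> ('a \<Rightarrow> 'a) set \<Rightarrow>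
    (('a \<Rightarrow> 'a) \<Rightarrow> ('a \<Rightarrow> 'a)) \<Rightarrow> bool" where
  "banach_alg_iso E I J \<phi> \<longleftrightarrow> bij_betw \<phi> I J \<and>
     (\<forall>T\<in>I. \<forall>S\<in>I. \<phi> (op_add E T S) = op_add E (\<phi> T) (\<phi> S)) \<and>
     (\<forall>c. \<forall>T\<in>I. \<phi> (op_smul E c T) = op_smul E c (\<phi> T)) \<and>
     (\<forall>T\<in>I. \<forall>S\<in>I. \<phi> (op_comp E T S) = op_comp E (\<phi> T) (\<phi> S)) \<and>
     (\<exists>C. \<forall>T\<in>I. op_norm E (\<phi> T) \<le> C * op_norm E T) \<and>
     (\<exists>C. \<forall>T\<in>I. op_norm E T \<le> C * op_norm E (\<phi> T))"

definition Lp_fun :: "real \<Rightarrow> (real \<Rightarrow> 'k::{real_normed_field,banach,second_countable_topology}) set" where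
  "Lp_fun p = {f. f \<in> borel_measurable lborel \<and>
      set_integrable lborel {0<..<1::real} (\<lambda>x. norm (f x) powr p)}"

definition lp_class :: "(real \<Rightarrow> 'k::{real_normed_field,banach,second_countable_topology}) \<Rightarrow> (real \<Rightarrow> 'k) set" where
  "lp_class f = {g \<in> borel_measurable lborel. AE x in lborel. x \<in> {0<..<1} \<longrightarrow> g x = f x}"

definition lp_rep :: "(real \<Rightarrow> 'k) set \<Rightarrow> (real \<Rightarrow> 'k)" where
  "lp_rep A = (SOME f. f \<in> A)"

definition Lp_space :: "real \<Rightarrow> ((real \<Rightarrow> 'k::{real_normed_field,banach,second_countable_topology}) set, 'k) nspace" where
  "Lp_space p = \<lparr> nsp_carrier = lp_class ` Lp_fun p,
      nsp_add = (\<lambda>A B. lp_class (\<lambda>x. lp_rep A x + lp_rep B x)),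
      nsp_smul = (\<lambda>c A. lp_class (\<lambda>x. c * lp_rep A x)),
      nsp_zero = lp_class (\<lambda>_. 0),
      nsp_norm = (\<lambda>A. (LINT x:{0<..<1}|lborel. norm (lp_rep A x) powr p) powr (1 / p)) \<rparr>"

definition dsum :: "('a, 'k) nspace \<Rightarrow> ('a \<times> 'a, 'k) nspace" where
  "dsum E = \<lparr> nsp_carrier = nsp_carrier E \<times> nsp_carrier E,
      nsp_add = (\<lambda>(a, b) (c, d). (nsp_add E a c, nsp_add E b d)),
      nsp_smul = (\<lambda>c (a, b). (nsp_smul E c a, nsp_smul E c b)),
      nsp_zero = (nsp_zero E, nsp_zero E),
      nsp_norm = (\<lambda>(a, b). nsp_norm E a + nsp_norm E b) \<rparr>"

definition corner :: "('a, 'k) nspace \<Rightarrow> ('a \<Rightarrow> 'a) \<Rightarrow> ('a \<times> 'a \<Rightarrow> 'a \<times> 'a)" where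
  "corner E T = restrict (\<lambda>(a, b). (T a, nsp_zero E)) (nsp_carrier E \<times> nsp_carrier E)"

text \<open>I(S_0) = K + span S_0, I(S_(k+1)) = I(S_k) + span S_(k+1) (0-based indexing).\<close>
primrec subideal_chain :: "('a, 'k) nspace \<Rightarrow> ('a \<Rightarrow> 'a) set \<Rightarrow> (nat \<Rightarrow> ('a \<Rightarrow> 'a)) \<Rightarrow> nat \<Rightarrow> ('a \<Rightarrow> 'a) set" where
  "subideal_chain E B S 0 = {op_add E (op_smul E c (S 0)) R | c R. R \<in> B}"
| "subideal_chain E B S (Suc k) =
     {op_add E (op_smul E c (S (Suc k))) R | c R. R \<in> subideal_chain E B S k}"

end

theory Submission
 imports Defs "HOL-Library.Diagonal_Subsequence"
begin

text \<open>Let \<open>s = min p 2\<close> and \<open>r = max p 2\<close>. On \<open>L\<^sup>p\<close> there are functionals \<open>a n\<close> whose values are \<open>s\<close>-summable and vectors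
  \<open>u n\<close> with an upper \<open>r\<close>-estimate: for \<open>p < 2\<close> averages over disjoint sets and Rademacher functions, for \<open>p > 2\<close>
  Rademacher coefficients and normalised disjoint indicators. Since \<open>s < r\<close>, every bounded block sum
  \<open>\<Sum>n. \<theta> n a n (x) u n\<close> is finitely strictly singular (Milman), and \<open>T k\<close> is such a sum over the \<open>k\<close>-th of infinitely many
  disjoint infinite index sets. For strictly singular \<open>U\<close> both \<open>\<parallel>a n \<circ> U\<parallel>\<close> and \<open>\<parallel>U u n\<parallel>\<close> tend to 0, as otherwise
  gliding humps produce a copy of \<open>l\<^sup>s\<close> or \<open>l\<^sup>r\<close> on which \<open>U\<close> is bounded below. Hence \<open>U S k\<close> and \<open>S k U\<close> are compact, and
  modulo the compact operators the \<open>k\<close>-th algebra is the span of \<open>k + 1\<close> independent elements with zero products.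
  An isomorphism is spatial on the compact operators, so it preserves compactness and this dimension.\<close>

text \<open>The scalars \<open>'k\<close> form an arbitrary complete normed field over the reals, so
  an isometric embedding into the complex numbers is proved first; it supplies compactness of
  bounded sets of scalars, conjugation and the parallelogram law. Weak convergence is replaced by
  differences of subsequences: such differences in L^p can be thinned to obey an upper estimate with
  exponent \<open>min p 2\<close>, the exponent of the functionals \<open>a n\<close>. For the
  vectors \<open>u n\<close> the argument is run in the dual L^q, where \<open>min q 2\<close> is
  conjugate to \<open>max p 2\<close>. The obstacle is p = 1, where this dual argument breaks down;
  the Rademacher functions are there treated through the dyadic martingale formed by images under
  the operator, equi-integrability, and the strict convexity of \<open>sqrt (1 + x^2)\<close>. The
  subideals fail to be ideals because composing with the bounded map (x, y) to (y, 0) moves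
  \<open>S 0\<close> to a place where each member of the chain acts as a compact operator.\<close>

hide_fact (open) Henstock_Kurzweil_Integration.integrable_add Henstock_Kurzweil_Integration.integrable_bound
 Henstock_Kurzweil_Integration.integrable_cong
 Henstock_Kurzweil_Integration.integrable_diff Henstock_Kurzweil_Integration.integrable_sum
 Henstock_Kurzweil_Integration.integral_add Henstock_Kurzweil_Integration.integral_cong
 Henstock_Kurzweil_Integration.integral_diff Henstock_Kurzweil_Integration.integral_mult_right
 Henstock_Kurzweil_Integration.integral_sum

abbreviation (input) lim_seq (infixr "---->" 60) where "lim_seq X L \<equiv> X \<longlonglongrightarrow> L"

section \<open>The scalar field: isometric embedding into the complex numbers\<close>

text \<open>In the formal complexification put z = A + iB. The quantity is the norm of z - w times
  its formal conjugate, hence multiplicative, and z^2 - v^2 = (z - v)(z + v); the factor belonging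
  to -v is bounded below by \<open>M\<close>.\<close>

lemma sum_two_squares_mult_lower:
 fixes A B :: "'k::real_normed_field"
 assumes lower: "!!w. M <= norm ((A - of_real (Re w))\<^sup>2 + (B - of_real (Im w))\<^sup>2)" and "0 <= M"
 shows "M * norm ((A - of_real (Re v))\<^sup>2 + (B - of_real (Im v))\<^sup>2)
     <= norm ((A\<^sup>2 - B\<^sup>2 - of_real (Re (v\<^sup>2)))\<^sup>2 + (2 * A * B - of_real (Im (v\<^sup>2)))\<^sup>2)"
proof -
 have "(A\<^sup>2 - B\<^sup>2 - of_real (Re (v\<^sup>2)))\<^sup>2 + (2 * A * B - of_real (Im (v\<^sup>2)))\<^sup>2
   = ((A - of_real (Re (-v)))\<^sup>2 + (B - of_real (Im (-v)))\<^sup>2) *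
    ((A - of_real (Re v))\<^sup>2 + (B - of_real (Im v))\<^sup>2)"
  by (simp add: power2_eq_square algebra_simps)
 then show ?thesis
  using mult_right_mono[OF lower[of "-v"] norm_ge_zero] by (simp only: norm_mult)
qed

text \<open>The iterates z, z^2, z^4, ... of the formal element z = A + iB, kept as pairs because
  \<open>'k\<close> may or may not contain a square root of -1.\<close>

primrec csquares :: "'k::real_normed_field \<times> 'k => nat => 'k \<times> 'k" where
 "csquares y 0 = y"
| "csquares y (Suc n) = ((fst (csquares y n))\<^sup>2 - (snd (csquares y n))\<^sup>2,
   2 * fst (csquares y n) * snd (csquares y n))"

definition csq_dist :: "'k::real_normed_field \<times> 'k => complex => real" where
 "csq_dist y w = norm ((fst y - of_real (Re w))\<^sup>2 + (snd y - of_real (Im w))\<^sup>2)"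

lemma csq_dist_Suc:
 assumes "!!w. m <= csq_dist (csquares y n) w" "0 <= m"
 shows "m * csq_dist (csquares y n) v <= csq_dist (csquares y (Suc n)) (v\<^sup>2)"
 using sum_two_squares_mult_lower[of m "fst (csquares y n)" "snd (csquares y n)" v] assms
 by (simp add: csq_dist_def)

text \<open>Every \<open>w\<close> is the square of \<open>csqrt w\<close>, so the lower bound at
  one level passes to the next with its square.\<close>

lemma csq_dist_lower:
 assumes "!!w. m <= csq_dist y w" "0 <= m"
 shows "m ^ (2 ^ n) <= csq_dist (csquares y n) w"
proof (induction n arbitrary: w)
 case 0
 then show ?case using assms by simp
next
 case (Suc n)
 have "m ^ 2 ^ Suc n = m ^ 2 ^ n * m ^ 2 ^ n" by (simp add: mult_2 power_add)
 also have "... <= m ^ 2 ^ n * csq_dist (csquares y n) (csqrt w)"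
  using Suc.IH assms(2) by (intro mult_left_mono) auto
 also have "... <= csq_dist (csquares y (Suc n)) ((csqrt w)\<^sup>2)"
  using Suc.IH assms(2) by (intro csq_dist_Suc) auto
 finally show ?case by simp
qed

text \<open>The points \<open>eps\<close>, \<open>eps^2\<close>, \<open>eps^4\<close>, ... are
  followed. All factors but the first are bounded below by powers of \<open>m\<close>; the extra
  factor \<open>m\<close> on the right avoids the exponent 2^n - 1.\<close>

lemma csq_dist_lower_at:
 assumes "!!w. m <= csq_dist y w" "0 < m"
 shows "csq_dist y eps * m ^ (2 ^ n) <= m * csq_dist (csquares y n) (eps ^ (2 ^ n))"
proof (induction n)
 case 0
 then show ?case by (simp add: csq_dist_def)
next
 case (Suc n)
 have "csq_dist y eps * m ^ 2 ^ Suc n = (csq_dist y eps * m ^ 2 ^ n) * m ^ 2 ^ n"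
  by (simp add: mult_2 power_add)
 also have "... <= (m * csq_dist (csquares y n) (eps ^ 2 ^ n)) * m ^ 2 ^ n"
  using Suc assms(2) by (intro mult_right_mono) auto
 also have "... = m * (m ^ 2 ^ n * csq_dist (csquares y n) (eps ^ 2 ^ n))" by simp
 also have "... <= m * csq_dist (csquares y (Suc n)) ((eps ^ 2 ^ n)\<^sup>2)"
  using csq_dist_lower[OF assms(1)] assms(2)
  by (intro mult_left_mono csq_dist_Suc) auto
 also have "(eps ^ 2 ^ n)\<^sup>2 = eps ^ 2 ^ Suc n" by (simp add: power_mult[symmetric] mult.commute)
 finally show ?case .
qed

lemma csquares_bound: "norm (fst (csquares y n)) + norm (snd (csquares y n)) <= (norm (fst y) + norm (snd y)) ^ (2 ^ n)"
proof (induction n)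
 case (Suc n)
 let ?A = "fst (csquares y n)" and ?B = "snd (csquares y n)"
 have "norm (?A\<^sup>2 - ?B\<^sup>2) + norm (2 * ?A * ?B) <= (norm ?A + norm ?B)\<^sup>2"
  using norm_triangle_ineq4[of "?A\<^sup>2" "?B\<^sup>2"]
  by (simp add: norm_mult norm_power power2_eq_square algebra_simps)
 also have "... <= ((norm (fst y) + norm (snd y)) ^ (2 ^ n))\<^sup>2"
  using Suc by (intro power_mono) auto
 finally show ?case by (simp add: power_mult[symmetric] mult.commute)
qed simp

lemma csq_dist_zero: "csq_dist (csquares y n) 0 = csq_dist y 0 ^ (2 ^ n)"
proof (induction n)
 case (Suc n)
 let ?A = "fst (csquares y n)" and ?B = "snd (csquares y n)"
 have "(?A\<^sup>2 - ?B\<^sup>2)\<^sup>2 + (2 * ?A * ?B)\<^sup>2 = (?A\<^sup>2 + ?B\<^sup>2)\<^sup>2"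
  by (simp add: power2_eq_square algebra_simps)
 with Suc show ?case
  by (simp add: csq_dist_def norm_power power_mult[symmetric] mult.commute)
qed simp

lemma csq_dist_upper:
 "csq_dist y w <= csq_dist y 0 + 2 * (norm (fst y) + norm (snd y)) * cmod w + (cmod w)\<^sup>2"
proof -
 have *: "(fst y - of_real (Re w))\<^sup>2 + (snd y - of_real (Im w))\<^sup>2
   = ((fst y)\<^sup>2 + (snd y)\<^sup>2) - of_real (2 * Re w) * fst y - of_real (2 * Im w) * snd y + of_real ((cmod w)\<^sup>2)"
  by (simp only: cmod_power2) (simp add: power2_eq_square algebra_simps)
 have "csq_dist y w <= csq_dist y 0 + norm (of_real (2 * Re w) * fst y) + norm (of_real (2 * Im w) * snd y)
   + norm (of_real ((cmod w)\<^sup>2) :: 'a)"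
  unfolding csq_dist_def *
  by (simp del: norm_of_real, smt (verit) norm_triangle_ineq4 norm_triangle_ineq)
 also have "norm (of_real (2 * Re w) * fst y) <= 2 * cmod w * norm (fst y)"
  by (simp add: norm_mult mult_right_mono abs_Re_le_cmod)
 also have "norm (of_real (2 * Im w) * snd y) <= 2 * cmod w * norm (snd y)"
  by (simp add: norm_mult mult_right_mono abs_Im_le_cmod)
 also have "norm (of_real ((cmod w)\<^sup>2) :: 'a) = (cmod w)\<^sup>2" by (simp only: norm_of_real) simp
 finally show ?thesis by (simp add: algebra_simps)
qed

text \<open>If the minimum \<open>m\<close> of \<open>csq_dist y\<close> is positive, then it is also attained near a minimum point:
 dividing the estimates for the \<open>2\<^sup>n\<close>-th powers by \<open>m ^ (2\<^sup>n - 1)\<close> and letting \<open>n\<close> tend to infinity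
 leaves the value at \<open>eps\<close> below \<open>m\<close>.\<close>
lemma csq_dist_min_nearby:
 fixes y :: "'k::real_normed_field \<times> 'k"
 assumes min: "!!w. m <= csq_dist y w" "0 < m" "csq_dist y 0 = m"
  and small: "(norm (fst y) + norm (snd y)) * cmod eps < m" "(cmod eps)\<^sup>2 < m"
 shows "csq_dist y eps = m"
proof (rule antisym)
 let ?c = "norm (fst y) + norm (snd y)"
 let ?q1 = "?c * cmod eps / m" and ?q2 = "(cmod eps)\<^sup>2 / m"
 have est: "csq_dist y eps <= m * (1 + 2 * ?q1 ^ (2 ^ n) + ?q2 ^ (2 ^ n))" for n
 proof -
  have "csq_dist y eps * m ^ (2 ^ n) <= m * csq_dist (csquares y n) (eps ^ (2 ^ n))"
   using csq_dist_lower_at[OF min(1,2)] .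
  also have "... <= m * (m ^ (2 ^ n) + 2 * (norm (fst (csquares y n)) + norm (snd (csquares y n))) * cmod (eps ^ (2 ^ n))
    + (cmod (eps ^ 2 ^ n))\<^sup>2)"
   using csq_dist_upper[of "csquares y n" "eps ^ (2 ^ n)"] min(2,3)
   by (intro mult_left_mono) (auto simp: csq_dist_zero)
  also have "... <= m * (m ^ (2 ^ n) + 2 * ?c ^ (2 ^ n) * cmod (eps ^ (2 ^ n)) + (cmod (eps ^ 2 ^ n))\<^sup>2)"
   using csquares_bound[of y n] min(2)
   by (intro mult_left_mono add_mono mult_right_mono) auto
  also have "... = m * (m ^ (2 ^ n) + 2 * (?c * cmod eps) ^ (2 ^ n) + ((cmod eps)\<^sup>2) ^ 2 ^ n)"
   by (simp add: norm_power power_mult_distrib power_mult[symmetric] mult.commute)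
  finally have "csq_dist y eps <= m * (m ^ (2 ^ n) + 2 * (?c * cmod eps) ^ (2 ^ n) + ((cmod eps)\<^sup>2) ^ 2 ^ n) / m ^ (2 ^ n)"
   using min(2) by (simp add: pos_le_divide_eq)
  also have "... = m * (1 + 2 * ?q1 ^ (2 ^ n) + ?q2 ^ (2 ^ n))"
   using min(2) by (simp add: power_divide field_simps)
  finally show ?thesis .
 qed
 have inf: "filterlim (%n. 2 ^ n :: nat) sequentially sequentially"
  by (rule filterlim_subseq) (simp add: strict_mono_def)
 have "(%n. ?q1 ^ n) ----> 0" "(%n. ?q2 ^ n) ----> 0"
  using small min(2) by (intro LIMSEQ_power_zero; simp)+
 then have "(%n. ?q1 ^ (2 ^ n)) ----> 0" "(%n. ?q2 ^ (2 ^ n)) ----> 0"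
  by (auto intro: filterlim_compose[OF _ inf])
 then have "(%n. m * (1 + 2 * ?q1 ^ (2 ^ n) + ?q2 ^ (2 ^ n))) ----> m * (1 + 2 * 0 + 0)"
  by (intro tendsto_intros)
 then show "csq_dist y eps <= m"
  using est by (auto intro: LIMSEQ_le_const)
qed (rule min)

text \<open>A minimum point of \<open>h\<close>, the size of (x - Re z)^2 + (Im z)^2 over the
  complex plane, must be a zero. A positive minimum would also be attained at distance
  \<open>e\<close> to the right, again and again, although \<open>h\<close> exceeds
  \<open>h 0\<close> far out.\<close>

lemma real_normed_field_quadratic:
 fixes x :: "'k::real_normed_field"
 obtains a b :: real where "(x - of_real a)\<^sup>2 = - (of_real b)\<^sup>2"
proof -
 define h where "h z = csq_dist (x, 0) z" for z
 have hshift: "csq_dist (x - of_real (Re z), - of_real (Im z)) w = h (z + w)" for z w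
 proof -
  have "- of_real (Im z) - of_real (Im w) = (- of_real (Im z + Im w) :: 'k)" by simp
  then show ?thesis
   by (simp add: csq_dist_def h_def diff_diff_eq)
 qed
 have cont: "continuous_on UNIV h"
  unfolding h_def csq_dist_def by (intro continuous_intros)
 have h_lower: "(cmod z)\<^sup>2 - 2 * norm x * cmod z - (norm x)\<^sup>2 <= h z" for z
 proof -
  have eq: "of_real ((cmod z)\<^sup>2) = ((x - of_real (Re z))\<^sup>2 + (of_real (Im z))\<^sup>2) - x\<^sup>2 + of_real (2 * Re z) * x"
   by (simp only: cmod_power2) (simp add: power2_eq_square algebra_simps)
  have "norm (of_real ((cmod z)\<^sup>2) :: 'k) <= h z + norm (x\<^sup>2) + norm (of_real (2 * Re z) * x)"
   unfolding eq unfolding h_def csq_dist_def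
   by (simp del: norm_of_real, smt (verit) norm_triangle_ineq4 norm_triangle_ineq)
  moreover have "norm (of_real ((cmod z)\<^sup>2) :: 'k) = (cmod z)\<^sup>2" by (simp only: norm_of_real) simp
  moreover have "norm (of_real (2 * Re z) * x) <= 2 * cmod z * norm x"
   by (simp add: norm_mult mult_right_mono abs_Re_le_cmod)
  ultimately show ?thesis by (simp add: norm_power mult_ac)
 qed
 \<comment> \<open>For \<open>cmod z\<close> at least \<open>R\<close> the product of
   \<open>cmod z\<close> and \<open>cmod z - 2 * norm x\<close> exceeds twice the square of
   \<open>norm x\<close>, so the lower bound for \<open>h z\<close> exceeds
   \<open>h 0\<close>.\<close>
 define R where "R = 3 * norm x + 1"
 have far: "h 0 < h z" if "R <= cmod z" for z
 proof -
  have "h 0 = (norm x)\<^sup>2" by (simp add: h_def csq_dist_def norm_power)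
  also have "... < R * (R - 2 * norm x) - (norm x)\<^sup>2"
   by (simp add: R_def power2_eq_square algebra_simps) (smt (verit) norm_ge_zero mult_nonneg_nonneg)
  also have "... <= cmod z * (cmod z - 2 * norm x) - (norm x)\<^sup>2"
   using that by (intro diff_right_mono mult_mono) (auto simp: R_def intro: order_trans[of _ "3 * norm x + 1"])
  also have "... <= h z" using h_lower[of z] by (simp add: power2_eq_square algebra_simps)
  finally show ?thesis .
 qed
 have "0 < R" by (simp add: R_def add_nonneg_pos)
 then have "compact (cball (0::complex) R)" "cball (0::complex) R ~= {}" by simp_all
 then obtain z0 where z0: "!!z. z \<in> cball 0 R ==> h z0 <= h z"
  using continuous_attains_inf[of "cball 0 R" h] continuous_on_subset[OF cont subset_UNIV] by metis
 have min: "h z0 <= h z" for z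
 proof (cases "cmod z <= R")
  case False
  then show ?thesis using far[of z] z0[of 0] \<open>0 < R\<close> by simp
 qed (use z0 in auto)
 have "h z0 = 0"
 proof (rule ccontr)
  assume "h z0 ~= 0"
  then have pos: "0 < h z0" by (simp add: h_def csq_dist_def)
  \<comment> \<open>All minimum points have modulus below \<open>R\<close>, so \<open>c\<close>
    bounds the shifted pair at every one of them and a single step length \<open>e\<close> serves
    for all.\<close>
  define c where "c = norm x + 2 * R + 1"
  have c1: "1 <= c" using \<open>0 < R\<close> norm_ge_zero[of x] unfolding c_def by linarith
  then have c: "c > 0" by simp
  define e where "e = min 1 (h z0 / (2 * c))"
  have e: "0 < e" "c * e < h z0" "e\<^sup>2 < h z0"
  proof -
   show "0 < e" using pos c by (simp add: e_def)
   have "c * e <= h z0 / 2" using c pos by (simp add: e_def min_def field_simps)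
   then show 1: "c * e < h z0" using pos by simp
   have "e * e <= c * e" using \<open>0 < e\<close> c1 by (intro mult_right_mono) (auto simp: e_def)
   then show "e\<^sup>2 < h z0" using 1 by (simp add: power2_eq_square)
  qed
  have step: "h (z + of_real e) = h z0" if "h z = h z0" for z
  proof -
   have "\<not> R <= cmod z" using far[of z] min[of 0] that by auto
   then have "norm (x - of_real (Re z)) + norm (- of_real (Im z) :: 'k) <= c"
    using norm_triangle_ineq4[of x "of_real (Re z)"] abs_Re_le_cmod[of z] abs_Im_le_cmod[of z]
    by (simp add: c_def)
   then have "(norm (x - of_real (Re z)) + norm (- of_real (Im z) :: 'k)) * e <= c * e"
    using e(1) by (intro mult_right_mono) simp_all
   then have small: "(norm (x - of_real (Re z)) + norm (- of_real (Im z) :: 'k)) * e < h z0"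
    using e(2) by (rule le_less_trans)
   have "csq_dist (x - of_real (Re z), - of_real (Im z)) (of_real e) = h z0"
   proof (rule csq_dist_min_nearby)
    show "(norm (fst (x - of_real (Re z), - of_real (Im z) :: 'k)) +
      norm (snd (x - of_real (Re z), - of_real (Im z) :: 'k))) * cmod (of_real e) < h z0"
     using small e(1) by simp
   qed (use e(1,3) in \<open>simp_all add: hshift min that pos\<close>)
   then show ?thesis by (simp add: hshift)
  qed
  have iter: "h (z0 + of_real (of_nat n * e)) = h z0" for n
  proof (induction n)
   case (Suc n)
   from step[OF this] show ?case by (simp add: algebra_simps)
  qed simp
  obtain n where n: "R + cmod z0 < of_nat n * e" using e(1) reals_Archimedean3 by blast
  have "cmod (of_real (of_nat n * e)) <= cmod (z0 + of_real (of_nat n * e)) + cmod z0"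
   by (metis add_diff_cancel_left' norm_triangle_ineq4)
  moreover have "cmod (of_real (of_nat n * e)) = of_nat n * e"
   using e(1) by (simp add: norm_mult)
  ultimately have "R <= cmod (z0 + of_real (of_nat n * e))" using n by linarith
  from far[OF this] iter[of n] min[of 0] show False by simp
 qed
 then have "(x - of_real (Re z0))\<^sup>2 = - (of_real (Im z0))\<^sup>2"
  by (simp add: h_def csq_dist_def eq_neg_iff_add_eq_0)
 then show thesis by (rule that)
qed

text \<open>Multiplicativity forces the norm. For unimodular u all powers of u have norm at most 2,
  so u has norm at most 1; the conjugate obeys the same bound, and the product of the two is
  1.\<close>

lemma norm_complex_plane:
 fixes j :: "'k::real_normed_field"
 assumes j: "j\<^sup>2 = -1"
 shows "norm (of_real (Re z) + of_real (Im z) * j) = cmod z"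
proof -
 define g where "g z = of_real (Re z) + of_real (Im z) * j" for z
 have nj: "norm j = 1"
  by (metis j norm_minus_cancel norm_one norm_power power2_eq_1_iff norm_ge_zero real_norm_def abs_of_nonneg abs_1 abs_square_eq_1)
 have jj: "j * j = -1" using j by (simp add: power2_eq_square)
 have gm: "g (z * w) = g z * g w" for z w
 proof -
  have "g z * g w = of_real (Re z * Re w) + of_real (Re z * Im w + Im z * Re w) * j + of_real (Im z * Im w) * (j * j)"
   by (simp add: g_def algebra_simps)
  then show ?thesis by (simp add: jj g_def)
 qed
 have gp: "g (z ^ n) = g z ^ n" for z n
  by (induction n) (auto simp: gm, simp add: g_def)
 have le2: "norm (g z) <= 2 * cmod z" for z
 proof -
  have "norm (g z) <= \<bar>Re z\<bar> + \<bar>Im z\<bar>" unfolding g_def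
   by (rule norm_triangle_le) (simp add: norm_mult nj)
  then show ?thesis using abs_Re_le_cmod[of z] abs_Im_le_cmod[of z] by linarith
 qed
 have le1: "norm (g u) <= 1" if "cmod u = 1" for u
 proof (rule ccontr)
  assume "\<not> norm (g u) <= 1"
  then obtain n where "2 < norm (g u) ^ n" using real_arch_pow[of "norm (g u)" 2] by auto
  moreover have "norm (g (u ^ n)) <= 2" using le2[of "u ^ n"] that by (simp add: norm_power)
  ultimately show False by (simp add: gp norm_power)
 qed
 have eq1: "norm (g u) = 1" if "cmod u = 1" for u
 proof -
  have "norm (g u) * norm (g (cnj u)) = norm (g (u * cnj u))" by (simp add: gm norm_mult)
  also have "u * cnj u = 1" using that by (simp add: complex_norm_square[symmetric])
  finally have "norm (g u) * norm (g (cnj u)) = 1" by (simp add: g_def)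
  moreover have "norm (g u) * norm (g (cnj u)) <= norm (g u) * 1"
   using le1[of "cnj u"] that by (intro mult_left_mono) auto
  ultimately show ?thesis using le1[OF that] by linarith
 qed
 have "norm (g z) = cmod z"
 proof (cases "z = 0")
  case False
  have "norm (g (of_real (cmod z) * sgn z)) = cmod z"
  proof -
   have "norm (g (of_real (cmod z))) = cmod z" by (simp add: g_def)
   moreover have "norm (g (sgn z)) = 1" using False by (intro eq1) (simp add: norm_sgn)
   ultimately show ?thesis by (simp only: gm norm_mult)
  qed
  moreover have "of_real (cmod z) * sgn z = z" using False by (simp add: sgn_eq)
  ultimately show ?thesis by simp
 qed (simp add: g_def)
 then show ?thesis by (simp add: g_def)
qed

text \<open>With a square root j of -1 the quadratic of each x splits into linear factors, which
  makes the field a copy of the complex numbers; without one the quadratic forces b = 0 and the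
  field is the real line.\<close>

theorem real_normed_field_embeds_complex:
 obtains h :: "'k::real_normed_field => complex"
 where "linear h" "!!x y. h (x * y) = h x * h y" "!!x. cmod (h x) = norm x"
proof (cases "EX j::'k. j\<^sup>2 = -1")
 case True
 then obtain j :: 'k where j: "j\<^sup>2 = -1" by auto
 define g where "g z = of_real (Re z) + of_real (Im z) * j" for z
 have ng: "norm (g z) = cmod z" for z using norm_complex_plane[OF j] by (simp add: g_def)
 have lg: "linear g" unfolding g_def
  by (rule linearI) (auto simp: algebra_simps scaleR_conv_of_real)
 have jj: "j * j = -1" using j by (simp add: power2_eq_square)
 have gm: "g (z * w) = g z * g w" for z w
 proof -
  have "g z * g w = of_real (Re z * Re w) + of_real (Re z * Im w + Im z * Re w) * j + of_real (Im z * Im w) * (j * j)"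
   by (simp add: g_def algebra_simps)
  then show ?thesis by (simp add: jj g_def)
 qed
 have inj: "inj g"
 proof (rule injI)
  fix z w assume "g z = g w"
  then have "g (z - w) = 0" using linear_diff[OF lg, of z w] by simp
  then show "z = w" using ng[of "z - w"] by simp
 qed
 have surj: "EX z. g z = x" for x
 proof -
  obtain a b where ab: "(x - of_real a)\<^sup>2 = - (of_real b)\<^sup>2"
   using real_normed_field_quadratic by blast
  have "(x - of_real a - of_real b * j) * (x - of_real a + of_real b * j) = (x - of_real a)\<^sup>2 - (of_real b)\<^sup>2 * (j * j)"
   by (simp add: power2_eq_square algebra_simps)
  also have "... = 0" by (simp add: ab jj)
  finally consider "x - of_real a - of_real b * j = 0" | "x - of_real a + of_real b * j = 0"
   unfolding mult_eq_0_iff by blast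
  then show ?thesis
  proof cases
   case 1
   then have "g (Complex a b) = x" by (simp add: g_def algebra_simps)
   then show ?thesis by blast
  next
   case 2
   then have "g (Complex a (- b)) = x" by (simp add: g_def algebra_simps eq_neg_iff_add_eq_0)
   then show ?thesis by blast
  qed
 qed
 define h where "h = inv g"
 have gh: "g (h x) = x" for x unfolding h_def using surj by (metis surj_f_inv_f surjI)
 have hg: "h (g z) = z" for z unfolding h_def by (simp add: inj)
 show thesis
 proof (rule that)
  show "linear h"
   by (rule linearI) (metis gh hg linear_add[OF lg], metis gh hg linear_scale[OF lg])
  show "h (x * y) = h x * h y" for x y by (metis gh hg gm)
  show "cmod (h x) = norm x" for x by (metis gh ng)
 qed
next
 case False
 have "EX a. x = of_real a" for x :: 'k
 proof -
  obtain a b where ab: "(x - of_real a)\<^sup>2 = - (of_real b)\<^sup>2"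
   using real_normed_field_quadratic by blast
  have "b = 0"
  proof (rule ccontr)
   assume "b ~= 0"
   then have "((x - of_real a) / of_real b)\<^sup>2 = -1" by (simp add: power_divide ab)
   then show False using False by blast
  qed
  then show ?thesis using ab by auto
 qed
 then obtain h where h: "x = of_real (h x)" for x :: 'k by metis
 have h_of_real: "h (of_real a) = a" for a by (metis h of_real_eq_iff)
 show thesis
 proof (rule that)
  show "linear (%x. complex_of_real (h x))"
  proof (rule linearI)
   fix x y :: 'k and r :: real
   have "h (x + y) = h x + h y" by (metis h h_of_real of_real_add)
   then show "complex_of_real (h (x + y)) = complex_of_real (h x) + complex_of_real (h y)" by simp
   have "h (r *\<^sub>R x) = r * h x" by (metis h h_of_real of_real_mult scaleR_conv_of_real)
   then show "complex_of_real (h (r *\<^sub>R x)) = r *\<^sub>R complex_of_real (h x)"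
    by (simp add: scaleR_conv_of_real)
  qed
  show "complex_of_real (h (x * y)) = complex_of_real (h x) * complex_of_real (h y)" for x y
   by (metis h h_of_real of_real_mult)
  show "cmod (complex_of_real (h x)) = norm x" for x
   by (metis h norm_of_real)
 qed
qed

text \<open>The convergent subsequence is found in the complex plane and pulled back by the isometry
  as a Cauchy sequence, to which completeness of \<open>'k\<close> applies.\<close>

lemma bounded_scalar_seq_subseq:
 fixes x :: "nat => 'k::{real_normed_field, banach}"
 assumes "bounded (range x)"
 obtains r where "strict_mono r" "convergent (x \<circ> r)"
proof -
 obtain h :: "'k => complex" where h: "linear h" "!!x. cmod (h x) = norm x"
  using real_normed_field_embeds_complex by metis
 have "bounded (range (h \<circ> x))" using assms by (auto simp: bounded_iff h(2))
 then obtain l r where r: "strict_mono r" "((h \<circ> x) \<circ> r) ----> l"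
  using bounded_imp_convergent_subsequence by blast
 have "dist (h a) (h b) = dist a b" for a b
  by (simp add: dist_norm h(2) flip: linear_diff[OF h(1)])
 then have "Cauchy (x \<circ> r)"
  using LIMSEQ_imp_Cauchy[OF r(2)] by (simp add: Cauchy_def)
 then show thesis using that r(1) Cauchy_convergent_iff by blast
qed

lemma diagonal_scalar_subseq:
 fixes f :: "nat => nat => 'k::{real_normed_field, banach}"
 assumes bdd: "!!m. bounded (range (f m))"
 obtains r where "strict_mono r" "!!m. convergent (%n. f m (r n))"
proof -
 interpret subseqs "%m r. convergent (%n. f m (r n))"
 proof
  fix m and s :: "nat => nat"
  have "bounded (range (f m \<circ> s))" by (rule bounded_subset[OF bdd[of m]]) auto
  then obtain r' where "strict_mono r'" "convergent ((f m \<circ> s) \<circ> r')"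
   by (rule bounded_scalar_seq_subseq)
  then show "EX r'. strict_mono r' \<and> convergent (%n. f m ((s \<circ> r') n))"
   by (auto simp: o_def)
 qed
 have "convergent (%n. f m (diagseq n))" for m
 proof -
  have "convergent (%n. f m ((diagseq \<circ> (+) (Suc m)) n))"
  proof (rule diagseq_holds)
   fix r s :: "nat => nat" and m assume "strict_mono r" "convergent (%n. f m (s n))"
   then show "convergent (%n. f m ((s \<circ> r) n))"
    using convergent_subseq_convergent[of "%n. f m (s n)" r] by (simp add: o_def)
  qed
  then have "convergent (%n. f m (diagseq (n + Suc m)))" by (simp add: o_def add.commute)
  then show ?thesis by (rule convergent_ignore_initial_segment[THEN iffD1])
 qed
 then show thesis using that subseq_diagseq by blast
qed

section \<open>Normed spaces presented by records: vectors, functionals, operators\<close>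

text \<open>In place of the vector space axioms, \<open>\<iota>\<close> gives coordinates that are
  linear and separate points, so each vector identity reduces by \<open>iota_inject\<close> to an
  identity in the field.\<close>

locale normed_nspace =
 fixes E :: "('a, 'k::{real_normed_field, banach}) nspace" and \<iota> :: "'a => 'b => 'k"
 assumes zero_closed [simp, intro]: "nsp_zero E \<in> nsp_carrier E"
  and add_closed [simp, intro]: "x \<in> nsp_carrier E ==> y \<in> nsp_carrier E ==> nsp_add E x y \<in> nsp_carrier E"
  and smul_closed [simp, intro]: "x \<in> nsp_carrier E ==> nsp_smul E c x \<in> nsp_carrier E"
  and iota_inject: "x \<in> nsp_carrier E ==> y \<in> nsp_carrier E ==> (!!b. \<iota> x b = \<iota> y b) ==> x = y"
  and iota_zero [simp]: "\<iota> (nsp_zero E) b = 0"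
  and iota_add [simp]: "x \<in> nsp_carrier E ==> y \<in> nsp_carrier E ==> \<iota> (nsp_add E x y) b = \<iota> x b + \<iota> y b"
  and iota_smul [simp]: "x \<in> nsp_carrier E ==> \<iota> (nsp_smul E c x) b = c * \<iota> x b"
  and norm_add: "x \<in> nsp_carrier E ==> y \<in> nsp_carrier E ==>
   nsp_norm E (nsp_add E x y) <= nsp_norm E x + nsp_norm E y"
  and norm_smul [simp]: "x \<in> nsp_carrier E ==> nsp_norm E (nsp_smul E c x) = norm c * nsp_norm E x"
  and norm_eq_0D: "x \<in> nsp_carrier E ==> nsp_norm E x = 0 ==> x = nsp_zero E"
begin

abbreviation "V \<equiv> nsp_carrier E"
abbreviation vplus (infixl "\<oplus>" 65) where "x \<oplus> y \<equiv> nsp_add E x y"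
abbreviation vminus (infixl "\<ominus>" 65) where "x \<ominus> y \<equiv> nsp_minus E x y"
abbreviation vsmul (infixr "\<odot>" 75) where "c \<odot> x \<equiv> nsp_smul E c x"
abbreviation vzero ("\<zero>") where "\<zero> \<equiv> nsp_zero E"
abbreviation "N \<equiv> nsp_norm E"

lemma minus_closed [simp, intro]: "x \<in> V ==> y \<in> V ==> x \<ominus> y \<in> V"
 by (simp add: nsp_minus_def)

lemma iota_minus [simp]: "x \<in> V ==> y \<in> V ==> \<iota> (x \<ominus> y) b = \<iota> x b - \<iota> y b"
 by (simp add: nsp_minus_def)

lemma smul_0 [simp]: "x \<in> V ==> 0 \<odot> x = \<zero>"
 by (rule iota_inject) auto

lemma smul_1 [simp]: "x \<in> V ==> 1 \<odot> x = x"
 by (rule iota_inject) auto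

lemma smul_zero [simp]: "c \<odot> \<zero> = \<zero>"
 by (rule iota_inject) auto

lemma norm_zero [simp]: "N \<zero> = 0"
 using norm_smul[of \<zero> 0] by simp

lemma norm_nonneg [simp]: "x \<in> V ==> 0 <= N x"
proof -
 assume x: "x \<in> V"
 have "x \<oplus> (-1) \<odot> x = \<zero>" using x by (intro iota_inject) auto
 then show "0 <= N x" using norm_add[OF x, of "(-1) \<odot> x"] x by simp
qed

lemma norm_eq_0_iff [simp]: "x \<in> V ==> N x = 0 \<longleftrightarrow> x = \<zero>"
 using norm_eq_0D by auto

lemma norm_pos_iff: "x \<in> V ==> 0 < N x \<longleftrightarrow> x ~= \<zero>"
 using norm_nonneg[of x] norm_eq_0_iff[of x] by linarith

lemma minus_self [simp]: "x \<in> V ==> x \<ominus> x = \<zero>"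
 by (rule iota_inject) auto

lemma add_zero [simp]: "x \<in> V ==> x \<oplus> \<zero> = x" "x \<in> V ==> \<zero> \<oplus> x = x"
 by (rule iota_inject; simp)+

lemma minus_zero [simp]: "x \<in> V ==> x \<ominus> \<zero> = x"
 by (rule iota_inject; simp)

lemma minus_eq_zeroD: "x \<ominus> y = \<zero> ==> x \<in> V ==> y \<in> V ==> x = y"
 by (rule iota_inject) (metis iota_minus iota_zero right_minus_eq)+

lemma norm_minus: "x \<in> V ==> y \<in> V ==> N (x \<ominus> y) <= N x + N y"
 using norm_add[of x "(-1) \<odot> y"] by (simp add: nsp_minus_def)

lemma norm_minus_commute: "x \<in> V ==> y \<in> V ==> N (x \<ominus> y) = N (y \<ominus> x)"
proof -
 assume xy: "x \<in> V" "y \<in> V"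
 then have "x \<ominus> y = (-1) \<odot> (y \<ominus> x)" by (intro iota_inject) auto
 then show ?thesis using xy by simp
qed

lemma norm_minus_triangle: "x \<in> V ==> y \<in> V ==> z \<in> V ==> N (x \<ominus> z) <= N (x \<ominus> y) + N (y \<ominus> z)"
proof -
 assume xy: "x \<in> V" "y \<in> V" "z \<in> V"
 then have "x \<ominus> z = (x \<ominus> y) \<oplus> (y \<ominus> z)" by (intro iota_inject) auto
 then show ?thesis using xy norm_add[of "x \<ominus> y" "y \<ominus> z"] by simp
qed

lemma norm_le_minus: "x \<in> V ==> y \<in> V ==> N x <= N (x \<ominus> y) + N y"
 using norm_minus_triangle[of x y \<zero>] by simp

lemma lsum_closed [simp, intro]: "(!!i. i < n ==> f i \<in> V) ==> lsum E c f n \<in> V"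
 by (induction n) auto

lemma iota_lsum [simp]: "(!!i. i < n ==> f i \<in> V) ==> \<iota> (lsum E c f n) b = (\<Sum>i<n. c i * \<iota> (f i) b)"
 by (induction n) auto

lemma norm_lsum: "(!!i. i < n ==> f i \<in> V) ==> N (lsum E c f n) <= (\<Sum>i<n. norm (c i) * N (f i))"
proof (induction n)
 case (Suc n)
 then have "N (lsum E c f (Suc n)) <= N (lsum E c f n) + norm (c n) * N (f n)"
  using norm_add[of "lsum E c f n" "c n \<odot> f n"] by (simp add: less_SucI)
 with Suc show ?case by (simp add: less_SucI) 
qed simp

lemma lsum_in_subspace: "lin_subspace E M ==> (!!i. i < n ==> f i \<in> M) ==> lsum E c f n \<in> M"
 by (induction n) (auto simp: lin_subspace_def)

lemma minus_in_subspace: "lin_subspace E M ==> x \<in> M ==> y \<in> M ==> x \<ominus> y \<in> M"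
 by (auto simp: lin_subspace_def nsp_minus_def)

lemma lsum_add: "(!!i. i < n ==> f i \<in> V) ==> lsum E (%i. c i + d i) f n = lsum E c f n \<oplus> lsum E d f n"
 by (rule iota_inject) (auto simp: algebra_simps sum.distrib)

lemma lsum_smul: "(!!i. i < n ==> f i \<in> V) ==> lsum E (%i. a * c i) f n = a \<odot> lsum E c f n"
 by (rule iota_inject) (auto simp: algebra_simps sum_distrib_left)

lemma lsum_cong: "(!!i. i < n ==> c i = d i \<and> f i = g i) ==> lsum E c f n = lsum E d g n"
 by (induction n) auto

lemma lsum_zero: "(!!i. i < n ==> f i \<in> V) ==> (!!i. i < n ==> c i = 0) ==> lsum E c f n = \<zero>"
 by (rule iota_inject) auto

lemma lsum_single:
 assumes "!!i. i < n ==> f i \<in> V" "k < n"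
 shows "lsum E (%i. if i = k then 1 else 0) f n = f k"
 using assms by (intro iota_inject) (auto simp: if_distrib[of "%x. x * _"] cong: if_cong)

end

definition bounded_functional :: "('a, 'k::real_normed_field) nspace => ('a => 'k) => bool" where
 "bounded_functional E f \<longleftrightarrow>
   (\<forall>x\<in>nsp_carrier E. \<forall>y\<in>nsp_carrier E. f (nsp_add E x y) = f x + f y) \<and>
   (ALL c. \<forall>x\<in>nsp_carrier E. f (nsp_smul E c x) = c * f x) \<and>
   (EX C. \<forall>x\<in>nsp_carrier E. norm (f x) <= C * nsp_norm E x)"

text \<open>Bounded operators again form a normed space in this sense, so that linear combinations,
  limits and \<open>closed_add_line\<close> apply to sets of operators.\<close>

definition opsp :: "('a, 'k) nspace => ('a => 'a, 'k) nspace" where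
 "opsp E = \<lparr> nsp_carrier = Lops E, nsp_add = op_add E, nsp_smul = op_smul E,
   nsp_zero = op_zero E, nsp_norm = op_norm E \<rparr>"

lemma opsp_simps [simp]:
 "nsp_carrier (opsp E) = Lops E" "nsp_add (opsp E) = op_add E" "nsp_smul (opsp E) = op_smul E"
 "nsp_zero (opsp E) = op_zero E" "nsp_norm (opsp E) = op_norm E"
 by (simp_all add: opsp_def)

context normed_nspace
begin

lemma bfun_add: "bounded_functional E f ==> x \<in> V ==> y \<in> V ==> f (x \<oplus> y) = f x + f y"
 and bfun_smul: "bounded_functional E f ==> x \<in> V ==> f (c \<odot> x) = c * f x"
 by (auto simp: bounded_functional_def)

lemma bfun_minus: "bounded_functional E f ==> x \<in> V ==> y \<in> V ==> f (x \<ominus> y) = f x - f y"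
 by (simp add: nsp_minus_def bfun_add bfun_smul)

lemma bfun_zero: "bounded_functional E f ==> f \<zero> = 0"
 using bfun_smul[of f \<zero> 0] by simp

lemma bfun_lsum: "bounded_functional E f ==> (!!i. i < n ==> g i \<in> V) ==> f (lsum E c g n) = (\<Sum>i<n. c i * f (g i))"
 by (induction n) (auto simp: bfun_add bfun_smul bfun_zero)

lemma bfun_bound:
 assumes "bounded_functional E f"
 obtains C where "0 < C" "!!x. x \<in> V ==> norm (f x) <= C * N x"
proof -
 obtain C where C: "\<forall>x\<in>V. norm (f x) <= C * N x" using assms by (auto simp: bounded_functional_def)
 have "norm (f x) <= (\<bar>C\<bar> + 1) * N x" if "x \<in> V" for x
  using C[rule_format, OF that] mult_right_mono[of C "\<bar>C\<bar> + 1" "N x"] norm_nonneg[OF that] by linarith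
 then show ?thesis using that[of "\<bar>C\<bar> + 1"] by auto
qed

lemma LopsD:
 assumes "T \<in> Lops E"
 shows Lops_closed: "x \<in> V ==> T x \<in> V"
  and Lops_add: "x \<in> V ==> y \<in> V ==> T (x \<oplus> y) = T x \<oplus> T y"
  and Lops_smul: "x \<in> V ==> T (c \<odot> x) = c \<odot> T x"
  and Lops_extensional: "T \<in> extensional V"
 using assms by (auto simp: Lops_def bounded_op_def)

lemma LopsI:
 assumes "!!x. x \<in> V ==> f x \<in> V"
  and "!!x y. x \<in> V ==> y \<in> V ==> f (x \<oplus> y) = f x \<oplus> f y"
  and "!!x c. x \<in> V ==> f (c \<odot> x) = c \<odot> f x"
  and "!!x. x \<in> V ==> N (f x) <= C * N x"
 shows "restrict f V \<in> Lops E"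
 unfolding Lops_def bounded_op_def using assms by (auto intro!: exI[of _ C])

lemma Lops_eqI: "S \<in> Lops E ==> T \<in> Lops E ==> (!!x. x \<in> V ==> S x = T x) ==> S = T"
 by (rule extensionalityI[of _ V]) (auto intro: Lops_extensional)

lemma Lops_zero: "T \<in> Lops E ==> T \<zero> = \<zero>"
 using Lops_smul[of T \<zero> 0] Lops_closed[of T \<zero>] by simp

lemma Lops_minus: "T \<in> Lops E ==> x \<in> V ==> y \<in> V ==> T (x \<ominus> y) = T x \<ominus> T y"
 by (simp add: nsp_minus_def Lops_add Lops_smul)

lemma Lops_lsum: "T \<in> Lops E ==> (!!i. i < n ==> f i \<in> V) ==> T (lsum E c f n) = lsum E c (%i. T (f i)) n"
 by (induction n) (auto simp: Lops_add Lops_smul Lops_zero)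

lemma Lops_bounded:
 assumes "T \<in> Lops E"
 obtains C where "0 < C" "!!x. x \<in> V ==> N (T x) <= C * N x"
proof -
 obtain C where C: "\<forall>x\<in>V. N (T x) <= C * N x" using assms by (auto simp: Lops_def bounded_op_def)
 have "N (T x) <= (\<bar>C\<bar> + 1) * N x" if "x \<in> V" for x
  using C[rule_format, OF that] mult_right_mono[of C "\<bar>C\<bar> + 1" "N x"] norm_nonneg[OF that] by linarith
 then show ?thesis using that[of "\<bar>C\<bar> + 1"] by auto
qed

lemma op_norm_bdd: "T \<in> Lops E ==> bdd_above ((%x. N (T x)) ` {x \<in> V. N x <= 1})"
proof -
 assume T: "T \<in> Lops E"
 then obtain C where C: "0 < C" "!!x. x \<in> V ==> N (T x) <= C * N x" using Lops_bounded by blast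
 have "N (T x) <= C" if "x \<in> V" "N x <= 1" for x
  using C(2)[OF that(1)] mult_left_mono[OF that(2), of C] C(1) by linarith
 then show ?thesis by (intro bdd_aboveI[of _ C]) auto
qed

lemma op_norm_ge: "T \<in> Lops E ==> x \<in> V ==> N x <= 1 ==> N (T x) <= op_norm E T"
 unfolding op_norm_def by (rule cSup_upper) (auto intro: op_norm_bdd)

lemma op_norm_nonneg: "T \<in> Lops E ==> 0 <= op_norm E T"
 using op_norm_ge[of T \<zero>] by (simp add: Lops_zero)

lemma op_norm_bound: "T \<in> Lops E ==> x \<in> V ==> N (T x) <= op_norm E T * N x"
proof (cases "x = \<zero>")
 case False
 assume T: "T \<in> Lops E" and x: "x \<in> V"
 then have pos: "0 < N x" using False by (simp add: norm_pos_iff)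
 have "N (T (of_real (1 / N x) \<odot> x)) <= op_norm E T"
  using pos x T by (intro op_norm_ge) (auto simp: norm_divide)
 then show ?thesis using T x pos by (simp add: Lops_smul Lops_closed norm_divide field_simps)
qed (simp add: Lops_zero)

lemma op_norm_le: "(!!x. x \<in> V ==> N (T x) <= C * N x) ==> 0 <= C ==> op_norm E T <= C"
proof -
 assume C: "!!x. x \<in> V ==> N (T x) <= C * N x" "0 <= C"
 have "{x \<in> V. N x <= 1} ~= {}" by (auto intro!: exI[of _ \<zero>])
 moreover have "N (T x) <= C" if "x \<in> V" "N x <= 1" for x
  using C(1)[OF that(1)] mult_left_mono[OF that(2) C(2)] by simp
 ultimately show ?thesis unfolding op_norm_def by (intro cSup_least) auto
qed

lemma op_zero_apply [simp]: "x \<in> V ==> op_zero E x = \<zero>"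
 and op_add_apply [simp]: "x \<in> V ==> op_add E S T x = S x \<oplus> T x"
 and op_smul_apply [simp]: "x \<in> V ==> op_smul E c T x = c \<odot> T x"
 and op_comp_apply [simp]: "x \<in> V ==> op_comp E S T x = S (T x)"
 by (simp_all add: op_zero_def op_add_def op_smul_def op_comp_def)

lemma op_zero_in [simp, intro]: "op_zero E \<in> Lops E"
 unfolding op_zero_def by (rule LopsI[where C = 0]) auto

lemma op_add_in [simp, intro]:
 assumes S: "S \<in> Lops E" and T: "T \<in> Lops E" shows "op_add E S T \<in> Lops E"
 unfolding op_add_def
proof (rule LopsI[where C = "op_norm E S + op_norm E T"])
 fix x y c assume xy: "x \<in> V" "y \<in> V"
 note cl = Lops_closed[OF S] Lops_closed[OF T]
 show "S x \<oplus> T x \<in> V" using xy cl by simp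
 show "S (x \<oplus> y) \<oplus> T (x \<oplus> y) = S x \<oplus> T x \<oplus> (S y \<oplus> T y)"
  using xy cl by (intro iota_inject) (auto simp: Lops_add[OF S] Lops_add[OF T])
 show "S (c \<odot> x) \<oplus> T (c \<odot> x) = c \<odot> (S x \<oplus> T x)"
  using xy cl by (intro iota_inject) (auto simp: Lops_smul[OF S] Lops_smul[OF T] algebra_simps)
 show "N (S x \<oplus> T x) <= (op_norm E S + op_norm E T) * N x"
  using norm_add[of "S x" "T x"] op_norm_bound[OF S, of x] op_norm_bound[OF T, of x] xy cl
  by (simp add: algebra_simps)
qed

lemma op_smul_in [simp, intro]:
 assumes T: "T \<in> Lops E" shows "op_smul E c T \<in> Lops E"
 unfolding op_smul_def
proof (rule LopsI[where C = "norm c * op_norm E T"])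
 fix x y d assume xy: "x \<in> V" "y \<in> V"
 note cl = Lops_closed[OF T]
 show "c \<odot> T x \<in> V" using xy cl by simp
 show "c \<odot> T (x \<oplus> y) = c \<odot> T x \<oplus> c \<odot> T y"
  using xy cl by (intro iota_inject) (auto simp: Lops_add[OF T] algebra_simps)
 show "c \<odot> T (d \<odot> x) = d \<odot> c \<odot> T x"
  using xy cl by (intro iota_inject) (auto simp: Lops_smul[OF T] algebra_simps)
 show "N (c \<odot> T x) <= norm c * op_norm E T * N x"
  using op_norm_bound[OF T, of x] xy cl by (simp add: mult_left_mono mult.assoc)
qed

lemma op_comp_in [simp, intro]:
 assumes S: "S \<in> Lops E" and T: "T \<in> Lops E" shows "op_comp E S T \<in> Lops E"
 unfolding op_comp_def
proof (rule LopsI[where C = "op_norm E S * op_norm E T"])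
 fix x y c assume xy: "x \<in> V" "y \<in> V"
 note cl = Lops_closed[OF S] Lops_closed[OF T]
 show "S (T x) \<in> V" using xy cl by simp
 show "S (T (x \<oplus> y)) = S (T x) \<oplus> S (T y)" "S (T (c \<odot> x)) = c \<odot> S (T x)"
  using xy cl by (auto simp: Lops_add[OF S] Lops_add[OF T] Lops_smul[OF S] Lops_smul[OF T])
 show "N (S (T x)) <= op_norm E S * op_norm E T * N x"
  using op_norm_bound[OF S, of "T x"] mult_left_mono[OF op_norm_bound[OF T, of x] op_norm_nonneg[OF S]] xy cl
  by (simp add: mult.assoc)
qed

lemma normed_nspace_opsp:
 "normed_nspace (opsp E) (%T (x, b). if x \<in> V then \<iota> (T x) b else 0)"
proof (unfold_locales, unfold opsp_simps)
 fix S T :: "'a => 'a" and c :: 'k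
 assume S: "S \<in> Lops E"
 note cS = Lops_closed[OF S]
 have le: "op_norm E (op_smul E c S) <= norm c * op_norm E S" if S: "S \<in> Lops E" for S c
  using op_norm_bound[OF S] Lops_closed[OF S] op_norm_nonneg[OF S]
  by (intro op_norm_le) (auto simp: mult_left_mono mult.assoc)
 show "op_norm E (op_smul E c S) = norm c * op_norm E S"
 proof (rule antisym[OF le[OF S]])
  show "norm c * op_norm E S <= op_norm E (op_smul E c S)"
  proof (cases "c = 0")
   case False
   have "op_smul E (1 / c) (op_smul E c S) = S"
    using S False cS by (intro Lops_eqI) (auto intro!: iota_inject)
   with le[of "op_smul E c S" "1 / c"] False S show ?thesis
    by (simp add: norm_divide field_simps)
  qed (use op_norm_nonneg[of "op_smul E c S"] S in simp)
 qed
 show "op_norm E S = 0 ==> S = op_zero E"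
  using op_norm_bound[OF S] cS S norm_nonneg[OF cS]
  by (intro Lops_eqI) (auto intro!: norm_eq_0D antisym)
 assume T: "T \<in> Lops E"
 note cT = Lops_closed[OF T]
 show "op_norm E (op_add E S T) <= op_norm E S + op_norm E T"
 proof (rule op_norm_le)
  fix x assume x: "x \<in> V"
  show "N (op_add E S T x) <= (op_norm E S + op_norm E T) * N x"
   using norm_add[of "S x" "T x"] op_norm_bound[OF S, of x] op_norm_bound[OF T, of x] x cS cT
   by (simp add: algebra_simps)
 qed (use op_norm_nonneg S T in auto)
 show "S = T" if "!!b. (case b of (x, b) => if x \<in> V then \<iota> (S x) b else 0) =
   (case b of (x, b) => if x \<in> V then \<iota> (T x) b else 0)"
 proof (rule Lops_eqI[OF S T])
  fix x assume x: "x \<in> V"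
  then show "S x = T x" using that[of "(x, b)" for b] cS cT by (intro iota_inject) auto
 qed
qed (auto simp: Lops_closed split: prod.split)

end

text \<open>Elimination: an equation with a non-zero coefficient at \<open>k\<close> removes the
  unknown \<open>k\<close>, which leaves one equation and one unknown less. The unknowns are indexed
  by a general finite set because the removed one is arbitrary.\<close>

lemma homogeneous_system:
 fixes a :: "nat => 'i => 'k::field"
 assumes "finite I" "m < card I"
 shows "EX c. (\<exists>i\<in>I. c i ~= 0) \<and> (ALL j<m. (\<Sum>i\<in>I. c i * a j i) = 0)"
 using assms
proof (induction m arbitrary: I a)
 case 0
 then obtain i where "i \<in> I" by (metis card_gt_0_iff ex_in_conv)
 then show ?case by (intro exI[of _ "%_. 1"]) auto
next
 case (Suc m)
 show ?case
 proof (cases "\<forall>i\<in>I. a m i = 0")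
  case True
  obtain c where "\<exists>i\<in>I. c i ~= 0" "ALL j<m. (\<Sum>i\<in>I. c i * a j i) = 0"
   using Suc.IH[of I a] Suc.prems by auto
  then show ?thesis using True by (intro exI[of _ c]) (auto simp: less_Suc_eq)
 next
  case False
  then obtain k where k: "k \<in> I" "a m k ~= 0" by auto
  let ?J = "I - {k}"
  define a' where "a' j i = a j i - a j k * a m i / a m k" for j i
  obtain c where c: "\<exists>i\<in>?J. c i ~= 0" "ALL j<m. (\<Sum>i\<in>?J. c i * a' j i) = 0"
   using Suc.IH[of ?J a'] Suc.prems k by (auto simp: less_diff_conv)
  define d where "d = c (k := - (\<Sum>i\<in>?J. c i * a m i) / a m k)"
  have split: "(\<Sum>i\<in>I. d i * a j i) = d k * a j k + (\<Sum>i\<in>?J. c i * a j i)" for j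
  proof -
   have "(\<Sum>i\<in>I. d i * a j i) = d k * a j k + (\<Sum>i\<in>?J. d i * a j i)"
    using Suc.prems(1) k(1) by (simp add: sum.remove)
   also have "(\<Sum>i\<in>?J. d i * a j i) = (\<Sum>i\<in>?J. c i * a j i)"
    by (rule sum.cong) (auto simp: d_def)
   finally show ?thesis .
  qed
  have "(\<Sum>i\<in>I. d i * a j i) = 0" if "j < Suc m" for j
  proof (cases "j = m")
   case True
   then show ?thesis unfolding split using k(2) by (simp add: d_def)
  next
   case False
   have "0 = (\<Sum>i\<in>?J. c i * a' j i)" using c(2) False that by simp
   also have "... = (\<Sum>i\<in>?J. c i * a j i) - (\<Sum>i\<in>?J. c i * a m i) * (a j k / a m k)"
    by (simp add: a'_def algebra_simps sum_subtractf sum_distrib_left sum_divide_distrib)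
   finally show ?thesis unfolding split by (simp add: d_def)
  qed
  moreover have "\<exists>i\<in>I. d i ~= 0" using c(1) by (auto simp: d_def)
  ultimately show ?thesis by blast
 qed
qed

section \<open>Limits, closed subspaces and compact operators\<close>

definition nsp_lim :: "('a, 'k::real_normed_field) nspace => (nat => 'a) => 'a => bool" where
 "nsp_lim E x l \<longleftrightarrow> l \<in> nsp_carrier E \<and> (%n. nsp_norm E (nsp_minus E (x n) l)) ----> 0"

definition nsp_complete :: "('a, 'k::real_normed_field) nspace => bool" where
 "nsp_complete E \<longleftrightarrow> (ALL x. (ALL n. x n \<in> nsp_carrier E) --> nsp_cauchy E x --> (EX l. nsp_lim E x l))"

context normed_nspace
begin

lemma nsp_limI:
 assumes "l \<in> V" "!!n. x n \<in> V" "!!n. N (x n \<ominus> l) <= e n" "e ----> 0"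
 shows "nsp_lim E x l"
 unfolding nsp_lim_def using assms by (auto intro: tendsto_sandwich[of "%_. 0" _ _ e])

lemma closed_in_nspD: "closed_in_nsp E M ==> nsp_lim E x l ==> (!!n. x n \<in> M) ==> l \<in> M"
 unfolding closed_in_nsp_def nsp_lim_def by blast

lemma nsp_lim_unique:
 assumes "nsp_lim E x l" "nsp_lim E x m" "!!n. x n \<in> V"
 shows "l = m"
proof -
 have lm: "l \<in> V" "m \<in> V" using assms by (auto simp: nsp_lim_def)
 have "(%n. N (x n \<ominus> l) + N (x n \<ominus> m)) ----> 0 + 0"
  using assms(1,2) unfolding nsp_lim_def by (intro tendsto_add) auto
 moreover have "N (l \<ominus> m) <= N (x n \<ominus> l) + N (x n \<ominus> m)" for n
  using norm_minus_triangle[of l "x n" m] lm assms(3) by (simp add: norm_minus_commute)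
 ultimately have "N (l \<ominus> m) <= 0" by (intro LIMSEQ_le_const[of _ 0]) auto
 then have "N (l \<ominus> m) = 0" using norm_nonneg[OF minus_closed[OF lm]] by linarith
 then have "l \<ominus> m = \<zero>" using lm by (intro norm_eq_0D) auto
 then show ?thesis using lm by (rule minus_eq_zeroD)
qed

lemma nsp_lim_add:
 assumes "nsp_lim E x l" "nsp_lim E y m" "!!n. x n \<in> V" "!!n. y n \<in> V"
 shows "nsp_lim E (%n. x n \<oplus> y n) (l \<oplus> m)"
proof -
 have lm: "l \<in> V" "m \<in> V" using assms by (auto simp: nsp_lim_def)
 show ?thesis
 proof (rule nsp_limI)
  have "(%n. N (x n \<ominus> l) + N (y n \<ominus> m)) ----> 0 + 0"
   using assms(1,2) unfolding nsp_lim_def by (intro tendsto_add) auto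
  then show "(%n. N (x n \<ominus> l) + N (y n \<ominus> m)) ----> 0" by simp
  fix n
  have "(x n \<oplus> y n) \<ominus> (l \<oplus> m) = (x n \<ominus> l) \<oplus> (y n \<ominus> m)"
   using assms lm by (intro iota_inject) auto
  then show "N ((x n \<oplus> y n) \<ominus> (l \<oplus> m)) <= N (x n \<ominus> l) + N (y n \<ominus> m)"
   using norm_add assms lm by simp
 qed (use lm assms in auto)
qed

lemma nsp_lim_Lops:
 assumes T: "T \<in> Lops E" and lim: "nsp_lim E x l" and x: "!!n. x n \<in> V"
 shows "nsp_lim E (%n. T (x n)) (T l)"
proof (rule nsp_limI)
 have l: "l \<in> V" using lim by (auto simp: nsp_lim_def)
 show "T l \<in> V" "!!n. T (x n) \<in> V" using Lops_closed[OF T] l x by auto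
 have "(%n. op_norm E T * N (x n \<ominus> l)) ----> op_norm E T * 0"
  using lim unfolding nsp_lim_def by (intro tendsto_intros) auto
 then show "(%n. op_norm E T * N (x n \<ominus> l)) ----> 0" by simp
 show "N (T (x n) \<ominus> T l) <= op_norm E T * N (x n \<ominus> l)" for n
  using op_norm_bound[OF T, of "x n \<ominus> l"] l x by (simp add: Lops_minus[OF T])
qed

lemma nsp_lim_smul:
 assumes "nsp_lim E x l" "!!n. x n \<in> V"
 shows "nsp_lim E (%n. c \<odot> x n) (c \<odot> l)"
proof -
 have "restrict (%x. c \<odot> x) V \<in> Lops E"
  by (rule LopsI[where C = "norm c"]) (auto intro!: iota_inject simp: algebra_simps)
 from nsp_lim_Lops[OF this assms] assms(1) show ?thesis
  using assms(2) by (simp add: nsp_lim_def)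
qed

lemma nsp_lim_bfun:
 assumes f: "bounded_functional E f" and lim: "nsp_lim E x l" and x: "!!n. x n \<in> V"
 shows "(%n. f (x n)) ----> f l"
proof -
 have l: "l \<in> V" using lim by (auto simp: nsp_lim_def)
 obtain C where C: "0 < C" "!!x. x \<in> V ==> norm (f x) <= C * N x" using bfun_bound[OF f] by blast
 have "(%n. C * N (x n \<ominus> l)) ----> C * 0"
  using lim unfolding nsp_lim_def by (intro tendsto_intros) auto
 then have C0: "(%n. C * N (x n \<ominus> l)) ----> 0" by simp
 have "\<forall>\<^sub>F n in sequentially. norm (f (x n \<ominus> l)) <= C * N (x n \<ominus> l)"
  using C(2)[OF minus_closed[OF x l]] by simp
 from Lim_null_comparison[OF this C0] have "(%n. f (x n \<ominus> l)) ----> 0" .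
 then have "(%n. f (x n) - f l) ----> 0" using x l by (simp add: bfun_minus[OF f])
 then show ?thesis by (simp add: LIM_zero_iff)
qed

lemma nsp_lim_norm:
 assumes lim: "nsp_lim E x l" and x: "!!n. x n \<in> V"
 shows "(%n. N (x n)) ----> N l"
proof -
 have l: "l \<in> V" using lim by (auto simp: nsp_lim_def)
 have "\<bar>N (x n) - N l\<bar> <= N (x n \<ominus> l)" for n
  using norm_le_minus[of "x n" l] norm_le_minus[of l "x n"] l x by (simp add: norm_minus_commute)
 then have "\<forall>\<^sub>F n in sequentially. norm (N (x n) - N l) <= N (x n \<ominus> l)" by simp
 from Lim_null_comparison[OF this] have "(%n. N (x n) - N l) ----> 0"
  using lim unfolding nsp_lim_def by blast
 then show ?thesis by (simp add: LIM_zero_iff)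
qed

text \<open>If \<open>S\<close> lies outside the closed \<open>M\<close>, its positive distance from
  \<open>M\<close> bounds the coefficient of \<open>S\<close> by the norm of the sum. The
  coefficients of a convergent sequence are then Cauchy, and the parts in \<open>M\<close> converge
  as well.\<close>

lemma closed_add_line:
 assumes lin: "lin_subspace E M" and cl: "closed_in_nsp E M" and S: "S \<in> V"
 shows "lin_subspace E {c \<odot> S \<oplus> m | c m. m \<in> M}" "closed_in_nsp E {c \<odot> S \<oplus> m | c m. m \<in> M}"
proof -
 let ?L = "{c \<odot> S \<oplus> m | c m. m \<in> M}"
 have MV: "!!x. x \<in> M ==> x \<in> V" and z: "\<zero> \<in> M" and Madd: "!!x y. x \<in> M ==> y \<in> M ==> x \<oplus> y \<in> M"
  and Msm: "!!c x. x \<in> M ==> c \<odot> x \<in> M"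
  using lin by (auto simp: lin_subspace_def)
 show "lin_subspace E ?L"
  unfolding lin_subspace_def
 proof (intro conjI ballI allI)
  show "?L \<subseteq> V" using MV S by auto
  show "\<zero> \<in> ?L" using z S by (auto intro!: exI[of _ 0] exI[of _ \<zero>])
  fix x assume "x \<in> ?L"
  then obtain c m where x: "x = c \<odot> S \<oplus> m" "m \<in> M" by auto
  { fix d
   have "d \<odot> x = (d * c) \<odot> S \<oplus> d \<odot> m" using x S MV
    by (intro iota_inject) (auto simp: algebra_simps)
   then show "d \<odot> x \<in> ?L" using x Msm by blast }
  fix y assume "y \<in> ?L"
  then obtain d n where y: "y = d \<odot> S \<oplus> n" "n \<in> M" by auto
  have "x \<oplus> y = (c + d) \<odot> S \<oplus> (m \<oplus> n)" using x y S MV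
   by (intro iota_inject) (auto simp: algebra_simps)
  then show "x \<oplus> y \<in> ?L" using x y Madd by blast
 qed
 show "closed_in_nsp E ?L"
 proof (cases "S \<in> M")
  case True
  have "?L = M"
  proof (intro equalityI subsetI)
   fix x assume "x \<in> M"
   then have "x = 0 \<odot> S \<oplus> x" using S MV by simp
   then show "x \<in> ?L" using \<open>x \<in> M\<close> by blast
  qed (use True Madd Msm in auto)
  then show ?thesis using cl by simp
 next
  case False
  have "EX d>0. \<forall>m\<in>M. d <= N (S \<oplus> m)"
  proof (rule ccontr)
   assume "\<not> ?thesis"
   then have "ALL n. \<exists>m\<in>M. N (S \<oplus> m) < 1 / real (Suc n)"
    by (meson not_le of_nat_0_less_iff zero_less_Suc zero_less_divide_1_iff)
   then obtain m where m: "!!n. m n \<in> M" "!!n. N (S \<oplus> m n) < 1 / real (Suc n)" by metis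
   have eq: "N ((-1) \<odot> m n \<ominus> S) = N (S \<oplus> m n)" for n
   proof -
    have "(-1) \<odot> m n \<ominus> S = (-1) \<odot> (S \<oplus> m n)" using m S MV by (intro iota_inject) auto
    then show ?thesis using m S MV by simp
   qed
   have "nsp_lim E (%n. (-1) \<odot> m n) S"
    using m(2) MV[OF m(1)] S LIMSEQ_inverse_real_of_nat
    by (intro nsp_limI[where e = "%n. inverse (real (Suc n))"]) (auto simp: eq inverse_eq_divide intro: less_imp_le)
   then have "S \<in> M" by (rule closed_in_nspD[OF cl]) (rule Msm[OF m(1)])
   with False show False ..
  qed
  then obtain d where d: "0 < d" "!!m. m \<in> M ==> d <= N (S \<oplus> m)" by auto
  have dc: "d * norm c <= N (c \<odot> S \<oplus> m)" if "m \<in> M" for c m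
  proof (cases "c = 0")
   case False
   have "c \<odot> S \<oplus> m = c \<odot> (S \<oplus> (1 / c) \<odot> m)" using that S MV False by (intro iota_inject) (auto simp: field_simps)
   then show ?thesis using d(2)[OF Msm[OF that], of "1/c"] S MV that
    using mult_left_mono[of d "N (S \<oplus> (1 / c) \<odot> m)" "norm c"] by (simp add: mult.commute)
  qed (use that MV S in auto)
  show ?thesis
   unfolding closed_in_nsp_def
  proof (intro allI impI)
   fix x y assume x: "ALL n. x n \<in> ?L" and y: "y \<in> V" and lim: "(%n. N (x n \<ominus> y)) ----> 0"
   have "ALL n. EX c m. x n = c \<odot> S \<oplus> m \<and> m \<in> M" using x by auto
   then obtain c m where cm: "!!n. x n = c n \<odot> S \<oplus> m n" "!!n. m n \<in> M" by metis
   have xV: "x n \<in> V" for n using cm S MV by auto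
   have le: "d * norm (c n - c k) <= N (x n \<ominus> y) + N (x k \<ominus> y)" for n k
   proof -
    have "x n \<ominus> x k = (c n - c k) \<odot> S \<oplus> (m n \<ominus> m k)"
     unfolding cm(1) using cm S MV by (intro iota_inject) (auto simp: algebra_simps)
    then have "d * norm (c n - c k) <= N (x n \<ominus> x k)"
     using dc minus_in_subspace[OF lin cm(2) cm(2)] by simp
    also have "... <= N (x n \<ominus> y) + N (x k \<ominus> y)"
     using norm_minus_triangle[of "x n" y "x k"] xV y by (simp add: norm_minus_commute)
    finally show ?thesis .
   qed
   have "Cauchy c"
   proof (rule metric_CauchyI)
    fix e :: real assume e: "0 < e"
    then have "0 < d * e / 2" using d by simp
    from LIMSEQ_D[OF lim this] obtain n0 where n0: "!!n. n >= n0 ==> N (x n \<ominus> y) < d * e / 2"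
     using xV y by auto
    have "dist (c n) (c k) < e" if "n >= n0" "k >= n0" for n k
    proof -
     have "d * norm (c n - c k) < d * e" using le[of n k] n0[OF that(1)] n0[OF that(2)] by simp
     then show ?thesis using d by (simp add: dist_norm)
    qed
    then show "EX M. ALL m>=M. ALL n>=M. dist (c m) (c n) < e" by blast
   qed
   then obtain c0 where c0: "c ----> c0" using Cauchy_convergent convergent_def by blast
   have "nsp_lim E m (y \<ominus> c0 \<odot> S)"
   proof (rule nsp_limI)
    have "(%n. N (x n \<ominus> y) + norm (c0 - c n) * N S) ----> 0 + norm (c0 - c0) * N S"
     using lim c0 by (intro tendsto_intros)
    then show "(%n. N (x n \<ominus> y) + norm (c0 - c n) * N S) ----> 0" by simp
    fix n
    have "m n \<ominus> (y \<ominus> c0 \<odot> S) = (x n \<ominus> y) \<oplus> (c0 - c n) \<odot> S"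
     using cm y S MV by (intro iota_inject) (auto simp: algebra_simps)
    then show "N (m n \<ominus> (y \<ominus> c0 \<odot> S)) <= N (x n \<ominus> y) + norm (c0 - c n) * N S"
     using norm_add[of "x n \<ominus> y" "(c0 - c n) \<odot> S"] xV y S by simp
   qed (use cm MV y S in auto)
   then have "y \<ominus> c0 \<odot> S \<in> M" by (rule closed_in_nspD[OF cl]) (rule cm(2))
   moreover have "y = c0 \<odot> S \<oplus> (y \<ominus> c0 \<odot> S)" using y S by (intro iota_inject) auto
   ultimately show "y \<in> ?L" by blast
  qed
 qed
qed

lemma nsp_cauchy_subseq: "nsp_cauchy E y ==> strict_mono r ==> nsp_cauchy E (%n. y (r n))"
 unfolding nsp_cauchy_def by (meson le_trans seq_suble)

lemma nsp_cauchy_add: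
 assumes x: "nsp_cauchy E x" "!!n. x n \<in> V" and y: "nsp_cauchy E y" "!!n. y n \<in> V"
 shows "nsp_cauchy E (%n. x n \<oplus> y n)"
 unfolding nsp_cauchy_def
proof (intro allI impI)
 fix e :: real assume "0 < e"
 then have e: "0 < e / 2" by simp
 obtain a where a: "!!m n. m >= a ==> n >= a ==> N (x m \<ominus> x n) < e / 2"
  using x(1) e unfolding nsp_cauchy_def by blast
 obtain b where b: "!!m n. m >= b ==> n >= b ==> N (y m \<ominus> y n) < e / 2"
  using y(1) e unfolding nsp_cauchy_def by blast
 have "N ((x m \<oplus> y m) \<ominus> (x n \<oplus> y n)) < e" if "m >= max a b" "n >= max a b" for m n
 proof -
  have "(x m \<oplus> y m) \<ominus> (x n \<oplus> y n) = (x m \<ominus> x n) \<oplus> (y m \<ominus> y n)"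
   using x y by (intro iota_inject) auto
  then have "N ((x m \<oplus> y m) \<ominus> (x n \<oplus> y n)) <= N (x m \<ominus> x n) + N (y m \<ominus> y n)"
   using norm_add[of "x m \<ominus> x n" "y m \<ominus> y n"] x y by simp
  then show ?thesis using a[of m n] b[of m n] that by simp
 qed
 then show "EX a. ALL m>=a. ALL n>=a. N ((x m \<oplus> y m) \<ominus> (x n \<oplus> y n)) < e" by blast
qed

lemma nsp_cauchy_Lops:
 assumes T: "T \<in> Lops E" and x: "nsp_cauchy E x" "!!n. x n \<in> V"
 shows "nsp_cauchy E (%n. T (x n))"
 unfolding nsp_cauchy_def
proof (intro allI impI)
 fix e :: real assume e: "0 < e"
 obtain C where C: "0 < C" "!!x. x \<in> V ==> N (T x) <= C * N x" using Lops_bounded[OF T] by blast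
 obtain a where a: "!!m n. m >= a ==> n >= a ==> N (x m \<ominus> x n) < e / C"
  using x(1) e C(1) unfolding nsp_cauchy_def by (meson divide_pos_pos)
 have "N (T (x m) \<ominus> T (x n)) < e" if "m >= a" "n >= a" for m n
 proof -
  have "N (T (x m) \<ominus> T (x n)) <= C * N (x m \<ominus> x n)"
   using C(2)[of "x m \<ominus> x n"] x(2) by (simp add: Lops_minus[OF T])
  also have "... < e" using a[OF that] C(1) by (simp add: field_simps)
  finally show ?thesis .
 qed
 then show "EX a. ALL m>=a. ALL n>=a. N (T (x m) \<ominus> T (x n)) < e" by blast
qed

lemma K_ops_Lops: "T \<in> K_ops E ==> T \<in> Lops E"
 by (simp add: K_ops_def)

lemma K_opsD:
 fixes x :: "nat => 'a"
 assumes "T \<in> K_ops E" "!!n. x n \<in> V \<and> N (x n) <= 1"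
 obtains r where "strict_mono r" "nsp_cauchy E (%n. T (x (r n)))"
 using assms unfolding K_ops_def by blast

lemma K_ops_subseq:
 fixes x :: "nat => 'a"
 assumes T: "T \<in> K_ops E" and x: "!!n. x n \<in> V" "!!n. N (x n) <= B"
 obtains r where "strict_mono r" "nsp_cauchy E (%n. T (x (r n)))"
proof -
 define b where "b = \<bar>B\<bar> + 1"
 have b: "0 < b" "B <= b" by (auto simp: b_def)
 let ?y = "%n. of_real (1 / b) \<odot> x n"
 have "?y n \<in> V \<and> N (?y n) <= 1" for n
  using x b order_trans[OF x(2) b(2), of n] by (auto simp: norm_divide)
 then obtain r where r: "strict_mono r" "nsp_cauchy E (%n. T (?y (r n)))"
  by (rule K_opsD[OF T])
 have TL: "T \<in> Lops E" using T by (rule K_ops_Lops)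
 have sm: "restrict (%x. of_real b \<odot> x) V \<in> Lops E"
  by (rule LopsI[where C = "\<bar>b\<bar>"]) (auto intro!: iota_inject simp: algebra_simps)
 have "nsp_cauchy E (%n. restrict (%x. of_real b \<odot> x) V (T (?y (r n))))"
  using Lops_closed[OF TL] x by (intro nsp_cauchy_Lops[OF sm r(2)]) auto
 moreover have "restrict (%x. of_real b \<odot> x) V (T (?y n)) = T (x n)" for n
  using x b Lops_closed[OF TL] by (auto simp: Lops_smul[OF TL] intro!: iota_inject)
 ultimately show thesis using that r(1) by simp
qed

lemma K_opsI:
 assumes "T \<in> Lops E"
  and "!!x :: nat => 'a. (!!n. x n \<in> V) ==> (!!n. N (x n) <= 1) ==>
   EX r. strict_mono r \<and> nsp_cauchy E (%n. T (x (r n)))"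
 shows "T \<in> K_ops E"
 using assms by (auto simp: K_ops_def)

lemma K_ops_separated:
 fixes x :: "nat => 'a"
 assumes T: "T \<in> K_ops E" and x: "!!n. x n \<in> V" "!!n. N (x n) <= B"
  and sep: "0 < d" "!!m n. m ~= n ==> d <= N (T (x m) \<ominus> T (x n))"
 shows False
proof -
 obtain r where r: "strict_mono r" "nsp_cauchy E (%n. T (x (r n)))"
  by (rule K_ops_subseq[OF T x])
 then obtain a where "!!m n. m >= a ==> n >= a ==> N (T (x (r m)) \<ominus> T (x (r n))) < d"
  using sep(1) unfolding nsp_cauchy_def by blast
 from this[of a "Suc a"] sep(2)[of "r a" "r (Suc a)"] show False
  using strict_monoD[OF r(1), of a "Suc a"] by auto
qed

lemma K_ops_zero: "op_zero E \<in> K_ops E"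
 by (rule K_opsI) (auto simp: nsp_cauchy_def intro!: exI[of _ id] strict_mono_id)

lemma K_ops_add:
 assumes S: "S \<in> K_ops E" and T: "T \<in> K_ops E" shows "op_add E S T \<in> K_ops E"
proof (rule K_opsI)
 note SL = K_ops_Lops[OF S] and TL = K_ops_Lops[OF T]
 show "op_add E S T \<in> Lops E" using SL TL by simp
 fix x :: "nat => 'a" assume x: "!!n. x n \<in> V" "!!n. N (x n) <= 1"
 obtain r where r: "strict_mono r" "nsp_cauchy E (%n. S (x (r n)))"
  by (rule K_ops_subseq[OF S x])
 obtain q where q: "strict_mono q" "nsp_cauchy E (%n. T (x (r (q n))))"
  by (rule K_ops_subseq[OF T, of "%n. x (r n)" 1]) (use x in auto)
 have "nsp_cauchy E (%n. S (x (r (q n))) \<oplus> T (x (r (q n))))"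
  using nsp_cauchy_subseq[OF r(2) q(1)] q(2) x Lops_closed[OF SL] Lops_closed[OF TL]
  by (intro nsp_cauchy_add) auto
 then show "EX r. strict_mono r \<and> nsp_cauchy E (%n. op_add E S T (x (r n)))"
  using x strict_mono_o[OF r(1) q(1)] by (intro exI[of _ "r \<circ> q"]) auto
qed

lemma K_ops_comp_left:
 assumes S: "S \<in> Lops E" and T: "T \<in> K_ops E" shows "op_comp E S T \<in> K_ops E"
proof (rule K_opsI)
 note TL = K_ops_Lops[OF T]
 show "op_comp E S T \<in> Lops E" using S TL by simp
 fix x :: "nat => 'a" assume x: "!!n. x n \<in> V" "!!n. N (x n) <= 1"
 obtain r where r: "strict_mono r" "nsp_cauchy E (%n. T (x (r n)))"
  by (rule K_ops_subseq[OF T x])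
 from nsp_cauchy_Lops[OF S r(2)] show "EX r. strict_mono r \<and> nsp_cauchy E (%n. op_comp E S T (x (r n)))"
  using x r(1) Lops_closed[OF TL] by (intro exI[of _ r]) auto
qed

lemma K_ops_comp_right:
 assumes S: "S \<in> K_ops E" and T: "T \<in> Lops E" shows "op_comp E S T \<in> K_ops E"
proof (rule K_opsI)
 note SL = K_ops_Lops[OF S]
 show "op_comp E S T \<in> Lops E" using SL T by simp
 fix x :: "nat => 'a" assume x: "!!n. x n \<in> V" "!!n. N (x n) <= 1"
 have b: "N (T (x n)) <= op_norm E T" for n using op_norm_ge[OF T] x by simp
 obtain r where r: "strict_mono r" "nsp_cauchy E (%n. S (T (x (r n))))"
  by (rule K_ops_subseq[OF S, of "%n. T (x n)" "op_norm E T"]) (use b x Lops_closed[OF T] in auto)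
 then show "EX r. strict_mono r \<and> nsp_cauchy E (%n. op_comp E S T (x (r n)))"
  using x by auto
qed

lemma K_ops_smul:
 assumes T: "T \<in> K_ops E" shows "op_smul E c T \<in> K_ops E"
proof -
 have sm: "restrict (%x. c \<odot> x) V \<in> Lops E"
  by (rule LopsI[where C = "norm c"]) (auto intro!: iota_inject simp: algebra_simps)
 note TL = K_ops_Lops[OF T]
 have "op_smul E c T = op_comp E (restrict (%x. c \<odot> x) V) T"
  using TL sm by (intro Lops_eqI) (auto simp: Lops_closed)
 then show ?thesis using K_ops_comp_left[OF sm T] by simp
qed

lemma lin_subspace_K_ops: "lin_subspace (opsp E) (K_ops E)"
 by (auto simp: lin_subspace_def K_ops_zero K_ops_add K_ops_smul K_ops_Lops)

lemma op_minus_apply [simp]: "x \<in> V ==> nsp_minus (opsp E) S T x = S x \<ominus> T x"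
 by (simp add: nsp_minus_def)

text \<open>A diagonal subsequence makes the images under all \<open>U m\<close> Cauchy at once, and
  a three-epsilon estimate passes this to \<open>T\<close>.\<close>

lemma closed_K_ops: "closed_in_nsp (opsp E) (K_ops E)"
 unfolding closed_in_nsp_def
proof (intro allI impI)
 interpret ops: normed_nspace "opsp E" "%T (x, b). if x \<in> V then \<iota> (T x) b else 0"
  by (rule normed_nspace_opsp)
 fix U T
 assume U: "ALL n. U n \<in> K_ops E" and T: "T \<in> nsp_carrier (opsp E)"
  and lim: "(%n. nsp_norm (opsp E) (nsp_minus (opsp E) (U n) T)) ----> 0"
 have TL: "T \<in> Lops E" using T by simp
 have UL: "U n \<in> Lops E" for n using U K_ops_Lops by blast
 show "T \<in> K_ops E"
 proof (rule K_opsI[OF TL])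
  fix x :: "nat => 'a" assume x: "!!n. x n \<in> V" "!!n. N (x n) <= 1"
  interpret subseqs "%m r. nsp_cauchy E (%n. U m (x (r n)))"
  proof
   fix m and s :: "nat => nat"
   obtain r where "strict_mono r" "nsp_cauchy E (%n. U m (x (s (r n))))"
    by (rule K_ops_subseq[OF U[rule_format], of "%n. x (s n)" 1]) (use x in auto)
   then show "EX r. strict_mono r \<and> nsp_cauchy E (%n. U m (x ((s \<circ> r) n)))" by auto
  qed
  define d where "d = diagseq"
  have diag: "nsp_cauchy E (%n. U m (x (d (Suc m + n))))" for m
  proof -
   have "nsp_cauchy E (%n. U m (x ((diagseq \<circ> (+) (Suc m)) n)))"
   proof (rule diagseq_holds)
    fix r s :: "nat => nat" and m
    assume "strict_mono r" "nsp_cauchy E (%n. U m (x (s n)))"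
    from nsp_cauchy_subseq[OF this(2,1)] show "nsp_cauchy E (%n. U m (x ((s \<circ> r) n)))" by simp
   qed
   then show ?thesis by (simp add: d_def)
  qed
  have "nsp_cauchy E (%n. T (x (d n)))"
   unfolding nsp_cauchy_def
  proof (intro allI impI)
   fix e :: real assume "0 < e"
   then have e: "0 < e / 3" by simp
   from LIMSEQ_D[OF lim this] obtain m where "\<bar>op_norm E (nsp_minus (opsp E) (U m) T)\<bar> < e / 3" by auto
   then have m: "N (U m y \<ominus> T y) < e / 3" if "y \<in> V" "N y <= 1" for y
    using op_norm_ge[of "nsp_minus (opsp E) (U m) T" y] ops.minus_closed[of "U m" T] that UL TL by simp
   obtain a where a: "!!i j. i >= a ==> j >= a ==>
     N (U m (x (d (Suc m + i))) \<ominus> U m (x (d (Suc m + j)))) < e / 3"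
    using diag[of m] e unfolding nsp_cauchy_def by blast
   have "N (T (x (d i)) \<ominus> T (x (d j))) < e" if ij: "i >= Suc m + a" "j >= Suc m + a" for i j
   proof -
    let ?y = "x (d i)" and ?z = "x (d j)"
    have cl: "T ?y \<in> V" "T ?z \<in> V" "U m ?y \<in> V" "U m ?z \<in> V"
     using x Lops_closed[OF TL] Lops_closed[OF UL] by auto
    have "N (T ?y \<ominus> T ?z) <= N (T ?y \<ominus> U m ?y) + N (U m ?y \<ominus> T ?z)"
     using norm_minus_triangle cl by blast
    also have "N (U m ?y \<ominus> T ?z) <= N (U m ?y \<ominus> U m ?z) + N (U m ?z \<ominus> T ?z)"
     using norm_minus_triangle cl by blast
    also have "N (T ?y \<ominus> U m ?y) = N (U m ?y \<ominus> T ?y)" using norm_minus_commute cl by simp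
    finally have "N (T ?y \<ominus> T ?z) <= N (U m ?y \<ominus> T ?y) + (N (U m ?y \<ominus> U m ?z) + N (U m ?z \<ominus> T ?z))"
     by simp
    moreover have "N (U m ?y \<ominus> U m ?z) < e / 3"
     using a[of "i - Suc m" "j - Suc m"] ij by simp
    ultimately show ?thesis using m[of ?y] m[of ?z] x by simp
   qed
   then show "EX a. ALL m>=a. ALL n>=a. N (T (x (d m)) \<ominus> T (x (d n))) < e" by blast
  qed
  then show "EX r. strict_mono r \<and> nsp_cauchy E (%n. T (x (r n)))" using subseq_diagseq unfolding d_def by blast
 qed
qed

lemma K_ops_uniform_limit:
 assumes T: "T \<in> Lops E" and F: "!!n. F n \<in> K_ops E"
  and le: "!!n x. x \<in> V ==> N (F n x \<ominus> T x) <= e n * N x" and e: "e ----> 0" "!!n. 0 <= e n"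
 shows "T \<in> K_ops E"
proof -
 have "op_norm E (nsp_minus (opsp E) (F n) T) <= e n" for n
  using le e(2) by (intro op_norm_le) auto
 moreover interpret ops: normed_nspace "opsp E" "%T (x, b). if x \<in> V then \<iota> (T x) b else 0"
  by (rule normed_nspace_opsp)
 have "nsp_lim (opsp E) F T"
  using calculation T K_ops_Lops[OF F] e(1) by (intro ops.nsp_limI[where e = e]) auto
 then show ?thesis using closed_K_ops F unfolding closed_in_nsp_def nsp_lim_def by blast
qed

definition rank_one :: "('a => 'k) => 'a => 'a => 'a" where
 "rank_one f u = restrict (%x. f x \<odot> u) V"

lemma rank_one_apply [simp]: "x \<in> V ==> rank_one f u x = f x \<odot> u"
 by (simp add: rank_one_def)

lemma rank_one_K_ops:
 assumes f: "bounded_functional E f" and u: "u \<in> V"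
 shows "rank_one f u \<in> K_ops E"
proof (rule K_opsI)
 obtain C where C: "0 < C" "!!x. x \<in> V ==> norm (f x) <= C * N x" using bfun_bound[OF f] by blast
 show "rank_one f u \<in> Lops E"
  unfolding rank_one_def
 proof (rule LopsI[where C = "C * N u"])
  fix x assume "x \<in> V"
  then show "N (f x \<odot> u) <= C * N u * N x"
   using mult_right_mono[OF C(2)[of x] norm_nonneg[OF u]] u by (simp add: mult_ac)
 qed (use u f in \<open>auto simp: bfun_add bfun_smul algebra_simps intro!: iota_inject\<close>)
 fix x :: "nat => 'a" assume x: "!!n. x n \<in> V" "!!n. N (x n) <= 1"
 have "norm (f (x n)) <= C" for n
  using C(2)[OF x(1), of n] mult_left_mono[OF x(2), of C n] C(1) by linarith
 then have "bounded (range (%n. f (x n)))" by (auto simp: bounded_iff)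
 then obtain r where r: "strict_mono r" "convergent ((%n. f (x n)) \<circ> r)"
  by (rule bounded_scalar_seq_subseq)
 have "nsp_cauchy E (%n. f (x (r n)) \<odot> u)"
  unfolding nsp_cauchy_def
 proof (intro allI impI)
  fix e :: real assume "0 < e"
  then have "0 < e / (N u + 1)" using u by (simp add: add_nonneg_pos)
  then obtain a where a: "!!m n. m >= a ==> n >= a ==> dist (f (x (r m))) (f (x (r n))) < e / (N u + 1)"
   using convergent_Cauchy[OF r(2)] unfolding Cauchy_def comp_def by blast
  have "N (f (x (r m)) \<odot> u \<ominus> f (x (r n)) \<odot> u) < e" if "m >= a" "n >= a" for m n
  proof -
   have "f (x (r m)) \<odot> u \<ominus> f (x (r n)) \<odot> u = (f (x (r m)) - f (x (r n))) \<odot> u"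
    using u by (intro iota_inject) (auto simp: algebra_simps)
   then have "N (f (x (r m)) \<odot> u \<ominus> f (x (r n)) \<odot> u) <= dist (f (x (r m))) (f (x (r n))) * (N u + 1)"
    using u by (simp add: dist_norm mult_left_mono)
   also have "... < e" using a[OF that] u by (simp add: pos_less_divide_eq add_nonneg_pos)
   finally show ?thesis .
  qed
  then show "EX a. ALL m>=a. ALL n>=a. N (f (x (r m)) \<odot> u \<ominus> f (x (r n)) \<odot> u) < e" by blast
 qed
 then show "EX r. strict_mono r \<and> nsp_cauchy E (%n. rank_one f u (x (r n)))"
  using r(1) x by auto
qed

end

section \<open>Finitely strictly singular operators\<close>

context normed_nspace
begin

text \<open>\<open>T\<close> is finitely strictly singular: there is no lower bound for \<open>T\<close> that is valid on subspaces of
 arbitrarily large finite dimension. The matrix \<open>b\<close> allows for finitely many linear side conditions.\<close>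
definition fss_dim :: "('a => 'a) => real => nat => nat => bool" where
 "fss_dim T \<delta> j n \<longleftrightarrow> (ALL f b. (ALL i<n. f i \<in> V) --> (ALL c. lsum E c f n = \<zero> --> (ALL i<n. c i = 0)) -->
   (EX c. lsum E c f n ~= \<zero> \<and> (ALL l<j. (\<Sum>i<n. c i * b l i) = (0::'k)) \<and>
    N (T (lsum E c f n)) < \<delta> * N (lsum E c f n)))"

definition fss :: "('a => 'a) => bool" where
 "fss T \<longleftrightarrow> T \<in> Lops E \<and> (ALL \<delta>>0. ALL j. EX n. fss_dim T \<delta> j n)"

lemma fss_dimD:
 assumes "fss_dim T \<delta> j n" "!!i. i < n ==> f i \<in> V" "!!c. lsum E c f n = \<zero> ==> (ALL i<n. c i = 0)"
 obtains c where "lsum E c f n ~= \<zero>" "!!l. l < j ==> (\<Sum>i<n. c i * b l i) = (0::'k)"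
  "N (T (lsum E c f n)) < \<delta> * N (lsum E c f n)"
proof -
 have "EX c. lsum E c f n ~= \<zero> \<and> (ALL l<j. (\<Sum>i<n. c i * b l i) = (0::'k)) \<and>
    N (T (lsum E c f n)) < \<delta> * N (lsum E c f n)"
  using assms(1)[unfolded fss_dim_def, THEN spec, THEN spec, of f b] assms(2,3) by simp
 then show thesis using that by (elim exE conjE) simp
qed

lemma fss_zero: "fss (op_zero E)"
 unfolding fss_def
proof (intro conjI allI impI)
 fix \<delta> :: real and j assume "0 < \<delta>"
 have "fss_dim (op_zero E) \<delta> j (Suc j)"
  unfolding fss_dim_def
 proof (intro allI impI)
  fix f :: "nat => 'a" and b :: "nat => nat => 'k"
  assume f: "ALL i<Suc j. f i \<in> V" and ind: "ALL c. lsum E c f (Suc j) = \<zero> --> (ALL i<Suc j. c i = 0)"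
  obtain c where c: "\<exists>i\<in>{..<Suc j}. c i ~= 0" "ALL l<j. (\<Sum>i\<in>{..<Suc j}. c i * b l i) = 0"
   using homogeneous_system[of "{..<Suc j}" j b] by auto
  have nz: "lsum E c f (Suc j) ~= \<zero>" using c(1) ind by (metis lessThan_iff)
  moreover have V: "lsum E c f (Suc j) \<in> V" using f by (intro lsum_closed) blast
  ultimately show "EX c. lsum E c f (Suc j) ~= \<zero> \<and> (ALL l<j. (\<Sum>i<Suc j. c i * b l i) = 0) \<and>
    N (op_zero E (lsum E c f (Suc j))) < \<delta> * N (lsum E c f (Suc j))"
   using c(2) \<open>0 < \<delta>\<close> norm_pos_iff[OF V]
   by (intro exI[of _ c]) (simp del: lsum.simps)
 qed
 then show "EX n. fss_dim (op_zero E) \<delta> j n" ..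
qed simp

lemma nsp_completeD:
 "nsp_complete E ==> (!!n. x n \<in> V) ==> nsp_cauchy E x ==> EX l. nsp_lim E x l"
 by (simp add: nsp_complete_def)

text \<open>On an infinite-dimensional subspace where \<open>T + R\<close> is bounded below there are unit vectors \<open>y j\<close>
 in the kernels of \<open>\<psi> 0, \<dots>, \<psi> (j - 1)\<close> with \<open>T (y j) \<rightarrow> 0\<close>; by compactness of \<open>R\<close> a subsequence is
 Cauchy, and its limit is a unit vector in the common kernel of all \<open>\<psi> i\<close>.\<close>
lemma fss_add_compact_SS:
 assumes complete: "nsp_complete E"
  and psi: "!!m :: nat. bounded_functional E (\<psi> m)"
  and sep: "!!x. x \<in> V ==> (!!m. \<psi> m x = 0) ==> x = \<zero>"
  and T: "fss T" and R: "R \<in> K_ops E"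
 shows "op_add E T R \<in> SS_ops E"
proof -
 have TL: "T \<in> Lops E" using T by (simp add: fss_def)
 note RL = K_ops_Lops[OF R]
 have False
  if M: "lin_subspace E M" "inf_dim E M" and \<delta>: "0 < \<delta>" "!!x. x \<in> M ==> \<delta> * N x <= N (op_add E T R x)" for M \<delta>
 proof -
  have MV: "!!x. x \<in> M ==> x \<in> V" using M(1) by (auto simp: lin_subspace_def)
  have "EX y. y \<in> M \<and> N y = 1 \<and> (ALL i<j. \<psi> i y = 0) \<and> N (T y) < 1 / real (Suc j)" for j
  proof -
   have "(0::real) < 1 / real (Suc j)" by simp
   then obtain n where n: "fss_dim T (1 / real (Suc j)) j n"
    using T unfolding fss_def by blast
   obtain f where f: "ALL i<n. f i \<in> M" "ALL c. lsum E c f n = \<zero> --> (ALL i<n. c i = 0)"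
    using M(2) unfolding inf_dim_def by blast
   have fV: "ALL i<n. f i \<in> V" using f(1) MV by blast
   \<comment> \<open>The matrix entries are \<open>\<psi> l (f i)\<close>, so the side conditions
     say that the first \<open>j\<close> functionals vanish at the vector found.\<close>
   obtain c where c: "lsum E c f n ~= \<zero>" "!!l. l < j ==> (\<Sum>i<n. c i * \<psi> l (f i)) = 0"
    "N (T (lsum E c f n)) < 1 / real (Suc j) * N (lsum E c f n)"
    using fss_dimD[OF n, of f "%l i. \<psi> l (f i)"] fV f(2) by blast
   let ?x = "lsum E c f n"
   have x: "?x \<in> M" using f(1) by (intro lsum_in_subspace[OF M(1)]) blast
   have xV: "?x \<in> V" using x MV by blast
   have pos: "0 < N ?x" using c(1) xV by (simp add: norm_pos_iff)
   let ?y = "of_real (1 / N ?x) \<odot> ?x"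
   have "?y \<in> M" using x M(1) by (auto simp: lin_subspace_def)
   moreover have "N ?y = 1" using pos xV c(1) by (simp add: norm_divide)
   moreover have "ALL i<j. \<psi> i ?y = 0"
    using c(2) fV xV by (simp add: bfun_smul[OF psi] bfun_lsum[OF psi])
   moreover have "N (T ?y) < 1 / real (Suc j)"
    using c(3) pos xV Lops_closed[OF TL xV] by (simp add: Lops_smul[OF TL] norm_divide field_simps)
   ultimately show ?thesis by blast
  qed
  then obtain y where y: "!!j. y j \<in> M" "!!j. N (y j) = 1" "!!j i. i < j ==> \<psi> i (y j) = 0"
   "!!j. N (T (y j)) < 1 / real (Suc j)" by metis
  have yV: "y j \<in> V" for j using y(1) MV by blast
  obtain r where r: "strict_mono r" "nsp_cauchy E (%n. R (y (r n)))"
   by (rule K_ops_subseq[OF R, of y 1]) (use y yV in auto)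
  have "nsp_cauchy E (%n. y (r n))"
   unfolding nsp_cauchy_def
  proof (intro allI impI)
   fix e :: real assume e: "0 < e"
   then have e3: "0 < e * \<delta> / 3" using \<delta>(1) by simp
   obtain a where a: "!!m n. m >= a ==> n >= a ==> N (R (y (r m)) \<ominus> R (y (r n))) < e * \<delta> / 3"
    using r(2) e3 unfolding nsp_cauchy_def by blast
   obtain b where b: "1 / real (Suc b) < e * \<delta> / 3"
    using reals_Archimedean[OF e3] by (auto simp: inverse_eq_divide)
   have small: "N (T (y (r m))) < e * \<delta> / 3" if "m >= b" for m
   proof -
    have "b <= r m" using that seq_suble[OF r(1), of m] by simp
    then have "1 / real (Suc (r m)) <= 1 / real (Suc b)" by (simp add: field_simps)
    then show ?thesis using y(4)[of "r m"] b by simp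
   qed
   have "N (y (r m) \<ominus> y (r n)) < e" if "m >= max a b" "n >= max a b" for m n
   proof -
    let ?d = "y (r m) \<ominus> y (r n)"
    have cl: "T (y k) \<in> V" "R (y k) \<in> V" for k using Lops_closed[OF TL] Lops_closed[OF RL] yV by auto
    have "\<delta> * N ?d <= N (op_add E T R ?d)"
     using \<delta>(2) minus_in_subspace[OF M(1) y(1) y(1)] by blast
    also have "... = N ((T (y (r m)) \<ominus> T (y (r n))) \<oplus> (R (y (r m)) \<ominus> R (y (r n))))"
     using yV by (simp add: Lops_minus[OF TL] Lops_minus[OF RL])
    also have "... <= N (T (y (r m)) \<ominus> T (y (r n))) + N (R (y (r m)) \<ominus> R (y (r n)))"
     using norm_add cl by simp
    also have "N (T (y (r m)) \<ominus> T (y (r n))) <= N (T (y (r m))) + N (T (y (r n)))"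
     using norm_minus cl by simp
    finally have "\<delta> * N ?d < e * \<delta>"
     using small[of m] small[of n] a[of m n] that by simp
    then show ?thesis using \<delta>(1) by (simp add: mult.commute)
   qed
   then show "EX a. ALL m>=a. ALL n>=a. N (y (r m) \<ominus> y (r n)) < e" by blast
  qed
  from nsp_completeD[OF complete yV this] obtain l where l: "nsp_lim E (%n. y (r n)) l" by blast
  have "\<psi> i l = 0" for i
  proof (rule LIMSEQ_unique[OF nsp_lim_bfun[OF psi l yV]])
   have "\<psi> i (y (r n)) = 0" if "n >= Suc i" for n
    using y(3)[of i "r n"] seq_suble[OF r(1), of n] that by simp
   then show "(%n. \<psi> i (y (r n))) ----> 0"
    by (intro tendsto_eventually eventually_sequentiallyI)
  qed
  moreover have "l \<in> V" using l by (simp add: nsp_lim_def)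
  ultimately have "l = \<zero>" by (intro sep)
  then show False
   using LIMSEQ_unique[OF nsp_lim_norm[OF l yV], of 1] by (simp add: y(2))
 qed
 then show ?thesis using TL RL unfolding SS_ops_def by blast
qed

lemma fss_SS:
 assumes "nsp_complete E" "!!m :: nat. bounded_functional E (\<psi> m)"
  and "!!x. x \<in> V ==> (!!m. \<psi> m x = 0) ==> x = \<zero>" and T: "fss T"
 shows "T \<in> SS_ops E"
proof -
 have "T \<in> Lops E" using T by (simp add: fss_def)
 then have "op_add E T (op_zero E) = T"
  by (intro Lops_eqI) (auto simp: Lops_closed)
 moreover have "op_add E T (op_zero E) \<in> SS_ops E"
  by (rule fss_add_compact_SS[where \<psi> = \<psi>]) (fact assms K_ops_zero)+
 ultimately show ?thesis by simp
qed

lemma SS_ops_Lops: "T \<in> SS_ops E ==> T \<in> Lops E"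
 by (simp add: SS_ops_def)

section \<open>The chain generated by a sequence of operators over the compact ones\<close>

context
 fixes S :: "nat => 'a => 'a"
 assumes S: "!!k. S k \<in> Lops E"
begin

abbreviation "chain \<equiv> subideal_chain E (K_ops E) S"

text \<open>One line at a time is added to the closed subspace of compact operators, so closedness
  survives by \<open>closed_add_line\<close>.\<close>

lemma chain_lin_closed: "lin_subspace (opsp E) (chain k) \<and> closed_in_nsp (opsp E) (chain k)"
proof -
 interpret ops: normed_nspace "opsp E" "%T (x, b). if x \<in> V then \<iota> (T x) b else 0"
  by (rule normed_nspace_opsp)
 show ?thesis
 proof (induction k)
  case 0
  show ?case using ops.closed_add_line[OF lin_subspace_K_ops closed_K_ops, of "S 0"] S by simp
 next
  case (Suc k)
  then show ?case using ops.closed_add_line[of "chain k" "S (Suc k)"] S by simp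
 qed
qed

lemma chain_Lops: "T \<in> chain k ==> T \<in> Lops E"
 using chain_lin_closed[of k] by (auto simp: lin_subspace_def)

lemma chain_mono: "chain k \<subseteq> chain (Suc k)"
proof
 fix T assume T: "T \<in> chain k"
 have "T = op_add E (op_smul E 0 (S (Suc k))) T"
  using chain_Lops[OF T] S Lops_closed[OF S] by (intro Lops_eqI) (auto simp: Lops_closed)
 then show "T \<in> chain (Suc k)" using T by auto
qed

lemma K_ops_chain: "K_ops E \<subseteq> chain k"
proof (induction k)
 case 0
 show ?case
 proof
  fix T assume T: "T \<in> K_ops E"
  have "T = op_add E (op_smul E 0 (S 0)) T"
   using K_ops_Lops[OF T] S Lops_closed[OF S] by (intro Lops_eqI) (auto simp: Lops_closed)
  then show "T \<in> chain 0" using T by auto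
 qed
next
 case (Suc k)
 then show ?case using chain_mono[of k] by blast
qed

lemma chain_contains: "j <= k ==> S j \<in> chain k"
proof (induction k)
 case 0
 have "S 0 = op_add E (op_smul E 1 (S 0)) (op_zero E)"
  using S Lops_closed[OF S] by (intro Lops_eqI) auto
 then show ?case using 0 K_ops_zero by auto
next
 case (Suc k)
 show ?case
 proof (cases "j = Suc k")
  case True
  have "S j = op_add E (op_smul E 1 (S (Suc k))) (op_zero E)"
   using S Lops_closed[OF S] True by (intro Lops_eqI) auto
  then show ?thesis using K_ops_zero K_ops_chain[of k] by auto
 next
  case False
  then show ?thesis using Suc chain_mono[of k] by auto
 qed
qed

lemma reorder:
 assumes "L \<in> Lops E" "S' \<in> Lops E" "R \<in> Lops E"
 shows "op_add E (op_add E L (op_smul E d S')) R = op_add E (op_smul E d S') (op_add E L R)"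
 using assms by (intro Lops_eqI) (auto intro!: iota_inject simp: Lops_closed)

text \<open>The nested form of the chain hides the dimension modulo compact operators; this flat
  form is what dimension counting and coefficient comparison use.\<close>

lemma chain_decompose:
 assumes "T \<in> chain k"
 obtains c R where "R \<in> K_ops E" "T = op_add E (lsum (opsp E) c S (Suc k)) R"
proof -
 interpret ops: normed_nspace "opsp E" "%T (x, b). if x \<in> V then \<iota> (T x) b else 0"
  by (rule normed_nspace_opsp)
 have "EX c R. R \<in> K_ops E \<and> T = op_add E (lsum (opsp E) c S (Suc k)) R"
  using assms
 proof (induction k arbitrary: T)
  case 0
  then obtain c R where cR: "R \<in> K_ops E" "T = op_add E (op_smul E c (S 0)) R" by auto
  have "lsum (opsp E) (%_. c) S (Suc 0) = op_smul E c (S 0)"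
   using ops.add_zero(2)[of "op_smul E c (S 0)"] S by simp
  then show ?case using cR by metis
 next
  case (Suc k)
  then obtain d T' where d: "T' \<in> chain k" "T = op_add E (op_smul E d (S (Suc k))) T'" by auto
  obtain c R where cR: "R \<in> K_ops E" "T' = op_add E (lsum (opsp E) c S (Suc k)) R"
   using Suc.IH[OF d(1)] by blast
  let ?c = "c(Suc k := d)"
  have eq: "lsum (opsp E) ?c S (Suc k) = lsum (opsp E) c S (Suc k)"
   by (rule ops.lsum_cong) auto
  have "op_add E (lsum (opsp E) ?c S (Suc (Suc k))) R =
    op_add E (op_add E (lsum (opsp E) c S (Suc k)) (op_smul E d (S (Suc k)))) R"
   using eq by (simp del: lsum.simps add: lsum.simps(2)[of _ _ _ "Suc k"])
  also have "... = T"
  proof -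
   have L: "lsum (opsp E) c S (Suc k) \<in> Lops E" using ops.lsum_closed[of "Suc k" S c] S by simp
   then have "op_add E (op_add E (lsum (opsp E) c S (Suc k)) (op_smul E d (S (Suc k)))) R
     = op_add E (op_smul E d (S (Suc k))) (op_add E (lsum (opsp E) c S (Suc k)) R)"
    using S K_ops_Lops[OF cR(1)] by (rule reorder)
   then show ?thesis using cR d by simp
  qed
  finally show ?case using cR(1) by metis
 qed
 then show thesis using that by blast
qed

text \<open>Both products are linear in \<open>T\<close>, compact on each generator by assumption,
  and compact on the compact part by the ideal property.\<close>

lemma chain_absorbs:
 assumes U: "U \<in> Lops E" and l: "!!j. op_comp E U (S j) \<in> K_ops E" and r: "!!j. op_comp E (S j) U \<in> K_ops E"
  and T: "T \<in> chain k"
 shows "op_comp E U T \<in> K_ops E \<and> op_comp E T U \<in> K_ops E"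
proof -
 have step: "op_comp E U (op_add E (op_smul E c (S j)) R) \<in> K_ops E \<and>
   op_comp E (op_add E (op_smul E c (S j)) R) U \<in> K_ops E"
  if R: "R \<in> Lops E" "op_comp E U R \<in> K_ops E" "op_comp E R U \<in> K_ops E" for c j R
 proof -
  note cl = Lops_closed[OF U] Lops_closed[OF S] Lops_closed[OF R(1)]
  have "op_comp E U (op_add E (op_smul E c (S j)) R) = op_add E (op_smul E c (op_comp E U (S j))) (op_comp E U R)"
   using U S R(1) cl by (intro Lops_eqI) (auto simp: Lops_add[OF U] Lops_smul[OF U])
  moreover have "op_comp E (op_add E (op_smul E c (S j)) R) U = op_add E (op_smul E c (op_comp E (S j) U)) (op_comp E R U)"
   using U S R(1) cl by (intro Lops_eqI) auto
  ultimately show ?thesis using K_ops_add K_ops_smul l r R by simp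
 qed
 show ?thesis using T
 proof (induction k arbitrary: T)
  case 0
  then obtain c R where "R \<in> K_ops E" "T = op_add E (op_smul E c (S 0)) R" by auto
  then show ?case using step[of R c 0] K_ops_Lops K_ops_comp_left[OF U] K_ops_comp_right[OF _ U] by simp
 next
  case (Suc k)
  then obtain c R where cR: "R \<in> chain k" "T = op_add E (op_smul E c (S (Suc k))) R" by auto
  then show ?case using step[of R c "Suc k"] chain_Lops Suc.IH by simp
 qed
qed

text \<open>Products with strictly singular operators fall not merely into the chain member but into
  the compact operators, which every member contains.\<close>

lemma closed_subideal_chain:
 assumes SS: "!!T k. T \<in> chain k ==> T \<in> SS_ops E"
  and absorb: "!!U j. U \<in> SS_ops E ==> op_comp E U (S j) \<in> K_ops E \<and> op_comp E (S j) U \<in> K_ops E"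
 shows "closed_subideal E (SS_ops E) (chain k)"
proof -
 have lin: "lin_subspace (opsp E) (chain k)" and cl: "closed_in_nsp (opsp E) (chain k)"
  using chain_lin_closed by auto
 show ?thesis
  unfolding closed_subideal_def
 proof (intro conjI ballI)
  show "chain k \<subseteq> SS_ops E" using SS by blast
  show "op_subspace E (chain k)" using lin by (auto simp: lin_subspace_def op_subspace_def)
  show "op_closed E (chain k)" using cl
   unfolding closed_in_nsp_def op_closed_def nsp_minus_def opsp_simps by blast
  fix T U assume TU: "T \<in> chain k" "U \<in> SS_ops E"
  then show "op_comp E U T \<in> chain k" "op_comp E T U \<in> chain k"
   using chain_absorbs[OF SS_ops_Lops[OF TU(2)] _ _ TU(1)] absorb[OF TU(2)] K_ops_chain by blast+
 qed
qed

end

end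

section \<open>Isomorphisms between operator algebras that contain the compact operators\<close>

lemma banach_alg_iso_inverse:
 assumes iso: "banach_alg_iso E I J \<phi>"
  and cl: "!!S T. S \<in> I ==> T \<in> I ==> op_add E S T \<in> I" "!!c T. T \<in> I ==> op_smul E c T \<in> I"
   "!!S T. S \<in> I ==> T \<in> I ==> op_comp E S T \<in> I"
 shows "banach_alg_iso E J I (inv_into I \<phi>)"
proof -
 let ?\<psi> = "inv_into I \<phi>"
 have bij: "bij_betw \<phi> I J" using iso by (simp add: banach_alg_iso_def)
 have inI: "?\<psi> T \<in> I" if "T \<in> J" for T using bij that by (metis bij_betw_imp_surj_on inv_into_into)
 have \<phi>\<psi>: "\<phi> (?\<psi> T) = T" if "T \<in> J" for T using bij that by (metis bij_betw_imp_surj_on f_inv_into_f)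
 have \<psi>\<phi>: "?\<psi> (\<phi> T) = T" if "T \<in> I" for T using bij that by (metis bij_betw_imp_inj_on inv_into_f_f)
 obtain C where "\<forall>T\<in>I. op_norm E (\<phi> T) <= C * op_norm E T"
  using iso unfolding banach_alg_iso_def by (elim conjE exE)
 then have C: "!!T. T \<in> I ==> op_norm E (\<phi> T) <= C * op_norm E T" by blast
 obtain D where "\<forall>T\<in>I. op_norm E T <= D * op_norm E (\<phi> T)"
  using iso unfolding banach_alg_iso_def by (elim conjE exE)
 then have D: "!!T. T \<in> I ==> op_norm E T <= D * op_norm E (\<phi> T)" by blast
 show ?thesis
  unfolding banach_alg_iso_def
 proof (intro conjI ballI allI)
  show "bij_betw ?\<psi> J I" using bij by (rule bij_betw_inv_into)
  show "EX C. \<forall>T\<in>J. op_norm E (?\<psi> T) <= C * op_norm E T" using D[OF inI] \<phi>\<psi> by (intro exI[of _ D]) auto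
  show "EX C. \<forall>T\<in>J. op_norm E T <= C * op_norm E (?\<psi> T)" using C[OF inI] \<phi>\<psi> by (intro exI[of _ C]) auto
  fix S T assume ST: "T \<in> J" "S \<in> J"
  have "\<phi> (op_add E (?\<psi> T) (?\<psi> S)) = op_add E T S" "\<phi> (op_comp E (?\<psi> T) (?\<psi> S)) = op_comp E T S"
   using iso inI \<phi>\<psi> ST unfolding banach_alg_iso_def by auto
  then show "?\<psi> (op_add E T S) = op_add E (?\<psi> T) (?\<psi> S)" "?\<psi> (op_comp E T S) = op_comp E (?\<psi> T) (?\<psi> S)"
   using \<psi>\<phi> cl inI ST by metis+
 next
  fix c T assume T: "T \<in> J"
  have "\<phi> (op_smul E c (?\<psi> T)) = op_smul E c T"
   using iso inI \<phi>\<psi> T unfolding banach_alg_iso_def by auto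
  then show "?\<psi> (op_smul E c T) = op_smul E c (?\<psi> T)" using \<psi>\<phi> cl inI T by metis
 qed
qed

context normed_nspace
begin

lemma iso_zero:
 assumes iso: "banach_alg_iso E I J \<phi>" and I: "I \<subseteq> Lops E" "op_zero E \<in> I" and J: "J \<subseteq> Lops E"
 shows "\<phi> (op_zero E) = op_zero E"
proof -
 have "op_smul E 0 (op_zero E) = op_zero E" by (intro Lops_eqI) auto
 then have "\<phi> (op_zero E) = op_smul E 0 (\<phi> (op_zero E))"
  using iso I(2) unfolding banach_alg_iso_def by metis
 moreover have "\<phi> (op_zero E) \<in> Lops E"
  using iso I J unfolding banach_alg_iso_def bij_betw_def by blast
 then have "op_smul E 0 (\<phi> (op_zero E)) = op_zero E"
  by (intro Lops_eqI) (auto simp: Lops_closed)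
 ultimately show ?thesis by simp
qed

lemma rank_one_Lops: "bounded_functional E f ==> u \<in> V ==> rank_one f u \<in> Lops E"
 by (rule K_ops_Lops[OF rank_one_K_ops])

text \<open>An isomorphism is implemented by \<open>U x = \<phi> (f\<^sub>0 \<otimes> x) y\<^sub>0\<close>, which is bounded because \<open>\<phi>\<close> is.\<close>
lemma iso_intertwiner:
 assumes iso: "banach_alg_iso E I J \<phi>" and I: "I \<subseteq> Lops E" "K_ops E \<subseteq> I" and J: "J \<subseteq> Lops E"
  and f0: "bounded_functional E f0" "z0 \<in> V" "f0 z0 ~= 0"
 obtains U where "U \<in> Lops E" "\<exists>x\<in>V. U x ~= \<zero>" "\<forall>T\<in>I. \<forall>x\<in>V. U (T x) = \<phi> T (U x)"
proof -
 have R1: "rank_one f0 x \<in> I" if "x \<in> V" for x using rank_one_K_ops[OF f0(1) that] I(2) by blast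
 have \<phi>L: "\<phi> T \<in> Lops E" if "T \<in> I" for T using iso J that unfolding banach_alg_iso_def bij_betw_def by blast
 have inj: "inj_on \<phi> I" using iso unfolding banach_alg_iso_def bij_betw_def by blast
 have zI: "op_zero E \<in> I" using I(2) K_ops_zero by blast
 have z0: "z0 ~= \<zero>" using f0 bfun_zero by metis
 have "rank_one f0 z0 z0 ~= \<zero>"
  using f0 z0 norm_eq_0_iff[OF smul_closed[OF f0(2)], of "f0 z0"] norm_pos_iff[OF f0(2)] by auto
 then have "rank_one f0 z0 ~= op_zero E" using f0(2) op_zero_apply[OF f0(2)] by metis
 then have "\<phi> (rank_one f0 z0) ~= op_zero E"
  using inj R1[OF f0(2)] zI iso_zero[OF iso I(1) zI J] by (metis inj_onD)
 then obtain y0 where y0: "y0 \<in> V" "\<phi> (rank_one f0 z0) y0 ~= \<zero>"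
  using Lops_eqI[OF \<phi>L[OF R1[OF f0(2)]] op_zero_in] by auto
 define U where "U = restrict (%x. \<phi> (rank_one f0 x) y0) V"
 obtain C where "\<forall>T\<in>I. op_norm E (\<phi> T) <= C * op_norm E T"
  using iso unfolding banach_alg_iso_def by (elim conjE exE)
 then have C: "!!T. T \<in> I ==> op_norm E (\<phi> T) <= C * op_norm E T" by blast
 obtain D where D: "0 < D" "!!x. x \<in> V ==> norm (f0 x) <= D * N x" using bfun_bound[OF f0(1)] by blast
 have hom: "\<phi> (op_add E S T) = op_add E (\<phi> S) (\<phi> T)" "\<phi> (op_smul E c T) = op_smul E c (\<phi> T)"
  "\<phi> (op_comp E S T) = op_comp E (\<phi> S) (\<phi> T)" if "S \<in> I" "T \<in> I" for S T c
  using iso that unfolding banach_alg_iso_def by auto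
 show thesis
 proof (rule that[of U])
  show "U \<in> Lops E" unfolding U_def
  proof (rule LopsI)
   fix x y c assume xy: "x \<in> V" "y \<in> V"
   show "\<phi> (rank_one f0 x) y0 \<in> V" using Lops_closed[OF \<phi>L[OF R1]] xy y0 by simp
   have "rank_one f0 (x \<oplus> y) = op_add E (rank_one f0 x) (rank_one f0 y)"
    using xy f0(1) by (intro Lops_eqI) (auto simp: rank_one_Lops algebra_simps intro!: iota_inject)
   then show "\<phi> (rank_one f0 (x \<oplus> y)) y0 = \<phi> (rank_one f0 x) y0 \<oplus> \<phi> (rank_one f0 y) y0"
    using hom R1 xy y0 by simp
   have "rank_one f0 (c \<odot> x) = op_smul E c (rank_one f0 x)"
    using xy f0(1) by (intro Lops_eqI) (auto simp: rank_one_Lops algebra_simps intro!: iota_inject)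
   then show "\<phi> (rank_one f0 (c \<odot> x)) y0 = c \<odot> \<phi> (rank_one f0 x) y0"
    using hom(2)[OF R1 R1, OF xy(1) xy(1)] y0 by simp
   have "op_norm E (rank_one f0 x) <= D * N x"
   proof (rule op_norm_le)
    fix z assume z: "z \<in> V"
    show "N (rank_one f0 x z) <= D * N x * N z"
     using mult_right_mono[OF D(2)[OF z] norm_nonneg[OF xy(1)]] z xy by (simp add: mult_ac)
   qed (use D xy in auto)
   then have "\<bar>C\<bar> * op_norm E (rank_one f0 x) <= \<bar>C\<bar> * (D * N x)" by (intro mult_left_mono) auto
   moreover have "op_norm E (\<phi> (rank_one f0 x)) <= \<bar>C\<bar> * op_norm E (rank_one f0 x)"
    using C[OF R1[OF xy(1)]] op_norm_nonneg[OF rank_one_Lops[OF f0(1) xy(1)]]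
     mult_right_mono[of C "\<bar>C\<bar>" "op_norm E (rank_one f0 x)"] by linarith
   ultimately have "op_norm E (\<phi> (rank_one f0 x)) * N y0 <= \<bar>C\<bar> * (D * N x) * N y0"
    using y0 by (intro mult_right_mono) auto
   then show "N (\<phi> (rank_one f0 x) y0) <= (\<bar>C\<bar> * D * N y0) * N x"
    using op_norm_bound[OF \<phi>L[OF R1[OF xy(1)]] y0(1)] by (simp add: mult_ac)
  qed
  show "\<exists>x\<in>V. U x ~= \<zero>" using y0 f0(2) by (auto simp: U_def)
  have "U (T x) = \<phi> T (U x)" if T: "T \<in> I" and x: "x \<in> V" for T x
  proof -
  have TL: "T \<in> Lops E" using T I(1) by blast
  have "rank_one f0 (T x) = op_comp E T (rank_one f0 x)"
   using x f0(1) TL by (intro Lops_eqI) (auto simp: rank_one_Lops Lops_closed Lops_smul)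
  then show ?thesis
   using hom(3)[OF T R1[OF x]] x y0 Lops_closed[OF TL x] by (simp add: U_def)
  qed
  then show "\<forall>T\<in>I. \<forall>x\<in>V. U (T x) = \<phi> T (U x)" by blast
 qed
qed

text \<open>Let \<open>U\<close> and \<open>W\<close> implement the isomorphism and its inverse.
  Then W U commutes with all of \<open>I\<close>, in particular with rank one operators, so it is a
  scalar c; this is not 0 because \<open>W\<close> is injective and \<open>U\<close> is not zero.
  Hence T = (1/c) W \<phi>(T) U.\<close>

lemma iso_reflects_compact:
 assumes iso: "banach_alg_iso E I J \<phi>" and I: "I \<subseteq> Lops E" "K_ops E \<subseteq> I" and J: "J \<subseteq> Lops E" "K_ops E \<subseteq> J"
  and cl: "!!S T. S \<in> I ==> T \<in> I ==> op_add E S T \<in> I" "!!c T. T \<in> I ==> op_smul E c T \<in> I"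
   "!!S T. S \<in> I ==> T \<in> I ==> op_comp E S T \<in> I"
  and nz: "z0 \<in> V" "z0 ~= \<zero>"
  and sep: "!!x. x \<in> V ==> x ~= \<zero> ==> EX f. bounded_functional E f \<and> f x ~= 0"
  and T: "T \<in> I" "\<phi> T \<in> K_ops E"
 shows "T \<in> K_ops E"
proof -
 let ?\<psi> = "inv_into I \<phi>"
 obtain f0 where f0: "bounded_functional E f0" "f0 z0 ~= 0" using sep[OF nz] by blast
 have iso': "banach_alg_iso E J I ?\<psi>" using banach_alg_iso_inverse[OF iso cl] .
 have bij: "bij_betw \<phi> I J" using iso by (simp add: banach_alg_iso_def)
 have \<psi>\<phi>: "?\<psi> (\<phi> T) = T" if "T \<in> I" for T using bij that by (metis bij_betw_imp_inj_on inv_into_f_f)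
 have \<phi>J: "\<phi> T \<in> J" if "T \<in> I" for T using bij that by (metis bij_betwE)
 obtain U where U: "U \<in> Lops E" "\<exists>x\<in>V. U x ~= \<zero>" "\<forall>T\<in>I. \<forall>x\<in>V. U (T x) = \<phi> T (U x)"
  by (rule iso_intertwiner[OF iso I J(1) f0(1) nz(1) f0(2)])
 obtain W where W: "W \<in> Lops E" "\<exists>x\<in>V. W x ~= \<zero>" "\<forall>T\<in>J. \<forall>x\<in>V. W (T x) = ?\<psi> T (W x)"
  by (rule iso_intertwiner[OF iso' J I(1) f0(1) nz(1) f0(2)])
 note Ucl = Lops_closed[OF U(1)] and Wcl = Lops_closed[OF W(1)]
 have comm: "W (U (T x)) = T (W (U x))" if "T \<in> I" "x \<in> V" for T x
  using U(3)[rule_format, OF that] W(3)[rule_format, OF \<phi>J[OF that(1)] Ucl[OF that(2)]] \<psi>\<phi>[OF that(1)] by simp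
 have \<psi>L: "?\<psi> T \<in> Lops E" if "T \<in> J" for T
  using bij that I(1) by (metis bij_betw_imp_surj_on inv_into_into subsetD)
 \<comment> \<open>If \<open>W\<close> kills y, intertwining with the rank one operator built from
   \<open>f\<close> and z shows that it kills f(y) z for every z, hence everything.\<close>
 have Winj: "W y ~= \<zero>" if y: "y \<in> V" "y ~= \<zero>" for y
 proof
  assume 0: "W y = \<zero>"
  obtain f where f: "bounded_functional E f" "f y ~= 0" using sep[OF y] by blast
  have "W z = \<zero>" if z: "z \<in> V" for z
  proof -
   have R: "rank_one f z \<in> J" using rank_one_K_ops[OF f(1) z] J(2) by blast
   have "f y \<odot> W z = W (rank_one f z y)" using y z by (simp add: Lops_smul[OF W(1)])
   also have "... = \<zero>" using W(3)[rule_format, OF R y(1)] 0 Lops_zero[OF \<psi>L[OF R]] by simp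
   finally have "norm (f y) * N (W z) = 0" using Wcl[OF z] norm_smul by (metis norm_zero)
   then show "W z = \<zero>" using f(2) Wcl[OF z] by simp
  qed
  then show False using W(2) by blast
 qed
 \<comment> \<open>Commuting with the rank one operator built from \<open>f0\<close> and z,
   evaluated at \<open>z0\<close>, identifies W U z as this multiple of z.\<close>
 define c where "c = f0 (W (U z0)) / f0 z0"
 have scalar: "W (U z) = c \<odot> z" if z: "z \<in> V" for z
 proof -
  have R: "rank_one f0 z \<in> I" using rank_one_K_ops[OF f0(1) z] I(2) by blast
  have "f0 z0 \<odot> W (U z) = W (U (rank_one f0 z z0))"
   using nz z Ucl by (simp add: Lops_smul[OF W(1)] Lops_smul[OF U(1)])
  also have "... = f0 (W (U z0)) \<odot> z" using comm[OF R nz(1)] Wcl Ucl nz by simp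
  finally have eq: "f0 z0 \<odot> W (U z) = f0 (W (U z0)) \<odot> z" .
  have "W (U z) = (1 / f0 z0) \<odot> (f0 z0 \<odot> W (U z))" using f0(2) Wcl Ucl z by (intro iota_inject) auto
  also have "... = c \<odot> z" unfolding eq using z by (intro iota_inject) (auto simp: c_def)
  finally show ?thesis .
 qed
 have "c ~= 0"
 proof
  assume "c = 0"
  then have "W (U x) = \<zero>" if "x \<in> V" for x using scalar[OF that] that by simp
  then show False using U(2) Winj Ucl by blast
 qed
 have "T = op_smul E (1 / c) (op_comp E W (op_comp E (\<phi> T) U))"
 proof (rule Lops_eqI)
  show TL: "T \<in> Lops E" using T(1) I(1) by blast
  show "op_smul E (1 / c) (op_comp E W (op_comp E (\<phi> T) U)) \<in> Lops E"
   using K_ops_Lops[OF T(2)] U(1) W(1) by simp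
  fix x assume x: "x \<in> V"
  have "W (\<phi> T (U x)) = c \<odot> T x"
   using scalar[OF Lops_closed[OF TL x]] by (simp only: U(3)[rule_format, OF T(1) x])
  then have "op_smul E (1 / c) (op_comp E W (op_comp E (\<phi> T) U)) x = (1 / c) \<odot> c \<odot> T x"
   using x by simp
  also have "... = T x" using \<open>c ~= 0\<close> Lops_closed[OF TL x] by (intro iota_inject) auto
  finally show "T x = op_smul E (1 / c) (op_comp E W (op_comp E (\<phi> T) U)) x" by simp
 qed
 then show ?thesis
  using K_ops_smul[OF K_ops_comp_left[OF W(1) K_ops_comp_right[OF T(2) U(1)]]] by metis
qed

text \<open>If r < k, the k + 1 images of the generators lie in a space of dimension at most r + 1
  modulo compact operators, so a non-trivial combination of generators has compact image. It is then
  compact itself, against independence. The other case follows by passing to the inverse.\<close>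

lemma chain_not_iso:
 fixes S :: "nat => 'a => 'a"
 assumes S: "!!k. S k \<in> Lops E"
  and cl: "!!k A B. A \<in> subideal_chain E (K_ops E) S k ==> B \<in> subideal_chain E (K_ops E) S k ==>
   op_comp E A B \<in> subideal_chain E (K_ops E) S k"
  and indep: "!!k c i. lsum (opsp E) c S (Suc k) \<in> K_ops E ==> i <= k ==> c i = 0"
  and nz: "z0 \<in> V" "z0 ~= \<zero>"
  and sep: "!!x. x \<in> V ==> x ~= \<zero> ==> EX f. bounded_functional E f \<and> f x ~= 0"
  and iso: "banach_alg_iso E (subideal_chain E (K_ops E) S k) (subideal_chain E (K_ops E) S r) \<phi>"
 shows "k = r"
proof -
 let ?I = "subideal_chain E (K_ops E) S"
 interpret ops: normed_nspace "opsp E" "%T (x, b). if x \<in> V then \<iota> (T x) b else 0"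
  by (rule normed_nspace_opsp)
 have lin: "lin_subspace (opsp E) (?I k)" for k using chain_lin_closed[of S, OF S] by blast
 have IL: "?I k \<subseteq> Lops E" for k using lin[of k] by (auto simp: lin_subspace_def)
 have Iadd: "A \<in> ?I k ==> B \<in> ?I k ==> op_add E A B \<in> ?I k" and Ismul: "A \<in> ?I k ==> op_smul E c A \<in> ?I k" for k A B c
  using lin[of k] by (auto simp: lin_subspace_def)
 have KI: "K_ops E \<subseteq> ?I k" for k by (rule K_ops_chain[OF S])
 have no: False if iso: "banach_alg_iso E (?I k) (?I r) \<phi>" and "r < k" for k r \<phi>
 proof -
  have SI: "S j \<in> ?I k" if "j < Suc k" for j using chain_contains[OF S, of j k] that by simp
  have \<phi>I: "\<phi> A \<in> ?I r" if "A \<in> ?I k" for A using iso that unfolding banach_alg_iso_def by (metis bij_betwE)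
  have "EX c R. R \<in> K_ops E \<and> \<phi> (S j) = op_add E (lsum (opsp E) c S (Suc r)) R" if "j < Suc k" for j
   by (rule chain_decompose[OF S \<phi>I[OF SI[OF that]]]) blast
  then obtain c R where cR: "!!j. j < Suc k ==> R j \<in> K_ops E"
   "!!j. j < Suc k ==> \<phi> (S j) = op_add E (lsum (opsp E) (c j) S (Suc r)) (R j)" by metis
  \<comment> \<open>There are k + 1 unknowns and r + 1 equations, one for each generator that can
    occur in the images.\<close>
  obtain \<mu> where \<mu>: "\<exists>j\<in>{..<Suc k}. \<mu> j ~= 0" "ALL l<Suc r. (\<Sum>j\<in>{..<Suc k}. \<mu> j * c j l) = 0"
   using homogeneous_system[of "{..<Suc k}" "Suc r" "%l j. c j l"] \<open>r < k\<close> by auto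
  have RL: "R j \<in> nsp_carrier (opsp E)" if "j < Suc k" for j using K_ops_Lops[OF cR(1)[OF that]] by simp
  have SL: "S j \<in> nsp_carrier (opsp E)" for j using S by simp
  have \<phi>SL: "\<phi> (S j) \<in> nsp_carrier (opsp E)" if "j < Suc k" for j using \<phi>I[OF SI[OF that]] IL by auto
  have "lsum (opsp E) \<mu> (%j. \<phi> (S j)) (Suc k) = lsum (opsp E) \<mu> R (Suc k)"
  proof (rule ops.iota_inject)
   show "lsum (opsp E) \<mu> (%j. \<phi> (S j)) (Suc k) \<in> nsp_carrier (opsp E)"
    "lsum (opsp E) \<mu> R (Suc k) \<in> nsp_carrier (opsp E)"
    by (rule ops.lsum_closed, erule \<phi>SL RL)+
   fix b :: "'a \<times> 'b"
   define \<iota>' where "\<iota>' A = (case b of (x, b) => if x \<in> V then \<iota> (A x) b else 0)" for A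
   have "\<iota>' (lsum (opsp E) \<mu> (%j. \<phi> (S j)) (Suc k)) = (\<Sum>j<Suc k. \<mu> j * \<iota>' (\<phi> (S j)))"
    unfolding \<iota>'_def by (rule ops.iota_lsum, erule \<phi>SL)
   also have "... = (\<Sum>j<Suc k. \<mu> j * ((\<Sum>l<Suc r. c j l * \<iota>' (S l)) + \<iota>' (R j)))"
   proof (rule sum.cong[OF refl])
    fix j assume "j \<in> {..<Suc k}"
    then have j: "j < Suc k" by simp
    have "\<iota>' (\<phi> (S j)) = \<iota>' (lsum (opsp E) (c j) S (Suc r)) + \<iota>' (R j)"
     unfolding cR(2)[OF j] \<iota>'_def opsp_simps(2)[symmetric]
     by (rule ops.iota_add[OF ops.lsum_closed[OF SL] RL[OF j]])
    also have "\<iota>' (lsum (opsp E) (c j) S (Suc r)) = (\<Sum>l<Suc r. c j l * \<iota>' (S l))"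
     unfolding \<iota>'_def by (rule ops.iota_lsum[OF SL])
    finally show "\<mu> j * \<iota>' (\<phi> (S j)) = \<mu> j * ((\<Sum>l<Suc r. c j l * \<iota>' (S l)) + \<iota>' (R j))" by simp
   qed
   also have "... = (\<Sum>j<Suc k. \<Sum>l<Suc r. \<mu> j * c j l * \<iota>' (S l)) + (\<Sum>j<Suc k. \<mu> j * \<iota>' (R j))"
    by (simp only: distrib_left sum.distrib sum_distrib_left mult.assoc)
   also have "(\<Sum>j<Suc k. \<Sum>l<Suc r. \<mu> j * c j l * \<iota>' (S l)) = (\<Sum>l<Suc r. (\<Sum>j<Suc k. \<mu> j * c j l) * \<iota>' (S l))"
    unfolding sum_distrib_right by (rule sum.swap)
   also have "... = 0" using \<mu>(2) by (intro sum.neutral) (auto simp del: sum.lessThan_Suc)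
   also have "0 + (\<Sum>j<Suc k. \<mu> j * \<iota>' (R j)) = \<iota>' (lsum (opsp E) \<mu> R (Suc k))"
    unfolding \<iota>'_def add_0 by (rule ops.iota_lsum[symmetric], erule RL)
   finally show "(case b of (x, b) => if x \<in> V then \<iota> (lsum (opsp E) \<mu> (%j. \<phi> (S j)) (Suc k) x) b else 0) =
     (case b of (x, b) => if x \<in> V then \<iota> (lsum (opsp E) \<mu> R (Suc k) x) b else 0)"
    unfolding \<iota>'_def .
  qed
  moreover have "lsum (opsp E) \<mu> R (Suc k) \<in> K_ops E"
   using cR(1) by (intro ops.lsum_in_subspace[OF lin_subspace_K_ops])
  \<comment> \<open>The map is additive only on its domain, so membership of the partial sums is
    carried along in the induction.\<close>
  moreover have "n <= Suc k ==> lsum (opsp E) \<mu> S n \<in> ?I k \<and> \<phi> (lsum (opsp E) \<mu> S n) = lsum (opsp E) \<mu> (%j. \<phi> (S j)) n" for n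
  proof (induction n)
   case 0
   have "op_zero E \<in> ?I k" using KI K_ops_zero by blast
   then show ?case using iso_zero[OF iso IL _ IL] by simp
  next
   case (Suc n)
   then have n: "lsum (opsp E) \<mu> S n \<in> ?I k" "op_smul E (\<mu> n) (S n) \<in> ?I k" "S n \<in> ?I k" using SI Ismul by auto
   have "\<phi> (op_add E (lsum (opsp E) \<mu> S n) (op_smul E (\<mu> n) (S n)))
     = op_add E (\<phi> (lsum (opsp E) \<mu> S n)) (op_smul E (\<mu> n) (\<phi> (S n)))"
    using iso n unfolding banach_alg_iso_def by simp
   then show ?case using Iadd[OF n(1,2)] Suc by simp
  qed
  ultimately have "lsum (opsp E) \<mu> S (Suc k) \<in> ?I k" "\<phi> (lsum (opsp E) \<mu> S (Suc k)) \<in> K_ops E"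
   by (auto simp del: lsum.simps)
  then have "lsum (opsp E) \<mu> S (Suc k) \<in> K_ops E"
   using iso_reflects_compact[OF iso IL KI IL KI Iadd Ismul cl nz sep] by blast
  then show False using indep \<mu>(1) by (auto simp del: lsum.simps simp: less_Suc_eq_le)
 qed
 show "k = r"
 proof (rule ccontr)
  assume "k ~= r"
  then consider "r < k" | "k < r" by linarith
  then show False
  proof cases
   case 1
   then show False using no[OF iso] by blast
  next
   case 2
   then show False using no[OF banach_alg_iso_inverse[OF iso Iadd Ismul cl]] by blast
  qed
 qed
qed

end

section \<open>Series operators built from lower s-estimates and upper r-estimates\<close>

lemma le_powr_inverse: "x powr r <= y ==> 0 <= x ==> 0 < r ==> x <= y powr (1 / r)" for x y r :: real
 using powr_mono2[of "1 / r" "x powr r" y] by (simp add: powr_powr)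

lemma powr_le_cancel: "x powr r <= y powr r ==> 0 <= x ==> 0 <= y ==> 0 < r ==> x <= y" for x y r :: real
 using powr_less_mono2[of r y x] by (meson linorder_not_le)

lemma powr_split:
 fixes A eps r s :: real
 assumes "0 <= eps" "0 <= A"
 shows "(eps * A) powr (r - s) * A powr s = eps powr (r - s) * A powr r"
proof -
 have "A powr (r - s) * A powr s = A powr r" by (simp flip: powr_add)
 then show ?thesis using assms by (simp add: powr_mult mult.assoc)
qed

lemma powr_split_root:
 fixes A eps r s :: real
 assumes "0 <= eps" "0 <= A" "0 < r"
 shows "(eps powr (r - s) * A powr r) powr (1 / r) = eps powr ((r - s) / r) * A"
 using assms by (simp add: powr_mult powr_powr)

text \<open>The power r - s of each term is split off and controlled by the uniform bound; this
  turns the gap between s and r into a gain when all terms are small.\<close>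

lemma sum_powr_le:
 fixes d :: "'i => 'k::real_normed_vector"
 assumes "!!i. i \<in> I ==> norm (d i) <= M" "s <= r"
 shows "(\<Sum>i\<in>I. norm (d i) powr r) <= M powr (r - s) * (\<Sum>i\<in>I. norm (d i) powr s)"
 unfolding sum_distrib_left
proof (rule sum_mono)
 fix i assume "i \<in> I"
 then have "norm (d i) powr (r - s) * norm (d i) powr s <= M powr (r - s) * norm (d i) powr s"
  using assms by (intro mult_right_mono powr_mono2) auto
 then show "norm (d i) powr r <= M powr (r - s) * norm (d i) powr s"
  by (simp flip: powr_add)
qed

context normed_nspace
begin

text \<open>The map that sends the unit vectors of the finitely supported sequences, with the l^r
  norm, to \<open>u n\<close> is bounded by \<open>C\<close>.\<close>

definition upper_est :: "real => real => (nat => 'a) => bool" where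
 "upper_est r C u \<longleftrightarrow> 0 <= C \<and> (ALL n. u n \<in> V) \<and>
   (ALL m c. N (lsum E c u m) <= C * (\<Sum>i<m. norm (c i) powr r) powr (1 / r))"

text \<open>The map from x to the sequence of the values \<open>a n x\<close> is bounded by
  \<open>C\<close> into l^s. The inequality is raised to the power s so that partial sums compare
  without roots.\<close>

definition coef_est :: "real => real => (nat => 'a => 'k) => bool" where
 "coef_est s C a \<longleftrightarrow> 0 < C \<and> (ALL n. bounded_functional E (a n)) \<and>
   (ALL m. \<forall>x\<in>V. (\<Sum>i<m. norm (a i x) powr s) <= (C * N x) powr s)"

definition vsum :: "(nat => 'k) => (nat => 'a) => 'a" where
 "vsum d u = (SOME y. nsp_lim E (%m. lsum E d u m) y)"

definition series_op :: "(nat => 'a => 'k) => (nat => 'a) => 'a => 'a" where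
 "series_op a u = restrict (%x. vsum (%i. a i x) u) V"

lemma upper_est_in: "upper_est r C u ==> u n \<in> V"
 by (simp add: upper_est_def)

lemma coef_est_bfun: "coef_est s C a ==> bounded_functional E (a n)"
 by (simp add: coef_est_def)

lemma coef_est_le:
 assumes a: "coef_est s C a" and s: "0 < s" and x: "x \<in> V"
 shows "norm (a i x) <= C * N x"
proof -
 have "norm (a i x) powr s <= (\<Sum>i<Suc i. norm (a i x) powr s)"
  by (rule member_le_sum) auto
 also have "... <= (C * N x) powr s" using a x unfolding coef_est_def by blast
 finally show ?thesis using powr_le_cancel[of "norm (a i x)" s "C * N x"] a s x by (auto simp: coef_est_def)
qed

lemma coef_est_summable:
 assumes a: "coef_est s C a" and x: "x \<in> V"
 shows "summable (%i. norm (a i x) powr s)"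
 using a x by (intro summableI_nonneg_bounded[where x = "(C * N x) powr s"]) (auto simp: coef_est_def)

lemma coef_est_summable':
 assumes a: "coef_est s C a" and s: "0 < s" "s <= r" and x: "x \<in> V"
 shows "summable (%i. norm (a i x) powr r)"
proof (rule summable_comparison_test'[where N = 0])
 show "summable (%i. (C * N x) powr (r - s) * norm (a i x) powr s)"
  using coef_est_summable[OF a x] by (rule summable_mult)
 show "norm (norm (a i x) powr r) <= (C * N x) powr (r - s) * norm (a i x) powr s" for i
  using sum_powr_le[of "{i}" "%i. a i x" "C * N x" s r] coef_est_le[OF a s(1) x] s by simp
qed

lemma coef_est_tendsto:
 assumes a: "coef_est s C a" and s: "0 < s" and x: "x \<in> V"
 shows "(%i. a i x) ----> 0"
proof -
 have "(%i. (norm (a i x) powr s) powr (1 / s)) ----> 0 powr (1 / s)"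
  using summable_LIMSEQ_zero[OF coef_est_summable[OF a x]] s by (intro tendsto_powr') auto
 then show ?thesis using s by (simp add: powr_powr tendsto_norm_zero_iff)
qed

lemma lsum_minus_partial:
 assumes "!!n. u n \<in> V" "m <= n"
 shows "lsum E d u n \<ominus> lsum E d u m = lsum E (%i. if i < m then 0 else d i) u n"
proof (rule iota_inject)
 fix b
 have "(\<Sum>i<n. (if i < m then 0 else d i) * \<iota> (u i) b) + (\<Sum>i<m. d i * \<iota> (u i) b) =
   (\<Sum>i<n. (if i < m then 0 else d i) * \<iota> (u i) b) + (\<Sum>i<n. (if i < m then d i else 0) * \<iota> (u i) b)"
  using assms(2) by (intro arg_cong2[where f = "(+)"] refl sum.mono_neutral_cong_left) auto
 also have "... = (\<Sum>i<n. d i * \<iota> (u i) b)"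
  unfolding sum.distrib[symmetric] by (intro sum.cong) auto
 finally show "\<iota> (lsum E d u n \<ominus> lsum E d u m) b = \<iota> (lsum E (%i. if i < m then 0 else d i) u n) b"
  using assms by (simp add: algebra_simps)
qed (use assms in auto)

text \<open>The upper estimate, applied to coefficients set to 0 below m, bounds differences of
  partial sums by tails of the sum of r-th powers.\<close>

lemma vsum_lim:
 assumes cp: "nsp_complete E" and u: "upper_est r C u" and r: "0 < r"
  and sm: "summable (%i. norm (d i) powr r)"
 shows "nsp_lim E (%m. lsum E d u m) (vsum d u)"
proof -
 note uV = upper_est_in[OF u]
 have C: "0 <= C" using u by (simp add: upper_est_def)
 have "nsp_cauchy E (%m. lsum E d u m)"
  unfolding nsp_cauchy_def
 proof (intro allI impI)
  fix e :: real assume e: "0 < e"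
  then have "0 < (e / (C + 1)) powr r" using C by simp
  then obtain k where k: "!!m n. m >= k ==> \<bar>\<Sum>i=m..<n. norm (d i) powr r\<bar> < (e / (C + 1)) powr r"
   using sm unfolding summable_Cauchy real_norm_def by blast
  have le: "N (lsum E d u n \<ominus> lsum E d u m) < e" if "k <= m" "m <= n" for m n
  proof -
   have "(\<Sum>i<n. norm (if i < m then 0 else d i) powr r) = (\<Sum>i=m..<n. norm (d i) powr r)"
    using that by (intro sum.mono_neutral_cong_right) auto
   then have "N (lsum E d u n \<ominus> lsum E d u m) <= C * (\<Sum>i=m..<n. norm (d i) powr r) powr (1 / r)"
    unfolding lsum_minus_partial[OF uV that(2)] using u unfolding upper_est_def by metis
   also have "... <= C * ((e / (C + 1)) powr r) powr (1 / r)"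
    using k[OF that(1), of n] C r by (intro mult_left_mono powr_mono2) (auto simp: sum_nonneg)
   also have "... = C * (e / (C + 1))" using e C r by (simp add: powr_powr)
   also have "... < e" using e C by (simp add: field_simps)
   finally show ?thesis .
  qed
  have "N (lsum E d u m \<ominus> lsum E d u n) < e" if "k <= m" "k <= n" for m n
   using le[of m n] le[of n m] that norm_minus_commute[of "lsum E d u m" "lsum E d u n"] uV
   by (cases "m <= n") auto
  then show "EX k. ALL m>=k. ALL n>=k. N (lsum E d u m \<ominus> lsum E d u n) < e" by blast
 qed
 from nsp_completeD[OF cp _ this] obtain y where "nsp_lim E (%m. lsum E d u m) y" using uV by auto
 then show ?thesis unfolding vsum_def by (rule someI)
qed

context
 fixes r s Ca Cu :: real and a :: "nat => 'a => 'k" and u :: "nat => 'a"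
 assumes cp: "nsp_complete E" and rs: "0 < s" "s < r"
  and a: "coef_est s Ca a" and u: "upper_est r Cu u"
begin

lemma series_op_lim: "x \<in> V ==> nsp_lim E (%m. lsum E (%i. a i x) u m) (series_op a u x)"
 unfolding series_op_def using rs by (simp add: vsum_lim[OF cp u] coef_est_summable'[OF a])

lemma series_op_closed: "x \<in> V ==> series_op a u x \<in> V"
 using series_op_lim by (simp add: nsp_lim_def)

lemma nsp_lim_le:
 assumes lim: "nsp_lim E y l" and V: "!!n. y n \<in> V" "z \<in> V" and le: "!!n. m <= n ==> N (y n \<ominus> z) <= B"
 shows "N (l \<ominus> z) <= B"
proof -
 have "nsp_lim E (%n. y n \<oplus> (-1) \<odot> z) (l \<oplus> (-1) \<odot> z)"
  using V by (intro nsp_lim_add[OF lim]) (auto simp: nsp_lim_def)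
 then have "(%n. N (y n \<ominus> z)) ----> N (l \<ominus> z)"
  unfolding nsp_minus_def[symmetric] using V by (intro nsp_lim_norm) auto
 then show ?thesis using le by (auto intro: LIMSEQ_le_const2)
qed

text \<open>The operator factors through l^s and l^r, and coefficients at most eps times the bound
  \<open>Ca * N x\<close> gain the factor eps^((r - s) / r) in passing from one to the other. With m
  = 0 and eps = 1 this gives boundedness; small eps gives compactness and finite strict
  singularity.\<close>

lemma series_op_tail:
 assumes x: "x \<in> V" and eps: "0 <= eps" "!!i. m <= i ==> norm (a i x) <= eps * (Ca * N x)"
 shows "N (series_op a u x \<ominus> lsum E (%i. a i x) u m) <= Cu * eps powr ((r - s) / r) * (Ca * N x)"
proof (rule nsp_lim_le[OF series_op_lim[OF x], where m = m])
 note uV = upper_est_in[OF u]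
 show "lsum E (%i. a i x) u n \<in> V" for n using uV by simp
 show "lsum E (%i. a i x) u m \<in> V" using uV by simp
 have pos: "0 <= Ca * N x" using a x by (simp add: coef_est_def)
 fix n assume n: "m <= n"
 have "(\<Sum>i<n. norm (if i < m then 0 else a i x) powr r)
   <= (eps * (Ca * N x)) powr (r - s) * (\<Sum>i<n. norm (if i < m then 0 else a i x) powr s)"
  using eps pos rs by (intro sum_powr_le) auto
 also have "(\<Sum>i<n. norm (if i < m then 0 else a i x) powr s) <= (\<Sum>i<n. norm (a i x) powr s)"
  by (intro sum_mono) auto
 also have "... <= (Ca * N x) powr s" using a x unfolding coef_est_def by blast
 finally have "(\<Sum>i<n. norm (if i < m then 0 else a i x) powr r) <= (eps * (Ca * N x)) powr (r - s) * (Ca * N x) powr s"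
  by (simp add: mult_left_mono)
 also have "... = eps powr (r - s) * (Ca * N x) powr r"
  using eps(1) pos by (rule powr_split)
 finally have "(\<Sum>i<n. norm (if i < m then 0 else a i x) powr r) powr (1 / r)
   <= (eps powr (r - s) * (Ca * N x) powr r) powr (1 / r)"
  using rs by (intro powr_mono2) (auto simp: sum_nonneg)
 also have "... = eps powr ((r - s) / r) * (Ca * N x)"
  using eps(1) pos rs by (intro powr_split_root) auto
 finally have *: "Cu * (\<Sum>i<n. norm (if i < m then 0 else a i x) powr r) powr (1 / r)
   <= Cu * (eps powr ((r - s) / r) * (Ca * N x))"
  using u by (intro mult_left_mono) (auto simp: upper_est_def)
 have "N (lsum E (%i. if i < m then 0 else a i x) u n) <= Cu * (\<Sum>i<n. norm (if i < m then 0 else a i x) powr r) powr (1 / r)"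
  using u unfolding upper_est_def by blast
 with * show "N (lsum E (%i. a i x) u n \<ominus> lsum E (%i. a i x) u m) <= Cu * eps powr ((r - s) / r) * (Ca * N x)"
  unfolding lsum_minus_partial[OF uV n] by (simp add: mult.assoc)
qed

lemma series_op_Lops: "series_op a u \<in> Lops E"
proof -
 note uV = upper_est_in[OF u] and bf = coef_est_bfun[OF a]
 have eq: "series_op a u = restrict (series_op a u) V" by (auto simp: series_op_def fun_eq_iff)
 show ?thesis
 proof (subst eq, rule LopsI[where C = "Cu * Ca"])
  fix x y c assume xy: "x \<in> V" "y \<in> V"
  show "series_op a u x \<in> V" using series_op_closed xy by simp
  have "lsum E (%i. a i (x \<oplus> y)) u m = lsum E (%i. a i x) u m \<oplus> lsum E (%i. a i y) u m" for m
   using xy uV by (simp add: bfun_add[OF bf] lsum_add)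
  then show "series_op a u (x \<oplus> y) = series_op a u x \<oplus> series_op a u y"
   using nsp_lim_unique[OF series_op_lim[of "x \<oplus> y"]] nsp_lim_add[OF series_op_lim[OF xy(1)] series_op_lim[OF xy(2)]] xy uV
   by simp
  have "lsum E (%i. a i (c \<odot> x)) u m = c \<odot> lsum E (%i. a i x) u m" for m
   using xy uV by (simp add: bfun_smul[OF bf] lsum_smul)
  then show "series_op a u (c \<odot> x) = c \<odot> series_op a u x"
   using nsp_lim_unique[OF series_op_lim[of "c \<odot> x"]] nsp_lim_smul[OF series_op_lim[OF xy(1)]] xy uV
   by simp
  show "N (series_op a u x) <= Cu * Ca * N x"
   using series_op_tail[OF xy(1), of 1 0] coef_est_le[OF a rs(1) xy(1)] series_op_closed[OF xy(1)]
   by (simp add: mult.assoc)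
 qed
qed

lemma series_op_eqI:
 assumes x: "x \<in> V" and lim: "nsp_lim E (%m. lsum E (%i. a i x) u m) y"
 shows "series_op a u x = y"
 using nsp_lim_unique[OF series_op_lim[OF x] lim] upper_est_in[OF u] by simp

lemma series_op_finite_rank:
 "EX F. F \<in> K_ops E \<and> (\<forall>x\<in>V. F x = lsum E (%i. a i x) u m)"
proof (induction m)
 case 0
 then show ?case using K_ops_zero by (intro exI[of _ "op_zero E"]) auto
next
 case (Suc m)
 then obtain F where "F \<in> K_ops E" "\<forall>x\<in>V. F x = lsum E (%i. a i x) u m" by blast
 then show ?case
  using K_ops_add[OF _ rank_one_K_ops[OF coef_est_bfun[OF a] upper_est_in[OF u]]]
  by (intro exI[of _ "op_add E F (rank_one (a m) (u m))"]) auto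
qed

lemma series_op_compactI:
 assumes le: "!!\<eta>. 0 < \<eta> ==> EX m. \<forall>x\<in>V. N (series_op a u x \<ominus> lsum E (%i. a i x) u m) <= \<eta> * N x"
 shows "series_op a u \<in> K_ops E"
proof -
 have "EX F. F \<in> K_ops E \<and> (\<forall>x\<in>V. N (F x \<ominus> series_op a u x) <= inverse (real (Suc n)) * N x)" for n
 proof -
  obtain m where m: "!!x. x \<in> V ==> N (series_op a u x \<ominus> lsum E (%i. a i x) u m) <= inverse (real (Suc n)) * N x"
   using le[of "inverse (real (Suc n))"] by auto
  obtain F where F: "F \<in> K_ops E" "\<forall>x\<in>V. F x = lsum E (%i. a i x) u m"
   using series_op_finite_rank by blast
  show ?thesis
  proof (intro exI[of _ F] conjI ballI F(1))
   fix x assume x: "x \<in> V"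
   then show "N (F x \<ominus> series_op a u x) <= inverse (real (Suc n)) * N x"
    using m[OF x] F(2) norm_minus_commute[OF series_op_closed[OF x], of "F x"] upper_est_in[OF u] by simp
  qed
 qed
 then obtain F where "!!n. F n \<in> K_ops E" "!!n x. x \<in> V ==> N (F n x \<ominus> series_op a u x) <= inverse (real (Suc n)) * N x"
  by metis
 then show ?thesis
  by (intro K_ops_uniform_limit[OF series_op_Lops _ _ LIMSEQ_inverse_real_of_nat]) auto
qed

text \<open>Uniformly small functionals make the tails small in operator norm, so the operator is a
  norm limit of finite rank operators.\<close>

lemma series_op_compact_coef:
 assumes "!!\<eta>. 0 < \<eta> ==> EX m. ALL i>=m. \<forall>x\<in>V. norm (a i x) <= \<eta> * N x"
 shows "series_op a u \<in> K_ops E"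
proof (rule series_op_compactI)
 fix \<eta> :: real assume \<eta>: "0 < \<eta>"
 have Ca: "0 < Ca" and Cu: "0 <= Cu" using a u by (auto simp: coef_est_def upper_est_def)
 define q where "q = (r - s) / r"
 have q: "0 < q" using rs by (simp add: q_def)
 \<comment> \<open>This solves eps^q * (Cu + 1) * Ca = \<eta>; \<open>Cu + 1\<close> stands in for
   \<open>Cu\<close>, which may be 0.\<close>
 define eps where "eps = (\<eta> / ((Cu + 1) * Ca)) powr (1 / q)"
 have eps: "0 < eps" using \<eta> Ca Cu by (simp add: eps_def)
 obtain m where m: "!!i x. m <= i ==> x \<in> V ==> norm (a i x) <= (eps * Ca) * N x"
  using assms[of "eps * Ca"] eps Ca by auto
 have "N (series_op a u x \<ominus> lsum E (%i. a i x) u m) <= \<eta> * N x" if x: "x \<in> V" for x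
 proof -
  have "N (series_op a u x \<ominus> lsum E (%i. a i x) u m) <= Cu * eps powr q * (Ca * N x)"
   unfolding q_def using m[OF _ x] eps x by (intro series_op_tail) (auto simp: mult.assoc)
  also have "eps powr q = \<eta> / ((Cu + 1) * Ca)" using q \<eta> Ca Cu by (simp add: eps_def powr_powr)
  also have "Cu * (\<eta> / ((Cu + 1) * Ca)) * (Ca * N x) = (Cu / (Cu + 1)) * (\<eta> * N x)" using Ca by simp
  also have "... <= 1 * (\<eta> * N x)" using Cu \<eta> x by (intro mult_right_mono) auto
  finally show ?thesis by simp
 qed
 then show "EX m. \<forall>x\<in>V. N (series_op a u x \<ominus> lsum E (%i. a i x) u m) <= \<eta> * N x" by blast
qed

text \<open>Only boundedly many coefficients of \<open>x\<close> exceed \<open>eps * (Ca * N x)\<close>; their contribution is small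
 because \<open>u i \<rightarrow> 0\<close>, and the others contribute little because \<open>s < r\<close>.\<close>
lemma series_op_compact_vec:
 assumes u0: "(%n. N (u n)) ----> 0"
 shows "series_op a u \<in> K_ops E"
proof (rule series_op_compactI)
 fix \<eta> :: real assume \<eta>: "0 < \<eta>"
 note uV = upper_est_in[OF u]
 have Ca: "0 < Ca" and Cu: "0 <= Cu" using a u by (auto simp: coef_est_def upper_est_def)
 define q where "q = (r - s) / r"
 have q: "0 < q" using rs by (simp add: q_def)
 define eps where "eps = (\<eta> / (2 * ((Cu + 1) * Ca))) powr (1 / q)"
 have eps: "0 < eps" using \<eta> Ca Cu by (simp add: eps_def)
 \<comment> \<open>At most eps^(-s) coefficients exceed \<open>eps * A\<close>, each contributing at
   most \<open>A * \<kappa>\<close>; this value makes their total at most half of \<eta> times the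
   norm of x.\<close>
 define \<kappa> where "\<kappa> = \<eta> * eps powr s / (2 * Ca)"
 have \<kappa>: "0 < \<kappa>" using \<eta> eps Ca by (simp add: \<kappa>_def)
 obtain m where m: "!!i. m <= i ==> N (u i) < \<kappa>"
  using LIMSEQ_D[OF u0 \<kappa>] uV by auto
 have "N (series_op a u x \<ominus> lsum E (%i. a i x) u m) <= \<eta> * N x" if x: "x \<in> V" for x
 proof (cases "x = \<zero>")
  case True
  then show ?thesis using Lops_zero[OF series_op_Lops] uV by (simp add: bfun_zero[OF coef_est_bfun[OF a]] lsum_zero)
 next
  case False
  then have Nx: "0 < N x" using x by (simp add: norm_pos_iff)
  define A where "A = Ca * N x"
  have A: "0 < A" using Ca Nx by (simp add: A_def)
  have aA: "norm (a i x) <= A" for i unfolding A_def by (rule coef_est_le[OF a rs(1) x])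
  have sum_s: "(\<Sum>i<n. norm (a i x) powr s) <= A powr s" for n
   using a x unfolding coef_est_def A_def by blast
  have pos: "0 < (eps * A) powr s" using eps A by simp
  show ?thesis
  proof (rule nsp_lim_le[OF series_op_lim[OF x], where m = m])
   fix n assume n: "m <= n"
   let ?small = "%i. if i < m \<or> norm (a i x) > eps * A then 0 else a i x"
   let ?big = "%i. if \<not> i < m \<and> norm (a i x) > eps * A then a i x else 0"
   have "lsum E (%i. a i x) u n \<ominus> lsum E (%i. a i x) u m = lsum E (%i. ?small i + ?big i) u n"
    unfolding lsum_minus_partial[OF uV n] by (rule lsum_cong) auto
   also have "... = lsum E ?small u n \<oplus> lsum E ?big u n" using uV by (rule lsum_add)
   finally have "N (lsum E (%i. a i x) u n \<ominus> lsum E (%i. a i x) u m) <= N (lsum E ?small u n) + N (lsum E ?big u n)"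
    using norm_add uV by simp
   moreover have "N (lsum E ?small u n) <= \<eta> / 2 * N x"
   proof -
    have "(\<Sum>i<n. norm (?small i) powr r) <= (eps * A) powr (r - s) * (\<Sum>i<n. norm (?small i) powr s)"
     using eps A rs by (intro sum_powr_le) auto
    also have "(\<Sum>i<n. norm (?small i) powr s) <= (\<Sum>i<n. norm (a i x) powr s)"
     by (intro sum_mono) auto
    also have "... <= A powr s" by (rule sum_s)
    finally have "(\<Sum>i<n. norm (?small i) powr r) <= (eps * A) powr (r - s) * A powr s"
     by (simp add: mult_left_mono)
    also have "... = eps powr (r - s) * A powr r" using eps A by (intro powr_split) auto
    finally have "(\<Sum>i<n. norm (?small i) powr r) powr (1 / r) <= (eps powr (r - s) * A powr r) powr (1 / r)"
     using rs by (intro powr_mono2) (auto simp: sum_nonneg)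
    also have "... = eps powr q * A" using eps A rs unfolding q_def by (intro powr_split_root) auto
    also have "eps powr q = \<eta> / (2 * ((Cu + 1) * Ca))" using q \<eta> Ca Cu by (simp add: eps_def powr_powr)
    finally have "Cu * (\<Sum>i<n. norm (?small i) powr r) powr (1 / r) <= Cu * (\<eta> / (2 * ((Cu + 1) * Ca)) * A)"
     using Cu by (intro mult_left_mono)
    also have "... = (Cu / (Cu + 1)) * (\<eta> / 2 * N x)" using Ca by (simp add: A_def)
    also have "... <= 1 * (\<eta> / 2 * N x)" using Cu \<eta> Nx by (intro mult_right_mono) auto
    finally have "Cu * (\<Sum>i<n. norm (?small i) powr r) powr (1 / r) <= \<eta> / 2 * N x" by simp
    moreover have "N (lsum E ?small u n) <= Cu * (\<Sum>i<n. norm (?small i) powr r) powr (1 / r)"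
     using u unfolding upper_est_def by blast
    ultimately show ?thesis by linarith
   qed
   moreover have "N (lsum E ?big u n) <= \<eta> / 2 * N x"
   proof -
    have "N (lsum E ?big u n) <= (\<Sum>i<n. norm (?big i) * N (u i))" using uV by (rule norm_lsum)
    \<comment> \<open>As in Chebyshev's inequality: where a coefficient is large, the quotient of
      its s-th power by that of \<open>eps * A\<close> is at least 1 and may be inserted as a
      factor.\<close>
    also have "... <= (\<Sum>i<n. norm (a i x) powr s * (A * (\<kappa> / (eps * A) powr s)))"
    proof (rule sum_mono)
     fix i assume "i \<in> {..<n}"
     show "norm (?big i) * N (u i) <= norm (a i x) powr s * (A * (\<kappa> / (eps * A) powr s))"
     proof (cases "\<not> i < m \<and> norm (a i x) > eps * A")
      case True
      have "(eps * A) powr s <= norm (a i x) powr s" using True eps A rs by (intro powr_mono2) auto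
      then have "1 <= norm (a i x) powr s / (eps * A) powr s"
       unfolding le_divide_eq_1_pos[OF pos] .
      then have "A * \<kappa> * 1 <= A * \<kappa> * (norm (a i x) powr s / (eps * A) powr s)"
       using A \<kappa> by (intro mult_left_mono) auto
      moreover have "norm (a i x) * N (u i) <= A * \<kappa>"
       using True m[of i] aA[of i] A uV by (intro mult_mono) auto
      ultimately show ?thesis using True by (simp add: mult_ac)
     next
      case False
      then show ?thesis using A \<kappa> by auto
     qed
    qed
    also have "... = (\<Sum>i<n. norm (a i x) powr s) * (A * (\<kappa> / (eps * A) powr s))"
     by (rule sum_distrib_right[symmetric])
    also have "... <= A powr s * (A * (\<kappa> / (eps * A) powr s))"
     using A \<kappa> by (intro mult_right_mono sum_s) auto
    also have "... = A * (\<eta> / (2 * Ca))" using A eps Ca by (simp add: \<kappa>_def powr_mult)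
    also have "... = \<eta> / 2 * N x" using Ca by (simp add: A_def)
    finally show ?thesis .
   qed
   ultimately show "N (lsum E (%i. a i x) u n \<ominus> lsum E (%i. a i x) u m) <= \<eta> * N x"
    by (simp add: field_simps)
  qed (use uV in auto)
 qed
 then show "EX m. \<forall>x\<in>V. N (series_op a u x \<ominus> lsum E (%i. a i x) u m) <= \<eta> * N x" by blast
qed

text \<open>Milman's lemma: an \<open>n\<close>-dimensional space of null sequences contains a vector attaining its
 maximum modulus at many coordinates. As long as fewer coordinates than the dimension are maximal,
 the vector can be moved along a direction that vanishes at all of them until a further one is.\<close>
lemma milman_vector:
 fixes b :: "nat => nat => 'k"
 assumes f: "!!i. i < n ==> f i \<in> V" and ind: "!!c. lsum E c f n = \<zero> ==> ALL i<n. c i = 0"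
  and inj: "!!c. (!!l. l < j ==> (\<Sum>i<n. c i * b l i) = 0) ==> lsum E c f n ~= \<zero> ==> EX i. a i (lsum E c f n) ~= 0"
  and k: "k + j <= n"
 shows "EX c J. (ALL l<j. (\<Sum>i<n. c i * b l i) = 0) \<and> (ALL i. norm (a i (lsum E c f n)) <= 1) \<and>
  finite J \<and> card J = k \<and> (\<forall>i\<in>J. norm (a i (lsum E c f n)) = 1)"
 using k
proof (induction k)
 case 0
 have "lsum E (%_. 0) f n = \<zero>" using f by (simp add: lsum_zero)
 then show ?case by (intro exI[of _ "%_. 0"] exI[of _ "{}"]) (simp add: bfun_zero[OF coef_est_bfun[OF a]])
next
 case (Suc k)
 note bf = coef_est_bfun[OF a]
 obtain c J where c: "ALL l<j. (\<Sum>i<n. c i * b l i) = 0" "ALL i. norm (a i (lsum E c f n)) <= 1"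
  and J: "finite J" "card J = k" "\<forall>i\<in>J. norm (a i (lsum E c f n)) = 1"
  using Suc by auto
 obtain h where h: "bij_betw h {..<k} J" using J by (metis bij_betw_from_nat_into_finite)
 \<comment> \<open>The direction must respect the j side conditions and vanish at the k coordinates
   that are already maximal; it exists because k + j is still below n.\<close>
 let ?sys = "%l i. if l < j then b l i else a (h (l - j)) (f i)"
 obtain d where d: "\<exists>i\<in>{..<n}. d i ~= 0" "ALL l<j + k. (\<Sum>i\<in>{..<n}. d i * ?sys l i) = 0"
  using homogeneous_system[of "{..<n}" "j + k" ?sys] Suc.prems by auto
 let ?x = "lsum E c f n" and ?y = "lsum E d f n"
 have V: "?x \<in> V" "?y \<in> V" using f by auto
 have db: "(\<Sum>i<n. d i * b l i) = 0" if "l < j" for l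
  using d(2)[rule_format, of l] that by simp
 have yJ: "a i ?y = 0" if iJ: "i \<in> J" for i
 proof -
  obtain l where l: "l < k" "h l = i" using h iJ by (auto simp: bij_betw_def)
  have "(\<Sum>i'<n. d i' * a i (f i')) = 0"
   using d(2)[rule_format, of "j + l"] l by simp
  moreover have "a i ?y = (\<Sum>i'<n. d i' * a i (f i'))" by (rule bfun_lsum[OF bf f])
  ultimately show ?thesis by simp
 qed
 have y: "?y ~= \<zero>" using ind d(1) by blast
 obtain i0 where i0: "a i0 ?y ~= 0" using inj[OF db y] by blast
 define g where "g i t = norm (a i ?x + of_real t * a i ?y)" for i t
 \<comment> \<open>All t for which the moved vector still has coordinates at most 1. The set is
   closed and, through the coordinate \<open>i0\<close>, bounded, so it has a largest
   element.\<close>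
 define S where "S = {t. 0 <= t \<and> (ALL i. g i t <= 1)}"
 have S0: "0 \<in> S" using c(2) by (simp add: S_def g_def)
 have bdd: "t <= 2 / norm (a i0 ?y)" if "t \<in> S" for t
 proof -
  have "norm (of_real t * a i0 ?y) <= g i0 t + norm (a i0 ?x)"
   unfolding g_def by (metis add_diff_cancel_left' norm_triangle_ineq4)
  also have "... <= 1 + 1" using that c(2) by (intro add_mono) (auto simp: S_def)
  finally show ?thesis using that i0 by (simp add: S_def norm_mult pos_le_divide_eq)
 qed
 have "closed S"
 proof -
  have "S = {0..} \<inter> (\<Inter>i. {t. g i t <= 1})" by (auto simp: S_def)
  moreover have "closed {t. g i t <= 1}" for i unfolding g_def by (intro closed_Collect_le continuous_intros)
  ultimately show ?thesis by auto
 qed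
 define t where "t = Sup S"
 have bddS: "bdd_above S" by (rule bdd_aboveI) (rule bdd)
 have tS: "t \<in> S" unfolding t_def using closed_contains_Sup[OF _ bddS \<open>closed S\<close>] S0 by blast
 \<comment> \<open>Otherwise the motion could continue: beyond some index the coordinates stay below
   1/2 + 1/2, finitely many others below 1 are kept there by continuity, and those in
   \<open>J\<close> do not move.\<close>
 have "EX i. i \<notin> J \<and> g i t = 1"
 proof (rule ccontr)
  assume no: "\<nexists>i. i \<notin> J \<and> g i t = 1"
  have lt: "g i t < 1" if "i \<notin> J" for i using no that tS by (auto simp: S_def less_le)
  have "(%i. a i ?x + of_real t * a i ?y) ----> 0 + of_real t * 0"
   by (intro tendsto_intros coef_est_tendsto[OF a rs(1)] V)
  then have "(%i. g i t) ----> 0" unfolding g_def using tendsto_norm_zero by force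
  moreover have "(%i. norm (a i ?y)) ----> 0"
   using coef_est_tendsto[OF a rs(1) V(2)] by (rule tendsto_norm_zero)
  ultimately have "\<forall>\<^sub>F i in sequentially. g i t < 1 / 2 \<and> norm (a i ?y) < 1 / 2"
   by (intro eventually_conj order_tendstoD(2)) auto
  then obtain M where M: "!!i. M <= i ==> g i t < 1 / 2 \<and> norm (a i ?y) < 1 / 2"
   by (auto simp: eventually_sequentially)
  have cont: "\<forall>\<^sub>F h in at_right 0. i \<notin> J --> g i (t + h) < 1" for i
  proof (cases "i \<in> J")
   case False
   have "((%h. g i (t + h)) \<longlongrightarrow> g i (t + 0)) (at_right 0)"
    unfolding g_def by (intro tendsto_intros)
   then show ?thesis using lt[OF False] order_tendstoD(2) by fastforce
  qed simp
  have "\<forall>\<^sub>F h in at_right (0::real). \<forall>i\<in>{..<M}. i \<notin> J --> g i (t + h) < 1"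
   using cont by (intro eventually_ball_finite) auto
  moreover have "\<forall>\<^sub>F h in at_right (0::real). h < 1" 
   by (rule order_tendstoD(2)[OF tendsto_ident_at]) simp
  moreover have "\<forall>\<^sub>F h in at_right (0::real). 0 < h" by (rule eventually_at_right_less)
  ultimately have "\<forall>\<^sub>F h in at_right (0::real). (\<forall>i\<in>{..<M}. i \<notin> J --> g i (t + h) < 1) \<and> h < 1 \<and> 0 < h"
   by (intro eventually_conj)
  then obtain h where h: "\<forall>i\<in>{..<M}. i \<notin> J --> g i (t + h) < 1" "h < 1" "0 < h"
   using eventually_happens'[OF trivial_limit_at_right_real] by blast
  have "g i (t + h) <= 1" for i
  proof (cases "i \<in> J")
   case True
   then show ?thesis using yJ c(2) by (simp add: g_def)
  next
   case False
   show ?thesis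
   proof (cases "i < M")
    case True
    then show ?thesis using h(1) False by auto
   next
    case False
    have "g i (t + h) <= g i t + norm (of_real h * a i ?y)"
     unfolding g_def using norm_triangle_ineq[of "a i ?x + of_real t * a i ?y" "of_real h * a i ?y"]
     by (simp add: algebra_simps)
    also have "norm (of_real h * a i ?y) <= 1 * norm (a i ?y)"
     unfolding norm_mult using h by (intro mult_right_mono) auto
    finally show ?thesis using M[of i] False by simp
   qed
  qed
  then have "t + h \<in> S" using tS h by (auto simp: S_def)
  then have "t + h <= t" unfolding t_def using bddS by (intro cSup_upper)
  then show False using h by simp
 qed
 then obtain i1 where i1: "i1 \<notin> J" "g i1 t = 1" by blast
 let ?c = "%i. c i + of_real t * d i"
 have z: "lsum E ?c f n = ?x \<oplus> of_real t \<odot> ?y"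
  using f by (simp add: lsum_add lsum_smul)
 have gz: "norm (a i (lsum E ?c f n)) = g i t" for i
  unfolding z g_def using V by (simp add: bfun_add[OF bf] bfun_smul[OF bf])
 have "(\<Sum>i<n. ?c i * b l i) = 0" if "l < j" for l
  using c(1) db[OF that] that
  by (simp add: algebra_simps sum.distrib flip: sum_distrib_left)
 moreover have "g i t = 1" if "i \<in> J" for i using yJ[OF that] J(3) that by (simp add: g_def)
 moreover have "g i t <= 1" for i using tS by (simp add: S_def)
 ultimately show ?case using i1 J
  by (intro exI[of _ ?c] exI[of _ "insert i1 J"]) (simp add: gz)
qed

text \<open>A vector with all coordinates at most 1 and k of them of modulus 1 has norm at least
  k^(1/s) / Ca, so its coordinates are small relative to its norm and \<open>series_op_tail\<close>
  bounds the ratio by a multiple of k^(-q). If some admissible vector has all coordinates 0, the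
  operator kills it outright.\<close>

lemma series_op_fss: "fss (series_op a u)"
 unfolding fss_def
proof (intro conjI allI impI series_op_Lops)
 fix \<delta> :: real and j :: nat assume \<delta>: "0 < \<delta>"
 have Ca: "0 < Ca" and Cu: "0 <= Cu" using a u by (auto simp: coef_est_def upper_est_def)
 define q where "q = (r - s) / r / s"
 have q: "0 < q" using rs by (simp add: q_def)
 have "(%k. real k powr (- q)) ----> 0"
  by (rule tendsto_neg_powr) (use q filterlim_real_sequentially in auto)
 then have "(%k. Cu * Ca * real k powr (- q)) ----> 0" by (rule tendsto_mult_right_zero)
 then have "\<forall>\<^sub>F k in sequentially. Cu * Ca * real k powr (- q) < \<delta>"
  using \<delta> by (rule order_tendstoD(2))
 then obtain k0 where k0: "!!k. k0 <= k ==> Cu * Ca * real k powr (- q) < \<delta>"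
  unfolding eventually_sequentially by blast
 define k where "k = Suc k0"
 have k: "Cu * Ca * real k powr (- q) < \<delta>" "0 < k" using k0[of k] by (auto simp: k_def)
 have "fss_dim (series_op a u) \<delta> j (k + j)"
  unfolding fss_dim_def
 proof (intro allI impI)
  fix f :: "nat => 'a" and b :: "nat => nat => 'k"
  let ?n = "k + j"
  assume f: "ALL i<?n. f i \<in> V" and ind: "ALL c. lsum E c f ?n = \<zero> --> (ALL i<?n. c i = 0)"
  have V: "lsum E c f ?n \<in> V" for c using f by (intro lsum_closed) blast
  show "EX c. lsum E c f ?n ~= \<zero> \<and> (ALL l<j. (\<Sum>i<?n. c i * b l i) = 0) \<and>
    N (series_op a u (lsum E c f ?n)) < \<delta> * N (lsum E c f ?n)"
  proof (cases "EX c. (ALL l<j. (\<Sum>i<?n. c i * b l i) = 0) \<and> lsum E c f ?n ~= \<zero> \<and> (ALL i. a i (lsum E c f ?n) = 0)")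
   case True
   then obtain c where c: "ALL l<j. (\<Sum>i<?n. c i * b l i) = 0" "lsum E c f ?n ~= \<zero>" "!!i. a i (lsum E c f ?n) = 0"
    by blast
   have "N (series_op a u (lsum E c f ?n)) <= 0"
    using series_op_tail[OF V, of 0 0 c] series_op_closed[OF V] c(3) by simp
   also have "0 < \<delta> * N (lsum E c f ?n)" using \<delta> c(2) V by (simp add: norm_pos_iff)
   finally show ?thesis using c by blast
  next
   case False
   have "EX c J. (ALL l<j. (\<Sum>i<?n. c i * b l i) = 0) \<and> (ALL i. norm (a i (lsum E c f ?n)) <= 1) \<and>
     finite J \<and> card J = k \<and> (\<forall>i\<in>J. norm (a i (lsum E c f ?n)) = 1)"
   proof (rule milman_vector)
    show "f i \<in> V" if "i < ?n" for i using f that by blast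
    show "ALL i<?n. c i = 0" if "lsum E c f ?n = \<zero>" for c using ind that by blast
    show "EX i. a i (lsum E c f ?n) ~= 0"
     if "!!l. l < j ==> (\<Sum>i<?n. c i * b l i) = 0" "lsum E c f ?n ~= \<zero>" for c
     using False that by blast
   qed simp
   then obtain c J where c: "ALL l<j. (\<Sum>i<?n. c i * b l i) = 0" "ALL i. norm (a i (lsum E c f ?n)) <= 1"
    and J: "finite J" "card J = k" "\<forall>i\<in>J. norm (a i (lsum E c f ?n)) = 1" by blast
   let ?x = "lsum E c f ?n"
   obtain m where m: "J \<subseteq> {..<m}" using finite_nat_bounded[OF J(1)] by blast
   have "real k = (\<Sum>i\<in>J. norm (a i ?x) powr s)" using J by simp
   also have "... <= (\<Sum>i<m. norm (a i ?x) powr s)" using m by (intro sum_mono2) auto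
   also have "... <= (Ca * N ?x) powr s" using a V unfolding coef_est_def by blast
   finally have le: "real k <= (Ca * N ?x) powr s" .
   have A: "0 < Ca * N ?x" using le k(2) Ca norm_nonneg[OF V[of c]] by (cases "N ?x = 0") auto
   have root: "real k powr (1 / s) <= Ca * N ?x"
    using powr_mono2[of "1 / s", OF _ _ le] A rs by (simp add: powr_powr)
   \<comment> \<open>Normalised so that the coordinate bound in \<open>series_op_tail\<close>
     becomes 1.\<close>
   define eps where "eps = 1 / (Ca * N ?x)"
   have epsA: "eps * (Ca * N ?x) = 1" unfolding eps_def using less_imp_neq[OF A] by (metis nonzero_divide_eq_eq)
   have "N (series_op a u ?x) <= Cu * eps powr ((r - s) / r) * (Ca * N ?x)"
    using series_op_tail[OF V, of eps 0 c, unfolded epsA] series_op_closed[OF V] c(2) A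
    by (simp add: eps_def)
   also have "eps powr ((r - s) / r) <= (real k powr (- (1 / s))) powr ((r - s) / r)"
    using root A rs k(2) by (intro powr_mono2) (auto simp: eps_def powr_minus field_simps)
   also have "... = real k powr (- q)" by (simp add: powr_powr q_def mult.commute)
   finally have "N (series_op a u ?x) <= Cu * real k powr (- q) * (Ca * N ?x)"
    using Cu A by (simp add: mult_left_mono mult_right_mono)
   also have "... = (Cu * Ca * real k powr (- q)) * N ?x" by simp
   also have "... < \<delta> * N ?x" using k(1) A Ca by (intro mult_strict_right_mono) (auto simp: zero_less_mult_iff)
   finally show ?thesis using A Ca c by (intro exI[of _ c]) auto
  qed
 qed
 then show "EX n. fss_dim (series_op a u) \<delta> j n" by blast
qed

end

end

section \<open>L^p functions on a measure space\<close>

definition Lpf :: "real => 'a measure => ('a => 'b::{real_normed_field, banach, second_countable_topology}) set" where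
 "Lpf p M = {f \<in> borel_measurable M. integrable M (%x. norm (f x) powr p)}"

definition Lpn :: "real => 'a measure => ('a => 'b::{real_normed_field, banach, second_countable_topology}) => real" where
 "Lpn p M f = (LINT x|M. norm (f x) powr p) powr (1 / p)"

lemma LpfI: "f \<in> borel_measurable M ==> integrable M (%x. norm (f x) powr p) ==> f \<in> Lpf p M"
 and Lpf_measurable: "f \<in> Lpf p M ==> f \<in> borel_measurable M"
 and Lpf_integrable: "f \<in> Lpf p M ==> integrable M (%x. norm (f x) powr p)"
 by (simp_all add: Lpf_def)

lemma Lpn_nonneg [simp]: "0 <= Lpn p M f"
 by (simp add: Lpn_def)

lemma Lpn_powr: "0 < p ==> Lpn p M f powr p = (LINT x|M. norm (f x) powr p)"
 by (simp add: Lpn_def powr_powr)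

lemma Lpn_leI: "0 < p ==> (LINT x|M. norm (f x) powr p) <= C powr p ==> 0 <= C ==> Lpn p M f <= C"
 by (rule powr_le_cancel[of _ p]) (simp_all add: Lpn_powr)

lemma Lpf_dominated:
 assumes g: "g \<in> Lpf p M" and f: "f \<in> borel_measurable M" and le: "AE x in M. norm (f x) <= c * norm (g x)" and p: "0 < p" "0 <= c"
 shows "f \<in> Lpf p M" "Lpn p M f <= c * Lpn p M g"
proof -
 have le': "AE x in M. norm (f x) powr p <= c powr p * norm (g x) powr p"
  using le by eventually_elim (use p in \<open>auto simp flip: powr_mult intro: powr_mono2\<close>)
 have int: "integrable M (%x. c powr p * norm (g x) powr p)" using g by (simp add: Lpf_def)
 have f': "integrable M (%x. norm (f x) powr p)"
  using le' f by (intro integrable_bound[OF int]) auto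
 then show "f \<in> Lpf p M" using f by (rule LpfI[rotated])
 have "(LINT x|M. norm (f x) powr p) <= (LINT x|M. c powr p * norm (g x) powr p)"
  using f' int le' by (rule integral_mono_AE)
 also have "... = (c * Lpn p M g) powr p" using p by (simp add: powr_mult Lpn_powr)
 finally show "Lpn p M f <= c * Lpn p M g" using p by (intro Lpn_leI) auto
qed

lemma Lpf_cong_AE:
 assumes g: "g \<in> Lpf p M" and f: "f \<in> borel_measurable M" and eq: "AE x in M. f x = g x"
 shows "f \<in> Lpf p M"
proof -
 have [measurable]: "g \<in> borel_measurable M" "f \<in> borel_measurable M" using g f by (auto simp: Lpf_def)
 have "integrable M (%x. norm (f x) powr p) \<longleftrightarrow> integrable M (%x. norm (g x) powr p)"
  using eq by (intro integrable_cong_AE) auto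
 then show ?thesis using g f by (auto simp: Lpf_def)
qed

lemma Lpn_cong_AE:
 assumes [measurable]: "f \<in> borel_measurable M" "g \<in> borel_measurable M" and eq: "AE x in M. f x = g x"
 shows "Lpn p M f = Lpn p M g"
proof -
 have "(LINT x|M. norm (f x) powr p) = (LINT x|M. norm (g x) powr p)"
  using eq by (intro integral_cong_AE) auto
 then show ?thesis by (simp add: Lpn_def)
qed

lemma Lpf_zero [simp]: "(%_. 0) \<in> Lpf p M"
 by (simp add: Lpf_def)

lemma Lpn_zero [simp]: "Lpn p M (%_. 0) = 0"
 by (simp add: Lpn_def)

lemma Lpf_cmult: "f \<in> Lpf p M ==> 0 < p ==> (%x. c * f x) \<in> Lpf p M"
 by (auto simp: Lpf_def norm_mult powr_mult)

lemma Lpn_cmult: "0 < p ==> Lpn p M (%x. c * f x) = norm c * Lpn p M f"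
 by (simp add: Lpn_def norm_mult powr_mult powr_powr)

lemma powr_convex_nonneg:
 fixes a b t p :: real
 assumes p: "1 <= p" and ab: "0 <= a" "0 <= b" and t: "0 <= t" "t <= 1"
 shows "(t * a + (1 - t) * b) powr p <= t * a powr p + (1 - t) * b powr p"
proof -
 have le: "t powr p <= t" if "0 <= t" "t <= 1" for t :: real
  using powr_mono'[of 1 p t] p that by (cases "t = 0") auto
 consider "a = 0" | "b = 0" | "0 < a" "0 < b" using ab by fastforce
 then show ?thesis
 proof cases
  case 1
  have "(1 - t) powr p * b powr p <= (1 - t) * b powr p" using le[of "1 - t"] t by (intro mult_right_mono) auto
  then show ?thesis using 1 ab t p by (simp add: powr_mult)
 next
  case 2
  have "t powr p * a powr p <= t * a powr p" using le[of t] t by (intro mult_right_mono) auto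
  then show ?thesis using 2 ab t p by (simp add: powr_mult)
 next
  case 3
  have "((1 - (1 - t)) *\<^sub>R a + (1 - t) *\<^sub>R b) powr p <= (1 - (1 - t)) * a powr p + (1 - t) * b powr p"
   using 3 t by (intro convex_onD[OF powr_convex[OF p]]) auto
  then show ?thesis by simp
 qed
qed

text \<open>Minkowski's inequality from convexity: the sum of the moduli of f and g is a + b times
  the convex combination of those of f / a and g / b with weights a / (a + b) and b / (a + b).
  Strict bounds keep a and b positive; \<open>Lpn_triangle\<close> removes the slack.\<close>

lemma Lpf_Lpn_add_strict:
 assumes f: "f \<in> Lpf p M" and g: "g \<in> Lpf p M" and p: "1 <= p" and ab: "Lpn p M f < a" "Lpn p M g < b"
 shows "(%x. f x + g x) \<in> Lpf p M \<and> Lpn p M (%x. f x + g x) <= a + b"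
proof -
 have [measurable]: "f \<in> borel_measurable M" "g \<in> borel_measurable M" using f g by (auto simp: Lpf_def)
 have a: "0 < a" and b: "0 < b" using ab Lpn_nonneg by (metis le_less_trans)+
 let ?t = "a / (a + b)"
 let ?h = "%x. (a + b) powr p * (?t * (norm (f x) / a) powr p + (1 - ?t) * (norm (g x) / b) powr p)"
 have t: "0 <= ?t" "?t <= 1" using a b by auto
 have pt: "norm (f x + g x) powr p <= ?h x" for x
 proof -
  have "(a + b) * (?t * (norm (f x) / a) + (1 - ?t) * (norm (g x) / b)) = norm (f x) + norm (g x)"
  proof -
   have "1 - ?t = b / (a + b)" using a b by (simp add: field_simps)
   then show ?thesis using a b by (simp add: distrib_left)
  qed
  then have "norm (f x + g x) <= (a + b) * (?t * (norm (f x) / a) + (1 - ?t) * (norm (g x) / b))"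
   using norm_triangle_ineq[of "f x" "g x"] by simp
  then have "norm (f x + g x) powr p <= ((a + b) * (?t * (norm (f x) / a) + (1 - ?t) * (norm (g x) / b))) powr p"
   using p by (intro powr_mono2) auto
  also have "... = (a + b) powr p * (?t * (norm (f x) / a) + (1 - ?t) * (norm (g x) / b)) powr p"
   by (rule powr_mult)
  also have "... <= ?h x" using a b by (intro mult_left_mono powr_convex_nonneg[OF p _ _ t]) auto
  finally show ?thesis .
 qed
 have ia: "integrable M (%x. (norm (f x) / a) powr p)" "integrable M (%x. (norm (g x) / b) powr p)"
  using f g a b by (auto simp: Lpf_def powr_divide)
 then have int: "integrable M ?h" by auto
 have fg: "integrable M (%x. norm (f x + g x) powr p)"
  by (rule integrable_bound[OF int]) (auto intro!: AE_I2 order_trans[OF pt] abs_ge_self)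
 have fa: "(LINT x|M. (norm (f x) / a) powr p) <= 1" if "Lpn p M f < a" "0 < a" for f :: "'a => 'b" and a
 proof -
  have "(LINT x|M. (norm (f x) / a) powr p) = Lpn p M f powr p / a powr p"
   using that p by (simp add: powr_divide Lpn_powr)
  also have "... <= 1" using that p by (auto intro!: powr_mono2)
  finally show ?thesis .
 qed
 have "(LINT x|M. norm (f x + g x) powr p) <= (LINT x|M. ?h x)"
  using fg int pt by (rule integral_mono)
 also have "... = (a + b) powr p * (?t * (LINT x|M. (norm (f x) / a) powr p) + (1 - ?t) * (LINT x|M. (norm (g x) / b) powr p))"
  using ia by simp
 also have "... <= (a + b) powr p * (?t * 1 + (1 - ?t) * 1)"
  using fa[OF ab(1) a] fa[OF ab(2) b] t by (intro mult_left_mono add_mono) auto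
 finally have "(LINT x|M. norm (f x + g x) powr p) <= (a + b) powr p" by simp
 then have "Lpn p M (%x. f x + g x) <= a + b" using p a b by (intro Lpn_leI) auto
 then show ?thesis using fg by (auto simp: Lpf_def)
qed

lemma Lpf_add: "f \<in> Lpf p M ==> g \<in> Lpf p M ==> 1 <= p ==> (%x. f x + g x) \<in> Lpf p M"
 using Lpf_Lpn_add_strict[of f p M g "Lpn p M f + 1" "Lpn p M g + 1"] by simp

lemma Lpn_triangle:
 assumes "f \<in> Lpf p M" "g \<in> Lpf p M" "1 <= p"
 shows "Lpn p M (%x. f x + g x) <= Lpn p M f + Lpn p M g"
proof (rule field_le_epsilon)
 fix e :: real assume "0 < e"
 then show "Lpn p M (%x. f x + g x) <= Lpn p M f + Lpn p M g + e"
  using Lpf_Lpn_add_strict[OF assms, of "Lpn p M f + e / 2" "Lpn p M g + e / 2"] by simp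
qed

lemma Lpf_diff: "f \<in> Lpf p M ==> g \<in> Lpf p M ==> 1 <= p ==> (%x. f x - g x) \<in> Lpf p M"
 using Lpf_add[of f p M "%x. (-1) * g x"] Lpf_cmult[of g p M "-1"] by simp

lemma Lpn_diff: "f \<in> Lpf p M ==> g \<in> Lpf p M ==> 1 <= p ==> Lpn p M (%x. f x - g x) <= Lpn p M f + Lpn p M g"
 using Lpn_triangle[of f p M "%x. (-1) * g x"] Lpf_cmult[of g p M "-1"] Lpn_cmult[of p M "-1" g] by simp

lemma Lpf_sum: "(!!i. i \<in> I ==> f i \<in> Lpf p M) ==> 1 <= p ==> (%x. \<Sum>i\<in>I. f i x) \<in> Lpf p M"
 by (induction I rule: infinite_finite_induct) (auto intro: Lpf_add)

lemma Lpn_sum: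
 "(!!i. i \<in> I ==> f i \<in> Lpf p M) ==> 1 <= p ==> Lpn p M (%x. \<Sum>i\<in>I. f i x) <= (\<Sum>i\<in>I. Lpn p M (f i))"
proof (induction I rule: infinite_finite_induct)
 case (insert i I)
 then show ?case using Lpn_triangle[of "f i" p M "%x. \<Sum>i\<in>I. f i x"] Lpf_sum[of I f p M] by force
qed auto

lemma Lpn_eq_0D:
 assumes f: "f \<in> Lpf p M" and 0: "Lpn p M f = 0" and p: "0 < p"
 shows "AE x in M. f x = 0"
proof -
 have "(LINT x|M. norm (f x) powr p) = 0" using Lpn_powr[OF p, of M f] 0 by simp
 then have "AE x in M. norm (f x) powr p = 0"
  using integral_nonneg_eq_0_iff_AE[OF Lpf_integrable[OF f]] by auto
 then show ?thesis by simp
qed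

text \<open>Young's inequality for f / a and g / b, with a and b strictly above the norms so that
  division is safe; afterwards a and b tend to the norms.\<close>

lemma holder:
 fixes f g :: "'a => 'b::{real_normed_field, banach, second_countable_topology}"
 assumes f: "f \<in> Lpf p M" and g: "g \<in> Lpf q M" and p: "1 < p" and q: "1 < q" and pq: "1 / p + 1 / q = 1"
 shows "integrable M (%x. f x * g x)" "norm (LINT x|M. f x * g x) <= Lpn p M f * Lpn q M g"
proof -
 have [measurable]: "f \<in> borel_measurable M" "g \<in> borel_measurable M" using f g by (auto simp: Lpf_def)
 have pt: "norm (f x * g x) <= a * b * ((norm (f x) / a) powr p / p + (norm (g x) / b) powr q / q)"
  if ab: "0 < a" "0 < b" for a b x
 proof -
  have "norm (f x * g x) = a * b * ((norm (f x) / a) * (norm (g x) / b))" using that by (simp add: norm_mult)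
  also have "... <= a * b * ((norm (f x) / a) powr p / p + (norm (g x) / b) powr q / q)"
   using ab by (intro mult_left_mono Youngs_inequality[OF p q pq]) auto
  finally show ?thesis .
 qed
 have int: "integrable M (%x. a * b * ((norm (f x) / a) powr p / p + (norm (g x) / b) powr q / q))"
  if "0 < a" "0 < b" for a b
  using f g that by (auto simp: Lpf_def powr_divide)
 show fg: "integrable M (%x. f x * g x)"
  by (rule integrable_bound[OF int[of 1 1]]) (auto intro!: AE_I2 order_trans[OF pt[of 1 1]] abs_ge_self)
 have le: "norm (LINT x|M. f x * g x) <= a * b" if ab: "Lpn p M f < a" "Lpn q M g < b" for a b
 proof -
  have a: "0 < a" and b: "0 < b" using ab Lpn_nonneg by (metis le_less_trans)+
  have "norm (LINT x|M. f x * g x) <= (LINT x|M. norm (f x * g x))" by (rule integral_norm_bound)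
  also have "... <= (LINT x|M. a * b * ((norm (f x) / a) powr p / p + (norm (g x) / b) powr q / q))"
   using fg int[OF a b] pt[OF a b] by (intro integral_mono) auto
  also have "... = a * b * (Lpn p M f powr p / a powr p / p + Lpn q M g powr q / b powr q / q)"
   using f g a b p q by (simp add: Lpf_def powr_divide Lpn_powr)
  also have "... <= a * b * (1 / p + 1 / q)"
   using a b ab p q by (intro mult_left_mono add_mono divide_right_mono) (auto intro!: powr_mono2)
  finally show ?thesis using pq by simp
 qed
 have "norm (LINT x|M. f x * g x) <= (Lpn p M f + e) * (Lpn q M g + e)" if "0 < e" for e
  using le[of "Lpn p M f + e" "Lpn q M g + e"] that by simp
 moreover have "((%e. (Lpn p M f + e) * (Lpn q M g + e)) \<longlongrightarrow> (Lpn p M f + 0) * (Lpn q M g + 0)) (at_right 0)"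
  by (intro tendsto_intros)
 ultimately have "norm (LINT x|M. f x * g x) <= (Lpn p M f + 0) * (Lpn q M g + 0)"
  by (intro tendsto_lowerbound[where F = "at_right 0"]) (auto simp: eventually_at_right_less eventually_at_filter)
 then show "norm (LINT x|M. f x * g x) <= Lpn p M f * Lpn q M g" by simp
qed

context finite_measure
begin

lemma Lpf_bounded:
 assumes "f \<in> borel_measurable M" "!!x. norm (f x) <= C" and p: "0 < p"
 shows "f \<in> Lpf p M"
proof (rule LpfI)
 show "integrable M (%x. norm (f x) powr p)"
  by (rule integrable_const_bound[of _ "C powr p"]) (use assms in \<open>auto intro!: powr_mono2\<close>)
qed (use assms in auto)

text \<open>A form of Jensen's inequality: with \<open>D\<close> the \<open>p\<close>-th mean of \<open>f\<close> over \<open>A\<close>, the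
 function \<open>\<bar>f\<bar> / D\<close> is bounded by \<open>1 + (\<bar>f\<bar> / D)\<^sup>p\<close>.\<close>
lemma Lpf_set_integral:
 fixes f :: "'a => 'b::{real_normed_field, banach, second_countable_topology}"
 assumes f: "f \<in> Lpf p M" and p: "1 <= p" and A: "A \<in> sets M" "0 < measure M A"
  and fA: "(LINT x|M. indicator A x * norm (f x) powr p) <= C powr p" "0 <= C"
 shows "(LINT x|M. indicator A x * norm (f x)) <= 2 * measure M A powr (1 - 1 / p) * C"
  and "integrable M (%x. indicator A x * norm (f x))"
proof -
 have [measurable]: "f \<in> borel_measurable M" using f by (auto simp: Lpf_def)
 note [measurable] = A(1)
 let ?m = "measure M A"
 have intp: "integrable M (%x. indicator A x * norm (f x) powr p)"
  using integrable_mult_indicator[OF A(1) Lpf_integrable[OF f]] by simp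
 have int1: "integrable M (%x. indicator A x :: real)" 
  by (rule integrable_const_bound[where B = 1]) (use A in auto)
 have pt: "indicator A x * norm (f x) <= D * (indicator A x + indicator A x * norm (f x) powr p / D powr p)" if D: "0 < D" for D x
 proof -
  have le: "y <= 1 + y powr p" if "0 <= y" for y :: real
  proof (cases "y <= 1")
   case False
   then show ?thesis using powr_mono[of 1 p y] p by simp
  qed (use that in \<open>simp add: add_increasing2\<close>)
  have "norm (f x) <= D * (1 + (norm (f x) / D) powr p)" using le[of "norm (f x) / D"] D by (simp add: field_simps)
  then show ?thesis using D by (auto simp: powr_divide split: split_indicator)
 qed
 have intD: "integrable M (%x. D * (indicator A x + indicator A x * norm (f x) powr p / D powr p))" for D :: real
  using intp int1 by auto
 show int: "integrable M (%x. indicator A x * norm (f x))"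
  by (rule integrable_bound[OF intD[of 1]]) (auto intro!: AE_I2 order_trans[OF pt[of 1]] abs_ge_self)
 have le: "(LINT x|M. indicator A x * norm (f x)) <= 2 * ?m powr (1 - 1 / p) * c" if c: "C < c" for c
 proof -
  have c0: "0 < c" using c fA(2) by simp
  let ?D = "c / ?m powr (1 / p)"
  have D: "0 < ?D" using c0 A by simp
  have "(LINT x|M. indicator A x * norm (f x)) <= (LINT x|M. ?D * (indicator A x + indicator A x * norm (f x) powr p / ?D powr p))"
   using int intD pt[OF D] by (rule integral_mono)
  also have "... = ?D * (?m + (LINT x|M. indicator A x * norm (f x) powr p) / ?D powr p)"
   using int1 intp A by simp
  also have "... <= ?D * (?m + c powr p / ?D powr p)"
   using D fA c p by (intro mult_left_mono add_mono divide_right_mono order_trans[OF fA(1)] powr_mono2) auto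
  also have "c powr p / ?D powr p = ?m" using c0 p A by (simp add: powr_divide powr_powr)
  also have "?D * (?m + ?m) = 2 * (?m / ?m powr (1 / p)) * c" by simp
  also have "?m / ?m powr (1 / p) = ?m powr (1 - 1 / p)" using A by (simp add: powr_diff)
  finally show ?thesis .
 qed
 show "(LINT x|M. indicator A x * norm (f x)) <= 2 * ?m powr (1 - 1 / p) * C"
 proof (rule tendsto_lowerbound)
  show "((%c. 2 * ?m powr (1 - 1 / p) * c) \<longlongrightarrow> 2 * ?m powr (1 - 1 / p) * C) (at_right C)"
   by (intro tendsto_intros)
  show "\<forall>\<^sub>F c in at_right C. (LINT x|M. indicator A x * norm (f x)) <= 2 * ?m powr (1 - 1 / p) * c"
   using le eventually_at_right_less[of C] by (auto elim: eventually_mono)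
 qed simp
qed

lemma Lpf_set_integral':
 fixes f :: "'a => 'b::{real_normed_field, banach, second_countable_topology}"
 assumes f: "f \<in> Lpf p M" and p: "1 <= p" and A: "A \<in> sets M"
 shows "(LINT x|M. indicator A x * norm (f x)) <= 2 * (measure M (space M) + 1) * Lpn p M f"
  and "integrable M (%x. indicator A x * norm (f x))"
proof -
 have [measurable]: "f \<in> borel_measurable M" using f by (auto simp: Lpf_def)
 note [measurable] = A
 have "(LINT x|M. indicator A x * norm (f x)) <= 2 * (measure M (space M) + 1) * Lpn p M f \<and>
   integrable M (%x. indicator A x * norm (f x))"
 proof (cases "measure M A = 0")
  case True
  then have "AE x in M. indicator A x * norm (f x) = 0"
   using A AE_not_in[of A M] by (auto simp: null_sets_def emeasure_eq_measure elim!: eventually_mono split: split_indicator)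
  then show ?thesis
   using integral_eq_zero_AE[of "%x. indicator A x * norm (f x)" M]
    integrable_cong_AE[of "%x. indicator A x * norm (f x)" M "%_. 0"] by simp
 next
  case False
  then have pos: "0 < measure M A" by (simp add: zero_less_measure_iff)
  have "integrable M (%x. indicator A x * norm (f x) powr p)"
   using integrable_mult_indicator[OF A Lpf_integrable[OF f]] by simp
  then have "(LINT x|M. indicator A x * norm (f x) powr p) <= (LINT x|M. norm (f x) powr p)"
   using Lpf_integrable[OF f] by (intro integral_mono) (auto split: split_indicator)
  then have *: "(LINT x|M. indicator A x * norm (f x) powr p) <= Lpn p M f powr p" using p by (simp add: Lpn_powr)
  have "measure M A powr (1 - 1 / p) <= (measure M (space M) + 1) powr (1 - 1 / p)"
   using p bounded_measure[of A] by (intro powr_mono2) auto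
  also have "... <= (measure M (space M) + 1) powr 1" using p by (intro powr_mono) auto
  finally have "2 * measure M A powr (1 - 1 / p) * Lpn p M f <= 2 * (measure M (space M) + 1) * Lpn p M f"
   by (intro mult_right_mono) auto
  then show ?thesis using Lpf_set_integral[OF f p A pos * Lpn_nonneg] by linarith
 qed
 then show "(LINT x|M. indicator A x * norm (f x)) <= 2 * (measure M (space M) + 1) * Lpn p M f"
  "integrable M (%x. indicator A x * norm (f x))" by auto
qed

lemma Lpf_integrable1:
 assumes f: "f \<in> Lpf p M" and p: "1 <= p"
 shows "integrable M f" "(LINT x|M. norm (f x)) <= 2 * (measure M (space M) + 1) * Lpn p M f"
proof -
 have [measurable]: "f \<in> borel_measurable M" using f by (auto simp: Lpf_def)
 have "integrable M (%x. indicator (space M) x * norm (f x)) \<longleftrightarrow> integrable M (%x. norm (f x))"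
  by (intro integrable_cong) auto
 moreover have "(LINT x|M. indicator (space M) x * norm (f x)) = (LINT x|M. norm (f x))"
  by (intro integral_cong) auto
 ultimately show "integrable M f" "(LINT x|M. norm (f x)) <= 2 * (measure M (space M) + 1) * Lpn p M f"
  using Lpf_set_integral'[OF f p, of "space M"] by (auto simp: integrable_norm_iff)
qed

lemma Lpf_simple_approx:
 fixes f :: "'a => 'b::{real_normed_field, banach, second_countable_topology}"
 assumes f: "f \<in> Lpf p M" and p: "1 <= p"
 obtains F where "!!i :: nat. simple_function M (F i)" "(%i. Lpn p M (%x. F i x - f x)) ----> 0"
proof -
 have [measurable]: "f \<in> borel_measurable M" using f by (auto simp: Lpf_def)
 obtain F where "(ALL i. simple_function M (F i)) \<and> (\<forall>x\<in>space M. (%i. F i x) ----> f x) \<and>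
  (ALL i. \<forall>x\<in>space M. dist (F i x) 0 <= 2 * dist (f x) 0)"
  using borel_measurable_implies_sequence_metric[of f M 0] by auto
 then have F: "!!i. simple_function M (F i)" "!!x. x \<in> space M ==> (%i. F i x) ----> f x"
  "!!i x. x \<in> space M ==> dist (F i x) 0 <= 2 * dist (f x) 0"
  by auto
 have [measurable]: "F i \<in> borel_measurable M" for i using F(1) by (rule borel_measurable_simple_function)
 have "(%i. \<integral>x. norm (F i x - f x) powr p \<partial>M) ----> (LINT x|M. 0)"
 proof (rule integral_dominated_convergence[where w = "%x. 3 powr p * norm (f x) powr p"])
  show "AE x in M. (%i. norm (F i x - f x) powr p) ----> 0"
  proof (rule AE_I2)
   fix x assume x: "x \<in> space M"
   have "(%i. F i x - f x) ----> f x - f x" by (intro tendsto_intros F x)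
   then have "(%i. norm (F i x - f x) powr p) ----> 0 powr p"
    using p by (intro tendsto_powr') (auto intro: tendsto_norm_zero)
   then show "(%i. norm (F i x - f x) powr p) ----> 0" using p by simp
  qed
  fix i show "AE x in M. norm (norm (F i x - f x) powr p) <= 3 powr p * norm (f x) powr p"
  proof (rule AE_I2)
   fix x assume x: "x \<in> space M"
   have "norm (F i x - f x) <= 3 * norm (f x)" using F(3)[OF x, of i] norm_triangle_ineq4[of "F i x" "f x"] by simp
   then have "norm (F i x - f x) powr p <= (3 * norm (f x)) powr p" using p by (intro powr_mono2) auto
   then show "norm (norm (F i x - f x) powr p) <= 3 powr p * norm (f x) powr p" by (simp add: powr_mult)
  qed
 qed (use Lpf_integrable[OF f] in auto)
 then have "(%i. Lpn p M (%x. F i x - f x)) ----> 0 powr (1 / p)"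
  unfolding Lpn_def using p by (intro tendsto_powr') auto
 then have "(%i. Lpn p M (%x. F i x - f x)) ----> 0" by simp
 then show thesis by (rule that[OF F(1)])
qed

text \<open>Riesz-Fischer: a subsequence with geometrically small increments converges almost
  everywhere, because on a finite measure space the increments are summable in L^1 as well.\<close>

lemma Lpf_complete:
 fixes f :: "nat => 'a => 'b::{real_normed_field, banach, second_countable_topology}"
 assumes f: "!!n. f n \<in> Lpf p M" and p: "1 <= p"
  and cauchy: "!!e. 0 < e ==> EX k. ALL m>=k. ALL n>=k. Lpn p M (%x. f m x - f n x) < e"
 obtains g where "g \<in> Lpf p M" "(%n. Lpn p M (%x. f n x - g x)) ----> 0"
proof -
 have [measurable]: "f n \<in> borel_measurable M" for n using f by (auto simp: Lpf_def)
 obtain k where k: "!!j m n. k j <= m ==> k j <= n ==> Lpn p M (%x. f m x - f n x) < (1 / 2) ^ j"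
  using cauchy[of "(1/2)^j" for j] by (metis zero_less_power half_gt_zero zero_less_one)
 \<comment> \<open>The partial sums make both \<open>r j\<close> and \<open>r (Suc j)\<close> at
   least \<open>k j\<close>; the summand j makes the sequence tend to infinity.\<close>
 define r where "r j = (\<Sum>i\<le>j. k i) + j" for j
 have kr: "k j <= r j" "k j <= r (Suc j)" for j
  using member_le_sum[of j "{..j}" k] by (auto simp: r_def)
 have mono: "j <= r j" for j by (simp add: r_def)
 define C where "C = 2 * (measure M (space M) + 1)"
 have C: "0 <= C" by (simp add: C_def)
 have d: "(%x. f m x - f n x) \<in> Lpf p M" for m n using f p by (intro Lpf_diff)
 have intj: "(\<integral>\<^sup>+ x. ennreal (norm (f (r (Suc j)) x - f (r j) x)) \<partial>M) <= ennreal (C * (1 / 2) ^ j)" for j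
 proof -
  have "(LINT x|M. norm (f (r (Suc j)) x - f (r j) x)) <= C * Lpn p M (%x. f (r (Suc j)) x - f (r j) x)"
   unfolding C_def by (rule Lpf_integrable1(2)[OF d p])
  also have "... <= C * (1 / 2) ^ j" using k[OF kr(2) kr(1), of j] C by (intro mult_left_mono) auto
  finally show ?thesis
   using Lpf_integrable1(1)[OF d p] by (subst nn_integral_eq_integral) (auto intro: ennreal_leI)
 qed
 have "(\<integral>\<^sup>+ x. (\<Sum>j. ennreal (norm (f (r (Suc j)) x - f (r j) x))) \<partial>M) = (\<Sum>j. \<integral>\<^sup>+ x. ennreal (norm (f (r (Suc j)) x - f (r j) x)) \<partial>M)"
  by (rule nn_integral_suminf) simp
 also have "... <= (\<Sum>j. ennreal (C * (1 / 2) ^ j))" using intj by (intro suminf_le) auto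
 also have "... = ennreal (\<Sum>j. C * (1 / 2) ^ j)"
  using C by (intro suminf_ennreal2 summable_mult) (auto simp: summable_geometric_iff)
 finally have "(\<integral>\<^sup>+ x. (\<Sum>j. ennreal (norm (f (r (Suc j)) x - f (r j) x))) \<partial>M) ~= \<infinity>" by (auto simp: top_unique)
 then have "AE x in M. (\<Sum>j. ennreal (norm (f (r (Suc j)) x - f (r j) x))) ~= \<infinity>"
  by (intro nn_integral_PInf_AE) auto
 then have conv: "AE x in M. (%j. f (r j) x) ----> lim (%j. f (r j) x)"
 proof eventually_elim
  case (elim x)
  then have "summable (%j. norm (f (r (Suc j)) x - f (r j) x))" by (intro summable_suminf_not_top) auto
  then have "summable (%j. f (r (Suc j)) x - f (r j) x)" by (rule summable_norm_cancel)
  then have "convergent (%n. \<Sum>j<n. f (r (Suc j)) x - f (r j) x)" by (simp add: summable_iff_convergent)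
  then have "convergent (%n. f (r n) x - f (r 0) x)" using sum_lessThan_telescope[of "%j. f (r j) x"] by simp
  then have "convergent (%n. (f (r n) x - f (r 0) x) + f (r 0) x)" by (intro convergent_add convergent_const)
  then show ?case by (simp add: convergent_LIMSEQ_iff)
 qed
 define g where "g x = lim (%j. f (r j) x)" for x
 have [measurable]: "g \<in> borel_measurable M" unfolding g_def by (rule borel_measurable_lim_metric) simp
 \<comment> \<open>Fatou's lemma along the subsequence turns a Cauchy bound at n into a bound for
   the distance of \<open>f n\<close> from the pointwise limit, for indices n outside the
   subsequence too.\<close>
 have fatou: "integrable M (%x. norm (f n x - g x) powr p) \<and> (LINT x|M. norm (f n x - g x) powr p) <= e powr p"
  if le: "!!m. k0 <= m ==> Lpn p M (%x. f n x - f m x) < e" for n k0 e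
 proof -
  have e: "0 < e" using le[of k0] Lpn_nonneg by (metis le_less_trans order_refl)
  have "(\<integral>\<^sup>+ x. ennreal (norm (f n x - g x) powr p) \<partial>M) = (\<integral>\<^sup>+ x. liminf (%j. ennreal (norm (f n x - f (r j) x) powr p)) \<partial>M)"
  proof (rule nn_integral_cong_AE)
   show "AE x in M. ennreal (norm (f n x - g x) powr p) = liminf (%j. ennreal (norm (f n x - f (r j) x) powr p))"
    using conv
   proof eventually_elim
    case (elim x)
    then have "(%j. norm (f n x - f (r j) x) powr p) ----> norm (f n x - g x) powr p"
     unfolding g_def using p by (intro tendsto_powr' tendsto_intros) auto
    then have "(%j. ennreal (norm (f n x - f (r j) x) powr p)) ----> ennreal (norm (f n x - g x) powr p)"
     by (rule tendsto_ennrealI)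
    then show ?case using lim_imp_Liminf[OF sequentially_bot] by metis
   qed
  qed
  also have "... <= liminf (%j. \<integral>\<^sup>+ x. ennreal (norm (f n x - f (r j) x) powr p) \<partial>M)"
   by (rule nn_integral_liminf) simp
  also have "... <= liminf (%j. ennreal (e powr p))"
  proof (rule Liminf_mono, rule eventually_sequentiallyI)
   fix j assume "k0 <= j"
   then have "Lpn p M (%x. f n x - f (r j) x) powr p <= e powr p"
    using le[of "r j"] mono[of j] p by (intro powr_mono2) auto
   then have "(LINT x|M. norm (f n x - f (r j) x) powr p) <= e powr p" using p by (simp add: Lpn_powr)
   then show "(\<integral>\<^sup>+ x. ennreal (norm (f n x - f (r j) x) powr p) \<partial>M) <= ennreal (e powr p)"
    using Lpf_integrable[OF d] by (subst nn_integral_eq_integral) (auto intro: ennreal_leI)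
  qed
  also have "... = ennreal (e powr p)" by (simp add: Liminf_const)
  finally have le': "(\<integral>\<^sup>+ x. ennreal (norm (f n x - g x) powr p) \<partial>M) <= ennreal (e powr p)" .
  then have int: "integrable M (%x. norm (f n x - g x) powr p)"
   by (intro integrableI_bounded) (auto simp: less_top[symmetric] top_unique)
  then show ?thesis using le' by (auto simp: nn_integral_eq_integral)
 qed
 have "g \<in> Lpf p M"
 proof -
  have "(%x. f (k 0) x - g x) \<in> Lpf p M"
   using fatou[of "k 0" "k 0" "(1/2)^0"] k[of 0 "k 0"] by (intro LpfI) auto
  from Lpf_diff[OF f[of "k 0"] this p] show ?thesis by simp
 qed
 moreover have "(%n. Lpn p M (%x. f n x - g x)) ----> 0"
 proof (rule LIMSEQ_I)
  fix e :: real assume e: "0 < e"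
  then obtain k0 where k0: "ALL m>=k0. ALL n>=k0. Lpn p M (%x. f m x - f n x) < e / 2" using cauchy[of "e / 2"] by auto
  have "norm (Lpn p M (%x. f n x - g x) - 0) < e" if "k0 <= n" for n
  proof -
   have "Lpn p M (%x. f n x - g x) <= e / 2"
    using fatou[of k0 n "e / 2"] k0 that e p by (intro Lpn_leI) auto
   then show ?thesis using e by simp
  qed
  then show "EX k0. ALL n>=k0. norm (Lpn p M (%x. f n x - g x) - 0) < e" by blast
 qed
 ultimately show thesis using that by blast
qed

end

section \<open>A second-order inequality for p-th powers, and upper estimates for orthogonal
  sums\<close>

text \<open>The interval for u is the range of |1 + b/a|^2 - 1 when |b| is at most |a| / 2.\<close>

lemma powr_taylor2:
 fixes \<alpha> :: real
 obtains K where "0 <= K" "!!u. -3/4 <= u ==> u <= 5/4 ==> (1 + u) powr \<alpha> <= 1 + \<alpha> * u + K * u\<^sup>2"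
proof -
 \<comment> \<open>The power with exponent \<open>\<alpha> - 2\<close> is monotone, so on the
   interval it is at most its value at one of the ends 1/4 and 9/4; the sum covers both signs of the
   exponent.\<close>
 define B where "B = (1/4) powr (\<alpha> - 2) + (9/4) powr (\<alpha> - 2)"
 define K where "K = \<bar>\<alpha> * (\<alpha> - 1)\<bar> * B"
 have der: "((%u. (1 + u) powr \<beta>) has_real_derivative \<beta> * (1 + u) powr (\<beta> - 1)) (at u)" if "-3/4 <= u" for u \<beta> :: real
  using that by (auto intro!: derivative_eq_intros)
 have bnd: "(1 + v) powr (\<alpha> - 2) <= B" if "-3/4 <= v" "v <= 5/4" for v
 proof (cases "0 <= \<alpha> - 2")
  case True
  then have "(1 + v) powr (\<alpha> - 2) <= (9/4) powr (\<alpha> - 2)" using that by (intro powr_mono2) auto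
  then show ?thesis by (simp add: B_def add_increasing)
 next
  case False
  then have "(1 + v) powr (\<alpha> - 2) <= (1/4) powr (\<alpha> - 2)" using that by (intro powr_mono2') auto
  then show ?thesis by (simp add: B_def add_increasing2)
 qed
 have mvt: "EX w. \<bar>w\<bar> <= \<bar>u\<bar> \<and> -3/4 <= w \<and> w <= 5/4 \<and> (1 + u) powr \<beta> - 1 = u * (\<beta> * (1 + w) powr (\<beta> - 1))"
  if u: "-3/4 <= u" "u <= 5/4" for u \<beta> :: real
 proof -
  consider "u = 0" | "0 < u" | "u < 0" by linarith
  then show ?thesis
  proof cases
   case 1
   then show ?thesis by (intro exI[of _ 0]) auto
  next
   case 2
   then obtain w where w: "0 < w" "w < u" "(1 + u) powr \<beta> - (1 + 0) powr \<beta> = (u - 0) * (\<beta> * (1 + w) powr (\<beta> - 1))"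
    using MVT2[of 0 u "%u. (1 + u) powr \<beta>" "%u. \<beta> * (1 + u) powr (\<beta> - 1)"] der by auto
   then show ?thesis using that by (intro exI[of _ w]) auto
  next
   case 3
   then obtain w where w: "u < w" "w < 0" "(1 + 0) powr \<beta> - (1 + u) powr \<beta> = (0 - u) * (\<beta> * (1 + w) powr (\<beta> - 1))"
    using MVT2[of u 0 "%u. (1 + u) powr \<beta>" "%u. \<beta> * (1 + u) powr (\<beta> - 1)"] der u by auto
   then show ?thesis using u by (intro exI[of _ w]) auto
  qed
 qed
 have "(1 + u) powr \<alpha> <= 1 + \<alpha> * u + K * u\<^sup>2" if u: "-3/4 <= u" "u <= 5/4" for u
 proof -
  obtain w where w: "\<bar>w\<bar> <= \<bar>u\<bar>" "-3/4 <= w" "w <= 5/4" "(1 + u) powr \<alpha> - 1 = u * (\<alpha> * (1 + w) powr (\<alpha> - 1))"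
   using mvt[OF u] by blast
  obtain v where v: "\<bar>v\<bar> <= \<bar>w\<bar>" "-3/4 <= v" "v <= 5/4" "(1 + w) powr (\<alpha> - 1) - 1 = w * ((\<alpha> - 1) * (1 + v) powr (\<alpha> - 1 - 1))"
   using mvt[OF w(2,3)] by blast
  have "(1 + u) powr \<alpha> - 1 - \<alpha> * u = u * \<alpha> * ((1 + w) powr (\<alpha> - 1) - 1)"
   using w(4) by (simp add: algebra_simps)
  also have "... = u * w * (\<alpha> * (\<alpha> - 1)) * (1 + v) powr (\<alpha> - 2)"
   unfolding v(4) by simp
  also have "... <= \<bar>u * w * (\<alpha> * (\<alpha> - 1))\<bar> * (1 + v) powr (\<alpha> - 2)" by (intro mult_right_mono) auto
  also have "... <= \<bar>u * w * (\<alpha> * (\<alpha> - 1))\<bar> * B" using bnd[OF v(2,3)] by (intro mult_left_mono) auto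
  also have "... = \<bar>u\<bar> * \<bar>w\<bar> * K" by (simp add: K_def abs_mult)
  also have "... <= \<bar>u\<bar> * \<bar>u\<bar> * K" using w(1) by (intro mult_right_mono mult_left_mono) (auto simp: K_def B_def)
  finally show ?thesis by (simp add: power2_eq_square algebra_simps)
 qed
 moreover have "0 <= K" by (simp add: K_def B_def)
 ultimately show thesis using that by blast
qed

text \<open>Where b is large compared with a, everything is controlled by |b|^p. Elsewhere |a + b|^2
  = |a|^2 (1 + u), and the Taylor inequality with exponent p / 2 applies; its quadratic remainder is
  at most of order t because |b/a| < 1 and t <= 2.\<close>

lemma cmod_add_powr_le:
 fixes p :: real
 assumes p: "1 < p" and t: "t = min p 2"
 obtains C where "0 < C" "!!a b. cmod (a + b) powr p <= cmod a powr p + p * cmod a powr (p - 2) * Re (cnj a * b)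
   + C * (cmod a powr (p - t) * cmod b powr t + cmod b powr p)"
proof -
 obtain K where K: "0 <= K" "!!u. -3/4 <= u ==> u <= 5/4 ==> (1 + u) powr (p / 2) <= 1 + p / 2 * u + K * u\<^sup>2"
  using powr_taylor2[of "p / 2"] by blast
 \<comment> \<open>For |a| <= 2|b| the first summand covers |a + b|^p and the second the linear
   term. The other two come from the remainder, where |u| is at most 5/2 times |b/a|.\<close>
 define C where "C = 3 powr p + p * 2 powr (p - 1) + p / 2 + K * (25/4)"
 have C: "0 < C" using p K(1) by (simp add: C_def add_pos_nonneg)
 have "cmod (a + b) powr p <= cmod a powr p + p * cmod a powr (p - 2) * Re (cnj a * b)
   + C * (cmod a powr (p - t) * cmod b powr t + cmod b powr p)" for a b
 proof (cases "cmod a <= 2 * cmod b")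
  case True
  have "cmod (a + b) <= 3 * cmod b" using norm_triangle_ineq[of a b] True by linarith
  then have 1: "cmod (a + b) powr p <= 3 powr p * cmod b powr p"
   using p powr_mono2[of p "cmod (a + b)" "3 * cmod b"] by (simp add: powr_mult)
  have "\<bar>cmod a powr (p - 2) * Re (cnj a * b)\<bar> <= cmod a powr (p - 2) * (cmod a * cmod b)"
   unfolding abs_mult using abs_Re_le_cmod[of "cnj a * b"] by (intro mult_mono) (auto simp: norm_mult)
  also have "... = cmod a powr (p - 1) * cmod b"
   using powr_add[of "cmod a" "p - 2" 1] by (cases "a = 0") (auto simp: mult_ac)
  also have "... <= (2 * cmod b) powr (p - 1) * cmod b" using True p by (intro mult_right_mono powr_mono2) auto
  also have "... = 2 powr (p - 1) * cmod b powr p"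
   using powr_add[of "cmod b" "p - 1" 1] by (cases "b = 0") (auto simp: powr_mult)
  finally have "p * \<bar>cmod a powr (p - 2) * Re (cnj a * b)\<bar> <= p * (2 powr (p - 1) * cmod b powr p)"
   using p by (intro mult_left_mono) auto
  moreover have "p * - (cmod a powr (p - 2) * Re (cnj a * b)) <= p * \<bar>cmod a powr (p - 2) * Re (cnj a * b)\<bar>"
   using p by (intro mult_left_mono abs_ge_minus_self) auto
  ultimately have 2: "- (p * cmod a powr (p - 2) * Re (cnj a * b)) <= p * 2 powr (p - 1) * cmod b powr p"
   unfolding mult_minus_right mult.assoc by (rule order_trans[rotated])
  have "(3 powr p + p * 2 powr (p - 1)) * cmod b powr p <= C * cmod b powr p"
   using p K by (intro mult_right_mono) (auto simp: C_def)
  also have "... <= C * (cmod a powr (p - t) * cmod b powr t + cmod b powr p)" using C by (intro mult_left_mono) auto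
  finally have 3: "3 powr p * cmod b powr p + p * 2 powr (p - 1) * cmod b powr p <= C * (cmod a powr (p - t) * cmod b powr t + cmod b powr p)"
   by (simp add: algebra_simps)
  have "0 <= cmod a powr p" by simp
  with 1 2 3 show ?thesis by linarith
 next
  case False
  then have a: "0 < cmod a" by (smt (verit) norm_ge_zero)
  define \<beta> where "\<beta> = cmod b / cmod a"
  define \<rho> where "\<rho> = Re (cnj a * b) / (cmod a)\<^sup>2"
  define u where "u = 2 * \<rho> + \<beta>\<^sup>2"
  have \<beta>: "0 <= \<beta>" "\<beta> < 1/2" using False a by (auto simp: \<beta>_def field_simps)
  have \<rho>: "\<bar>\<rho>\<bar> <= \<beta>"
  proof -
   have "\<bar>Re (cnj a * b)\<bar> <= cmod a * cmod b" using abs_Re_le_cmod[of "cnj a * b"] by (simp add: norm_mult)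
   then show ?thesis using a by (simp add: \<rho>_def \<beta>_def power2_eq_square field_simps)
  qed
  have \<beta>2: "\<beta>\<^sup>2 <= \<beta> / 2" using \<beta> mult_left_mono[of \<beta> "1/2" \<beta>] by (simp add: power2_eq_square)
  have u: "\<bar>u\<bar> <= 5/2 * \<beta>" 
   using abs_triangle_ineq[of "2 * \<rho>" "\<beta>\<^sup>2"] \<rho> \<beta>2 by (simp add: u_def abs_mult)
  have "(cmod (a + b))\<^sup>2 = (cmod a)\<^sup>2 + 2 * Re (cnj a * b) + (cmod b)\<^sup>2"
   by (simp only: cmod_power2) (simp add: power2_eq_square algebra_simps)
  also have "... = (cmod a)\<^sup>2 * (1 + u)" using a by (simp add: u_def \<rho>_def \<beta>_def field_simps power_divide)
  finally have sq: "(cmod (a + b))\<^sup>2 = (cmod a)\<^sup>2 * (1 + u)" .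
  have u_rng: "-3/4 <= u" "u <= 5/4"
  proof -
   have "0 <= (1 - \<beta>)\<^sup>2 - 1/4"
   proof -
    have "1/2 * (1/2) <= (1 - \<beta>) * (1 - \<beta>)" using \<beta> by (intro mult_mono) auto
    then show ?thesis by (simp add: power2_eq_square)
   qed
   then show "-3/4 <= u" using \<rho> by (simp add: u_def power2_eq_square algebra_simps abs_le_iff)
   show "u <= 5/4" using u \<beta> by linarith
  qed
  have "cmod (a + b) powr p = ((cmod (a + b))\<^sup>2) powr (p / 2)"
   by (simp add: powr_powr flip: powr_numeral)
  also have "... = ((cmod a)\<^sup>2) powr (p / 2) * (1 + u) powr (p / 2)" unfolding sq by (rule powr_mult)
  also have "((cmod a)\<^sup>2) powr (p / 2) = cmod a powr p" by (simp add: powr_powr flip: powr_numeral)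
  also have "cmod a powr p * (1 + u) powr (p / 2) <= cmod a powr p * (1 + p / 2 * u + K * u\<^sup>2)"
   using K(2)[OF u_rng] by (intro mult_left_mono) auto
  also have "... = cmod a powr p + p * (cmod a powr p * \<rho>) + cmod a powr p * (p / 2 * \<beta>\<^sup>2 + K * u\<^sup>2)"
   by (simp add: u_def algebra_simps)
  also have "cmod a powr p * \<rho> = cmod a powr (p - 2) * Re (cnj a * b)"
   using a powr_add[of "cmod a" "p - 2" 2] by (simp add: \<rho>_def)
  also have "cmod a powr p * (p / 2 * \<beta>\<^sup>2 + K * u\<^sup>2) <= cmod a powr p * (C * \<beta>\<^sup>2)"
  proof (intro mult_left_mono)
   have "u\<^sup>2 <= (5/2 * \<beta>)\<^sup>2" using u \<beta> by (intro abs_le_square_iff[THEN iffD1]) auto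
   then have "K * u\<^sup>2 <= K * (25/4 * \<beta>\<^sup>2)" using K(1) by (intro mult_left_mono) (auto simp: power2_eq_square)
   moreover have "(p / 2 + K * (25/4)) * \<beta>\<^sup>2 <= C * \<beta>\<^sup>2" using p by (intro mult_right_mono) (auto simp: C_def)
   ultimately show "p / 2 * \<beta>\<^sup>2 + K * u\<^sup>2 <= C * \<beta>\<^sup>2" by (simp add: algebra_simps)
  qed auto
  also have "cmod a powr p * (C * \<beta>\<^sup>2) <= cmod a powr p * (C * \<beta> powr t)"
  proof (intro mult_left_mono)
   show "\<beta>\<^sup>2 <= \<beta> powr t"
    using \<beta> t powr_mono'[of t 2 \<beta>] by (cases "\<beta> = 0") (auto simp flip: powr_numeral)
  qed (use C in auto)
  also have "cmod a powr p * (C * \<beta> powr t) = C * (cmod a powr (p - t) * cmod b powr t)"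
   using a by (simp add: \<beta>_def powr_divide powr_diff)
  finally show ?thesis using C by (simp add: algebra_simps) (smt (verit) mult_nonneg_nonneg powr_ge_zero)
 qed
 then show thesis using that C by blast
qed

lemma powr_mult_le_sum:
 fixes x y s p :: real
 assumes "0 <= x" "0 <= y" "0 <= s" "s <= p"
 shows "x powr (p - s) * y powr s <= x powr p + y powr p"
proof -
 have "x powr (p - s) * y powr s <= max x y powr (p - s) * max x y powr s"
  using assms by (intro mult_mono powr_mono2) auto
 also have "... = max x y powr p" by (simp flip: powr_add)
 also have "... <= x powr p + y powr p" by (auto simp: max_def)
 finally show ?thesis .
qed

context finite_measure
begin

text \<open>By orthogonality the linear term integrates to 0. The mixed term is normalised by a and
  b and split by \<open>powr_mult_le_sum\<close> into two parts that each integrate to at most 1,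
  whence the factor 2.\<close>

lemma Lpn_add_orthogonal:
 fixes h :: "'k::{real_normed_field, banach, second_countable_topology} => complex"
 assumes p: "1 < p" and t: "t = min p 2"
  and C: "0 < C" "!!a b. cmod (a + b) powr p <= cmod a powr p + p * cmod a powr (p - 2) * Re (cnj a * b)
   + C * (cmod a powr (p - t) * cmod b powr t + cmod b powr p)"
  and h: "linear h" "!!x. cmod (h x) = norm x"
  and f: "f \<in> Lpf p M" and d: "d \<in> Lpf p M"
  and orth: "integrable M (%x. norm (f x) powr (p - 2) * Re (cnj (h (f x)) * h (d x)))"
   "(LINT x|M. norm (f x) powr (p - 2) * Re (cnj (h (f x)) * h (d x))) = 0"
  and ab: "Lpn p M f < a" "Lpn p M d < b"
 shows "Lpn p M (%x. f x + d x) powr p <= Lpn p M f powr p + C * (2 * (a powr (p - t) * b powr t) + b powr p)"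
proof -
 have [measurable]: "f \<in> borel_measurable M" "d \<in> borel_measurable M" using f d by (auto simp: Lpf_def)
 have a: "0 < a" and b: "0 < b" using ab Lpn_nonneg by (metis le_less_trans)+
 have tp: "0 <= t" "t <= p" using t p by auto
 have int: "integrable M (%x. norm (f x) powr p)" "integrable M (%x. norm (d x) powr p)"
  using f d by (auto simp: Lpf_def)
 have le: "norm (f x) powr (p - t) * norm (d x) powr t
   <= a powr (p - t) * b powr t * (norm (f x) powr p / a powr p + norm (d x) powr p / b powr p)" for x
 proof -
  have "norm (f x) powr (p - t) * norm (d x) powr t = a powr (p - t) * b powr t * ((norm (f x) / a) powr (p - t) * (norm (d x) / b) powr t)"
   using a b by (simp add: powr_divide)
  also have "... <= a powr (p - t) * b powr t * ((norm (f x) / a) powr p + (norm (d x) / b) powr p)"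
   using a b tp by (intro mult_left_mono powr_mult_le_sum) auto
  finally show ?thesis by (simp add: powr_divide)
 qed
 have "Lpn p M (%x. f x + d x) powr p = (LINT x|M. norm (f x + d x) powr p)" using p by (simp add: Lpn_powr)
 also have "... <= (LINT x|M. norm (f x) powr p + p * (norm (f x) powr (p - 2) * Re (cnj (h (f x)) * h (d x)))
   + C * (a powr (p - t) * b powr t * (norm (f x) powr p / a powr p + norm (d x) powr p / b powr p) + norm (d x) powr p))"
 proof (rule integral_mono)
  show "integrable M (%x. norm (f x + d x) powr p)" using Lpf_add[OF f d] p by (simp add: Lpf_def)
  show "integrable M (%x. norm (f x) powr p + p * (norm (f x) powr (p - 2) * Re (cnj (h (f x)) * h (d x)))
   + C * (a powr (p - t) * b powr t * (norm (f x) powr p / a powr p + norm (d x) powr p / b powr p) + norm (d x) powr p))"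
   using int orth(1) by (intro integrable_add integrable_mult_right integrable_divide_zero) auto
  fix x
  have "norm (f x + d x) powr p <= norm (f x) powr p + p * norm (f x) powr (p - 2) * Re (cnj (h (f x)) * h (d x))
    + C * (norm (f x) powr (p - t) * norm (d x) powr t + norm (d x) powr p)"
   using C(2)[of "h (f x)" "h (d x)"] by (simp add: h(2) flip: linear_add[OF h(1)])
  also have "... <= norm (f x) powr p + p * norm (f x) powr (p - 2) * Re (cnj (h (f x)) * h (d x))
    + C * (a powr (p - t) * b powr t * (norm (f x) powr p / a powr p + norm (d x) powr p / b powr p) + norm (d x) powr p)"
   using C(1) le[of x] by (intro add_left_mono mult_left_mono add_right_mono) auto
  finally show "norm (f x + d x) powr p <= norm (f x) powr p + p * (norm (f x) powr (p - 2) * Re (cnj (h (f x)) * h (d x)))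
   + C * (a powr (p - t) * b powr t * (norm (f x) powr p / a powr p + norm (d x) powr p / b powr p) + norm (d x) powr p)"
   by (simp add: mult.assoc)
 qed
 also have "... = Lpn p M f powr p + C * (a powr (p - t) * b powr t * (Lpn p M f powr p / a powr p + Lpn p M d powr p / b powr p) + Lpn p M d powr p)"
  using int orth p by (simp add: Lpn_powr)
 also have "... <= Lpn p M f powr p + C * (a powr (p - t) * b powr t * (1 + 1) + b powr p)"
  using C(1) a b ab p by (intro add_left_mono mult_left_mono add_mono) (auto intro!: powr_mono2)
 finally show ?thesis by (simp add: algebra_simps)
qed

text \<open>With \<open>\<sigma>\<close> the sum of the first \<open>(\<bar>c j\<bar> D)\<^sup>t\<close>, the bound \<open>\<parallel>\<Sum>j<n. c j d j\<parallel>\<^sup>p \<le> (K \<sigma>)\<^bsup>p/t\<^esup>\<close>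
 is preserved from \<open>n\<close> to \<open>n + 1\<close>.\<close>
lemma orthogonal_upper_estimate:
 fixes h :: "'k::{real_normed_field, banach, second_countable_topology} => complex" and d :: "nat => 'a => 'k"
 assumes p: "1 < p" and t: "t = min p 2"
  and h: "linear h" "!!x y. h (x * y) = h x * h y" "!!x. cmod (h x) = norm x"
  and d: "!!k. d k \<in> Lpf p M" and D: "!!k. Lpn p M (d k) < D"
  and orth: "!!k c. integrable M (%x. of_real (norm (\<Sum>j<k. c j * d j x) powr (p - 2)) * cnj (h (\<Sum>j<k. c j * d j x)) * h (d k x))"
   "!!k c. (LINT x|M. of_real (norm (\<Sum>j<k. c j * d j x) powr (p - 2)) * cnj (h (\<Sum>j<k. c j * d j x)) * h (d k x)) = 0"
 obtains C where "0 <= C" "ALL m c. Lpn p M (%x. \<Sum>i<m. c i * d i x) <= C * (\<Sum>i<m. norm (c i) powr t) powr (1 / t)"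
proof -
 obtain C where C: "0 < C" "!!a b. cmod (a + b) powr p <= cmod a powr p + p * cmod a powr (p - 2) * Re (cnj a * b)
   + C * (cmod a powr (p - t) * cmod b powr t + cmod b powr p)"
  using cmod_add_powr_le[OF p t] by blast
 have tp: "1 < t" "t <= p" using t p by auto
 \<comment> \<open>A new term costs C (2 + 1) times the same mixed quantity, hence
   \<open>3 * C\<close>; the value is at least 1 so that \<delta> is at most K \<delta>.\<close>
 define K where "K = max 1 (3 * C)"
 have K: "1 <= K" "3 * C <= K" by (auto simp: K_def)
 have D0: "0 < D" using D[of 0] Lpn_nonneg by (metis le_less_trans)
 define \<sigma> where "\<sigma> c m = (\<Sum>i<m. (norm (c i) * D) powr t)" for c :: "nat => 'k" and m
 have \<sigma>0: "0 <= \<sigma> c m" for c m by (simp add: \<sigma>_def sum_nonneg)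
 have fin: "(%x. \<Sum>i<m. c i * d i x) \<in> Lpf p M" for c m
  using p d by (intro Lpf_sum Lpf_cmult) auto
 have main: "Lpn p M (%x. \<Sum>i<m. c i * d i x) powr p <= (K * \<sigma> c m) powr (p / t)" for c m
 proof (induction m)
  case (Suc m)
  let ?S = "%x. \<Sum>i<m. c i * d i x"
  show ?case
  proof (cases "c m = 0")
   case True
   then show ?thesis using Suc tp p by (simp add: \<sigma>_def)
  next
   case False
   define \<delta> where "\<delta> = (norm (c m) * D) powr t"
   define z where "z = K * \<sigma> c (Suc m)"
   have \<delta>: "0 < \<delta>" using False D0 by (simp add: \<delta>_def)
   have zs: "z = K * \<sigma> c m + K * \<delta>" by (simp add: z_def \<sigma>_def \<delta>_def algebra_simps)
   have K\<delta>: "\<delta> <= K * \<delta>" using K \<delta> by simp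
   have z: "K * \<sigma> c m < z" "0 < z" "\<delta> <= z"
    using zs K\<delta> \<delta> K \<sigma>0[of c m] by (auto simp: add_nonneg_pos intro: add_increasing)
   have "Lpn p M ?S powr p <= (K * \<sigma> c m) powr (p / t)" by (rule Suc)
   also have "... < z powr (p / t)" using z \<sigma>0 K tp p by (intro powr_less_mono2) auto
   finally have "Lpn p M ?S powr p < (z powr (1 / t)) powr p" by (simp add: powr_powr)
   then have a: "Lpn p M ?S < z powr (1 / t)"
    using powr_mono2[of p "z powr (1 / t)" "Lpn p M ?S"] p by (meson Lpn_nonneg not_le powr_ge_zero less_imp_le order_less_trans zero_less_one)
   have b: "Lpn p M (%x. c m * d m x) < norm (c m) * D" using p D False by (simp add: Lpn_cmult)
   have re: "norm (?S x) powr (p - 2) * Re (cnj (h (?S x)) * h (c m * d m x))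
     = Re (h (c m) * (of_real (norm (?S x) powr (p - 2)) * cnj (h (?S x)) * h (d m x)))" for x
   proof -
    have "h (c m) * (of_real (norm (?S x) powr (p - 2)) * cnj (h (?S x)) * h (d m x))
      = of_real (norm (?S x) powr (p - 2)) * (cnj (h (?S x)) * h (c m * d m x))"
     by (simp add: h(2))
    moreover have "Re (of_real r * w) = r * Re w" for r w by simp
    ultimately show ?thesis by (simp only:)
   qed
   have "Lpn p M (%x. ?S x + c m * d m x) powr p <= Lpn p M ?S powr p
     + C * (2 * ((z powr (1 / t)) powr (p - t) * (norm (c m) * D) powr t) + (norm (c m) * D) powr p)"
   proof (rule Lpn_add_orthogonal[OF p t C h(1,3) fin _ _ _ a b])
    show "(%x. c m * d m x) \<in> Lpf p M" using p d by (intro Lpf_cmult) auto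
    show "integrable M (%x. norm (?S x) powr (p - 2) * Re (cnj (h (?S x)) * h (c m * d m x)))"
     unfolding re by (intro integrable_Re integrable_mult_right orth)
    show "(LINT x|M. norm (?S x) powr (p - 2) * Re (cnj (h (?S x)) * h (c m * d m x))) = 0"
     unfolding re by (subst integral_Re) (auto intro!: integrable_mult_right orth simp: orth(2))
   qed
   also have "(z powr (1 / t)) powr (p - t) * (norm (c m) * D) powr t = z powr (p / t - 1) * \<delta>"
    using tp by (simp add: powr_powr \<delta>_def diff_divide_distrib)
   also have "(norm (c m) * D) powr p = \<delta> powr (p / t)" using tp by (simp add: \<delta>_def powr_powr)
   also have "\<delta> powr (p / t) = \<delta> powr (p / t - 1) * \<delta>" using \<delta> by (simp add: powr_diff)
   also have "... <= z powr (p / t - 1) * \<delta>" using z \<delta> tp by (intro mult_right_mono powr_mono2) auto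
   finally have "Lpn p M (%x. \<Sum>i<Suc m. c i * d i x) powr p
     <= Lpn p M ?S powr p + C * (2 * (z powr (p / t - 1) * \<delta>) + z powr (p / t - 1) * \<delta>)"
    using C(1) by (simp add: mult_left_mono)
   also have "... <= (K * \<sigma> c m) powr (p / t) + (3 * C) * (z powr (p / t - 1) * \<delta>)" using Suc by simp
   also have "... <= (K * \<sigma> c m) powr (p / t) + K * (z powr (p / t - 1) * \<delta>)"
    using K \<delta> by (intro add_left_mono mult_right_mono) auto
   \<comment> \<open>Since p / t >= 1, the power z^(p/t - 1) dominates the same power of the old
     part; multiplied by the old and the new part of z, it adds up to z^(p/t), and the bound
     reproduces itself.\<close>
   also have "(K * \<sigma> c m) powr (p / t) <= z powr (p / t - 1) * (K * \<sigma> c m)"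
   proof (cases "\<sigma> c m = 0")
    case False
    then have pos: "0 < K * \<sigma> c m" using \<sigma>0[of c m] K by simp
    then have "(K * \<sigma> c m) powr (p / t) = (K * \<sigma> c m) powr (p / t - 1) * (K * \<sigma> c m)"
     by (simp add: powr_diff)
    also have "... <= z powr (p / t - 1) * (K * \<sigma> c m)"
     using pos z tp by (intro mult_right_mono powr_mono2) auto
    finally show ?thesis .
   qed simp
   also have "z powr (p / t - 1) * (K * \<sigma> c m) + K * (z powr (p / t - 1) * \<delta>) = z powr (p / t - 1) * z"
    unfolding zs by (simp add: algebra_simps)
   also have "... = z powr (p / t)" using z by (simp add: powr_diff)
   finally show ?thesis by (simp add: z_def)
  qed
 qed simp
 show thesis
 proof (rule that[of "K powr (1 / t) * D"])
  show "0 <= K powr (1 / t) * D" using D0 by simp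
  have "Lpn p M (%x. \<Sum>i<m. c i * d i x) <= K powr (1 / t) * D * (\<Sum>i<m. norm (c i) powr t) powr (1 / t)" for m c
  proof -
  have "Lpn p M (%x. \<Sum>i<m. c i * d i x) <= ((K * \<sigma> c m) powr (p / t)) powr (1 / p)"
   using main p by (intro le_powr_inverse) auto
  also have "... = (K * \<sigma> c m) powr (1 / t)" using p by (simp add: powr_powr)
  also have "\<sigma> c m = D powr t * (\<Sum>i<m. norm (c i) powr t)"
   by (simp add: \<sigma>_def powr_mult sum_distrib_left mult.commute)
  also have "(K * (D powr t * (\<Sum>i<m. norm (c i) powr t))) powr (1 / t) = K powr (1 / t) * D * (\<Sum>i<m. norm (c i) powr t) powr (1 / t)"
   using K D0 tp by (simp add: powr_mult powr_powr)
  finally show ?thesis .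
  qed
  then show "ALL m c. Lpn p M (%x. \<Sum>i<m. c i * d i x) <= K powr (1 / t) * D * (\<Sum>i<m. norm (c i) powr t) powr (1 / t)"
   by blast
 qed
qed

end

section \<open>Finite partitions and extraction of almost orthogonal subsequences\<close>

definition atom :: "'a measure => ('a => 'c) => 'c => 'a set" where
 "atom M \<pi> v = \<pi> -` {v} \<inter> space M"

text \<open>An increasing sequence of finite measurable partitions, each given by its quotient map.\<close>
definition partitions :: "'a measure => (nat => 'a => 'c) => bool" where
 "partitions M \<pi> \<longleftrightarrow> (ALL n. finite (\<pi> n ` space M)) \<and> (ALL n v. atom M (\<pi> n) v \<in> sets M) \<and>
   (ALL m n. m <= n --> (EX \<rho>. ALL x. \<pi> m x = \<rho> (\<pi> n x)))"

lemma partitions_factor: "partitions M \<pi> ==> m <= n ==> EX \<rho>. ALL x. \<pi> m x = \<rho> (\<pi> n x)"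
 by (simp add: partitions_def)

lemma simple_function_partition:
 assumes "finite (\<pi> ` space M)" "!!v. atom M \<pi> v \<in> sets M"
 shows "simple_function M (%x. F (\<pi> x))"
 unfolding simple_function_def
proof (intro conjI ballI)
 have "(%x. F (\<pi> x)) ` space M = F ` (\<pi> ` space M)" by auto
 then show "finite ((%x. F (\<pi> x)) ` space M)" using assms(1) by simp
 fix c
 have "(%x. F (\<pi> x)) -` {c} \<inter> space M = (\<Union>v\<in>{v \<in> \<pi> ` space M. F v = c}. atom M \<pi> v)"
  by (auto simp: atom_def)
 also have "... \<in> sets M" using assms by (intro sets.finite_UN) auto
 finally show "(%x. F (\<pi> x)) -` {c} \<inter> space M \<in> sets M" .
qed

text \<open>A function of the partition is a finite combination of indicators of atoms. In the
  application the integrals of \<open>w\<close> over all atoms vanish, and with them the integral of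
  the product.\<close>

lemma integral_partition:
 fixes w :: "'a => 'b::{real_normed_algebra, banach, second_countable_topology}"
 assumes \<pi>: "finite (\<pi> ` space M)" "!!v. atom M \<pi> v \<in> sets M" and w: "integrable M w"
 shows "integrable M (%x. G (\<pi> x) * w x)"
  "(LINT x|M. G (\<pi> x) * w x) = (\<Sum>v\<in>\<pi> ` space M. G v * (LINT x|M. indicator (atom M \<pi> v) x *\<^sub>R w x))"
proof -
 let ?g = "%x. \<Sum>v\<in>\<pi> ` space M. G v * (indicator (atom M \<pi> v) x *\<^sub>R w x)"
 have eq: "G (\<pi> x) * w x = ?g x" if x: "x \<in> space M" for x
 proof -
  have "?g x = (\<Sum>v\<in>\<pi> ` space M. if v = \<pi> x then G (\<pi> x) * w x else 0)"
   using x by (intro sum.cong) (auto simp: atom_def indicator_def)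
  then show ?thesis using x \<pi>(1) by simp
 qed
 have int: "integrable M (%x. G v * (indicator (atom M \<pi> v) x *\<^sub>R w x))" for v
  using integrable_mult_indicator[OF \<pi>(2) w] by (intro integrable_mult_right)
 have "integrable M ?g" using int by (intro integrable_sum)
 then show "integrable M (%x. G (\<pi> x) * w x)"
  using integrable_cong[OF refl eq, of M] by simp
 have "(LINT x|M. G (\<pi> x) * w x) = (LINT x|M. ?g x)" using eq by (intro integral_cong) auto
 also have "... = (\<Sum>v\<in>\<pi> ` space M. (LINT x|M. G v * (indicator (atom M \<pi> v) x *\<^sub>R w x)))"
  using int by (intro integral_sum)
 also have "... = (\<Sum>v\<in>\<pi> ` space M. G v * (LINT x|M. indicator (atom M \<pi> v) x *\<^sub>R w x))"
  using integrable_mult_indicator[OF \<pi>(2) w] by (intro sum.cong refl integral_mult_right)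
 finally show "(LINT x|M. G (\<pi> x) * w x) = (\<Sum>v\<in>\<pi> ` space M. G v * (LINT x|M. indicator (atom M \<pi> v) x *\<^sub>R w x))" .
qed

lemma bounded_linear_isometry:
 fixes h :: "'k::real_normed_vector => 'b::real_normed_vector"
 assumes "linear h" "!!x. norm (h x) = norm x"
 shows "bounded_linear h"
 using assms by (intro linear_conv_bounded_linear[THEN iffD1] | intro bounded_linear_intro[where K = 1])
  (auto simp: linear_add linear_scale)

context finite_measure
begin

text \<open>Simple approximants of all \<open>x n\<close> are enumerated in one sequence, and the
  n-th partition records the values of the first n of them. With lists of values, passing to a
  coarser partition is \<open>take\<close>.\<close>

lemma partitions_exist:
 fixes x :: "nat => 'a => 'k::{real_normed_field, banach, second_countable_topology}"
 assumes x: "!!n. x n \<in> Lpf p M" and p: "1 <= p"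
 obtains \<pi> :: "nat => 'a => 'k list" where "partitions M \<pi>"
  "ALL n. ALL e>0. EX k F. Lpn p M (%y. x n y - F (\<pi> k y)) < e"
proof -
 have "EX G. (ALL i :: nat. simple_function M (G i)) \<and> (%i. Lpn p M (%y. G i y - x n y)) ----> 0" for n
  using Lpf_simple_approx[OF x p, of n] by metis
 then obtain G where G: "!!n i. simple_function M (G n i)" "!!n. (%i :: nat. Lpn p M (%y. G n i y - x n y)) ----> 0"
  by metis
 define \<phi> where "\<phi> m = G (fst (prod_decode m)) (snd (prod_decode m))" for m
 have \<phi>: "simple_function M (\<phi> m)" for m using G(1) by (simp add: \<phi>_def)
 define \<pi> where "\<pi> n y = map (%m. \<phi> m y) [0..<n]" for n y
 have \<pi>_Suc: "\<pi> (Suc n) y = \<pi> n y @ [\<phi> n y]" for n y by (simp add: \<pi>_def)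
 have fin: "finite (\<pi> n ` space M)" for n
 proof (induction n)
  case 0
  show ?case by (rule finite_subset[of _ "{[]}"]) (auto simp: \<pi>_def)
 next
  case (Suc n)
  have "\<pi> (Suc n) ` space M \<subseteq> (%(l, a). l @ [a]) ` (\<pi> n ` space M \<times> \<phi> n ` space M)"
   by (auto simp: \<pi>_Suc)
  then show ?case using Suc simple_functionD(1)[OF \<phi>] by (meson finite_SigmaI finite_imageI finite_subset)
 qed
 have meas: "atom M (\<pi> n) v \<in> sets M" for n v
 proof (induction n arbitrary: v)
  case 0
  have "atom M (\<pi> 0) v = (if v = [] then space M else {})" by (auto simp: atom_def \<pi>_def)
  then show ?case by simp
 next
  case (Suc n)
  show ?case
  proof (cases "v = []")
   case True
   then have "atom M (\<pi> (Suc n)) v = {}" by (auto simp: atom_def \<pi>_Suc)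
   then show ?thesis by simp
  next
   case False
   then have "atom M (\<pi> (Suc n)) v = atom M (\<pi> n) (butlast v) \<inter> (\<phi> n -` {last v} \<inter> space M)"
    by (auto simp: atom_def \<pi>_Suc)
   then show ?thesis using Suc simple_functionD(2)[OF \<phi>] by auto
  qed
 qed
 have fac: "EX \<rho>. ALL x. \<pi> m x = \<rho> (\<pi> n x)" if "m <= n" for m n
  using that by (intro exI[of _ "take m"]) (simp add: \<pi>_def take_map)
 have "partitions M \<pi>" unfolding partitions_def
 proof (intro conjI allI impI)
  show "finite (\<pi> n ` space M)" for n by (rule fin)
  show "atom M (\<pi> n) v \<in> sets M" for n v by (rule meas)
  show "EX \<rho>. ALL x. \<pi> m x = \<rho> (\<pi> n x)" if "m <= n" for m n using that by (rule fac)
 qed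
 moreover have "EX k F. Lpn p M (%y. x n y - F (\<pi> k y)) < e" if e: "0 < e" for n e
 proof -
  have "\<forall>\<^sub>F i in sequentially. Lpn p M (%y. G n i y - x n y) < e"
   by (rule order_tendstoD(2)[OF G(2) e])
  then obtain i where i: "Lpn p M (%y. G n i y - x n y) < e"
   unfolding eventually_sequentially by blast
  have "Lpn p M (%y. x n y - \<pi> (Suc (prod_encode (n, i))) y ! prod_encode (n, i)) = Lpn p M (%y. G n i y - x n y)"
   by (simp add: Lpn_def \<pi>_def nth_append \<phi>_def norm_minus_commute)
  then show ?thesis using i by (intro exI[of _ "Suc (prod_encode (n, i))"] exI[of _ "%l. l ! prod_encode (n, i)"]) simp
 qed
 ultimately show thesis using that by blast
qed

context
 fixes p t B :: real and \<pi> :: "nat => 'a => 'c"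
  and z :: "nat => 'a => 'k::{real_normed_field, banach, second_countable_topology}"
 assumes p: "1 < p" and t: "t = min p 2" and \<pi>: "partitions M \<pi>"
  and z: "!!n. z n \<in> Lpf p M" and B: "!!n. Lpn p M (z n) <= B"
  and approx: "!!n e. 0 < e ==> EX k F. Lpn p M (%y. z n y - F (\<pi> k y)) < e"
  and weak: "!!k v. (%n. \<integral>y. indicator (atom M (\<pi> k) v) y *\<^sub>R z n y \<partial>M) ----> 0"
begin

lemma partition_Lpf: "(%y. F (\<pi> k y)) \<in> Lpf p M"
 for F :: "'c => 'b::{real_normed_field, banach, second_countable_topology}"
proof -
 have sf: "simple_function M (%y. F (\<pi> k y))" "simple_function M (%y. norm (F (\<pi> k y)) powr p)"
  using \<pi> by (auto simp: partitions_def intro!: simple_function_partition[where F = F] simple_function_partition[where F = "%v. norm (F v) powr p"])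
 obtain C where "!!y. y \<in> space M ==> norm (F (\<pi> k y)) powr p <= C"
  using simple_functionD(1)[OF sf(2)] by (metis (mono_tags, lifting) finite_imageI Max_ge imageI)
 then have "integrable M (%y. norm (F (\<pi> k y)) powr p)"
  using borel_measurable_simple_function[OF sf(2)] by (intro integrable_const_bound[of _ C]) auto
 then show ?thesis using borel_measurable_simple_function[OF sf(1)] by (rule LpfI[rotated])
qed

text \<open>An approximant of \<open>z n\<close> constant on fine atoms is corrected by its (small) means over the
 coarse atoms.\<close>
lemma extraction_step:
 assumes eps: "0 < eps"
 shows "EX n>n0. EX k'>=k. EX F. (ALL v. (LINT y|M. indicator (atom M (\<pi> k) v) y *\<^sub>R F (\<pi> k' y)) = 0) \<and>
  Lpn p M (%y. z n y - F (\<pi> k' y)) <= eps"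
proof -
 let ?A = "%v. atom M (\<pi> k) v" and ?V = "\<pi> k ` space M"
 have fin: "finite ?V" and A[measurable]: "?A v \<in> sets M" for v using \<pi> by (auto simp: partitions_def)
 define m where "m v = measure M (?A v)" for v
 define L where "L = 2 * (measure M (space M) + 1)"
 have L: "0 < L" by (simp add: L_def add_nonneg_pos)
 \<comment> \<open>If the integrals of the approximant over the coarse atoms are at most \<tau>, the
   correction has norm at most \<tau> Q.\<close>
 define Q where "Q = (\<Sum>v\<in>?V. Lpn p M (%y. indicator (?A v) y :: 'k) / m v)"
 have Q: "0 <= Q" by (auto simp: Q_def m_def intro!: sum_nonneg divide_nonneg_nonneg)
 define \<tau> where "\<tau> = eps / (2 * (Q + 1))"
 have \<tau>: "0 < \<tau>" using eps Q by (simp add: \<tau>_def)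
 \<comment> \<open>Small enough for the approximation itself and, after the factor \<open>L\<close>
   of the L^1 estimate, for the integrals over the atoms.\<close>
 define eps' where "eps' = min (eps / 2) (\<tau> / (2 * L))"
 have eps': "0 < eps'" "eps' <= eps / 2" "L * eps' <= \<tau> / 2" using eps \<tau> L by (auto simp: eps'_def min_def field_simps)
 have "\<forall>\<^sub>F n in sequentially. \<forall>v\<in>?V. norm (LINT y|M. indicator (?A v) y *\<^sub>R z n y) < \<tau> / 2"
  using \<tau> by (intro eventually_ball_finite[OF fin] ballI order_tendstoD(2)[OF tendsto_norm_zero[OF weak]]) simp
 then obtain n where n: "n > n0" "!!v. v \<in> ?V ==> norm (LINT y|M. indicator (?A v) y *\<^sub>R z n y) < \<tau> / 2"
  unfolding eventually_sequentially by (metis Suc_leI le_add1 le_add2 less_eq_Suc_le)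
 obtain k1 F1 where F1: "Lpn p M (%y. z n y - F1 (\<pi> k1 y)) < eps'" using approx[OF eps'(1)] by blast
 define k' where "k' = max k k1"
 obtain \<rho>1 \<rho> where \<rho>: "!!x. \<pi> k1 x = \<rho>1 (\<pi> k' x)" "!!x. \<pi> k x = \<rho> (\<pi> k' x)"
  using \<pi> by (metis k'_def max.cobounded1 max.cobounded2 partitions_def)
 define g where "g y = F1 (\<pi> k1 y)" for y
 have gL: "g \<in> Lpf p M" using partition_Lpf[of F1 k1] by (simp add: g_def[abs_def])
 have gint: "integrable M g" using Lpf_integrable1(1)[OF gL] p by simp
 \<comment> \<open>The mean over the atom; on a null atom the quotient is 0 by division by zero, in
   accordance with the vanishing integral.\<close>
 define c where "c v = (LINT y|M. indicator (?A v) y *\<^sub>R g y) / of_real (m v)" for v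
 define F where "F w = F1 (\<rho>1 w) - c (\<rho> w)" for w
 have F: "F (\<pi> k' y) = g y - c (\<pi> k y)" for y by (simp add: F_def g_def flip: \<rho>)
 have small: "norm (LINT y|M. indicator (?A v) y *\<^sub>R g y) <= \<tau>" if v: "v \<in> ?V" for v
 proof -
  have zi: "integrable M (z n)" using Lpf_integrable1(1)[OF z] p by simp
  have d: "(%y. z n y - g y) \<in> Lpf p M" using Lpf_diff[OF z gL] p by simp
  have "(LINT y|M. indicator (?A v) y *\<^sub>R g y) = (LINT y|M. indicator (?A v) y *\<^sub>R z n y) - (LINT y|M. indicator (?A v) y *\<^sub>R (z n y - g y))"
   using integrable_mult_indicator[OF A zi] integrable_mult_indicator[OF A gint]
   by (simp add: scaleR_diff_right)
  then have "norm (LINT y|M. indicator (?A v) y *\<^sub>R g y) <= \<tau> / 2 + norm (LINT y|M. indicator (?A v) y *\<^sub>R (z n y - g y))"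
   using n(2)[OF v] norm_triangle_ineq4[of "\<integral>y. indicator (?A v) y *\<^sub>R z n y \<partial>M" "\<integral>y. indicator (?A v) y *\<^sub>R (z n y - g y) \<partial>M"] by simp
  also have "norm (LINT y|M. indicator (?A v) y *\<^sub>R (z n y - g y)) <= (LINT y|M. norm (indicator (?A v) y *\<^sub>R (z n y - g y)))"
   by (rule integral_norm_bound)
  also have "... = (LINT y|M. indicator (?A v) y * norm (z n y - g y))" by simp
  also have "... <= L * Lpn p M (%y. z n y - g y)"
   unfolding L_def using Lpf_set_integral'(1)[OF d _ A] p by simp
  also have "... <= L * eps'" using F1 L by (intro mult_left_mono) (auto simp: g_def)
  finally show ?thesis using eps'(3) by simp
 qed
 have zero: "(LINT y|M. indicator (?A v) y *\<^sub>R F (\<pi> k' y)) = 0" for v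
 proof -
  have i1: "integrable M (%y. indicator (?A v) y *\<^sub>R c v)"
   using A by (intro integrable_scaleR_left) (auto intro!: integrable_const_bound[of _ 1])
  have "(LINT y|M. indicator (?A v) y *\<^sub>R F (\<pi> k' y)) = (LINT y|M. indicator (?A v) y *\<^sub>R g y - indicator (?A v) y *\<^sub>R c v)"
   by (intro integral_cong) (auto simp: F atom_def split: split_indicator)
  also have "... = (LINT y|M. indicator (?A v) y *\<^sub>R g y) - m v *\<^sub>R c v"
  proof -
   have "(LINT y|M. indicator (?A v) y *\<^sub>R c v) = (LINT y|M. indicator (?A v) y) *\<^sub>R c v"
    by (rule integral_scaleR_left) (auto intro!: integrable_const_bound[of _ 1])
   then show ?thesis using integrable_mult_indicator[OF A gint] i1 by (simp add: m_def)
  qed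
  also have "... = 0"
  proof (cases "m v = 0")
   case True
   then have "AE y in M. y \<notin> ?A v" using A AE_not_in[of "?A v" M] by (auto simp: null_sets_def emeasure_eq_measure m_def)
   then have "AE y in M. indicator (?A v) y *\<^sub>R g y = 0" by eventually_elim simp
   then have "(LINT y|M. indicator (?A v) y *\<^sub>R g y) = 0" by (rule integral_eq_zero_AE)
   then show ?thesis using True by simp
  qed (simp add: c_def scaleR_conv_of_real)
  finally show ?thesis .
 qed
 have "Lpn p M (%y. c (\<pi> k y)) <= \<tau> * Q"
 proof -
  have ind: "(%y. indicator (?A v) y :: 'k) \<in> Lpf p M" for v
   using p by (intro Lpf_bounded[of _ 1]) (auto split: split_indicator)
  have "Lpn p M (%y. c (\<pi> k y)) = Lpn p M (%y. \<Sum>v\<in>?V. c v * indicator (?A v) y)"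
  proof (rule Lpn_cong_AE)
   have "c (\<pi> k y) = (\<Sum>v\<in>?V. c v * indicator (?A v) y)" if y: "y \<in> space M" for y
   proof -
    have "(\<Sum>v\<in>?V. c v * indicator (?A v) y) = (\<Sum>v\<in>?V. if v = \<pi> k y then c (\<pi> k y) else 0)"
     using y by (intro sum.cong) (auto simp: atom_def indicator_def)
    then show ?thesis using y fin by simp
   qed
   then show "AE y in M. c (\<pi> k y) = (\<Sum>v\<in>?V. c v * indicator (?A v) y)" by (intro AE_I2)
   show "(%y. c (\<pi> k y)) \<in> borel_measurable M" using Lpf_measurable[OF partition_Lpf[of c k]] .
  qed measurable
  also have "... <= (\<Sum>v\<in>?V. Lpn p M (%y. c v * indicator (?A v) y))"
   using p ind by (intro Lpn_sum Lpf_cmult) auto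
  also have "... <= (\<Sum>v\<in>?V. \<tau> * (Lpn p M (%y. indicator (?A v) y :: 'k) / m v))"
  proof (rule sum_mono)
   fix v assume v: "v \<in> ?V"
   have "norm (c v) <= \<tau> / m v"
    using small[OF v] by (auto simp: c_def norm_divide m_def intro!: divide_right_mono)
   then have "norm (c v) * Lpn p M (%y. indicator (?A v) y :: 'k) <= \<tau> / m v * Lpn p M (%y. indicator (?A v) y :: 'k)"
    by (intro mult_right_mono) auto
   then show "Lpn p M (%y. c v * indicator (?A v) y) <= \<tau> * (Lpn p M (%y. indicator (?A v) y :: 'k) / m v)"
    using p by (simp add: Lpn_cmult)
  qed
  finally show ?thesis by (simp add: Q_def sum_distrib_left)
 qed
 also have "\<tau> * Q <= eps / 2" using eps Q by (simp add: \<tau>_def field_simps)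
 finally have cb: "Lpn p M (%y. c (\<pi> k y)) <= eps / 2" .
 have "Lpn p M (%y. z n y - F (\<pi> k' y)) = Lpn p M (%y. (z n y - g y) + c (\<pi> k y))" by (simp add: F algebra_simps)
 also have "... <= Lpn p M (%y. z n y - g y) + Lpn p M (%y. c (\<pi> k y))"
  using p by (intro Lpn_triangle Lpf_diff z gL partition_Lpf) auto
 also have "... <= eps" using F1 eps'(2) cb by (simp add: g_def)
 finally have "Lpn p M (%y. z n y - F (\<pi> k' y)) <= eps" .
 moreover have "k' >= k" by (simp add: k'_def)
 ultimately show ?thesis using zero n(1) by blast
qed

text \<open>Each new approximant has mean zero over atoms so fine that all earlier approximants are
  constant on them. Functions of the earlier sum are then orthogonal to it, as for martingale
  differences; the summable errors of approximation are added at the end.\<close>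

lemma weakly_null_upper_estimate:
 obtains \<sigma> :: "nat => nat" and C where "strict_mono \<sigma>" "0 <= C"
  "ALL m c. Lpn p M (%y. \<Sum>i<m. c i * z (\<sigma> i) y) <= C * (\<Sum>i<m. norm (c i) powr t) powr (1 / t)"
proof -
 \<comment> \<open>The state of the construction is an index, a level of the partitions and an
   approximant. The relation \<open>R\<close> demands that the next approximant has mean zero over
   the atoms of the present level.\<close>
 define P where "P i = (%(n, k, d). (EX F. d = (%y. F (\<pi> k y) :: 'k)) \<and> Lpn p M (%y. z n y - d y) <= (1 / 2) ^ i)" for i :: nat
 define R where "R = (%(n, k, d :: 'a => 'k) (n', k', d'). (n::nat) < n' \<and> k <= k' \<and>
  (ALL v. (LINT y|M. indicator (atom M (\<pi> k) v) y *\<^sub>R (d' y :: 'k)) = 0))"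
 have "EX f. ALL i. P i (f i) \<and> R (f i) (f (Suc i))"
 proof (rule dependent_nat_choice)
  obtain k F where "Lpn p M (%y. z 0 y - F (\<pi> k y)) < 1" using approx[of 1 0] by auto
  then show "EX x. P 0 x" by (intro exI[of _ "(0, k, %y. F (\<pi> k y))"]) (auto simp: P_def less_imp_le)
  fix x i assume "P i x"
  obtain n k d where x: "x = (n, k, d)" by (cases x)
  have "0 < (1 / 2 :: real) ^ Suc i" by simp
  from extraction_step[OF this, of n k] obtain n' k' F where
   "n' > n" "k' >= k" "ALL v. (LINT y|M. indicator (atom M (\<pi> k) v) y *\<^sub>R F (\<pi> k' y)) = 0"
   "Lpn p M (%y. z n' y - F (\<pi> k' y)) <= (1 / 2) ^ Suc i" by blast
  then show "EX y. P (Suc i) y \<and> R x y"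
   unfolding x by (intro exI[of _ "(n', k', %y. F (\<pi> k' y))"]) (auto simp: P_def R_def)
 qed
 then obtain f where f: "!!i. P i (f i)" "!!i. R (f i) (f (Suc i))" by blast
 define \<sigma> where "\<sigma> i = fst (f i)" for i
 define \<kappa> where "\<kappa> i = fst (snd (f i))" for i
 define d where "d i = snd (snd (f i))" for i
 have d: "EX F. d i = (%y. F (\<pi> (\<kappa> i) y))" "Lpn p M (%y. z (\<sigma> i) y - d i y) <= (1 / 2) ^ i" for i
  using f(1)[of i] by (auto simp: P_def \<sigma>_def \<kappa>_def d_def split: prod.splits)
 have Rf: "\<sigma> i < \<sigma> (Suc i) \<and> \<kappa> i <= \<kappa> (Suc i) \<and>
   (ALL v. (LINT y|M. indicator (atom M (\<pi> (\<kappa> i)) v) y *\<^sub>R d (Suc i) y) = 0)" for i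
  using f(2)[of i] by (cases "f i"; cases "f (Suc i)") (simp add: R_def \<sigma>_def \<kappa>_def d_def)
 then have \<sigma>: "strict_mono \<sigma>" and \<kappa>: "!!i. \<kappa> i <= \<kappa> (Suc i)"
  and zero: "!!i v. (LINT y|M. indicator (atom M (\<pi> (\<kappa> i)) v) y *\<^sub>R d (Suc i) y) = 0"
  by (simp_all add: strict_mono_Suc_iff)
 have \<kappa>_mono: "\<kappa> i <= \<kappa> j" if "i <= j" for i j using \<kappa> that by (rule lift_Suc_mono_le)
 have dL: "d i \<in> Lpf p M" for i using d(1)[of i] partition_Lpf by auto
 have dB: "Lpn p M (d i) < B + 2" for i
 proof -
  have "Lpn p M (d i) = Lpn p M (%y. z (\<sigma> i) y - (z (\<sigma> i) y - d i y))" by simp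
  also have "... <= Lpn p M (z (\<sigma> i)) + Lpn p M (%y. z (\<sigma> i) y - d i y)"
   using p by (intro Lpn_diff Lpf_diff z dL) auto
  also have "... <= B + (1 / 2) ^ i" using B d(2) by (intro add_mono)
  also have "... < B + 2" using power_le_one[of "1 / 2 :: real" i] by simp
  finally show ?thesis .
 qed
 obtain h :: "'k => complex" where h: "linear h" "!!x y. h (x * y) = h x * h y" "!!x. cmod (h x) = norm x"
  using real_normed_field_embeds_complex by blast
 have bl: "bounded_linear h" using bounded_linear_isometry[OF h(1,3)] .
 have orth: "integrable M (%y. of_real (norm (\<Sum>j<k. c j * d j y) powr (p - 2)) * cnj (h (\<Sum>j<k. c j * d j y)) * h (d k y)) \<and>
   (LINT y|M. of_real (norm (\<Sum>j<k. c j * d j y) powr (p - 2)) * cnj (h (\<Sum>j<k. c j * d j y)) * h (d k y)) = 0" for k c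
 proof (cases k)
  case 0
  then show ?thesis by simp
 next
  case (Suc i)
  have "EX H. ALL y. d j y = H (\<pi> (\<kappa> i) y)" if "j < k" for j
  proof -
   have "\<kappa> j <= \<kappa> i" using \<kappa>_mono that Suc by simp
   from partitions_factor[OF \<pi> this] obtain \<rho> where "ALL y. \<pi> (\<kappa> j) y = \<rho> (\<pi> (\<kappa> i) y)" by (elim exE)
   moreover obtain F where "d j = (%y. F (\<pi> (\<kappa> j) y))" using d(1)[of j] by (elim exE)
   ultimately have "ALL y. d j y = F (\<rho> (\<pi> (\<kappa> i) y))" by simp
   then show ?thesis by (intro exI[of _ "%v. F (\<rho> v)"])
  qed
  then obtain H where H: "!!j y. j < k ==> d j y = H j (\<pi> (\<kappa> i) y)" by metis
  \<comment> \<open>Up to the factor p, this is the derivative of the p-th power of the modulus at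
    the earlier sum. It depends only on the atom at level \<open>\<kappa> i\<close>, over which the
    next approximant has mean zero.\<close>
  define G where "G v = of_real (norm (\<Sum>j<k. c j * H j v) powr (p - 2)) * cnj (h (\<Sum>j<k. c j * H j v))" for v
  have eq: "of_real (norm (\<Sum>j<k. c j * d j y) powr (p - 2)) * cnj (h (\<Sum>j<k. c j * d j y)) * h (d k y) = G (\<pi> (\<kappa> i) y) * h (d k y)" for y
   using H by (simp add: G_def)
  have di: "integrable M (d k)" using Lpf_integrable1(1)[OF dL] p by simp
  have hi: "integrable M (%y. h (d k y))" using integrable_bounded_linear[OF bl di] .
  have \<pi>i: "finite (\<pi> (\<kappa> i) ` space M)" "atom M (\<pi> (\<kappa> i)) v \<in> sets M" for v using \<pi> by (auto simp: partitions_def)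
  have "(LINT y|M. indicator (atom M (\<pi> (\<kappa> i)) v) y *\<^sub>R h (d k y)) = h (LINT y|M. indicator (atom M (\<pi> (\<kappa> i)) v) y *\<^sub>R d k y)" for v
   using integral_bounded_linear[OF bl integrable_mult_indicator[OF \<pi>i(2) di], of v]
   by (simp add: linear_scale[OF h(1)])
  then have "(LINT y|M. indicator (atom M (\<pi> (\<kappa> i)) v) y *\<^sub>R h (d k y)) = 0" for v
   using zero Suc by (simp add: linear_0[OF h(1)])
  then show ?thesis unfolding eq using integral_partition[OF \<pi>i hi, of G] by simp
 qed
 note o1 = orth[THEN conjunct1] and o2 = orth[THEN conjunct2]
 obtain C where C: "0 <= C" "ALL m c. Lpn p M (%x. \<Sum>i<m. c i * d i x) <= C * (\<Sum>i<m. norm (c i) powr t) powr (1 / t)"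
  by (rule orthogonal_upper_estimate[where d = d, OF p t h dL dB o1 o2])
 have t0: "0 < t" using t p by simp
 show thesis
 \<comment> \<open>The i-th error is at most (1/2)^i and each coefficient at most the l^t norm, so
   the errors contribute at most 2.\<close>
 proof (rule that[OF \<sigma>, of "C + 2"])
  have "Lpn p M (%y. \<Sum>i<m. c i * z (\<sigma> i) y) <= (C + 2) * (\<Sum>i<m. norm (c i) powr t) powr (1 / t)" for m c
  proof -
  let ?s = "(\<Sum>i<m. norm (c i) powr t) powr (1 / t)"
  have ci: "norm (c i) <= ?s" if "i < m" for i
   using that t0 by (intro le_powr_inverse member_le_sum) auto
  have "Lpn p M (%y. \<Sum>i<m. c i * z (\<sigma> i) y) = Lpn p M (%y. (\<Sum>i<m. c i * d i y) + (\<Sum>i<m. c i * (z (\<sigma> i) y - d i y)))"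
   by (simp add: algebra_simps sum_subtractf)
  also have "... <= Lpn p M (%y. \<Sum>i<m. c i * d i y) + Lpn p M (%y. \<Sum>i<m. c i * (z (\<sigma> i) y - d i y))"
   using p by (intro Lpn_triangle Lpf_sum Lpf_cmult Lpf_diff z dL) auto
  also have "Lpn p M (%y. \<Sum>i<m. c i * (z (\<sigma> i) y - d i y)) <= (\<Sum>i<m. Lpn p M (%y. c i * (z (\<sigma> i) y - d i y)))"
   using p by (intro Lpn_sum Lpf_cmult Lpf_diff z dL) auto
  also have "... <= (\<Sum>i<m. ?s * (1 / 2) ^ i)"
   using p ci d(2) by (intro sum_mono) (auto simp: Lpn_cmult intro!: mult_mono)
  also have "... = ?s * (\<Sum>i<m. (1 / 2) ^ i)" by (rule sum_distrib_left[symmetric])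
  also have "?s * (\<Sum>i<m. (1 / 2 :: real) ^ i) <= ?s * 2" by (intro mult_left_mono) (auto simp: geometric_sum)
  also have "Lpn p M (%x. \<Sum>i<m. c i * d i x) <= C * ?s" using C(2) by blast
  finally show ?thesis
   by (simp add: algebra_simps mult_left_mono)
  qed
  then show "ALL m c. Lpn p M (%y. \<Sum>i<m. c i * z (\<sigma> i) y) <= (C + 2) * (\<Sum>i<m. norm (c i) powr t) powr (1 / t)"
   by blast
 qed (use C in auto)
qed

end

text \<open>For p = 1 the exponent is 1 and the triangle inequality suffices. For p > 1 a diagonal
  subsequence makes the integrals over all atoms of all partitions converge, so that differences
  tend to 0 against every atom. The maps \<nu> and \<tau> stay free because the gliding hump
  arguments choose partners and thin the sequence before the upper estimate is extracted.\<close>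

lemma Lpf_difference_upper_estimate:
 fixes x :: "nat => 'a => 'k::{real_normed_field, banach, second_countable_topology}"
 assumes p: "1 <= p" and t: "t = min p 2" and x: "!!n. x n \<in> Lpf p M" and B: "!!n. Lpn p M (x n) <= B"
 shows "EX \<rho> :: nat => nat. strict_mono \<rho> \<and> (ALL (\<nu> :: nat => nat) (\<tau> :: nat => nat). (ALL k. k < \<nu> k) --> strict_mono \<tau> -->
  (EX (\<sigma> :: nat => nat) C. strict_mono \<sigma> \<and> 0 <= C \<and> (ALL m c.
   Lpn p M (%y. \<Sum>i<m. c i * (x (\<rho> (\<nu> (\<tau> (\<sigma> i)))) y - x (\<rho> (\<tau> (\<sigma> i))) y)) <= C * (\<Sum>i<m. norm (c i) powr t) powr (1 / t))))"
proof (cases "p = 1")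
 case True
 have dB: "Lpn p M (%y. x i y - x j y) <= 2 * B" for i j
  using Lpn_diff[OF x x p, of i j] B[of i] B[of j] by simp
 have "Lpn p M (%y. \<Sum>i<m. c i * (x (a i) y - x (b i) y)) <= 2 * B * (\<Sum>i<m. norm (c i) powr t) powr (1 / t)"
  for m c and a b :: "nat => nat"
 proof -
  have "Lpn p M (%y. \<Sum>i<m. c i * (x (a i) y - x (b i) y)) <= (\<Sum>i<m. Lpn p M (%y. c i * (x (a i) y - x (b i) y)))"
   using p by (intro Lpn_sum Lpf_cmult Lpf_diff x) auto
  also have "... <= (\<Sum>i<m. norm (c i) * (2 * B))"
   using p dB by (intro sum_mono) (auto simp: Lpn_cmult intro!: mult_left_mono)
  finally show ?thesis using True t by (simp add: sum_nonneg sum_distrib_left mult.commute)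
 qed
 moreover have "0 <= B" using B Lpn_nonneg order_trans by blast
 ultimately have "EX (\<sigma> :: nat => nat) C. strict_mono \<sigma> \<and> 0 <= C \<and> (ALL m c.
   Lpn p M (%y. \<Sum>i<m. c i * (x (id (\<nu> (\<tau> (\<sigma> i)))) y - x (id (\<tau> (\<sigma> i))) y)) <= C * (\<Sum>i<m. norm (c i) powr t) powr (1 / t))"
  for \<nu> \<tau> :: "nat => nat"
  by (intro exI[of _ "%i :: nat. i"] exI[of _ "2 * B"]) (auto simp: strict_mono_def)
 then show ?thesis by (intro exI[of _ id]) (auto simp: strict_mono_def)
next
 case False
 then have p1: "1 < p" using p by simp
 obtain \<pi> :: "nat => 'a => 'k list" where \<pi>: "partitions M \<pi>"
  "ALL n. ALL e>0. EX k F. Lpn p M (%y. x n y - F (\<pi> k y)) < e"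
  by (rule partitions_exist[OF x p])
 have A: "atom M (\<pi> k) v \<in> sets M" for k v using \<pi>(1) by (auto simp: partitions_def)
 have xi: "integrable M (x n)" for n using Lpf_integrable1(1)[OF x p] .
 let ?I = "SIGMA k:UNIV. \<pi> k ` space M"
 have cI: "countable ?I" using \<pi>(1) by (intro countable_SIGMA) (auto simp: partitions_def intro: countable_finite)
 define e where "e = from_nat_into ?I"
 define f where "f m n = (LINT y|M. indicator (atom M (\<pi> (fst (e m))) (snd (e m))) y *\<^sub>R x n y)" for m n
 have bd: "bounded (range (f m))" for m
 proof -
  have "norm (f m n) <= 2 * (measure M (space M) + 1) * B" for n
  proof -
   have "norm (f m n) <= (LINT y|M. indicator (atom M (\<pi> (fst (e m))) (snd (e m))) y * norm (x n y))"
    unfolding f_def by (rule order_trans[OF integral_norm_bound]) simp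
   also have "... <= 2 * (measure M (space M) + 1) * Lpn p M (x n)" by (rule Lpf_set_integral'(1)[OF x p A])
   also have "... <= 2 * (measure M (space M) + 1) * B" using B by (intro mult_left_mono) (auto simp: add_nonneg_nonneg)
   finally show ?thesis .
  qed
  then show ?thesis by (auto simp: bounded_iff)
 qed
 have "EX \<rho>. strict_mono \<rho> \<and> (ALL m. convergent (%n. f m (\<rho> n)))"
  by (rule diagonal_scalar_subseq[of f, OF bd]) blast
 then obtain \<rho> where \<rho>: "strict_mono \<rho>" "!!m. convergent (%n. f m (\<rho> n))" by blast
 have conv: "convergent (%n. \<integral>y. indicator (atom M (\<pi> k) v) y *\<^sub>R x (\<rho> n) y \<partial>M)" for k v
 proof (cases "v \<in> \<pi> k ` space M")
  case True
  then obtain m where "e m = (k, v)" unfolding e_def using from_nat_into_surj[OF cI, of "(k, v)"] by auto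
  then show ?thesis using \<rho>(2)[of m] by (simp add: f_def)
 next
  case False
  then have "atom M (\<pi> k) v = {}" by (auto simp: atom_def)
  then show ?thesis by (simp add: convergent_const)
 qed
 show ?thesis
 proof (rule exI[of _ \<rho>], intro conjI \<rho>(1) allI impI)
  fix \<nu> \<tau> :: "nat => nat" assume \<nu>: "ALL k. k < \<nu> k" and \<tau>: "strict_mono \<tau>"
  define z where "z k y = x (\<rho> (\<nu> (\<tau> k))) y - x (\<rho> (\<tau> k)) y" for k y
  have z: "z n \<in> Lpf p M" for n using p by (auto simp: z_def[abs_def] intro!: Lpf_diff x)
  have zB: "Lpn p M (z n) <= 2 * B" for n
   using Lpn_diff[OF x x p, of "\<rho> (\<nu> (\<tau> n))" "\<rho> (\<tau> n)"] B[of "\<rho> (\<nu> (\<tau> n))"] B[of "\<rho> (\<tau> n)"]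
   by (simp add: z_def[abs_def])
  have approx: "EX k F. Lpn p M (%y. z n y - F (\<pi> k y)) < e" if e: "0 < e" for n e
  proof -
   let ?a = "\<rho> (\<nu> (\<tau> n))" and ?b = "\<rho> (\<tau> n)"
   obtain k F where F: "Lpn p M (%y. x ?a y - F (\<pi> k y)) < e / 2"
    using \<pi>(2)[rule_format, of "e / 2" ?a] e by auto
   obtain l G where G: "Lpn p M (%y. x ?b y - G (\<pi> l y)) < e / 2"
    using \<pi>(2)[rule_format, of "e / 2" ?b] e by auto
   obtain \<rho>1 \<rho>2 where r: "!!y. \<pi> k y = \<rho>1 (\<pi> (max k l) y)" "!!y. \<pi> l y = \<rho>2 (\<pi> (max k l) y)"
    using \<pi>(1) by (metis max.cobounded1 max.cobounded2 partitions_def)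
   have sf: "(%y. F (\<pi> k y)) \<in> Lpf p M" for F :: "'k list => 'k" and k
   proof -
    have s: "simple_function M (%y. F (\<pi> k y))"
     using \<pi>(1) by (auto simp: partitions_def intro!: simple_function_partition[where F = F])
    have s2: "simple_function M (%y. norm (F (\<pi> k y)) powr p)"
     using \<pi>(1) by (auto simp: partitions_def intro!: simple_function_partition[where F = "%v. norm (F v) powr p"])
    obtain C where "!!y. y \<in> space M ==> norm (F (\<pi> k y)) powr p <= C"
     using simple_functionD(1)[OF s2] by (metis (mono_tags, lifting) finite_imageI Max_ge imageI)
    then have "integrable M (%y. norm (F (\<pi> k y)) powr p)"
     using borel_measurable_simple_function[OF s2] by (intro integrable_const_bound[of _ C]) auto
    then show ?thesis using borel_measurable_simple_function[OF s] by (rule LpfI[rotated])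
   qed
   let ?H = "%v. F (\<rho>1 v) - G (\<rho>2 v)"
   have "Lpn p M (%y. z n y - ?H (\<pi> (max k l) y)) = Lpn p M (%y. (x ?a y - F (\<pi> k y)) - (x ?b y - G (\<pi> l y)))"
    by (simp add: z_def algebra_simps r[symmetric])
   also have "... <= Lpn p M (%y. x ?a y - F (\<pi> k y)) + Lpn p M (%y. x ?b y - G (\<pi> l y))"
    using p by (intro Lpn_diff Lpf_diff x sf) auto
   finally show ?thesis using F G by (intro exI[of _ "max k l"] exI[of _ ?H]) linarith
  qed
  have weak: "(%n. \<integral>y. indicator (atom M (\<pi> k) v) y *\<^sub>R z n y \<partial>M) ----> 0" for k v
  proof -
   let ?f = "%n. \<integral>y. indicator (atom M (\<pi> k) v) y *\<^sub>R x (\<rho> n) y \<partial>M"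
   obtain L where L: "?f ----> L" using conv convergent_def by blast
   have f1: "filterlim \<tau> sequentially sequentially" using \<tau> by (rule filterlim_subseq)
   have f2: "filterlim (%n. \<nu> (\<tau> n)) sequentially sequentially"
    using f1 by (rule filterlim_at_top_mono) (use \<nu> in \<open>auto simp: less_imp_le\<close>)
   have "(%n. ?f (\<nu> (\<tau> n)) - ?f (\<tau> n)) ----> L - L"
    by (intro tendsto_diff filterlim_compose[OF L f1] filterlim_compose[OF L f2])
   moreover have "(LINT y|M. indicator (atom M (\<pi> k) v) y *\<^sub>R z n y) = ?f (\<nu> (\<tau> n)) - ?f (\<tau> n)" for n
    using integrable_mult_indicator[OF A xi] by (simp add: z_def scaleR_diff_right)
   ultimately show ?thesis by simp
  qed
  obtain \<sigma> :: "nat => nat" and C where "strict_mono \<sigma>" "0 <= C"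
   "ALL m c. Lpn p M (%y. \<Sum>i<m. c i * z (\<sigma> i) y) <= C * (\<Sum>i<m. norm (c i) powr t) powr (1 / t)"
   by (rule weakly_null_upper_estimate[OF p1 t \<pi>(1) z zB approx weak])
  then show "EX (\<sigma> :: nat => nat) C. strict_mono \<sigma> \<and> 0 <= C \<and> (ALL m c.
   Lpn p M (%y. \<Sum>i<m. c i * (x (\<rho> (\<nu> (\<tau> (\<sigma> i)))) y - x (\<rho> (\<tau> (\<sigma> i))) y)) <= C * (\<Sum>i<m. norm (c i) powr t) powr (1 / t))"
   unfolding z_def by blast
 qed
qed

end

section \<open>The concrete space L^p(0,1)\<close>

text \<open>A density on the whole line instead of a restricted space: representatives in
  \<open>Lp_space\<close> are measurable functions on the line, identified when equal almost
  everywhere on the interval.\<close>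

definition leb01 :: "real measure" where
 "leb01 = density lborel (indicator {0<..<1})"

lemma space_leb01 [simp]: "space leb01 = UNIV"
 and sets_leb01 [simp, measurable_cong]: "sets leb01 = sets borel"
 by (simp_all add: leb01_def)

lemma measurable_leb01 [simp]: "borel_measurable leb01 = borel_measurable lborel"
 by (rule measurable_cong_sets) simp_all

lemma emeasure_leb01: "A \<in> sets borel ==> emeasure leb01 A = emeasure lborel (A \<inter> {0<..<1})"
 unfolding leb01_def
 by (subst emeasure_density) (simp_all add: indicator_inter_arith[symmetric] Int_commute flip: nn_integral_indicator)

interpretation unit: finite_measure leb01
 by (rule finite_measureI) (simp add: emeasure_leb01)

lemma measure_leb01: "A \<in> sets borel ==> measure leb01 A = measure lborel (A \<inter> {0<..<1})"
 by (simp add: measure_def emeasure_leb01)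

lemma measure_unit_UNIV [simp]: "measure leb01 UNIV = 1"
 by (simp add: measure_leb01)

lemma AE_leb01: "(AE x in leb01. P x) \<longleftrightarrow> (AE x in lborel. x \<in> {0<..<1} --> P x)"
 unfolding leb01_def
 by (subst AE_density) (auto intro!: AE_cong simp: indicator_def)

lemma integrable_leb01:
 fixes f :: "real => 'b::{banach, second_countable_topology}"
 assumes "f \<in> borel_measurable lborel"
 shows "integrable leb01 f \<longleftrightarrow> set_integrable lborel {0<..<1} f"
proof -
 have "leb01 = density lborel (%x. ennreal (indicator {0<..<1} x))"
  unfolding leb01_def by (rule arg_cong[where f = "density lborel"]) (auto simp: fun_eq_iff indicator_def)
 then show ?thesis unfolding set_integrable_def using assms by (subst integrable_density[symmetric]) auto
qed

lemma integral_leb01: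
 fixes f :: "real => 'b::{banach, second_countable_topology}"
 assumes "f \<in> borel_measurable lborel"
 shows "(LINT x|leb01. f x) = (LINT x:{0<..<1}|lborel. f x)"
proof -
 have "leb01 = density lborel (%x. ennreal (indicator {0<..<1} x))"
  unfolding leb01_def by (rule arg_cong[where f = "density lborel"]) (auto simp: fun_eq_iff indicator_def)
 then show ?thesis unfolding set_lebesgue_integral_def using assms by (subst integral_density[symmetric]) auto
qed

lemma Lp_fun_eq: "Lp_fun p = (Lpf p leb01 :: (real => 'k::{real_normed_field, banach, second_countable_topology}) set)"
 by (auto simp: Lp_fun_def Lpf_def integrable_leb01)

lemma lp_class_eq: "lp_class f = {g \<in> borel_measurable lborel. AE x in leb01. g x = f x}"
 by (simp add: lp_class_def AE_leb01)

lemma lp_class_self: "f \<in> borel_measurable lborel ==> f \<in> lp_class f"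
 by (simp add: lp_class_eq)

lemma lp_class_cong: "AE x in leb01. f x = g x ==> lp_class f = lp_class g"
proof -
 assume "AE x in leb01. f x = g x"
 then have "(AE x in leb01. h x = f x) \<longleftrightarrow> (AE x in leb01. h x = g x)" for h
  by (auto elim: eventually_elim2)
 then show ?thesis by (simp add: lp_class_eq)
qed

lemma lp_rep_class:
 assumes "f \<in> borel_measurable lborel"
 shows "lp_rep (lp_class f) \<in> borel_measurable lborel" "AE x in leb01. lp_rep (lp_class f) x = f x"
proof -
 have "lp_rep (lp_class f) \<in> lp_class f"
  unfolding lp_rep_def using lp_class_self[OF assms] by (rule someI[where P = "%g. g \<in> lp_class f"])
 then show "lp_rep (lp_class f) \<in> borel_measurable lborel" "AE x in leb01. lp_rep (lp_class f) x = f x"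
  by (simp_all add: lp_class_eq)
qed

text \<open>Integrals over Borel sets are linear and determine an integrable function almost
  everywhere, so they serve as the coordinates of \<open>normed_nspace\<close>.\<close>

definition Lp_iota :: "(real => 'k::{real_normed_field, banach, second_countable_topology}) set => real set => 'k" where
 "Lp_iota A S = (if S \<in> sets borel then \<integral>x. indicator S x *\<^sub>R lp_rep A x \<partial>leb01 else 0)"

definition Lp_pair :: "(real => 'k::{real_normed_field, banach, second_countable_topology}) => (real => 'k) set => 'k" where
 "Lp_pair g A = (LINT x|leb01. lp_rep A x * g x)"

text \<open>Integration over half-lines with rational end point; the decodings enumerate the
  quotients of an integer by a positive natural number. Countably many test functionals are what
  \<open>fss_add_compact_SS\<close> asks for.\<close>

definition Lp_test :: "nat => (real => 'k::{real_normed_field, banach, second_countable_topology}) set => 'k" where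
 "Lp_test m = Lp_pair (indicator {..of_int (int_decode (fst (prod_decode m))) / real (Suc (snd (prod_decode m)))})"

context
 fixes p :: real
 assumes p: "1 <= p"
begin

abbreviation "X \<equiv> Lp_space p :: ((real => 'k) set, 'k::{real_normed_field, banach, second_countable_topology}) nspace"
abbreviation "F \<equiv> Lpf p leb01 :: (real => 'k::{real_normed_field, banach, second_countable_topology}) set"

lemma F_measurable: "f \<in> F ==> f \<in> borel_measurable lborel"
 using Lpf_measurable[of f p leb01] by simp

lemma lp_rep_Lpf: "f \<in> F ==> lp_rep (lp_class f) \<in> F"
proof -
 assume f: "f \<in> F"
 show ?thesis
  using Lpf_cong_AE[OF f, of "lp_rep (lp_class f)"] lp_rep_class[OF F_measurable[OF f]] by simp
qed

lemma carrier_Lp: "nsp_carrier X = lp_class ` F"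
 by (simp add: Lp_space_def Lp_fun_eq)

lemma Lp_carrierI: "f \<in> F ==> lp_class f \<in> nsp_carrier X"
 by (simp add: carrier_Lp)

lemma Lp_carrierD: "A \<in> nsp_carrier X ==> lp_rep A \<in> F \<and> A = lp_class (lp_rep A)"
proof -
 assume "A \<in> nsp_carrier X"
 then obtain f where f: "f \<in> F" "A = lp_class f" by (auto simp: carrier_Lp)
 then show ?thesis using lp_rep_Lpf lp_class_cong[OF lp_rep_class(2)[OF F_measurable]] by metis
qed

lemma Lp_zero: "nsp_zero X = lp_class (%_. 0)"
 by (simp add: Lp_space_def)

lemma Lp_add: "f \<in> F ==> g \<in> F ==> nsp_add X (lp_class f) (lp_class g) = lp_class (%x. f x + g x)"
 using lp_rep_class(2)[OF F_measurable, of f] lp_rep_class(2)[OF F_measurable, of g]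
 by (auto simp: Lp_space_def intro!: lp_class_cong elim: eventually_elim2)

lemma Lp_smul: "f \<in> F ==> nsp_smul X c (lp_class f) = lp_class (%x. c * f x)"
 using lp_rep_class(2)[OF F_measurable, of f]
 by (auto simp: Lp_space_def intro!: lp_class_cong elim: eventually_mono)

lemma Lp_norm: "f \<in> F ==> nsp_norm X (lp_class f) = Lpn p leb01 f"
proof -
 assume f: "f \<in> F"
 have "(%x. norm (lp_rep (lp_class f) x) powr p) \<in> borel_measurable lborel"
  using lp_rep_class(1)[OF F_measurable[OF f]] by simp
 then have "nsp_norm X (lp_class f) = Lpn p leb01 (lp_rep (lp_class f))"
  by (simp add: Lp_space_def Lpn_def integral_leb01)
 also have "... = Lpn p leb01 f"
  using lp_rep_class[OF F_measurable[OF f]] F_measurable[OF f] by (intro Lpn_cong_AE) auto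
 finally show ?thesis .
qed

lemma Lp_minus: "f \<in> F ==> g \<in> F ==> nsp_minus X (lp_class f) (lp_class g) = lp_class (%x. f x - g x)"
 using Lp_add[of f "%x. -1 * g x"] Lpf_cmult[of g p leb01 "-1"] p by (simp add: nsp_minus_def Lp_smul)

lemma Lp_lsum: "(!!i. i < n ==> f i \<in> F) ==> lsum X c (%i. lp_class (f i)) n = lp_class (%x. \<Sum>i<n. c i * f i x)"
proof (induction n)
 case (Suc n)
 have "(%x. \<Sum>i<n. c i * f i x) \<in> F" using Suc.prems p by (intro Lpf_sum Lpf_cmult) auto
 moreover have "(%x. c n * f n x) \<in> F" using Suc.prems p by (intro Lpf_cmult) auto
 ultimately show ?case using Suc by (simp add: Lp_smul Lp_add less_SucI)
qed (simp add: Lp_zero)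

lemma F_integrable: "f \<in> F ==> integrable leb01 f"
 using unit.Lpf_integrable1(1) p by blast

lemma Lp_iota_class:
 assumes "f \<in> F"
 shows "Lp_iota (lp_class f) S = (if S \<in> sets borel then \<integral>x. indicator S x *\<^sub>R f x \<partial>leb01 else 0)"
proof -
 have "(LINT x|leb01. indicator S x *\<^sub>R lp_rep (lp_class f) x) = (LINT x|leb01. indicator S x *\<^sub>R f x)" if "S \<in> sets borel"
  using lp_rep_class[OF F_measurable[OF assms]] F_measurable[OF assms] that
  by (intro integral_cong_AE) (auto elim: eventually_mono)
 then show ?thesis by (simp add: Lp_iota_def)
qed

lemma normed_nspace_Lp: "normed_nspace (X :: ((real => 'k) set, 'k::{real_normed_field, banach, second_countable_topology}) nspace) Lp_iota"
proof
 have p0: "0 < p" using p by simp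
 have int: "integrable leb01 (%x. indicator S x *\<^sub>R f x)" if "f \<in> F" "S \<in> sets borel" for f :: "real => 'k" and S
  using that by (intro integrable_mult_indicator F_integrable) auto
 show "nsp_zero X \<in> nsp_carrier X" by (simp add: Lp_zero Lp_carrierI)
 show "Lp_iota (nsp_zero X) b = 0" for b by (simp add: Lp_zero Lp_iota_class)
 fix A B :: "(real => 'k) set" and c assume "A \<in> nsp_carrier X"
 then obtain f where f: "f \<in> F" "A = lp_class f" by (auto simp: carrier_Lp)
 have cf: "(%x. c * f x) \<in> F" using f p0 by (intro Lpf_cmult) auto
 show "nsp_smul X c A \<in> nsp_carrier X" using cf f by (simp add: Lp_smul Lp_carrierI)
 show "Lp_iota (nsp_smul X c A) b = c * Lp_iota A b" for b
 proof (cases "b \<in> sets borel")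
  case True
  have "(LINT x|leb01. indicator b x *\<^sub>R (c * f x)) = (LINT x|leb01. c * (indicator b x *\<^sub>R f x))"
   by (intro integral_cong) auto
  also have "... = c * (LINT x|leb01. indicator b x *\<^sub>R f x)"
   using int[OF f(1) True] by (intro integral_mult_right)
  finally show ?thesis unfolding f(2) Lp_smul[OF f(1)] Lp_iota_class[OF cf] Lp_iota_class[OF f(1)] using True by simp
 next
  case False
  then show ?thesis unfolding f(2) Lp_smul[OF f(1)] Lp_iota_class[OF cf] Lp_iota_class[OF f(1)] by simp
 qed
 show "nsp_norm X (nsp_smul X c A) = norm c * nsp_norm X A"
  using cf f p0 by (simp add: Lp_smul Lp_norm Lpn_cmult)
 show "A = nsp_zero X" if "nsp_norm X A = 0"
  using Lpn_eq_0D[OF f(1) _ p0] that f by (auto simp: Lp_norm Lp_zero intro!: lp_class_cong)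
 assume "B \<in> nsp_carrier X"
 then obtain g where g: "g \<in> F" "B = lp_class g" by (auto simp: carrier_Lp)
 have fg: "(%x. f x + g x) \<in> F" using f g p by (intro Lpf_add) auto
 show "nsp_add X A B \<in> nsp_carrier X" using f g fg by (simp add: Lp_add Lp_carrierI)
 show "Lp_iota (nsp_add X A B) b = Lp_iota A b + Lp_iota B b" for b
  using f g fg int[OF f(1)] int[OF g(1)] by (simp add: Lp_add Lp_iota_class scaleR_add_right)
 show "nsp_norm X (nsp_add X A B) <= nsp_norm X A + nsp_norm X B"
  using f g fg p by (simp add: Lp_add Lp_norm Lpn_triangle)
 assume eq: "!!b. Lp_iota A b = Lp_iota B b"
 have "AE x in leb01. f x = g x"
 proof (rule unit.density_unique_banach[OF F_integrable[OF f(1)] F_integrable[OF g(1)]])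
  fix S assume "S \<in> sets leb01"
  then show "set_lebesgue_integral leb01 S f = set_lebesgue_integral leb01 S g"
   using eq[of S] f g by (simp add: Lp_iota_class set_lebesgue_integral_def)
 qed
 then show "A = B" using f g by (simp add: lp_class_cong)
qed

lemma Lp_complete: "nsp_complete (X :: ((real => 'k) set, 'k::{real_normed_field, banach, second_countable_topology}) nspace)"
 unfolding nsp_complete_def
proof (intro allI impI)
 fix A :: "nat => (real => 'k) set" assume A: "ALL n. A n \<in> nsp_carrier X" and c: "nsp_cauchy X A"
 define f where "f n = lp_rep (A n)" for n
 have f: "f n \<in> F" "A n = lp_class (f n)" for n using Lp_carrierD[OF A[rule_format]] by (auto simp: f_def)
 have d: "(%x. f m x - f n x) \<in> F" for m n using f(1) p by (intro Lpf_diff)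
 have N: "nsp_norm X (nsp_minus X (A m) (A n)) = Lpn p leb01 (%x. f m x - f n x)" for m n
  unfolding f(2) using f(1) d by (simp add: Lp_minus Lp_norm)
 have "EX g. g \<in> F \<and> (%n. Lpn p leb01 (%x. f n x - g x)) ----> 0"
 proof (rule unit.Lpf_complete[OF f(1) p])
  show "EX k. ALL m>=k. ALL n>=k. Lpn p leb01 (%x. f m x - f n x) < e" if "0 < e" for e
   using c that unfolding nsp_cauchy_def N by blast
 qed blast
 then obtain g where g: "g \<in> F" "(%n. Lpn p leb01 (%x. f n x - g x)) ----> 0" by blast
 have "nsp_norm X (nsp_minus X (A n) (lp_class g)) = Lpn p leb01 (%x. f n x - g x)" for n
  unfolding f(2) using f(1) g(1) Lpf_diff[OF f(1) g(1) p] by (simp add: Lp_minus Lp_norm)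
 then show "EX l. nsp_lim X A l" using g by (intro exI[of _ "lp_class g"]) (simp add: nsp_lim_def Lp_carrierI)
qed

lemma Lp_pair_class:
 assumes "f \<in> F" and [measurable]: "g \<in> borel_measurable lborel"
 shows "Lp_pair g (lp_class f) = (LINT x|leb01. f x * g x)"
proof -
 have [measurable]: "f \<in> borel_measurable lborel" "lp_rep (lp_class f) \<in> borel_measurable lborel"
  using F_measurable[OF assms(1)] lp_rep_class(1) by auto
 show ?thesis unfolding Lp_pair_def
  using lp_rep_class(2)[OF F_measurable[OF assms(1)]] by (intro integral_cong_AE) (auto elim: eventually_mono)
qed

lemma bounded_functional_Lp_pair:
 fixes g :: "real => 'k::{real_normed_field, banach, second_countable_topology}"
 assumes g[measurable]: "g \<in> borel_measurable lborel"
  and bd: "!!f. f \<in> F ==> integrable leb01 (%x. f x * g x) \<and> norm (LINT x|leb01. f x * g x) <= C * Lpn p leb01 f"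
 shows "bounded_functional X (Lp_pair g)"
 unfolding bounded_functional_def
proof (intro conjI ballI allI exI[of _ C])
 have p0: "0 < p" using p by simp
 fix A B :: "(real => 'k) set" assume A: "A \<in> nsp_carrier X"
 obtain f where f: "f \<in> F" "A = lp_class f" using A by (auto simp: carrier_Lp)
 show "norm (Lp_pair g A) <= C * nsp_norm X A" using bd f by (simp add: Lp_pair_class Lp_norm)
 show "Lp_pair g (nsp_smul X c A) = c * Lp_pair g A" for c
  using f p0 bd[OF f(1)] by (simp add: Lp_smul Lp_pair_class Lpf_cmult mult.assoc)
 assume "B \<in> nsp_carrier X"
 then obtain h where h: "h \<in> F" "B = lp_class h" by (auto simp: carrier_Lp)
 show "Lp_pair g (nsp_add X A B) = Lp_pair g A + Lp_pair g B"
  using f h p bd[OF f(1)] bd[OF h(1)] by (simp add: Lp_add Lp_pair_class Lpf_add distrib_right)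
qed

lemma bounded_functional_Lp_bounded:
 fixes g :: "real => 'k::{real_normed_field, banach, second_countable_topology}"
 assumes g[measurable]: "g \<in> borel_measurable lborel" and le: "!!x. norm (g x) <= D"
 shows "bounded_functional X (Lp_pair g)"
proof (rule bounded_functional_Lp_pair[OF g, of "4 * D"])
 fix f :: "real => 'k" assume f: "f \<in> F"
 have [measurable]: "f \<in> borel_measurable lborel" using F_measurable[OF f] .
 have D: "0 <= D" using le norm_ge_zero order_trans by blast
 have nf: "integrable leb01 (%x. D * norm (f x))" using F_integrable[OF f] by simp
 have le': "norm (f x * g x) <= D * norm (f x)" for x
  using mult_left_mono[OF le[of x], of "norm (f x)"] by (simp add: norm_mult mult.commute)
 have i: "integrable leb01 (%x. f x * g x)"
  by (rule integrable_bound[OF nf]) (auto intro!: AE_I2 order_trans[OF le'] abs_ge_self)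
 have "norm (LINT x|leb01. f x * g x) <= (LINT x|leb01. D * norm (f x))"
  using i nf le' by (intro order_trans[OF integral_norm_bound] integral_mono) auto
 also have "... <= D * (4 * Lpn p leb01 f)"
  using unit.Lpf_integrable1(2)[OF f p] D by (simp add: mult_left_mono)
 finally show "integrable leb01 (%x. f x * g x) \<and> norm (LINT x|leb01. f x * g x) <= 4 * D * Lpn p leb01 f"
  using i by simp
qed

lemma bounded_functional_Lp_test: "bounded_functional X (Lp_test m)"
 unfolding Lp_test_def by (rule bounded_functional_Lp_bounded[of _ 1]) (auto split: split_indicator)

text \<open>Half-lines with real end point are limits from the right of rational ones. They generate
  the Borel sets and are stable under intersection, so all set integrals vanish.\<close>

lemma Lp_test_separating:
 fixes A :: "(real => 'k::{real_normed_field, banach, second_countable_topology}) set"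
 assumes A: "A \<in> nsp_carrier X" and 0: "!!m. Lp_test m A = 0"
 shows "A = nsp_zero X"
proof -
 obtain f where f: "f \<in> F" "A = lp_class f" using A by (auto simp: carrier_Lp)
 have [measurable]: "f \<in> borel_measurable lborel" using F_measurable[OF f(1)] .
 have fi: "integrable leb01 f" using F_integrable[OF f(1)] .
 let ?I = "%S. \<integral>x. indicator S x *\<^sub>R f x \<partial>leb01"
 have int: "integrable leb01 (%x. indicator S x *\<^sub>R f x)" if "S \<in> sets borel" for S
  using that fi by (intro integrable_mult_indicator) auto
 have q0: "?I {..of_int i / real (Suc n)} = 0" for i n
 proof -
  have "Lp_test (prod_encode (int_encode i, n)) A = (LINT x|leb01. f x * indicator {..of_int i / real (Suc n)} x)"
   unfolding Lp_test_def f(2) by (subst Lp_pair_class[OF f(1)]) simp_all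
  also have "... = ?I {..of_int i / real (Suc n)}"
   by (intro integral_cong) (auto split: split_indicator)
  finally show ?thesis using 0 by simp
 qed
 have a0: "?I {..a} = 0" for a
 proof -
  define q where "q n = of_int (\<lfloor>a * real (Suc n)\<rfloor> + 1) / real (Suc n)" for n
  have q: "a < q n" "q n <= a + 1 / real (Suc n)" for n
  proof -
   have "a * real (Suc n) < of_int (\<lfloor>a * real (Suc n)\<rfloor> + 1)" by (rule floor_less_iff[THEN iffD1]) simp
   then show "a < q n" by (simp add: q_def pos_less_divide_eq del: of_nat_Suc)
   have "of_int (\<lfloor>a * real (Suc n)\<rfloor> + 1) <= a * real (Suc n) + 1" by simp
   then have "q n <= (a * real (Suc n) + 1) / real (Suc n)" unfolding q_def by (intro divide_right_mono) auto
   also have "... = a + 1 / real (Suc n)" by (simp add: add_divide_distrib del: of_nat_Suc)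
   finally show "q n <= a + 1 / real (Suc n)" .
  qed
  have "(%n. a + 1 / real (Suc n)) ----> a + 0"
   by (intro tendsto_add tendsto_const) (use LIMSEQ_inverse_real_of_nat in \<open>simp add: inverse_eq_divide\<close>)
  then have ql: "(%n. a + 1 / real (Suc n)) ----> a" by simp
  have "(%n. ?I {..q n}) ----> ?I {..a}"
  proof (rule integral_dominated_convergence[where w = "%x. norm (f x)"])
   show "AE x in leb01. (%n. indicator {..q n} x *\<^sub>R f x) ----> indicator {..a} x *\<^sub>R f x"
   proof (rule AE_I2)
    fix x
    show "(%n. indicator {..q n} x *\<^sub>R f x) ----> indicator {..a} x *\<^sub>R f x"
    proof (cases "x <= a")
     case True
     then have "x <= q n" for n using q(1)[of n] by simp
     then show ?thesis using True by simp
    next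
     case False
     then have "\<forall>\<^sub>F n in sequentially. a + 1 / real (Suc n) < x" using order_tendstoD(2)[OF ql] by simp
     then have "\<forall>\<^sub>F n in sequentially. indicator {..q n} x *\<^sub>R f x = indicator {..a} x *\<^sub>R f x"
     proof eventually_elim
      case (elim n)
      then show ?case using q(2)[of n] False by simp
     qed
     then show ?thesis by (rule tendsto_eventually)
    qed
   qed
  qed (use fi in \<open>auto split: split_indicator\<close>)
  moreover have "?I {..q n} = 0" for n unfolding q_def by (rule q0)
  ultimately show ?thesis by (simp add: LIMSEQ_const_iff)
 qed
 \<comment> \<open>The complement step below needs the whole line; the half-line up to 1 already
   carries all the mass.\<close>
 have UN: "?I UNIV = 0"
 proof -
  have "{..of_int 1 / real (Suc 0)} = {..1::real}" by simp
  then have "?I {..1} = 0" using q0[of 1 0] by simp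
  moreover have "?I UNIV = ?I {..1}"
  proof (rule integral_cong_AE)
   show "AE x in leb01. indicator UNIV x *\<^sub>R f x = indicator {..1} x *\<^sub>R f x"
    unfolding AE_leb01 by (rule AE_I2) auto
  qed auto
  ultimately show ?thesis by simp
 qed
 have all: "?I S = 0" if S: "S \<in> sets borel" for S
 proof -
  have "Int_stable (range (%a::real. {..a}))" by (auto simp: Int_stable_def)
  moreover have "range (%a::real. {..a}) \<subseteq> Pow UNIV" by simp
  moreover have "S \<in> sigma_sets UNIV (range (%a::real. {..a}))" using S by (simp add: borel_eq_atMost)
  ultimately show ?thesis
  proof (induction rule: sigma_sets_induct_disjoint)
   case (compl T)
   then have T: "T \<in> sets borel" by (simp add: borel_eq_atMost)
   have "?I (UNIV - T) = (LINT x|leb01. indicator UNIV x *\<^sub>R f x - indicator T x *\<^sub>R f x)"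
    by (intro integral_cong) (auto split: split_indicator)
   also have "... = ?I UNIV - ?I T" using int[OF T] int[of UNIV] by (intro integral_diff) auto
   finally show ?case using compl UN by simp
  next
   case (union T)
   then have T: "T i \<in> sets borel" for i by (auto simp: borel_eq_atMost)
   have "set_lebesgue_integral leb01 (\<Union>i. T i) f = (\<Sum>i. set_lebesgue_integral leb01 (T i) f)"
   proof (rule lebesgue_integral_countable_add)
    show "T i \<inter> T j = {}" if "i ~= j" for i j using union(1) that by (auto simp: disjoint_family_on_def)
    show "set_integrable leb01 (\<Union> (range T)) f"
     unfolding set_integrable_def by (rule int) (use T in auto)
   qed (use T in auto)
   then show ?case using union by (simp add: set_lebesgue_integral_def)
  qed (use a0 in auto)
 qed
 have "AE x in leb01. f x = 0"
  by (rule unit.density_zero[OF fi]) (simp add: set_lebesgue_integral_def all)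
 then show ?thesis unfolding f(2) Lp_zero by (rule lp_class_cong)
qed

end

section \<open>The direct sum of two copies of a space\<close>

definition dsum_iota :: "('a => 'b => 'k) => 'a \<times> 'a => bool \<times> 'b => 'k" where
 "dsum_iota \<iota> = (%(x, y) (c, b). if c then \<iota> x b else \<iota> y b)"

lemma dsum_simps [simp]:
 "nsp_carrier (dsum E) = nsp_carrier E \<times> nsp_carrier E"
 "nsp_add (dsum E) (a, b) (c, d) = (nsp_add E a c, nsp_add E b d)"
 "nsp_smul (dsum E) k (a, b) = (nsp_smul E k a, nsp_smul E k b)"
 "nsp_zero (dsum E) = (nsp_zero E, nsp_zero E)"
 "nsp_norm (dsum E) (a, b) = nsp_norm E a + nsp_norm E b"
 by (simp_all add: dsum_def)

lemma dsum_minus [simp]: "nsp_minus (dsum E) (a, b) (c, d) = (nsp_minus E a c, nsp_minus E b d)"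
 by (simp add: nsp_minus_def)

lemma lsum_dsum: "lsum (dsum E) c f n = (lsum E c (%i. fst (f i)) n, lsum E c (%i. snd (f i)) n)"
proof (induction n)
 case (Suc n)
 then show ?case by (cases "f n") simp
qed simp

context normed_nspace
begin

lemma normed_nspace_dsum: "normed_nspace (dsum E) (dsum_iota \<iota>)"
proof
 fix x y :: "'a \<times> 'a" and c
 assume x: "x \<in> nsp_carrier (dsum E)"
 show "nsp_norm (dsum E) x = 0 ==> x = nsp_zero (dsum E)"
  using x norm_nonneg[of "fst x"] norm_nonneg[of "snd x"]
  by (cases x) (auto simp: add_nonneg_eq_0_iff)
 assume y: "y \<in> nsp_carrier (dsum E)"
 show "x = y" if eq: "!!b. dsum_iota \<iota> x b = dsum_iota \<iota> y b"
 proof -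
  have "fst x = fst y" using x y eq[of "(True, b)" for b]
   by (intro iota_inject) (auto simp: dsum_iota_def split: prod.splits)
  moreover have "snd x = snd y" using x y eq[of "(False, b)" for b]
   by (intro iota_inject) (auto simp: dsum_iota_def split: prod.splits)
  ultimately show ?thesis by (simp add: prod_eq_iff)
 qed
 show "nsp_norm (dsum E) (nsp_add (dsum E) x y) <= nsp_norm (dsum E) x + nsp_norm (dsum E) y"
  using x y norm_add[of "fst x" "fst y"] norm_add[of "snd x" "snd y"] by (cases x; cases y) auto
qed (auto simp: dsum_iota_def algebra_simps)

lemma nsp_lim_dsumI:
 assumes a: "nsp_lim E a l" "!!n. a n \<in> V" and b: "nsp_lim E b m" "!!n. b n \<in> V"
 shows "nsp_lim (dsum E) (%n. (a n, b n)) (l, m)"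
proof -
 have "(%n. N (a n \<ominus> l) + N (b n \<ominus> m)) ----> 0 + 0"
  using a b unfolding nsp_lim_def by (intro tendsto_add) auto
 then show ?thesis using a b by (simp add: nsp_lim_def)
qed

lemma dsum_complete:
 assumes "nsp_complete E" shows "nsp_complete (dsum E)"
 unfolding nsp_complete_def
proof (intro allI impI)
 fix x assume x: "ALL n. x n \<in> nsp_carrier (dsum E)" and c: "nsp_cauchy (dsum E) x"
 define a where "a n = fst (x n)" for n
 define b where "b n = snd (x n)" for n
 have ab: "a n \<in> V" "b n \<in> V" and xab: "x n = (a n, b n)" for n using x[rule_format, of n] by (auto simp: a_def b_def)
 have "nsp_cauchy E a \<and> nsp_cauchy E b"
  unfolding nsp_cauchy_def
 proof (intro conjI allI impI)
  fix e :: real assume "0 < e"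
  then obtain k where k: "ALL m>=k. ALL n>=k. N (a m \<ominus> a n) + N (b m \<ominus> b n) < e"
   using c by (auto simp: nsp_cauchy_def xab)
  have "N (a m \<ominus> a n) < e" "N (b m \<ominus> b n) < e" if "k <= m" "k <= n" for m n
   using k[rule_format, OF that] norm_nonneg[of "a m \<ominus> a n"] norm_nonneg[of "b m \<ominus> b n"] ab
   by (smt (verit) minus_closed)+
  then show "EX k. ALL m>=k. ALL n>=k. N (a m \<ominus> a n) < e" "EX k. ALL m>=k. ALL n>=k. N (b m \<ominus> b n) < e" by blast+
 qed
 then obtain l m where "nsp_lim E a l" "nsp_lim E b m"
  using nsp_completeD[OF assms, of a] nsp_completeD[OF assms, of b] ab by blast
 from nsp_lim_dsumI[OF this(1) ab(1) this(2) ab(2)] have "nsp_lim (dsum E) x (l, m)" by (simp flip: xab)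
 then show "EX l. nsp_lim (dsum E) x l" by blast
qed

lemma bounded_functional_fst: "bounded_functional E f ==> bounded_functional (dsum E) (%x. f (fst x))"
 and bounded_functional_snd: "bounded_functional E f ==> bounded_functional (dsum E) (%x. f (snd x))"
proof -
 assume f: "bounded_functional E f"
 obtain C where C: "0 < C" "!!x. x \<in> V ==> norm (f x) <= C * N x" using bfun_bound[OF f] by blast
 have le: "norm (f a) <= C * (N a + N b)" "norm (f b) <= C * (N a + N b)" if "a \<in> V" "b \<in> V" for a b
  using C(2)[OF that(1)] C(2)[OF that(2)] C(1) that by (auto simp: distrib_left intro: add_increasing add_increasing2)
 show "bounded_functional (dsum E) (%x. f (fst x))" "bounded_functional (dsum E) (%x. f (snd x))"
  using le unfolding bounded_functional_def
  by (auto simp: bfun_add[OF f] bfun_smul[OF f] intro!: exI[of _ C])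
qed

end

section \<open>Gliding humps and the failure of strict singularity\<close>

lemma strict_mono_choice:
 fixes P :: "nat => nat => bool"
 assumes "!!k. \<forall>\<^sub>F n in sequentially. P k n"
 shows "EX \<nu>. strict_mono \<nu> \<and> (ALL k. k < \<nu> k) \<and> (ALL k. P k (\<nu> k))"
proof -
 have ex: "EX n>l. k < n \<and> P k n" for k l
 proof -
  have "\<forall>\<^sub>F n in sequentially. P k n \<and> l < n \<and> k < n"
   by (intro eventually_conj assms eventually_gt_at_top)
  then show ?thesis by (auto dest!: eventually_happens)
 qed
 have "EX \<nu>. ALL k. (k < \<nu> k \<and> P k (\<nu> k)) \<and> \<nu> k < \<nu> (Suc k)"
  by (rule dependent_nat_choice) (use ex in blast)+
 then obtain \<nu> where "ALL k. (k < \<nu> k \<and> P k (\<nu> k)) \<and> \<nu> k < \<nu> (Suc k)" ..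
 then show ?thesis by (intro exI[of _ \<nu>]) (auto simp: strict_mono_Suc_iff)
qed

text \<open>Each new index is chosen against all indices up to the present one, which is possible
  because rows and columns are null. The bound eps / 4^j for the larger index j gives eps / 2^(i +
  j).\<close>

lemma matrix_extraction:
 fixes \<alpha> :: "nat => nat => 'k::real_normed_vector"
 assumes row: "!!i. (%j. \<alpha> i j) ----> 0" and col: "!!j. (%i. \<alpha> i j) ----> 0" and eps: "0 < eps"
 shows "EX \<sigma>. strict_mono \<sigma> \<and> (ALL i j. i ~= j --> norm (\<alpha> (\<sigma> i) (\<sigma> j)) <= eps / 2 ^ (i + j))"
proof -
 have ex: "EX k'. k < k' \<and> (ALL l<=k. norm (\<alpha> l k') <= eps / 4 ^ Suc n \<and> norm (\<alpha> k' l) <= eps / 4 ^ Suc n)" for n k :: nat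
 proof -
  define e where "e = eps / 4 ^ Suc n"
  have e: "0 < e" using eps by (simp add: e_def)
  have "\<forall>\<^sub>F k' in sequentially. norm (\<alpha> l k') < e \<and> norm (\<alpha> k' l) < e" for l
   using eventually_conj[OF tendstoD[OF row e] tendstoD[OF col e]] by simp
  then have "\<forall>\<^sub>F k' in sequentially. \<forall>l\<in>{..k}. norm (\<alpha> l k') < e \<and> norm (\<alpha> k' l) < e"
   by (subst eventually_ball_finite_distrib) auto
  then have "\<forall>\<^sub>F k' in sequentially. (\<forall>l\<in>{..k}. norm (\<alpha> l k') < e \<and> norm (\<alpha> k' l) < e) \<and> k < k'"
   by (intro eventually_conj eventually_gt_at_top)
  then obtain k' where "(\<forall>l\<in>{..k}. norm (\<alpha> l k') < e \<and> norm (\<alpha> k' l) < e) \<and> k < k'"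
   by (auto dest!: eventually_happens)
  then show ?thesis unfolding e_def[symmetric] by (intro exI[of _ k']) (auto intro: less_imp_le)
 qed
 define Q where "Q n k k' \<longleftrightarrow> k < k' \<and> (ALL l<=k. norm (\<alpha> l k') <= eps / 4 ^ Suc n \<and> norm (\<alpha> k' l) <= eps / 4 ^ Suc n)" for n k k' :: nat
 have "EX \<sigma> :: nat => nat. ALL n. True \<and> Q n (\<sigma> n) (\<sigma> (Suc n))"
  by (rule dependent_nat_choice) (use ex in \<open>auto simp: Q_def\<close>)
 then obtain \<sigma> where \<sigma>: "!!n. Q n (\<sigma> n) (\<sigma> (Suc n))" by blast
 have mono: "strict_mono \<sigma>" using \<sigma> by (simp add: Q_def strict_mono_Suc_iff)
 have lt: "norm (\<alpha> (\<sigma> i) (\<sigma> j)) <= eps / 2 ^ (i + j) \<and> norm (\<alpha> (\<sigma> j) (\<sigma> i)) <= eps / 2 ^ (i + j)" if "i < j" for i j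
 proof -
  obtain n where n: "j = Suc n" "i <= n" using \<open>i < j\<close> by (cases j) auto
  have "\<sigma> i <= \<sigma> n" using mono n by (simp add: strict_mono_less_eq)
  then have "norm (\<alpha> (\<sigma> i) (\<sigma> j)) <= eps / 4 ^ j" "norm (\<alpha> (\<sigma> j) (\<sigma> i)) <= eps / 4 ^ j"
   using \<sigma>[of n] unfolding Q_def n(1) by blast+
  moreover have "(2::real) ^ (i + j) <= 4 ^ j"
  proof -
   have "(2::real) ^ (i + j) <= 2 ^ (2 * j)" using \<open>i < j\<close> by (intro power_increasing) auto
   then show ?thesis by (simp add: power_mult)
  qed
  then have "eps / 4 ^ j <= eps / 2 ^ (i + j)" using eps by (intro divide_left_mono) auto
  ultimately show ?thesis by linarith
 qed
 have "norm (\<alpha> (\<sigma> i) (\<sigma> j)) <= eps / 2 ^ (i + j)" if "i ~= j" for i j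
  using lt[of i j] lt[of j i] that by (cases i j rule: linorder_cases) (auto simp: add.commute)
 with mono show ?thesis by blast
qed

text \<open>A later thinning of the indices only improves the off-diagonal bounds.\<close>

lemma strict_mono_halving:
 assumes "strict_mono \<tau>" "0 <= eps" shows "eps / 2 ^ (\<tau> i + \<tau> j) <= eps / (2::real) ^ (i + j)"
 using assms strict_mono_imp_increasing[OF assms(1)]
 by (intro divide_left_mono power_increasing add_mono) auto

lemma sum_halves: "(\<Sum>i<m. (1/2::real) ^ i) <= 2"
 by (simp add: sum_gp_strict)

text \<open>The i-th coordinate is off by at most a multiple of 2^(-i) times the l^s norm
  \<open>G\<close> that is to be bounded. The constant 1/32 is small enough for these errors to be
  absorbed into the left side after taking s-th powers.\<close>

lemma perturbed_lower_estimate: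
 fixes \<gamma> \<beta> :: "nat => real"
 assumes s: "1 <= s" and \<delta>: "0 < \<delta>" and nn: "!!i. 0 <= \<gamma> i" "!!i. 0 <= \<beta> i"
  and le: "!!i. i < m ==> \<delta> * \<gamma> i <= \<beta> i + (\<Sum>j<m. \<gamma> j * (\<delta> / 32 / 2 ^ (i + j)))"
  and B: "(\<Sum>i<m. \<beta> i powr s) <= B powr s" "0 <= B"
 shows "(\<Sum>i<m. \<gamma> i powr s) powr (1 / s) <= 4 / \<delta> * B"
proof -
 define S where "S = (\<Sum>i<m. \<gamma> i powr s)"
 define G where "G = S powr (1 / s)"
 have S0: "0 <= S" by (simp add: S_def sum_nonneg)
 have G0: "0 <= G" by (simp add: G_def)
 have GS: "G powr s = S" using S0 s by (simp add: G_def powr_powr)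
 have \<gamma>G: "\<gamma> j <= G" if "j < m" for j
 proof -
  have "\<gamma> j powr s <= S" unfolding S_def by (rule member_le_sum) (use that in auto)
  then show ?thesis unfolding G_def using nn s by (intro le_powr_inverse) auto
 qed
 have i: "\<delta> * \<gamma> i <= \<beta> i + \<delta> / 16 * G * (1/2) ^ i" if "i < m" for i
 proof -
  have "(\<Sum>j<m. \<gamma> j * (\<delta> / 32 / 2 ^ (i + j))) <= (\<Sum>j<m. G * (\<delta> / 32 / 2 ^ (i + j)))"
   using \<delta> by (intro sum_mono mult_right_mono \<gamma>G) auto
  also have "... = \<delta> / 32 * G * (1/2) ^ i * (\<Sum>j<m. (1/2) ^ j)"
   by (simp add: sum_distrib_left power_add power_divide field_simps)
  also have "... <= \<delta> / 32 * G * (1/2) ^ i * 2" using \<delta> G0 by (intro mult_left_mono sum_halves) auto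
  finally show ?thesis using le[OF that] by linarith
 qed
 have "\<delta> powr s * \<gamma> i powr s <= 2 powr s * \<beta> i powr s + (\<delta> / 8 * G) powr s * (1/2) ^ i" if "i < m" for i
 proof -
  define x where "x = \<delta> / 16 * G * (1/2) ^ i"
  have x0: "0 <= x" using \<delta> G0 by (simp add: x_def)
  have "(\<delta> * \<gamma> i) powr s <= (\<beta> i + x) powr s"
   using i[OF that] \<delta> nn s unfolding x_def by (intro powr_mono2) auto
  also have "... <= (2 * max (\<beta> i) x) powr s" using nn x0 s by (intro powr_mono2) (auto simp: add_nonneg_nonneg)
  also have "... <= (2 * \<beta> i) powr s + (2 * x) powr s" by (cases "\<beta> i <= x") (auto simp: max_def)
  also have "(2 * x) powr s = (\<delta> / 8 * G) powr s * ((1/2) ^ i) powr s"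
  proof -
   have "2 * x = (\<delta> / 8 * G) * (1/2) ^ i" by (simp add: x_def)
   moreover have "((\<delta> / 8 * G) * (1/2) ^ i) powr s = (\<delta> / 8 * G) powr s * ((1/2) ^ i) powr s"
    by (rule powr_mult)
   ultimately show ?thesis by (simp only:)
  qed
  also have "((1/2) ^ i) powr s <= ((1/2::real) ^ i) powr 1"
   using s by (intro powr_mono') (auto simp: power_le_one)
  then have "(\<delta> / 8 * G) powr s * ((1/2) ^ i) powr s <= (\<delta> / 8 * G) powr s * (1/2) ^ i"
   by (intro mult_left_mono) auto
  finally show ?thesis using \<delta> nn by (simp add: powr_mult)
 qed
 then have "(\<Sum>i<m. \<delta> powr s * \<gamma> i powr s) <= (\<Sum>i<m. 2 powr s * \<beta> i powr s + (\<delta> / 8 * G) powr s * (1/2) ^ i)"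
  by (intro sum_mono) auto
 then have "\<delta> powr s * S <= 2 powr s * (\<Sum>i<m. \<beta> i powr s) + (\<delta> / 8 * G) powr s * (\<Sum>i<m. (1/2) ^ i)"
  by (simp add: S_def sum.distrib sum_distrib_left)
 also have "... <= 2 powr s * B powr s + (\<delta> / 8 * G) powr s * 2"
  by (intro add_mono mult_left_mono B sum_halves) auto
 \<comment> \<open>The summed errors amount to at most 2 * (1/8), a quarter, of the left
   side.\<close>
 also have "(\<delta> / 8 * G) powr s = \<delta> powr s * S * (1/8) powr s"
  using \<delta> G0 by (simp add: powr_mult powr_divide GS)
 also have "(1/8) powr s <= (1/8::real) powr 1" using s by (intro powr_mono') auto
 then have "\<delta> powr s * S * (1/8) powr s <= \<delta> powr s * S * (1/8)" using S0 by (intro mult_left_mono) auto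
 finally have "\<delta> powr s * S <= 2 powr s * B powr s + \<delta> powr s * S * (1/8) * 2" by simp
 moreover have "0 <= \<delta> powr s * S" using S0 by simp
 ultimately have main: "\<delta> powr s * S * (1/2) <= 2 powr s * B powr s" by linarith
 have half: "(1/2) powr s <= (1/2::real) powr 1" using s by (intro powr_mono') auto
 have "(\<delta> / 2 * G) powr s = \<delta> powr s * S * (1/2) powr s"
  using \<delta> G0 by (simp add: powr_mult powr_divide GS)
 also have "... <= \<delta> powr s * S * (1/2)" using half S0 by (intro mult_left_mono) auto
 also have "... <= (2 * B) powr s" using main B by (simp add: powr_mult)
 finally have fin: "(\<delta> / 2 * G) powr s <= (2 * B) powr s" .
 have "\<delta> / 2 * G <= 2 * B" by (rule powr_le_cancel[OF fin]) (use \<delta> G0 B(2) s in simp_all)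
 then show ?thesis using \<delta> by (simp add: G_def S_def field_simps)
qed

context normed_nspace
begin

lemma lsum_pad:
 assumes "!!i. f i \<in> V" "m <= n"
 shows "lsum E c f m = lsum E (%i. if i < m then c i else 0) f n"
proof (rule iota_inject)
 fix b
 have "(\<Sum>i<n. (if i < m then c i else 0) * \<iota> (f i) b) = (\<Sum>i<m. c i * \<iota> (f i) b)"
  using assms(2) by (intro sum.mono_neutral_cong_right) auto
 then show "\<iota> (lsum E c f m) b = \<iota> (lsum E (%i. if i < m then c i else 0) f n) b"
  using assms(1) by simp
qed (use assms in auto)

lemma lsum_subseq:
 assumes f: "!!i. f i \<in> V" and \<kappa>: "strict_mono \<kappa>"
 shows "lsum E c (%i. f (\<kappa> i)) m =
  lsum E (%j. if j \<in> \<kappa> ` {..<m} then c (the_inv_into UNIV \<kappa> j) else 0) f (\<kappa> m)"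
proof (rule iota_inject)
 fix b
 have inj: "inj \<kappa>" using \<kappa> by (rule strict_mono_imp_inj_on)
 have "(\<Sum>j<\<kappa> m. (if j \<in> \<kappa> ` {..<m} then c (the_inv_into UNIV \<kappa> j) else 0) * \<iota> (f j) b) =
   (\<Sum>j\<in>\<kappa> ` {..<m}. c (the_inv_into UNIV \<kappa> j) * \<iota> (f j) b)"
  using \<kappa> by (intro sum.mono_neutral_cong_right) (auto simp: strict_mono_less)
 also have "... = (\<Sum>i<m. c i * \<iota> (f (\<kappa> i)) b)"
  using inj by (subst sum.reindex) (auto simp: inj_on_def the_inv_f_f)
 finally show "\<iota> (lsum E c (%i. f (\<kappa> i)) m) b =
  \<iota> (lsum E (%j. if j \<in> \<kappa> ` {..<m} then c (the_inv_into UNIV \<kappa> j) else 0) f (\<kappa> m)) b"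
  using f by simp
qed (use f in auto)

lemma upper_est_subseq:
 assumes u: "upper_est r C u" and \<kappa>: "strict_mono \<kappa>"
 shows "upper_est r C (%i. u (\<kappa> i))"
proof -
 have V: "u n \<in> V" for n using u by (simp add: upper_est_def)
 have est: "N (lsum E c u m) <= C * (\<Sum>i<m. norm (c i) powr r) powr (1 / r)" for m c
  using u by (simp add: upper_est_def)
 have "N (lsum E c (%i. u (\<kappa> i)) m) <= C * (\<Sum>i<m. norm (c i) powr r) powr (1 / r)" for m c
 proof -
  let ?c = "%j. if j \<in> \<kappa> ` {..<m} then c (the_inv_into UNIV \<kappa> j) else 0"
  have inj: "inj \<kappa>" using \<kappa> by (rule strict_mono_imp_inj_on)
  have "N (lsum E c (%i. u (\<kappa> i)) m) <= C * (\<Sum>j<\<kappa> m. norm (?c j) powr r) powr (1 / r)"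
   unfolding lsum_subseq[of u \<kappa>, OF V \<kappa>] by (rule est)
  also have "(\<Sum>j<\<kappa> m. norm (?c j) powr r) = (\<Sum>j\<in>\<kappa> ` {..<m}. norm (c (the_inv_into UNIV \<kappa> j)) powr r)"
   using \<kappa> by (intro sum.mono_neutral_cong_right) (auto simp: strict_mono_less)
  also have "... = (\<Sum>i<m. norm (c i) powr r)"
   using inj by (subst sum.reindex) (auto simp: inj_on_def the_inv_f_f)
  finally show ?thesis .
 qed
 then show ?thesis using u V by (simp add: upper_est_def)
qed

lemma coef_est_subseq:
 assumes a: "coef_est s C a" and \<kappa>: "strict_mono \<kappa>"
 shows "coef_est s C (%i. a (\<kappa> i))"
 unfolding coef_est_def
proof (intro conjI allI ballI)
 fix m x assume x: "x \<in> V"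
 have "(\<Sum>i<m. norm (a (\<kappa> i) x) powr s) = (\<Sum>j\<in>\<kappa> ` {..<m}. norm (a j x) powr s)"
  using strict_mono_imp_inj_on[OF \<kappa>] by (subst sum.reindex) (auto simp: inj_on_def)
 also have "... <= (\<Sum>j<\<kappa> m. norm (a j x) powr s)"
  using \<kappa> by (intro sum_mono2) (auto simp: strict_mono_less)
 also have "... <= (C * N x) powr s" using a x by (simp add: coef_est_def)
 finally show "(\<Sum>i<m. norm (a (\<kappa> i) x) powr s) <= (C * N x) powr s" .
qed (use a in \<open>auto simp: coef_est_def\<close>)

text \<open>The closed linear span of the \<open>z i\<close> is infinite-dimensional by
  independence, and the lower bound on finite combinations extends to it by continuity of
  \<open>U\<close>.\<close>

lemma not_SS_opsI:
 assumes U: "U \<in> Lops E" and z: "!!i. z i \<in> V"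
  and ind: "!!m c. lsum E c z m = \<zero> ==> ALL i<m. c i = 0"
  and \<delta>: "0 < \<delta>" "!!m c. \<delta> * N (lsum E c z m) <= N (U (lsum E c z m))"
 shows "U \<notin> SS_ops E"
proof
 assume SS: "U \<in> SS_ops E"
 define M where "M = {y \<in> V. ALL e>0. EX c m. N (y \<ominus> lsum E c z m) < e}"
 have MD: "EX c m. N (x \<ominus> lsum E c z m) < e" if "x \<in> M" "0 < e" for x e
  using that by (simp add: M_def)
 have MV: "x \<in> M ==> x \<in> V" for x by (simp add: M_def)
 have span: "lsum E c z m \<in> M" for c m
  using z unfolding M_def by (auto intro!: exI[of _ c] exI[of _ m])
 have lin: "lin_subspace E M"
  unfolding lin_subspace_def
 proof (intro conjI ballI allI)
  show "M \<subseteq> V" by (auto simp: M_def)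
  show "\<zero> \<in> M" using span[of undefined 0] by simp
  fix x assume x: "x \<in> M"
  show "x \<oplus> y \<in> M" if y: "y \<in> M" for y
  proof -
   have "EX c m. N ((x \<oplus> y) \<ominus> lsum E c z m) < e" if e: "0 < e" for e
   proof -
    obtain c m where c: "N (x \<ominus> lsum E c z m) < e / 2" using MD[OF x half_gt_zero[OF e]] by (elim exE)
    obtain d n where d: "N (y \<ominus> lsum E d z n) < e / 2" using MD[OF y half_gt_zero[OF e]] by (elim exE)
    let ?k = "max m n"
    have eq: "lsum E (%i. (if i < m then c i else 0) + (if i < n then d i else 0)) z ?k = lsum E c z m \<oplus> lsum E d z n"
     using lsum_pad[of z m ?k c] lsum_pad[of z n ?k d] z by (subst lsum_add) auto
    have "(x \<oplus> y) \<ominus> (lsum E c z m \<oplus> lsum E d z n) = (x \<ominus> lsum E c z m) \<oplus> (y \<ominus> lsum E d z n)"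
     using MV[OF x] MV[OF y] z by (intro iota_inject) simp_all
    moreover have "N ... <= N (x \<ominus> lsum E c z m) + N (y \<ominus> lsum E d z n)"
     using MV[OF x] MV[OF y] z by (intro norm_add) simp_all
    ultimately have "N ((x \<oplus> y) \<ominus> (lsum E c z m \<oplus> lsum E d z n)) < e" using c d by simp
    then show ?thesis unfolding eq[symmetric] by blast
   qed
   then show ?thesis using MV[OF x] MV[OF y] by (simp add: M_def)
  qed
  show "a \<odot> x \<in> M" for a
  proof -
   have "EX c m. N (a \<odot> x \<ominus> lsum E c z m) < e" if e: "0 < e" for e
   proof -
    have "0 < e / (norm a + 1)" using e by (simp add: add_nonneg_pos)
    from MD[OF x this] obtain c m where c: "N (x \<ominus> lsum E c z m) < e / (norm a + 1)" by (elim exE)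
    have V: "x \<ominus> lsum E c z m \<in> V" using x z by (auto simp: M_def)
    have "a \<odot> x \<ominus> lsum E (%i. a * c i) z m = a \<odot> (x \<ominus> lsum E c z m)"
     using MV[OF x] z by (intro iota_inject) (simp_all add: lsum_smul algebra_simps)
    then have "N (a \<odot> x \<ominus> lsum E (%i. a * c i) z m) = norm a * N (x \<ominus> lsum E c z m)" using V by simp
    also have "... <= (norm a + 1) * N (x \<ominus> lsum E c z m)" using V by (intro mult_right_mono) auto
    also have "... < e" using c by (simp add: pos_less_divide_eq add_nonneg_pos mult.commute)
    finally show ?thesis by blast
   qed
   then show ?thesis using MV[OF x] by (simp add: M_def)
  qed
 qed
 have "closed_in_nsp E M"
  unfolding closed_in_nsp_def
 proof (intro allI impI)
  fix x y assume x: "ALL n. x n \<in> M" and y: "y \<in> V" and lim: "(%n. N (x n \<ominus> y)) ----> 0"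
  have "EX c m. N (y \<ominus> lsum E c z m) < e" if e: "0 < e" for e
  proof -
   obtain n where n: "N (x n \<ominus> y) < e / 2"
    using order_tendstoD(2)[OF lim, of "e / 2"] e by (auto dest!: eventually_happens)
   obtain c m where c: "N (x n \<ominus> lsum E c z m) < e / 2" using MD[OF spec[OF x, of n] half_gt_zero[OF e]] by (elim exE)
   have V: "x n \<in> V" "lsum E c z m \<in> V" using MV[OF spec[OF x]] z by simp_all
   have "N (y \<ominus> lsum E c z m) <= N (y \<ominus> x n) + N (x n \<ominus> lsum E c z m)"
    using y V by (intro norm_minus_triangle) auto
   then have "N (y \<ominus> lsum E c z m) < e" using n c norm_minus_commute[OF y V(1)] by linarith
   then show ?thesis by blast
  qed
  then show "y \<in> M" using y by (simp add: M_def)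
 qed
 moreover have "inf_dim E M"
  unfolding inf_dim_def
 proof
  fix n
  show "EX f. (ALL i<n. f i \<in> M) \<and> (ALL c. lsum E c f n = \<zero> --> (ALL i<n. c i = 0))"
  proof (intro exI[of _ z] conjI allI impI)
   fix i
   show "z i \<in> M" using span[of "%j. if j = i then 1 else 0" "Suc i"] lsum_single[of "Suc i" z i] z by (simp del: lsum.simps)
  qed (use ind in blast)
 qed
 moreover have "\<delta> * N y <= N (U y)" if y: "y \<in> M" for y
 proof -
  obtain C where C: "0 < C" "!!x. x \<in> V ==> N (U x) <= C * N x" using Lops_bounded[OF U] by blast
  have "\<delta> * N y <= N (U y) + e" if e: "0 < e" for e
  proof -
   have "0 < e / (C + \<delta>)" using e C \<delta> by simp
   from MD[OF y this] obtain c m where c: "N (y \<ominus> lsum E c z m) < e / (C + \<delta>)" by (elim exE)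
   let ?v = "lsum E c z m"
   have V: "y \<in> V" "?v \<in> V" using MV[OF y] z by simp_all
   have "\<delta> * N y <= \<delta> * (N (y \<ominus> ?v) + N ?v)" using norm_le_minus[OF V] \<delta> by (intro mult_left_mono) auto
   also have "... <= \<delta> * N (y \<ominus> ?v) + N (U ?v)" using \<delta>(2)[of c m] by (simp add: algebra_simps)
   also have "N (U ?v) <= N (U ?v \<ominus> U y) + N (U y)" using V U by (intro norm_le_minus) (auto intro: Lops_closed)
   also have "N (U ?v \<ominus> U y) <= C * N (y \<ominus> ?v)"
    using C(2)[of "?v \<ominus> y"] V U norm_minus_commute[OF V] by (simp add: Lops_minus)
   also have "\<delta> * N (y \<ominus> ?v) + (C * N (y \<ominus> ?v) + N (U y)) = (C + \<delta>) * N (y \<ominus> ?v) + N (U y)"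
    by (simp add: algebra_simps)
   also have "(C + \<delta>) * N (y \<ominus> ?v) <= e" using c C \<delta> by (simp add: pos_less_divide_eq mult.commute less_imp_le)
   finally show ?thesis by simp
  qed
  then show ?thesis by (rule field_le_epsilon)
 qed
 ultimately show False using SS lin \<delta>(1) unfolding SS_ops_def by blast
qed

text \<open>Near-biorthogonality recovers the l^s norm of the coefficients from the image under
  \<open>U\<close>, and the upper estimate with the same exponent bounds the combination itself by
  that norm. So \<open>U\<close> is bounded below on the span.\<close>

lemma not_SS_ops_biorthogonal:
 assumes U: "U \<in> Lops E" and s: "1 <= s" and b: "coef_est s C b" and z: "upper_est s D z" and \<delta>: "0 < \<delta>"
  and diag: "!!i. \<delta> <= norm (b i (U (z i)))"
  and off: "!!i j. i ~= j ==> norm (b i (U (z j))) <= \<delta> / 32 / 2 ^ (i + j)"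
 shows "U \<notin> SS_ops E"
proof -
 have zV: "z i \<in> V" for i using z by (simp add: upper_est_def)
 have C: "0 < C" using b by (simp add: coef_est_def)
 have low: "(\<Sum>i<m. norm (c i) powr s) powr (1 / s) <= 4 / \<delta> * (C * N (U (lsum E c z m)))" for m c
 proof (rule perturbed_lower_estimate[where \<beta> = "%i. norm (b i (U (lsum E c z m)))"])
  have UV: "U (lsum E c z m) \<in> V" using U zV by (simp add: Lops_closed)
  then show "(\<Sum>i<m. norm (b i (U (lsum E c z m))) powr s) <= (C * N (U (lsum E c z m))) powr s"
   using b by (simp add: coef_est_def)
  show "0 <= C * N (U (lsum E c z m))" using UV C by simp
  fix i assume i: "i < m"
  have bi: "bounded_functional E (b i)" using b by (simp add: coef_est_def)
  have eq: "b i (U (lsum E c z m)) = (\<Sum>j<m. c j * b i (U (z j)))"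
   using U zV by (simp add: Lops_lsum Lops_closed bfun_lsum[OF bi])
  also have "... = c i * b i (U (z i)) + (\<Sum>j\<in>{..<m} - {i}. c j * b i (U (z j)))"
   using i by (subst sum.remove[of _ i]) auto
  finally have "norm (c i * b i (U (z i))) <= norm (b i (U (lsum E c z m))) + norm (\<Sum>j\<in>{..<m} - {i}. c j * b i (U (z j)))"
   by (metis add_diff_cancel_right' norm_triangle_ineq4)
  moreover have "norm (\<Sum>j\<in>{..<m} - {i}. c j * b i (U (z j))) <= (\<Sum>j\<in>{..<m} - {i}. norm (c j) * (\<delta> / 32 / 2 ^ (i + j)))"
   
  proof (rule sum_norm_le)
   fix j assume "j \<in> {..<m} - {i}"
   then show "norm (c j * b i (U (z j))) <= norm (c j) * (\<delta> / 32 / 2 ^ (i + j))"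
    unfolding norm_mult by (intro mult_left_mono off) auto
  qed
  moreover have "... <= (\<Sum>j<m. norm (c j) * (\<delta> / 32 / 2 ^ (i + j)))" using \<delta> by (intro sum_mono2) auto
  moreover have "\<delta> * norm (c i) <= norm (c i * b i (U (z i)))"
   using mult_right_mono[OF diag[of i], of "norm (c i)"] by (simp add: norm_mult mult.commute)
  ultimately show "\<delta> * norm (c i) <= norm (b i (U (lsum E c z m))) + (\<Sum>j<m. norm (c j) * (\<delta> / 32 / 2 ^ (i + j)))"
   by linarith
 qed (use s \<delta> in auto)
 have G0: "c i = 0" if "(\<Sum>i<m. norm (c i) powr s) powr (1 / s) <= 0" "i < m" for c :: "nat => 'k" and i m
 proof -
  have "(\<Sum>i<m. norm (c i) powr s) = 0" using that(1) by (simp add: powr_eq_0_iff order_antisym_conv)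
  then have "norm (c i) powr s = 0" using that(2) by (subst (asm) sum_nonneg_eq_0_iff) auto
  then show ?thesis by simp
 qed
 have D: "0 <= D" using z by (simp add: upper_est_def)
 show ?thesis
 proof (rule not_SS_opsI[OF U zV])
  fix m c assume "lsum E c z m = \<zero>"
  then have "(\<Sum>i<m. norm (c i) powr s) powr (1 / s) <= 0" using low[where m = m and c = c] U by (simp add: Lops_zero)
  then show "ALL i<m. c i = 0" using G0 by blast
 next
  \<comment> \<open>The bound uses \<open>D + 1\<close> in place of \<open>D\<close>, which may be
    0.\<close>
  show "0 < \<delta> / (4 * C * (D + 1))" using \<delta> C D by simp
  fix m and c :: "nat => 'k"
  let ?G = "(\<Sum>i<m. norm (c i) powr s) powr (1 / s)"
  have UV: "U (lsum E c z m) \<in> V" using U zV by (simp add: Lops_closed)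
  have "N (lsum E c z m) <= D * ?G" using z by (simp add: upper_est_def)
  also have "... <= (D + 1) * ?G" by (intro mult_right_mono) auto
  also have "... <= (D + 1) * (4 / \<delta> * (C * N (U (lsum E c z m))))" using D by (intro mult_left_mono low) auto
  finally have "N (lsum E c z m) <= 4 * C * (D + 1) * N (U (lsum E c z m)) / \<delta>" by (simp add: algebra_simps)
  then have "\<delta> / (4 * C * (D + 1)) * N (lsum E c z m) <= \<delta> / (4 * C * (D + 1)) * (4 * C * (D + 1) * N (U (lsum E c z m)) / \<delta>)"
   using \<delta> C D by (intro mult_left_mono) auto
  then show "\<delta> / (4 * C * (D + 1)) * N (lsum E c z m) <= N (U (lsum E c z m))" using \<delta> C D by simp
 qed
qed

text \<open>Otherwise m vectors, aligned by unimodular factors, give \<open>f\<close> a value of at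
  least m \<eta>, while the upper estimate allows only a multiple of m^(1/r); for r > 1 and large m
  this is impossible.\<close>

lemma upper_est_weakly_null:
 assumes u: "upper_est r C u" and r: "1 < r" and f: "bounded_functional E f"
 shows "(%n. f (u n)) ----> 0"
proof (rule ccontr)
 assume "\<not> ?thesis"
 then obtain \<eta> where \<eta>: "0 < \<eta>" "!!m. EX n>=m. \<eta> <= norm (f (u n))"
  by (auto simp: lim_sequentially dist_norm not_less)
 then have "infinite {n. \<eta> <= norm (f (u n))}" by (auto simp: infinite_nat_iff_unbounded_le)
 from infinite_enumerate[OF this] obtain \<kappa> :: "nat => nat" where \<kappa>0: "strict_mono \<kappa>" "ALL n. \<kappa> n \<in> {n. \<eta> <= norm (f (u n))}" by (elim exE conjE)
 then have \<kappa>: "strict_mono \<kappa>" "!!n. \<eta> <= norm (f (u (\<kappa> n)))" by auto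
 define v where "v i = u (\<kappa> i)" for i
 have v: "upper_est r C v" unfolding v_def by (rule upper_est_subseq[OF u \<kappa>(1)])
 have vV: "v i \<in> V" for i using v by (simp add: upper_est_def)
 obtain B where B: "0 < B" "!!x. x \<in> V ==> norm (f x) <= B * N x" using bfun_bound[OF f] by blast
 define c where "c i = of_real (norm (f (v i))) / f (v i)" for i
 have nz: "f (v i) ~= 0" for i using \<kappa>(2)[of i] \<eta>(1) by (auto simp: v_def)
 have nc: "norm (c i) = 1" for i using nz by (simp add: c_def norm_divide)
 have "real m * \<eta> <= B * C * real m powr (1 / r)" for m
 proof -
  have "real m * \<eta> <= (\<Sum>i<m. norm (f (v i)))"
   using sum_mono[of "{..<m}" "%_. \<eta>" "%i. norm (f (v i))"] \<kappa>(2) by (simp add: v_def)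
  also have "... = norm (f (lsum E c v m))"
   using nz vV by (simp add: bfun_lsum[OF f] c_def sum_nonneg flip: of_real_sum)
  also have "... <= B * N (lsum E c v m)" using vV by (intro B) auto
  also have "... <= B * (C * (\<Sum>i<m. norm (c i) powr r) powr (1 / r))"
   using v B(1) unfolding upper_est_def by (intro mult_left_mono) auto
  finally show ?thesis by (simp add: nc)
 qed
 then have le: "real m powr (1 - 1 / r) <= B * C / \<eta>" if "0 < m" for m
  using that \<eta>(1) by (simp add: powr_diff field_simps)
 define K where "K = max 1 (B * C / \<eta> + 1)"
 define e where "e = 1 - 1 / r"
 have e: "0 < e" using r by (simp add: e_def)
 obtain m where m: "K powr (1 / e) < real m" using reals_Archimedean2 by blast
 then have "(K powr (1 / e)) powr e < real m powr e" using e by (intro powr_less_mono2) auto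
 moreover have "(K powr (1 / e)) powr e = K" using e by (simp add: powr_powr) (simp add: K_def)
 moreover have "0 < m" using m by (metis gr0I of_nat_0 not_less powr_ge_zero)
 ultimately have "B * C / \<eta> < real m powr (1 - 1 / r)" "0 < m" by (auto simp: K_def e_def)
 with le[of m] show False by simp
qed

text \<open>Test against $\sum_i |h_i(x)|^r / h_i(x) \cdot h_i$.\<close>
lemma coef_est_of_dual_upper:
 assumes h: "!!i. bounded_functional E (h i)" and r: "1 < r" "1 / t + 1 / r = 1" and C: "0 < C"
  and up: "!!m b x. x \<in> V ==> norm (\<Sum>i<m. b i * h i x) <= C * (\<Sum>i<m. norm (b i) powr t) powr (1 / t) * N x"
 shows "coef_est r C h"
 unfolding coef_est_def
proof (intro conjI allI ballI)
 fix m x assume x: "x \<in> V"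
 define S where "S = (\<Sum>i<m. norm (h i x) powr r)"
 have S0: "0 <= S" by (simp add: S_def sum_nonneg)
 \<comment> \<open>Division by zero gives 0 where \<open>h i x\<close> vanishes. In all cases the
   t-th power of the modulus is the r-th power of \<open>norm (h i x)\<close>, because t (r - 1) =
   r.\<close>
 define b where "b i = of_real (norm (h i x) powr r) / h i x" for i
 have t: "1 / t = 1 - 1 / r" using r(2) by simp
 have t0: "0 < 1 / t" using r(1) by (simp add: t)
 have tr: "t * (r - 1) = r"
 proof -
  have "t > 0" using t0 by simp
  then show ?thesis using t r(1) by (simp add: field_simps)
 qed
 have nb: "norm (b i) powr t = norm (h i x) powr r" for i
 proof (cases "h i x = 0")
  case False
  then have "norm (b i) = norm (h i x) powr (r - 1)" by (simp add: b_def norm_divide powr_diff)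
  then show ?thesis using tr by (simp add: powr_powr mult.commute)
 qed (simp add: b_def)
 have "(\<Sum>i<m. b i * h i x) = of_real S"
  unfolding S_def of_real_sum by (rule sum.cong) (auto simp: b_def)
 then have le: "S <= C * S powr (1 / t) * N x" using up[OF x, of b m] S0 by (simp add: nb flip: S_def)
 show "S <= (C * N x) powr r"
 proof (cases "S = 0")
  case False
  then have pos: "0 < S" using S0 by simp
  have "S = S powr (1 / t) * S powr (1 / r)" using pos r(2) by (simp add: powr_add[symmetric])
  then have "S powr (1 / t) * S powr (1 / r) <= S powr (1 / t) * (C * N x)" using le by (simp add: mult_ac)
  then have "S powr (1 / r) <= C * N x" using pos by simp
  then have "(S powr (1 / r)) powr r <= (C * N x) powr r" using r by (intro powr_mono2) auto
  then show ?thesis using pos r by (simp add: powr_powr)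
 qed simp
qed (use h C in auto)

end

context normed_nspace
begin

lemma bounded_functional_comp:
 assumes f: "bounded_functional E f" and U: "U \<in> Lops E"
 shows "bounded_functional E (%x. f (U x))"
proof -
 obtain C where C: "0 < C" "!!x. x \<in> V ==> norm (f x) <= C * N x" using bfun_bound[OF f] by blast
 obtain D where D: "0 < D" "!!x. x \<in> V ==> N (U x) <= D * N x" using Lops_bounded[OF U] by blast
 have "norm (f (U x)) <= (C * D) * N x" if x: "x \<in> V" for x
 proof -
  have "norm (f (U x)) <= C * N (U x)" using x U by (intro C) (auto simp: Lops_closed)
  also have "... <= C * (D * N x)" using C x by (intro mult_left_mono D) auto
  finally show ?thesis by simp
 qed
 then show ?thesis
  using U unfolding bounded_functional_def
  by (auto simp: Lops_add Lops_smul Lops_closed bfun_add[OF f] bfun_smul[OF f])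
qed

lemma upper_est_norm:
 assumes u: "upper_est r C u" shows "N (u n) <= C"
proof -
 have V: "u n \<in> V" for n using u by (simp add: upper_est_def)
 let ?c = "%i. if i = n then 1 else (0::'k)"
 have "N (lsum E ?c u (Suc n)) <= C * (\<Sum>i<Suc n. norm (?c i) powr r) powr (1 / r)"
  using u unfolding upper_est_def by (elim conjE allE)
 moreover have "(\<Sum>i<Suc n. norm (?c i) powr r) = (\<Sum>i<Suc n. if i = n then 1 else 0)"
  by (rule sum.cong) auto
 moreover have "lsum E ?c u (Suc n) = u n" using V by (intro lsum_single) auto
 ultimately show ?thesis by simp
qed

end

lemma convergent_diff_null:
 fixes f :: "nat => 'k::real_normed_vector"
 assumes "convergent f" "strict_mono \<nu>" shows "(%n. f (\<nu> n) - f n) ----> 0"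
proof -
 obtain L where L: "f ----> L" using assms(1) by (auto simp: convergent_def)
 from LIMSEQ_subseq_LIMSEQ[OF L assms(2)] have "(%n. f (\<nu> n)) ----> L" by (simp add: o_def)
 from tendsto_diff[OF this L] show ?thesis by simp
qed

lemma tendsto_strict_mono: "f ----> L ==> strict_mono \<nu> ==> (%n. f (\<nu> n)) ----> L"
 using LIMSEQ_subseq_LIMSEQ by (fastforce simp: o_def)

lemma convergent_strict_mono: "convergent f ==> strict_mono \<nu> ==> convergent (%n. f (\<nu> n))"
 using convergent_subseq_convergent by (fastforce simp: o_def)

lemma Lp_difference_upper_est:
 fixes A :: "nat => (real => 'k::{real_normed_field, banach, second_countable_topology}) set"
 assumes p: "1 <= p" and t: "t = min p 2"
  and A: "!!n. A n \<in> nsp_carrier (Lp_space p)" and B: "!!n. nsp_norm (Lp_space p) (A n) <= B"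
 shows "EX \<rho> :: nat => nat. strict_mono \<rho> \<and> (ALL (\<nu> :: nat => nat) (\<tau> :: nat => nat). (ALL k. k < \<nu> k) --> strict_mono \<tau> -->
  (EX (\<sigma> :: nat => nat) C. strict_mono \<sigma> \<and> normed_nspace.upper_est (Lp_space p) t C
   (%i. nsp_minus (Lp_space p) (A (\<rho> (\<nu> (\<tau> (\<sigma> i))))) (A (\<rho> (\<tau> (\<sigma> i)))))))"
proof -
 interpret X: normed_nspace "Lp_space p :: ((real => 'k) set, 'k) nspace" Lp_iota by (rule normed_nspace_Lp[OF p])
 define x where "x n = lp_rep (A n)" for n
 have x: "x n \<in> Lpf p leb01" "A n = lp_class (x n)" for n
  using Lp_carrierD[OF p A] by (auto simp: x_def)
 have "Lpn p leb01 (x n) <= B" for n using B[of n] Lp_norm[OF p x(1)] x(2) by metis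
 from unit.Lpf_difference_upper_estimate[of p t x, OF p t x(1) this]
 obtain \<rho> :: "nat => nat" where \<rho>: "strict_mono \<rho>" and est: "ALL (\<nu> :: nat => nat) (\<tau> :: nat => nat). (ALL k. k < \<nu> k) --> strict_mono \<tau> -->
  (EX (\<sigma> :: nat => nat) C. strict_mono \<sigma> \<and> 0 <= C \<and> (ALL m c.
   Lpn p leb01 (%y. \<Sum>i<m. c i * (x (\<rho> (\<nu> (\<tau> (\<sigma> i)))) y - x (\<rho> (\<tau> (\<sigma> i))) y)) <= C * (\<Sum>i<m. norm (c i) powr t) powr (1 / t)))"
  by (elim exE conjE)
 show ?thesis
 proof (rule exI[of _ \<rho>], rule conjI[OF \<rho>], intro allI impI)
  fix \<nu> \<tau> :: "nat => nat" assume "ALL k. k < \<nu> k" "strict_mono \<tau>"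
  with est obtain \<sigma> :: "nat => nat" and C where \<sigma>: "strict_mono \<sigma>" "0 <= C" and le: "ALL m c.
   Lpn p leb01 (%y. \<Sum>i<m. c i * (x (\<rho> (\<nu> (\<tau> (\<sigma> i)))) y - x (\<rho> (\<tau> (\<sigma> i))) y)) <= C * (\<Sum>i<m. norm (c i) powr t) powr (1 / t)"
   by meson
  let ?d = "%i y. x (\<rho> (\<nu> (\<tau> (\<sigma> i)))) y - x (\<rho> (\<tau> (\<sigma> i))) y"
  have d: "?d i \<in> Lpf p leb01" for i by (intro Lpf_diff x p)
  have eq: "(%i. nsp_minus (Lp_space p) (A (\<rho> (\<nu> (\<tau> (\<sigma> i))))) (A (\<rho> (\<tau> (\<sigma> i))))) = (%i. lp_class (?d i))"
   unfolding x(2) by (rule ext) (rule Lp_minus[OF p x(1) x(1)])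
  have "X.upper_est t C (%i. lp_class (?d i))"
   unfolding X.upper_est_def
  proof (intro conjI allI)
   show "lp_class (?d n) \<in> nsp_carrier (Lp_space p)" for n by (rule Lp_carrierI[OF p d])
   fix m and c :: "nat => 'k"
   have "X.N (lsum (Lp_space p) c (%i. lp_class (?d i)) m) = Lpn p leb01 (%y. \<Sum>i<m. c i * ?d i y)"
    unfolding Lp_lsum[OF p d] by (rule Lp_norm[OF p]) (intro Lpf_sum Lpf_cmult d p; use p in simp)
   also have "... <= C * (\<Sum>i<m. norm (c i) powr t) powr (1 / t)" using le by (elim allE)
   finally show "X.N (lsum (Lp_space p) c (%i. lp_class (?d i)) m) <= C * (\<Sum>i<m. norm (c i) powr t) powr (1 / t)" .
  qed (rule \<sigma>(2))
  then show "EX (\<sigma> :: nat => nat) C. strict_mono \<sigma> \<and> X.upper_est t C (%i. nsp_minus (Lp_space p) (A (\<rho> (\<nu> (\<tau> (\<sigma> i))))) (A (\<rho> (\<tau> (\<sigma> i)))))"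
   using \<sigma>(1) unfolding eq[symmetric] by blast
 qed
qed

text \<open>Otherwise infinitely many of the functionals stay above \<eta> at images of vectors in
  the unit ball. Differences along a subsequence make the matrix of values null in rows and columns
  and obey an upper s-estimate, which matches the lower s-estimate of the functionals; this
  contradicts strict singularity.\<close>

lemma SS_ops_coefficients_vanish:
 fixes U :: "(real => 'k::{real_normed_field, banach, second_countable_topology}) set => (real => 'k) set"
 assumes p: "1 <= p" and s: "s = min p 2" and a: "normed_nspace.coef_est (Lp_space p) s C a"
  and U: "U \<in> SS_ops (Lp_space p)" and \<eta>: "0 < \<eta>"
 shows "EX m. ALL i>=m. \<forall>x\<in>nsp_carrier (Lp_space p). norm (a i (U x)) <= \<eta> * nsp_norm (Lp_space p) x"
proof (rule ccontr)
 interpret X: normed_nspace "Lp_space p :: ((real => 'k) set, 'k) nspace" Lp_iota by (rule normed_nspace_Lp[OF p])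
 assume neg: "\<not> ?thesis"
 have s1: "1 <= s" using p s by simp
 have UL: "U \<in> Lops (Lp_space p)" using U by (rule X.SS_ops_Lops)
 have abf: "bounded_functional (Lp_space p) (a n)" for n using a by (rule X.coef_est_bfun)
 have ex: "\<exists>x\<in>X.V. X.N x <= 1 \<and> \<eta> <= norm (a i (U x))" if x: "x \<in> X.V" "\<eta> * X.N x < norm (a i (U x))" for x i
 proof -
  have pos: "0 < X.N x"
  proof (rule ccontr)
   assume "\<not> ?thesis"
   then have "x = nsp_zero (Lp_space p)" using X.norm_nonneg[OF x(1)] X.norm_eq_0_iff[OF x(1)] by linarith
   then show False using x(2) by (simp add: X.Lops_zero[OF UL] X.bfun_zero[OF abf])
  qed
  have "norm (a i (U (nsp_smul (Lp_space p) (of_real (1 / X.N x)) x))) = norm (a i (U x)) / X.N x"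
   using x(1) pos by (simp add: X.Lops_smul[OF UL] X.bfun_smul[OF abf] X.Lops_closed[OF UL] norm_mult norm_divide)
  also have "... >= \<eta>" using x(2) pos by (simp add: pos_le_divide_eq)
  finally have "\<eta> <= norm (a i (U (nsp_smul (Lp_space p) (of_real (1 / X.N x)) x)))" .
  moreover have "X.N (nsp_smul (Lp_space p) (of_real (1 / X.N x)) x) <= 1" using x(1) pos by (simp add: norm_divide)
  ultimately show ?thesis using x(1) by (intro bexI[of _ "nsp_smul (Lp_space p) (of_real (1 / X.N x)) x"]) auto
 qed
 define S where "S = {i. \<exists>x\<in>X.V. X.N x <= 1 \<and> \<eta> <= norm (a i (U x))}"
 have "EX i>=m. i \<in> S" for m
 proof -
  from neg obtain i x where "m <= i" "x \<in> X.V" "\<eta> * X.N x < norm (a i (U x))" by (meson not_le)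
  with ex[of x i] show ?thesis unfolding S_def by blast
 qed
 then have "infinite S" by (auto simp: infinite_nat_iff_unbounded_le)
 from infinite_enumerate[OF this] obtain \<iota> :: "nat => nat" where \<iota>: "strict_mono \<iota>" "ALL n. \<iota> n \<in> S" by (elim exE conjE)
 then have "ALL n. EX x. x \<in> X.V \<and> X.N x <= 1 \<and> \<eta> <= norm (a (\<iota> n) (U x))" unfolding S_def by blast
 from choice[OF this] obtain x where x: "ALL n. x n \<in> X.V \<and> X.N (x n) <= 1 \<and> \<eta> <= norm (a (\<iota> n) (U (x n)))" by (elim exE)
 have bd: "bounded (range (%n. a m (U (x n))))" for m
 proof -
  obtain D where D: "0 < D" "!!x. x \<in> X.V ==> norm (a m (U x)) <= D * X.N x"
   using X.bfun_bound[OF X.bounded_functional_comp[OF abf UL]] by blast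
  have "norm (a m (U (x n))) <= D" for n
  proof -
   have "norm (a m (U (x n))) <= D * X.N (x n)" using x by (intro D) simp
   also have "... <= D * 1" using x D(1) by (intro mult_left_mono) simp_all
   finally show ?thesis by simp
  qed
  then show ?thesis by (auto intro: boundedI)
 qed
 have "EX \<rho>. strict_mono \<rho> \<and> (ALL m. convergent (%n. a m (U (x (\<rho> n)))))"
  by (rule diagonal_scalar_subseq[of "%m n. a m (U (x n))", OF bd]) blast
 then obtain \<rho>0 where \<rho>0: "strict_mono \<rho>0" and conv0: "ALL m. convergent (%n. a m (U (x (\<rho>0 n))))" by (elim exE conjE)
 have xV: "x n \<in> X.V" and x1: "X.N (x n) <= 1" for n using x by auto
 from Lp_difference_upper_est[OF p s, of "%n. x (\<rho>0 n)", OF xV x1]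
 obtain \<rho> :: "nat => nat" where \<rho>: "strict_mono \<rho>" and est: "ALL (\<nu> :: nat => nat) (\<tau> :: nat => nat). (ALL k. k < \<nu> k) --> strict_mono \<tau> -->
  (EX (\<sigma> :: nat => nat) C. strict_mono \<sigma> \<and> X.upper_est s C
   (%i. nsp_minus (Lp_space p) (x (\<rho>0 (\<rho> (\<nu> (\<tau> (\<sigma> i)))))) (x (\<rho>0 (\<rho> (\<tau> (\<sigma> i)))))))"
  by (elim exE conjE)
 define y where "y n = x (\<rho>0 (\<rho> n))" for n
 define l where "l n = \<iota> (\<rho>0 (\<rho> n))" for n
 have l: "strict_mono l" using \<iota>(1) \<rho>0 \<rho> by (simp add: l_def strict_mono_def)
 have yV: "y n \<in> X.V" for n by (simp add: y_def xV)
 have UyV: "U (y n) \<in> X.V" for n using yV by (rule X.Lops_closed[OF UL])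
 have big: "\<eta> <= norm (a (l n) (U (y n)))" for n using x by (simp add: y_def l_def)
 have conv: "convergent (%n. a m (U (y n)))" for m
  unfolding y_def using convergent_strict_mono[OF spec[OF conv0, of m] \<rho>] .
 have col0: "(%n. a (l n) v) ----> 0" if "v \<in> X.V" for v
  using tendsto_strict_mono[OF X.coef_est_tendsto[OF a _ that] l] s1 by simp
 \<comment> \<open>The partner \<open>\<nu> k\<close> is taken so late that its functional hardly
   sees \<open>U (y k)\<close>; the diagonal entry of the difference keeps half of \<eta>.\<close>
 have "\<forall>\<^sub>F n in sequentially. norm (a (l n) (U (y k))) <= \<eta> / 2" for k
  using tendstoD[OF col0[OF UyV[of k]], of "\<eta> / 2"] \<eta> by (auto elim: eventually_mono)
 from strict_mono_choice[of "%k n. norm (a (l n) (U (y k))) <= \<eta> / 2", OF this] obtain \<nu> where \<nu>: "strict_mono \<nu>" "ALL k. k < \<nu> k" "ALL k. norm (a (l (\<nu> k)) (U (y k))) <= \<eta> / 2"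
  by (elim exE conjE)
 define z where "z j = nsp_minus (Lp_space p) (y (\<nu> j)) (y j)" for j
 have zV: "z j \<in> X.V" for j using yV by (simp add: z_def)
 have Uz: "a m (U (z j)) = a m (U (y (\<nu> j))) - a m (U (y j))" for m j
  by (simp add: z_def X.Lops_minus[OF UL yV yV] X.bfun_minus[OF abf UyV UyV])
 have diag: "\<eta> / 2 <= norm (a (l (\<nu> i)) (U (z i)))" for i
 proof -
  have "norm (a (l (\<nu> i)) (U (y (\<nu> i)))) - norm (a (l (\<nu> i)) (U (y i))) <= norm (a (l (\<nu> i)) (U (z i)))"
   unfolding Uz by (rule norm_triangle_ineq2)
  then show ?thesis using big[of "\<nu> i"] spec[OF \<nu>(3), of i] by linarith
 qed
 \<comment> \<open>This is the purpose of the differences: along \<open>y\<close> itself the rows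
   converge, but not necessarily to 0.\<close>
 have row: "(%j. a (l (\<nu> i)) (U (z j))) ----> 0" for i
  unfolding Uz by (rule convergent_diff_null[OF conv \<nu>(1)])
 have col: "(%i. a (l (\<nu> i)) (U (z j))) ----> 0" for j
  by (rule tendsto_strict_mono[OF col0[OF X.Lops_closed[OF UL zV]] \<nu>(1)])
 have "0 < \<eta> / 2 / 32" using \<eta> by simp
 from matrix_extraction[of "%i j. a (l (\<nu> i)) (U (z j))", OF row col this]
 obtain \<sigma>0 where \<sigma>0: "strict_mono \<sigma>0"
  and off: "ALL i j. i ~= j --> norm (a (l (\<nu> (\<sigma>0 i))) (U (z (\<sigma>0 j)))) <= \<eta> / 2 / 32 / 2 ^ (i + j)" by (elim exE conjE)
 from est[rule_format, OF spec[OF \<nu>(2)] \<sigma>0] obtain \<sigma> :: "nat => nat" and D where \<sigma>: "strict_mono \<sigma>"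
  and D: "X.upper_est s D (%i. nsp_minus (Lp_space p) (x (\<rho>0 (\<rho> (\<nu> (\<sigma>0 (\<sigma> i)))))) (x (\<rho>0 (\<rho> (\<sigma>0 (\<sigma> i))))))"
  by (elim exE conjE)
 have "U \<notin> SS_ops (Lp_space p)"
 proof (rule X.not_SS_ops_biorthogonal[OF UL s1])
  show "X.coef_est s C (%i. a (l (\<nu> (\<sigma>0 (\<sigma> i)))))"
   by (rule X.coef_est_subseq[OF a, of "%i. l (\<nu> (\<sigma>0 (\<sigma> i)))"]) (use l \<nu>(1) \<sigma>0 \<sigma> in \<open>simp add: strict_mono_def\<close>)
  show "X.upper_est s D (%i. z (\<sigma>0 (\<sigma> i)))" using D by (simp add: z_def y_def)
  show "0 < \<eta> / 2" using \<eta> by simp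
  show "\<eta> / 2 <= norm (a (l (\<nu> (\<sigma>0 (\<sigma> i)))) (U (z (\<sigma>0 (\<sigma> i)))))" for i by (rule diag)
  fix i j :: nat assume "i ~= j"
  then have "\<sigma> i ~= \<sigma> j" using strict_mono_eq[OF \<sigma>] by simp
  from off[rule_format, OF this] show "norm (a (l (\<nu> (\<sigma>0 (\<sigma> i)))) (U (z (\<sigma>0 (\<sigma> j))))) <= \<eta> / 2 / 32 / 2 ^ (i + j)"
   using strict_mono_halving[OF \<sigma>, of "\<eta> / 2 / 32" i j] \<eta> by linarith
 qed
 then show False using U by blast
qed

lemma bounded_functional_Lp_conjugate:
 fixes g :: "real => 'k::{real_normed_field, banach, second_countable_topology}"
 assumes p: "1 < p" "1 < q" "1 / p + 1 / q = 1" and g: "g \<in> Lpf q leb01"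
 shows "bounded_functional (Lp_space p) (Lp_pair g)"
proof (rule bounded_functional_Lp_pair)
 show "g \<in> borel_measurable lborel" using Lpf_measurable[OF g] by simp
 fix f :: "real => 'k" assume "f \<in> Lpf p leb01"
 from holder[OF this g p] show "integrable leb01 (%x. f x * g x) \<and>
   norm (LINT x|leb01. f x * g x) <= Lpn q leb01 g * Lpn p leb01 f"
  by (simp add: mult.commute)
qed (use p in simp)

text \<open>The dual of \<open>SS_ops_coefficients_vanish\<close>. The images \<open>U (u n)\<close>
  are normed by functions in L^q, differences of these obey an upper estimate with exponent
  \<open>min q 2\<close>, conjugate to r, and so they act as functionals with a lower r-estimate,
  matching the upper r-estimate of the vectors.\<close>

lemma SS_ops_vectors_vanish:
 fixes U :: "(real => 'k::{real_normed_field, banach, second_countable_topology}) set => (real => 'k) set"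
 assumes p: "1 < p" and r: "r = max p 2" and u: "normed_nspace.upper_est (Lp_space p) r Cu u"
  and U: "U \<in> SS_ops (Lp_space p)"
 shows "(%n. nsp_norm (Lp_space p) (U (u n))) ----> 0"
proof (rule ccontr)
 have p1: "1 <= p" using p by simp
 interpret X: normed_nspace "Lp_space p :: ((real => 'k) set, 'k) nspace" Lp_iota by (rule normed_nspace_Lp[OF p1])
 assume neg: "\<not> ?thesis"
 define q where "q = p / (p - 1)"
 have q: "1 < q" "1 / p + 1 / q = 1" using p by (simp_all add: q_def field_simps)
 have pq: "(p - 1) * q = p" using p by (simp add: q_def)
 define t where "t = min q 2"
 have r1: "1 < r" using p r by simp
 have tr: "1 / t + 1 / r = 1"
 proof (cases "p <= 2")
  case True
  then have "2 <= q" using p by (simp add: q_def field_simps)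
  with True show ?thesis by (simp add: t_def r)
 next
  case False
  then have "q < 2" using p by (simp add: q_def field_simps)
  with False q show ?thesis by (simp add: t_def r)
 qed
 have UL: "U \<in> Lops (Lp_space p)" using U by (rule X.SS_ops_Lops)
 have uV: "u n \<in> X.V" for n using u by (simp add: X.upper_est_def)
 have UuV: "U (u n) \<in> X.V" for n using uV by (rule X.Lops_closed[OF UL])
 from neg obtain \<delta> where \<delta>: "0 < \<delta>" "!!m. EX n>=m. \<delta> <= X.N (U (u n))"
  using UuV by (auto simp: lim_sequentially dist_norm not_less)
 then have "infinite {n. \<delta> <= X.N (U (u n))}" by (auto simp: infinite_nat_iff_unbounded_le)
 from infinite_enumerate[OF this] obtain \<kappa> :: "nat => nat" where \<kappa>: "strict_mono \<kappa>" "ALL n. \<kappa> n \<in> {n. \<delta> <= X.N (U (u n))}"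
  by (elim exE conjE)
 define y where "y n = lp_rep (U (u (\<kappa> n)))" for n
 have y: "y n \<in> Lpf p leb01" "U (u (\<kappa> n)) = lp_class (y n)" for n
  using Lp_carrierD[OF p1 UuV] by (auto simp: y_def)
 have yN: "X.N (U (u (\<kappa> n))) = Lpn p leb01 (y n)" for n unfolding y(2) by (rule Lp_norm[OF p1 y(1)])
 have [measurable]: "y n \<in> borel_measurable leb01" for n using y(1) by (rule Lpf_measurable)
 obtain D where D: "0 < D" "!!x. x \<in> X.V ==> X.N (U x) <= D * X.N x" using X.Lops_bounded[OF UL] by blast
 define B where "B = D * Cu"
 have yB: "Lpn p leb01 (y n) <= B" for n
  using D(2)[OF uV[of "\<kappa> n"]] mult_left_mono[OF X.upper_est_norm[OF u, of "\<kappa> n"], of D] D(1)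
  unfolding yN B_def by linarith
 have yd: "\<delta> <= Lpn p leb01 (y n)" for n using \<kappa>(2) unfolding yN[symmetric] by simp
 have B0: "0 <= B" using yB[of 0] yd[of 0] \<delta>(1) by linarith
 \<comment> \<open>The norming function of \<open>y n\<close>, not normalised: its product with
   \<open>y n\<close> and the q-th power of its modulus are both the p-th power of the modulus of
   \<open>y n\<close>.\<close>
 define g where "g n x = of_real (norm (y n x) powr p) / y n x" for n x
 have [measurable]: "g n \<in> borel_measurable leb01" for n
  unfolding g_def[abs_def] by measurable
 have gq: "norm (g n x) powr q = norm (y n x) powr p" for n x
 proof (cases "y n x = 0")
  case False
  then have "norm (g n x) = norm (y n x) powr (p - 1)" by (simp add: g_def norm_divide powr_diff)
  then show ?thesis using pq by (simp add: powr_powr)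
 qed (simp add: g_def)
 have g: "g n \<in> Lpf q leb01" for n
  using Lpf_integrable[OF y(1)[of n]] by (intro LpfI) (simp_all add: gq)
 have gB: "Lpn q leb01 (g n) <= (B powr p) powr (1 / q)" for n
 proof -
  have "(LINT x|leb01. norm (y n x) powr p) = Lpn p leb01 (y n) powr p" using p by (simp add: Lpn_powr)
  also have "... <= B powr p" using yB p by (intro powr_mono2) auto
  finally show ?thesis unfolding Lpn_def gq using q by (intro powr_mono2) auto
 qed
 define \<eta> where "\<eta> = \<delta> powr p"
 have \<eta>: "0 < \<eta>" using \<delta> by (simp add: \<eta>_def)
 have gy: "\<eta> <= norm (Lp_pair (g n) (U (u (\<kappa> n))))" for n
 proof -
  have "Lp_pair (g n) (U (u (\<kappa> n))) = (LINT x|leb01. y n x * g n x)"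
   by (simp add: Lp_pair_def y_def)
  also have "... = (LINT x|leb01. of_real (norm (y n x) powr p))"
   by (intro integral_cong) (auto simp: g_def)
  also have "... = of_real (Lpn p leb01 (y n) powr p)"
   using p integral_bounded_linear[OF bounded_linear_of_real Lpf_integrable[OF y(1)], of n]
   by (simp add: Lpn_powr)
  finally show ?thesis using yd[of n] \<delta>(1) p unfolding \<eta>_def by (simp add: powr_mono2)
 qed
 have gbf: "bounded_functional (Lp_space p) (Lp_pair (g n))" for n
  by (rule bounded_functional_Lp_conjugate[OF p q g])
 have pair_bd: "bounded (range (%n. Lp_pair (g n) (U (u (\<kappa> m)))))" for m
 proof (rule boundedI)
  fix w assume "w \<in> range (%n. Lp_pair (g n) (U (u (\<kappa> m))))"
  then obtain n where w: "w = Lp_pair (g n) (U (u (\<kappa> m)))" by blast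
  have "norm w <= Lpn p leb01 (y m) * Lpn q leb01 (g n)"
   unfolding w Lp_pair_def y_def[symmetric] by (rule holder(2)[OF y(1) g p q])
  also have "... <= B * (B powr p) powr (1 / q)" using yB gB B0 by (intro mult_mono) auto
  finally show "norm w <= B * (B powr p) powr (1 / q)" .
 qed
 have "EX \<rho>. strict_mono \<rho> \<and> (ALL m. convergent (%n. Lp_pair (g (\<rho> n)) (U (u (\<kappa> m)))))"
  by (rule diagonal_scalar_subseq[of "%m n. Lp_pair (g n) (U (u (\<kappa> m)))", OF pair_bd]) blast
 then obtain \<rho>0 where \<rho>0: "strict_mono \<rho>0" and conv0: "ALL m. convergent (%n. Lp_pair (g (\<rho>0 n)) (U (u (\<kappa> m))))"
  by (elim exE conjE)
 have q1: "1 <= q" using q by simp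
 from unit.Lpf_difference_upper_estimate[OF q1 t_def, of "%n. g (\<rho>0 n)", OF g gB]
 obtain \<rho> :: "nat => nat" where \<rho>: "strict_mono \<rho>" and est: "ALL (\<nu> :: nat => nat) (\<tau> :: nat => nat). (ALL k. k < \<nu> k) --> strict_mono \<tau> -->
  (EX (\<sigma> :: nat => nat) C. strict_mono \<sigma> \<and> 0 <= C \<and> (ALL m c.
   Lpn q leb01 (%y. \<Sum>i<m. c i * (g (\<rho>0 (\<rho> (\<nu> (\<tau> (\<sigma> i))))) y - g (\<rho>0 (\<rho> (\<tau> (\<sigma> i)))) y)) <= C * (\<Sum>i<m. norm (c i) powr t) powr (1 / t)))"
  by (elim exE conjE)
 define G where "G n = g (\<rho>0 (\<rho> n))" for n
 define w where "w n = u (\<kappa> (\<rho>0 (\<rho> n)))" for n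
 have w: "X.upper_est r Cu w"
  unfolding w_def by (rule X.upper_est_subseq[OF u, of "%n. \<kappa> (\<rho>0 (\<rho> n))"]) (use \<kappa>(1) \<rho>0 \<rho> in \<open>simp add: strict_mono_def\<close>)
 have wV: "w n \<in> X.V" for n by (simp add: w_def uV)
 have UwV: "U (w n) \<in> X.V" for n by (simp add: w_def UuV)
 have GL: "G n \<in> Lpf q leb01" for n by (simp add: G_def g)
 have Gbf: "bounded_functional (Lp_space p) (Lp_pair (G n))" for n by (simp add: G_def gbf)
 have big: "\<eta> <= norm (Lp_pair (G n) (U (w n)))" for n by (simp add: G_def w_def gy)
 have conv: "convergent (%n. Lp_pair (G n) (U (w m)))" for m
  unfolding G_def w_def using convergent_strict_mono[OF spec[OF conv0] \<rho>] .
 \<comment> \<open>The vectors are weakly null already by their upper estimate with r > 1; here it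
   is the functionals that are replaced by differences, to make the columns null.\<close>
 have wnull: "(%n. f (U (w n))) ----> 0" if "bounded_functional (Lp_space p) f" for f
  by (rule X.upper_est_weakly_null[OF w r1 X.bounded_functional_comp[OF that UL]])
 have "\<forall>\<^sub>F n in sequentially. norm (Lp_pair (G k) (U (w n))) <= \<eta> / 2" for k
  using tendstoD[OF wnull[OF Gbf[of k]], of "\<eta> / 2"] \<eta> by (auto elim: eventually_mono)
 from strict_mono_choice[of "%k n. norm (Lp_pair (G k) (U (w n))) <= \<eta> / 2", OF this] obtain \<nu> where \<nu>: "strict_mono \<nu>" "ALL k. k < \<nu> k" "ALL k. norm (Lp_pair (G k) (U (w (\<nu> k)))) <= \<eta> / 2"
  by (elim exE conjE)
 define d where "d i x = G (\<nu> i) x - G i x" for i x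
 have d: "d i \<in> Lpf q leb01" for i unfolding d_def[abs_def] by (intro Lpf_diff GL q1)
 have dbf: "bounded_functional (Lp_space p) (Lp_pair (d i))" for i
  by (rule bounded_functional_Lp_conjugate[OF p q d])
 have pd: "Lp_pair (d i) A = Lp_pair (G (\<nu> i)) A - Lp_pair (G i) A" if A: "A \<in> X.V" for i A
 proof -
  have f: "lp_rep A \<in> Lpf p leb01" using Lp_carrierD[OF p1 A] by simp
  show ?thesis unfolding Lp_pair_def d_def
   using holder(1)[OF f GL p q] by (simp add: right_diff_distrib integral_diff)
 qed
 have diag: "\<eta> / 2 <= norm (Lp_pair (d i) (U (w (\<nu> i))))" for i
 proof -
  have "norm (Lp_pair (G (\<nu> i)) (U (w (\<nu> i)))) - norm (Lp_pair (G i) (U (w (\<nu> i)))) <= norm (Lp_pair (d i) (U (w (\<nu> i))))"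
   unfolding pd[OF UwV] by (rule norm_triangle_ineq2)
  then show ?thesis using big[of "\<nu> i"] spec[OF \<nu>(3), of i] by linarith
 qed
 have row: "(%j. Lp_pair (d i) (U (w (\<nu> j)))) ----> 0" for i
  by (rule tendsto_strict_mono[OF wnull[OF dbf] \<nu>(1)])
 have col: "(%i. Lp_pair (d i) (U (w (\<nu> j)))) ----> 0" for j
  unfolding pd[OF UwV] by (rule convergent_diff_null[OF conv \<nu>(1)])
 have "0 < \<eta> / 2 / 32" using \<eta> by simp
 from matrix_extraction[of "%i j. Lp_pair (d i) (U (w (\<nu> j)))", OF row col this]
 obtain \<sigma>0 where \<sigma>0: "strict_mono \<sigma>0"
  and off: "ALL i j. i ~= j --> norm (Lp_pair (d (\<sigma>0 i)) (U (w (\<nu> (\<sigma>0 j))))) <= \<eta> / 2 / 32 / 2 ^ (i + j)" by (elim exE conjE)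
 from est[rule_format, OF spec[OF \<nu>(2)] \<sigma>0] obtain \<sigma> :: "nat => nat" and C where \<sigma>: "strict_mono \<sigma>" "0 <= C"
  and C: "ALL m c. Lpn q leb01 (%y. \<Sum>i<m. c i * (g (\<rho>0 (\<rho> (\<nu> (\<sigma>0 (\<sigma> i))))) y - g (\<rho>0 (\<rho> (\<sigma>0 (\<sigma> i)))) y)) <= C * (\<Sum>i<m. norm (c i) powr t) powr (1 / t)"
  by (elim exE conjE)
 have C': "Lpn q leb01 (%y. \<Sum>i<m. c i * d (\<sigma>0 (\<sigma> i)) y) <= C * (\<Sum>i<m. norm (c i) powr t) powr (1 / t)" for m c
  unfolding d_def G_def using C by (elim allE)
 have coef: "X.coef_est r (C + 1) (%i. Lp_pair (d (\<sigma>0 (\<sigma> i))))"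
 proof (rule X.coef_est_of_dual_upper[OF dbf r1 tr])
  show "0 < C + 1" using \<sigma>(2) by simp
  fix m and b :: "nat => 'k" and A assume A: "A \<in> X.V"
  have f: "lp_rep A \<in> Lpf p leb01" "A = lp_class (lp_rep A)" using Lp_carrierD[OF p1 A] by simp_all
  have sd: "(%y. \<Sum>i<m. b i * d (\<sigma>0 (\<sigma> i)) y) \<in> Lpf q leb01"
   by (intro Lpf_sum Lpf_cmult d q1; use q1 in simp)
  have "(\<Sum>i<m. b i * Lp_pair (d (\<sigma>0 (\<sigma> i))) A) = (LINT x|leb01. lp_rep A x * (\<Sum>i<m. b i * d (\<sigma>0 (\<sigma> i)) x))"
   unfolding Lp_pair_def sum_distrib_left
   using holder(1)[OF f(1) d p q]
   by (subst integral_sum) (simp_all add: mult.left_commute[of _ "b _"])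
  also have "norm ... <= Lpn p leb01 (lp_rep A) * Lpn q leb01 (%y. \<Sum>i<m. b i * d (\<sigma>0 (\<sigma> i)) y)"
   by (rule holder(2)[OF f(1) sd p q])
  also have "... <= Lpn p leb01 (lp_rep A) * ((C + 1) * (\<Sum>i<m. norm (b i) powr t) powr (1 / t))"
   by (intro mult_left_mono order_trans[OF C'] mult_right_mono) auto
  also have "Lpn p leb01 (lp_rep A) = X.N A" using Lp_norm[OF p1 f(1)] f(2) by metis
  finally show "norm (\<Sum>i<m. b i * Lp_pair (d (\<sigma>0 (\<sigma> i))) A) <= (C + 1) * (\<Sum>i<m. norm (b i) powr t) powr (1 / t) * X.N A"
   by (simp add: mult_ac)
 qed
 have "U \<notin> SS_ops (Lp_space p)"
 proof (rule X.not_SS_ops_biorthogonal[OF UL _ coef])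
  show "X.upper_est r Cu (%i. w (\<nu> (\<sigma>0 (\<sigma> i))))"
   by (rule X.upper_est_subseq[OF w, of "%i. \<nu> (\<sigma>0 (\<sigma> i))"]) (use \<nu>(1) \<sigma>0 \<sigma> in \<open>simp add: strict_mono_def\<close>)
  show "0 < \<eta> / 2" "1 <= r" using \<eta> r1 by simp_all
  show "\<eta> / 2 <= norm (Lp_pair (d (\<sigma>0 (\<sigma> i))) (U (w (\<nu> (\<sigma>0 (\<sigma> i))))))" for i by (rule diag)
  fix i j :: nat assume "i ~= j"
  then have "\<sigma> i ~= \<sigma> j" using strict_mono_eq[OF \<sigma>(1)] by simp
  from off[rule_format, OF this] show "norm (Lp_pair (d (\<sigma>0 (\<sigma> i))) (U (w (\<nu> (\<sigma>0 (\<sigma> j)))))) <= \<eta> / 2 / 32 / 2 ^ (i + j)"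
   using strict_mono_halving[OF \<sigma>(1), of "\<eta> / 2 / 32" i j] \<eta> by linarith
 qed
 then show False using U by blast
qed

section \<open>A strictly convex gauge on the scalars\<close>

lemma norm_parallelogram:
 fixes b c :: "'k::real_normed_field"
 shows "(norm (b + c))\<^sup>2 + (norm (b - c))\<^sup>2 = 2 * (norm b)\<^sup>2 + 2 * (norm c)\<^sup>2"
proof -
 obtain h :: "'k => complex" where h: "linear h" "!!x y. h (x * y) = h x * h y" "!!x. cmod (h x) = norm x"
  using real_normed_field_embeds_complex by blast
 have "norm (b + c) = cmod (h b + h c)" "norm (b - c) = cmod (h b - h c)"
  using h(1) by (simp_all add: linear_add linear_diff flip: h(3))
 moreover have "(cmod (z + w))\<^sup>2 + (cmod (z - w))\<^sup>2 = 2 * (cmod z)\<^sup>2 + 2 * (cmod w)\<^sup>2" for z w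
  by (simp only: cmod_power2) (simp add: power2_eq_square algebra_simps)
 ultimately show ?thesis by (simp add: h(3))
qed

text \<open>With S = \<phi> b + \<phi> c and Q twice the value at the midpoint, the parallelogram
  law gives S^2 - Q^2 = |b - c|^2 - (\<phi> b - \<phi> c)^2. Here (\<phi> b - \<phi> c)^2 S^2 is at
  most |b - c|^2 (|b| + |c|)^2, and S^2 is at least 4 + (|b| + |c|)^2. What remains is S + Q <= 2
  S.\<close>

lemma sqrt_norm_gap:
 fixes b c :: "'k::real_normed_field"
 defines "\<phi> \<equiv> %x::'k. sqrt (1 + (norm x)\<^sup>2)"
 shows "2 * (norm (b - c))\<^sup>2 <= (\<phi> b + \<phi> c) ^ 3 * (\<phi> b + \<phi> c - 2 * \<phi> ((1/2) * (b + c)))"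
  and "0 <= \<phi> b + \<phi> c - 2 * \<phi> ((1/2) * (b + c))"
proof -
 define u v d where "u = norm b" and "v = norm c" and "d = norm (b - c)"
 define B C where "B = \<phi> b" and "C = \<phi> c"
 define S Q where "S = B + C" and "Q = 2 * \<phi> ((1/2) * (b + c))"
 have nn: "0 <= u" "0 <= v" "0 <= d" by (simp_all add: u_def v_def d_def)
 have B2: "B\<^sup>2 = 1 + u\<^sup>2" and C2: "C\<^sup>2 = 1 + v\<^sup>2" by (simp_all add: B_def C_def \<phi>_def u_def v_def)
 have BC0: "0 <= B" "0 <= C" by (simp_all add: B_def C_def \<phi>_def)
 have Q0: "0 <= Q" by (simp add: Q_def \<phi>_def)
 have "norm ((1/2) * (b + c)) = norm (b + c) / 2" by (simp add: norm_mult norm_divide)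
 then have "Q\<^sup>2 = 4 + (norm (b + c))\<^sup>2" by (simp add: Q_def \<phi>_def power_mult_distrib power_divide)
 then have Q2: "Q\<^sup>2 = 4 + 2 * u\<^sup>2 + 2 * v\<^sup>2 - d\<^sup>2" using norm_parallelogram[of b c] by (simp add: u_def v_def d_def)
 have uv: "1 + u * v <= B * C"
 proof (rule power2_le_imp_le)
  have "(B * C)\<^sup>2 = (1 + u * v)\<^sup>2 + (u - v)\<^sup>2" unfolding power_mult_distrib B2 C2 by (simp add: power2_eq_square algebra_simps)
  then show "(1 + u * v)\<^sup>2 <= (B * C)\<^sup>2" by simp
 qed (use BC0 in simp)
 have S2: "S\<^sup>2 = 2 + u\<^sup>2 + v\<^sup>2 + 2 * (B * C)" using B2 C2 by (simp add: S_def power2_sum)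
 have S4: "4 + (u + v)\<^sup>2 <= S\<^sup>2" using uv unfolding S2 by (simp add: power2_sum)
 have "\<bar>u - v\<bar> <= d" unfolding u_def v_def d_def by (rule norm_triangle_ineq3)
 then have uvd: "(u - v)\<^sup>2 <= d\<^sup>2" by (simp add: abs_le_square_iff[symmetric] d_def)
 have eq: "S\<^sup>2 - Q\<^sup>2 = d\<^sup>2 - (B - C)\<^sup>2" unfolding S2 Q2 power2_diff B2 C2 by simp
 have "(B - C)\<^sup>2 * S\<^sup>2 = (B\<^sup>2 - C\<^sup>2)\<^sup>2" by (simp add: S_def power2_eq_square algebra_simps)
 also have "... = (u - v)\<^sup>2 * (u + v)\<^sup>2" unfolding B2 C2 by (simp add: power2_eq_square algebra_simps)
 also have "... <= d\<^sup>2 * (u + v)\<^sup>2" using uvd by (rule mult_right_mono) simp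
 finally have "(B - C)\<^sup>2 * S\<^sup>2 <= d\<^sup>2 * (u + v)\<^sup>2" .
 moreover have "d\<^sup>2 * (4 + (u + v)\<^sup>2) <= d\<^sup>2 * S\<^sup>2" using S4 by (rule mult_left_mono) simp
 ultimately have key: "4 * d\<^sup>2 <= (S\<^sup>2 - Q\<^sup>2) * S\<^sup>2" unfolding eq by (simp add: algebra_simps)
 have "S ~= 0"
 proof
  assume "S = 0"
  then show False using S4 zero_le_power2[of "u + v"] by simp
 qed
 then have S1: "0 < S" using BC0 by (simp add: S_def)
 have "0 <= S\<^sup>2 - Q\<^sup>2"
 proof (rule ccontr)
  assume "\<not> ?thesis"
  then have "(S\<^sup>2 - Q\<^sup>2) * S\<^sup>2 < 0" using S1 by (intro mult_neg_pos) auto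
  then show False using key zero_le_power2[of d] by linarith
 qed
 then have "Q\<^sup>2 <= S\<^sup>2" by linarith
 then have QS: "Q <= S" by (rule power2_le_imp_le) (use S1 in simp)
 then show "0 <= \<phi> b + \<phi> c - 2 * \<phi> ((1/2) * (b + c))" by (simp add: S_def Q_def B_def C_def)
 have "(S\<^sup>2 - Q\<^sup>2) * S\<^sup>2 = (S - Q) * S\<^sup>2 * (S + Q)" by (simp add: power2_eq_square algebra_simps)
 also have "... <= (S - Q) * S\<^sup>2 * (2 * S)" using QS S1 by (intro mult_left_mono mult_nonneg_nonneg) auto
 finally have "4 * d\<^sup>2 <= 2 * (S ^ 3 * (S - Q))" using key by (simp add: power2_eq_square power3_eq_cube mult_ac)
 then show "2 * (norm (b - c))\<^sup>2 <= (\<phi> b + \<phi> c) ^ 3 * (\<phi> b + \<phi> c - 2 * \<phi> ((1/2) * (b + c)))"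
  by (simp add: d_def S_def Q_def B_def C_def)
qed

text \<open>For values up to \<open>M\<close> the quadratic gap estimate is made linear through x <=
  eps + x^2 / eps. If a value exceeds \<open>M\<close>, twice the values beyond \<open>M\<close>
  already dominate |b| + |c|.\<close>

lemma norm_diff_le_gap:
 fixes b c :: "'k::real_normed_field"
 defines "\<phi> \<equiv> %x::'k. sqrt (1 + (norm x)\<^sup>2)"
 assumes eps: "0 < eps" and M: "0 <= M"
 shows "norm (b - c) <= eps + 4 * (1 + M) ^ 3 / eps * (\<phi> b + \<phi> c - 2 * \<phi> ((1/2) * (b + c)))
  + 2 * (indicator {x. M < norm x} b * norm b) + 2 * (indicator {x. M < norm x} c * norm c)"
proof -
 define g where "g = \<phi> b + \<phi> c - 2 * \<phi> ((1/2) * (b + c))"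
 have g: "2 * (norm (b - c))\<^sup>2 <= (\<phi> b + \<phi> c) ^ 3 * g" "0 <= g"
  using sqrt_norm_gap[of b c] by (simp_all add: g_def \<phi>_def)
 have Kg: "0 <= 4 * (1 + M) ^ 3 / eps * g" using g eps M by simp
 have tri: "norm (b - c) <= norm b + norm c" by (rule norm_triangle_ineq4)
 show ?thesis
 proof (cases "norm b <= M \<and> norm c <= M")
  case True
  have \<phi>M: "\<phi> x <= 1 + M" if "norm x <= M" for x
  proof -
   have "1 + (norm x)\<^sup>2 <= (1 + M)\<^sup>2" unfolding power2_sum power_one using power_mono[OF that norm_ge_zero, of 2] M by linarith
   then show ?thesis unfolding \<phi>_def using M by (intro real_le_lsqrt) auto
  qed
  have "(\<phi> b + \<phi> c) ^ 3 <= (2 * (1 + M)) ^ 3"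
   using \<phi>M[of b] \<phi>M[of c] True by (intro power_mono) (auto simp: \<phi>_def)
  then have "(\<phi> b + \<phi> c) ^ 3 * g <= (2 * (1 + M)) ^ 3 * g" using g(2) by (rule mult_right_mono)
  also have "... = 8 * ((1 + M) ^ 3 * g)" by (simp only: power_mult_distrib) simp
  finally have "(\<phi> b + \<phi> c) ^ 3 * g <= 8 * ((1 + M) ^ 3 * g)" .
  then have d2: "(norm (b - c))\<^sup>2 <= 4 * (1 + M) ^ 3 * g" using g(1) by linarith
  have "norm (b - c) <= eps + (norm (b - c))\<^sup>2 / eps"
  proof (cases "norm (b - c) <= eps")
   case False
   then have "norm (b - c) * eps <= (norm (b - c))\<^sup>2" unfolding power2_eq_square by (intro mult_left_mono) auto
   then have "norm (b - c) <= (norm (b - c))\<^sup>2 / eps" using eps by (simp add: pos_le_divide_eq)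
   then show ?thesis using eps by linarith
  qed (use eps in \<open>simp add: add_increasing2\<close>)
  also have "(norm (b - c))\<^sup>2 / eps <= 4 * (1 + M) ^ 3 * g / eps" using d2 eps by (simp add: divide_right_mono)
  finally have "norm (b - c) <= eps + 4 * (1 + M) ^ 3 / eps * g" by simp
  moreover have "indicator {x. M < norm x} b = (0::real)" "indicator {x. M < norm x} c = (0::real)"
   using True by (simp_all add: indicator_def)
  ultimately show ?thesis unfolding g_def by simp
 next
  case False
  then have "norm b + norm c <= 2 * (indicator {x. M < norm x} b * norm b) + 2 * (indicator {x. M < norm x} c * norm c)"
   by (auto simp: indicator_def not_le)
  then show ?thesis using tri Kg eps unfolding g_def by linarith
 qed
qed

section \<open>Dyadic intervals and Rademacher functions\<close>

lemma sum_lessThan_double: "sum f {..<2 * m} = (\<Sum>j<m. f (2 * j) + f (2 * j + 1))" for m :: nat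
 by (induction m) (simp_all add: add.assoc)

definition dyadic :: "nat => nat => real set" where
 "dyadic n j = {real j / 2 ^ n ..< real (Suc j) / 2 ^ n}"

lemma dyadic_sets [measurable]: "dyadic n j \<in> sets borel" by (simp add: dyadic_def)

lemma measure_dyadic: "j < 2 ^ n ==> measure leb01 (dyadic n j) = 1 / 2 ^ n"
proof -
 assume j: "j < 2 ^ n"
 have "real (Suc j) <= 2 ^ n" using j by (metis Suc_leI of_nat_le_iff of_nat_numeral of_nat_power)
 then have le: "real (Suc j) / 2 ^ n <= 1" by simp
 have len: "real (Suc j) / 2 ^ n - real j / 2 ^ n = 1 / 2 ^ n" by (simp add: field_simps)
 show ?thesis
 \<comment> \<open>The first interval contains the point 0, which is missing from the open unit
   interval.\<close>
 proof (cases "j = 0")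
  case True
  have "x < 1" if "x < 1 / 2 ^ n" for x :: real
  proof -
   have "(1::real) / 2 ^ n <= 1" by simp
   with that show ?thesis by linarith
  qed
  with True have "dyadic n j \<inter> {0<..<1} = {0<..<1 / 2 ^ n}" by (auto simp: dyadic_def)
  then show ?thesis by (simp add: measure_leb01)
 next
  case False
  then have "0 < real j / 2 ^ n" by simp
  then have "0 < x \<and> x < 1" if "x \<in> dyadic n j" for x
   using that le unfolding dyadic_def atLeastLessThan_iff by linarith
  then have "dyadic n j \<inter> {0<..<1} = dyadic n j" by auto
  then show ?thesis using len by (simp add: measure_leb01 dyadic_def divide_right_mono)
 qed
qed

lemma dyadic_unique: "x \<in> dyadic n i ==> x \<in> dyadic n j ==> i = j"
proof -
 assume "x \<in> dyadic n i" "x \<in> dyadic n j"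
 then have "real i < real (Suc j)" "real j < real (Suc i)"
  by (auto simp: dyadic_def field_simps)
 then show ?thesis by linarith
qed

lemma dyadic_split: "dyadic n j = dyadic (Suc n) (2 * j) \<union> dyadic (Suc n) (2 * j + 1)"
proof -
 have "real j / 2 ^ n = real (2 * j) / 2 ^ Suc n" "real (Suc j) / 2 ^ n = real (Suc (2 * j + 1)) / 2 ^ Suc n"
  by (simp_all add: field_simps)
 moreover have "real (2 * j) / 2 ^ Suc n <= real (2 * j + 1) / 2 ^ Suc n" "real (2 * j + 1) / 2 ^ Suc n <= real (Suc (2 * j + 1)) / 2 ^ Suc n"
  by (simp_all add: field_simps)
 ultimately show ?thesis unfolding dyadic_def by (auto simp del: power_Suc of_nat_Suc of_nat_add of_nat_mult)
qed

lemma indicator_dyadic_split: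
 "(indicator (dyadic n j) x :: 'b::ring_1) = indicator (dyadic (Suc n) (2 * j)) x + indicator (dyadic (Suc n) (2 * j + 1)) x"
 using dyadic_unique[of x "Suc n" "2 * j" "2 * j + 1"] unfolding dyadic_split[of n j] by (auto simp: indicator_def)

definition dyadic_step :: "nat => (nat => 'k) => real => 'k::real_normed_field" where
 "dyadic_step n v x = (\<Sum>j<2 ^ n. indicator (dyadic n j) x * v j)"

lemma dyadic_step_measurable [measurable]:
 "(dyadic_step n v :: real => 'k::{real_normed_field, second_countable_topology}) \<in> borel_measurable borel"
 unfolding dyadic_step_def[abs_def] by measurable

lemma dyadic_step_Suc: "dyadic_step n v = dyadic_step (Suc n) (%k. v (k div 2))"
proof
 fix x
 have "dyadic_step n v x = (\<Sum>j<2 ^ n. indicator (dyadic (Suc n) (2 * j)) x * v j + indicator (dyadic (Suc n) (2 * j + 1)) x * v j)"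
  unfolding dyadic_step_def indicator_dyadic_split[of n] by (simp add: algebra_simps)
 also have "... = (\<Sum>k<2 * 2 ^ n. indicator (dyadic (Suc n) k) x * v (k div 2))"
  unfolding sum_lessThan_double by (rule sum.cong) auto
 finally show "dyadic_step n v x = dyadic_step (Suc n) (%k. v (k div 2)) x"
  unfolding dyadic_step_def power_Suc .
qed

lemma dyadic_step_add_mult: "dyadic_step n (%k. v k + c * w k) x = dyadic_step n v x + c * dyadic_step n w x"
 unfolding dyadic_step_def sum_distrib_left sum.distrib[symmetric] by (rule sum.cong) (simp_all add: algebra_simps)

lemma dyadic_step_eq: "k < 2 ^ n ==> x \<in> dyadic n k ==> dyadic_step n v x = v k"
proof -
 assume k: "k < 2 ^ n" "x \<in> dyadic n k"
 have "indicator (dyadic n j) x * v j = (if j = k then v j else 0)" for j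
  using k(2) dyadic_unique[OF _ k(2), of j] by (cases "j = k") (auto simp: indicator_def)
 then show ?thesis unfolding dyadic_step_def using k(1) by simp
qed

lemma dyadic_step_eq_0: "ALL k<2 ^ n. x \<notin> dyadic n k ==> dyadic_step n v x = 0"
 unfolding dyadic_step_def by (rule sum.neutral) (auto simp: indicator_def)

text \<open>Outside [0, 1) a step function has the value 0, which is why \<open>G\<close> must fix
  0.\<close>

lemma dyadic_step_compose:
 fixes G :: "'k::real_normed_field => real"
 assumes "G 0 = 0" shows "G (dyadic_step n v x) = dyadic_step n (%j. G (v j)) x"
proof (cases "EX k<2 ^ n. x \<in> dyadic n k")
 case True
 then obtain k where k: "k < 2 ^ n" "x \<in> dyadic n k" by blast
 show ?thesis unfolding dyadic_step_eq[OF k] ..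
next
 case False
 then have *: "ALL k<2 ^ n. x \<notin> dyadic n k" by blast
 show ?thesis unfolding dyadic_step_eq_0[OF *] by (rule assms)
qed

lemma integral_dyadic_step:
 fixes G :: "'k::real_normed_field => real"
 assumes "G 0 = 0"
 shows "integrable leb01 (%x. G (dyadic_step n v x))"
  and "(LINT x|leb01. G (dyadic_step n v x)) = (\<Sum>j<2 ^ n. G (v j)) / 2 ^ n"
proof -
 have i: "integrable leb01 (%x. indicator (dyadic n j) x * G (v j))" for j
  by (intro integrable_mult_left unit.integrable_const_bound[of _ 1]) (auto simp: indicator_def)
 then show "integrable leb01 (%x. G (dyadic_step n v x))"
  unfolding dyadic_step_compose[of G, OF assms] unfolding dyadic_step_def by (intro integrable_sum)
 have "(LINT x|leb01. G (dyadic_step n v x)) = (\<Sum>j<2 ^ n. \<integral>x. indicator (dyadic n j) x * G (v j) \<partial>leb01)"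
  unfolding dyadic_step_compose[of G, OF assms] unfolding dyadic_step_def using i by (intro integral_sum)
 also have "... = (\<Sum>j<2 ^ n. G (v j) / 2 ^ n)"
  by (rule sum.cong) (auto simp: measure_dyadic)
 finally show "(LINT x|leb01. G (dyadic_step n v x)) = (\<Sum>j<2 ^ n. G (v j)) / 2 ^ n"
  by (simp add: sum_divide_distrib)
qed

definition rademacher :: "nat => real => 'k::real_normed_field" where
 "rademacher n = dyadic_step (Suc n) (%k. if even k then 1 else -1)"

lemma rademacher_measurable [measurable]:
 "(rademacher n :: real => 'k::{real_normed_field, second_countable_topology}) \<in> borel_measurable borel"
 unfolding rademacher_def by measurable

lemma norm_rademacher_le: "norm (rademacher n x :: 'k::real_normed_field) <= 1"
proof (cases "EX k<2 ^ Suc n. x \<in> dyadic (Suc n) k")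
 case True
 then obtain k where k: "k < 2 ^ Suc n" "x \<in> dyadic (Suc n) k" by blast
 show ?thesis unfolding rademacher_def dyadic_step_eq[OF k] by simp
next
 case False
 then have "rademacher n x = (0::'k)" unfolding rademacher_def by (intro dyadic_step_eq_0) blast
 then show ?thesis by simp
qed

text \<open>The value of the Rademacher sum on the k-th dyadic interval of level n: the last binary
  digit of k decides the sign of the last term, the earlier digits those of the others.\<close>

primrec rademacher_coeff :: "(nat => 'k::real_normed_field) => nat => nat => 'k" where
 "rademacher_coeff c 0 k = 0"
| "rademacher_coeff c (Suc n) k = rademacher_coeff c n (k div 2) + c n * (if even k then 1 else -1)"

lemma rademacher_sum: "(\<Sum>i<n. c i * rademacher i x) = dyadic_step n (rademacher_coeff c n) x"
proof (induction n)
 case (Suc n)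
 have "(\<Sum>i<Suc n. c i * rademacher i x) = dyadic_step (Suc n) (%k. rademacher_coeff c n (k div 2)) x + c n * rademacher n x"
  by (simp add: Suc flip: dyadic_step_Suc)
 then show ?case
  unfolding rademacher_def by (simp add: dyadic_step_add_mult del: sum.lessThan_Suc)
qed (simp add: dyadic_step_def)

text \<open>The parallelogram law at each splitting of an interval takes the place of an inner
  product, so scalars of all kinds are treated alike.\<close>

lemma rademacher_coeff_squares: "(\<Sum>k<2 ^ n. (norm (rademacher_coeff c n k))\<^sup>2) / 2 ^ n = (\<Sum>i<n. (norm (c i))\<^sup>2)"
proof (induction n)
 case (Suc n)
 have "(\<Sum>k<2 ^ Suc n. (norm (rademacher_coeff c (Suc n) k))\<^sup>2) =
   (\<Sum>k<2 ^ n. (norm (rademacher_coeff c n k + c n))\<^sup>2 + (norm (rademacher_coeff c n k - c n))\<^sup>2)"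
  unfolding power_Suc sum_lessThan_double by (rule sum.cong) auto
 also have "... = (\<Sum>k<2 ^ n. 2 * (norm (rademacher_coeff c n k))\<^sup>2 + 2 * (norm (c n))\<^sup>2)"
  unfolding norm_parallelogram ..
 also have "... = 2 * (\<Sum>k<2 ^ n. (norm (rademacher_coeff c n k))\<^sup>2) + 2 ^ Suc n * (norm (c n))\<^sup>2"
  by (simp add: sum.distrib sum_distrib_left)
 finally show ?case using Suc by (simp add: add_divide_distrib)
qed simp

lemma rademacher_L2:
 fixes c :: "nat => 'k::real_normed_field"
 shows "integrable leb01 (%x. (norm (\<Sum>i<n. c i * rademacher i x))\<^sup>2)"
  and "(LINT x|leb01. (norm (\<Sum>i<n. c i * rademacher i x))\<^sup>2) = (\<Sum>i<n. (norm (c i))\<^sup>2)"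
 using integral_dyadic_step[of "%y::'k. (norm y)\<^sup>2" n "rademacher_coeff c n"]
 unfolding rademacher_sum by (simp_all add: rademacher_coeff_squares)

lemma rademacher_Lpf:
 "1 <= p ==> (rademacher n :: real => 'k::{real_normed_field, banach, second_countable_topology}) \<in> Lpf p leb01"
 by (rule unit.Lpf_bounded[where C = 1]) (auto simp: norm_rademacher_le)

text \<open>The L^2 identity suffices for p <= 2: where |f| exceeds A, |f|^p is at most A^(p-2)
  |f|^2, and elsewhere at most A^p. The integral is thus at most 2 A^p, hence the constant
  2.\<close>

lemma rademacher_Lpn:
 fixes c :: "nat => 'k::{real_normed_field, banach, second_countable_topology}"
 assumes p: "1 <= p" "p <= 2"
 shows "Lpn p leb01 (%x. \<Sum>i<n. c i * rademacher i x) <= 2 * (\<Sum>i<n. norm (c i) powr 2) powr (1 / 2)"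
proof -
 let ?f = "%x. \<Sum>i<n. c i * rademacher i x"
 define A where "A = (\<Sum>i<n. norm (c i) powr 2) powr (1 / 2)"
 have A2: "A\<^sup>2 = (\<Sum>i<n. (norm (c i))\<^sup>2)"
 proof -
  have "A\<^sup>2 = A powr 2" by (simp add: A_def)
  also have "... = (\<Sum>i<n. norm (c i) powr 2)" by (simp add: A_def powr_powr sum_nonneg)
  finally show ?thesis by simp
 qed
 have A0: "0 <= A" by (simp add: A_def)
 show ?thesis unfolding A_def[symmetric]
 proof (cases "A = 0")
  case True
  then have "c i = 0" if "i < n" for i using A2 that by (simp add: sum_nonneg_eq_0_iff)
  then have "?f = (%_. 0)" by auto
  then show "Lpn p leb01 ?f <= 2 * A" using A0 by simp
 next
  case False
  then have A: "0 < A" using A0 by simp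
  have pt: "norm (?f x) powr p <= A powr (p - 2) * (norm (?f x))\<^sup>2 + A powr p" for x
  proof (cases "norm (?f x) <= A")
   case True
   then have "norm (?f x) powr p <= A powr p" using p by (intro powr_mono2) auto
   then show ?thesis by (simp add: add_increasing)
  next
   case False
   then have pos: "0 < norm (?f x)" using A by linarith
   have "norm (?f x) powr p = norm (?f x) powr (p - 2) * norm (?f x) powr 2" unfolding powr_add[symmetric] by simp
   also have "... <= A powr (p - 2) * norm (?f x) powr 2"
    using False p A by (intro mult_right_mono powr_mono2') auto
   also have "norm (?f x) powr 2 = (norm (?f x))\<^sup>2" using pos by simp
   finally show ?thesis using powr_ge_zero[of A p] by linarith
  qed
  have "?f \<in> Lpf p leb01" by (intro Lpf_sum Lpf_cmult rademacher_Lpf p(1)) (use p in simp)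
  from Lpf_integrable[OF this] have "(LINT x|leb01. norm (?f x) powr p) <= (LINT x|leb01. A powr (p - 2) * (norm (?f x))\<^sup>2 + A powr p)"
   by (rule integral_mono) (use rademacher_L2(1)[of c n] pt in auto)
  also have "... = A powr (p - 2) * A\<^sup>2 + A powr p"
   using rademacher_L2[of c n] by (simp add: A2)
  also have "A powr (p - 2) * A\<^sup>2 = A powr (p - 2) * A powr 2" using A by simp
  also have "... = A powr p" unfolding powr_add[symmetric] by simp
  also have "A powr p + A powr p <= 2 powr p * A powr p"
   using powr_mono[of 1 p "2::real"] p mult_right_mono[of 2 "2 powr p" "A powr p"] by simp
  also have "... = (2 * A) powr p" by (simp add: powr_mult)
  finally show "Lpn p leb01 ?f <= 2 * A" using p A by (intro Lpn_leI) auto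
 qed
qed

lemma rademacher_of_real: "(rademacher n x :: 'k::real_normed_field) = of_real (rademacher n x)"
 unfolding rademacher_def dyadic_step_def by (auto simp: indicator_def intro!: sum.cong)

text \<open>Polarisation of the L^2 identity for real coefficients, carried over to
  \<open>'k\<close> by \<open>of_real\<close>.\<close>

lemma rademacher_orthonormal:
 "(LINT x|leb01. rademacher m x * rademacher n x) = (if m = n then 1 else (0::'k::{real_normed_field, banach, second_countable_topology}))"
proof -
 have int: "integrable leb01 (%x. rademacher m x * rademacher n x :: real)" for m n
 proof (rule unit.integrable_const_bound[of _ 1])
  show "AE x in leb01. norm (rademacher m x * rademacher n x :: real) <= 1"
   unfolding norm_mult by (intro AE_I2 mult_le_one norm_rademacher_le norm_ge_zero)
 qed simp
 have sq: "(LINT x|leb01. rademacher m x * rademacher m x) = (1::real)" for m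
  using rademacher_L2(2)[of "%i. if i = m then 1 else (0::real)" "Suc m"]
  by (simp add: if_distrib[of "%y. y * _"] if_distrib[of "%y. y\<^sup>2"] power2_eq_square cong: if_cong)
 have "(LINT x|leb01. rademacher m x * rademacher n x) = (if m = n then 1 else (0::real))"
 proof (cases "m = n")
  case False
  let ?c = "%i. if i = m \<or> i = n then 1 else (0::real)"
  let ?N = "Suc (max m n)"
  have "(\<Sum>i<?N. ?c i * rademacher i x) = (\<Sum>i\<in>{m, n}. rademacher i x)" for x
   by (rule sum.mono_neutral_cong_right) auto
  then have s: "(\<Sum>i<?N. ?c i * rademacher i x) = rademacher m x + rademacher n x" for x using False by simp
  have "(\<Sum>i<?N. (norm (?c i))\<^sup>2) = (\<Sum>i\<in>{m, n}. 1)" by (rule sum.mono_neutral_cong_right) auto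
  then have "(LINT x|leb01. (rademacher m x + rademacher n x :: real)\<^sup>2) = 2"
   using rademacher_L2(2)[of ?c ?N] False unfolding s by simp
  moreover have "(LINT x|leb01. (rademacher m x + rademacher n x :: real)\<^sup>2) =
   (LINT x|leb01. rademacher m x * rademacher m x + rademacher n x * rademacher n x + 2 * (rademacher m x * rademacher n x))"
   by (simp add: power2_eq_square algebra_simps)
  ultimately show ?thesis using int sq False by simp
 qed (simp add: sq)
 moreover have "(LINT x|leb01. rademacher m x * rademacher n x) = (of_real (LINT x|leb01. rademacher m x * rademacher n x) :: 'k)"
  unfolding rademacher_of_real[where 'k = 'k] of_real_mult[symmetric]
  by (rule integral_bounded_linear[OF bounded_linear_of_real int])
 ultimately show ?thesis by simp
qed

text \<open>The difference is bounded by 2, so its square is at most 4 times its p-th power, while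
  the square has integral 2.\<close>

lemma rademacher_separated:
 assumes p: "1 <= p" "p <= 2" and mn: "m ~= n"
 shows "1 / 2 <= Lpn p leb01 (%x. rademacher m x - rademacher n x :: 'k::{real_normed_field, banach, second_countable_topology})"
proof -
 let ?f = "%x. rademacher m x - rademacher n x :: 'k"
 let ?c = "%i. if i = m then 1 else if i = n then -1 else (0::'k)"
 let ?N = "Suc (max m n)"
 have "(\<Sum>i<?N. ?c i * rademacher i x) = (\<Sum>i\<in>{m, n}. ?c i * rademacher i x)" for x
  by (rule sum.mono_neutral_cong_right) auto
 then have s: "(\<Sum>i<?N. ?c i * rademacher i x) = ?f x" for x using mn by simp
 have "(\<Sum>i<?N. (norm (?c i))\<^sup>2) = (\<Sum>i\<in>{m, n}. 1)" by (rule sum.mono_neutral_cong_right) auto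
 then have int: "integrable leb01 (%x. (norm (?f x))\<^sup>2)" "(LINT x|leb01. (norm (?f x))\<^sup>2) = 2"
  using rademacher_L2[of ?c ?N] mn unfolding s by simp_all
 have f: "?f \<in> Lpf p leb01" by (intro Lpf_diff rademacher_Lpf p)
 have pt: "(norm (?f x))\<^sup>2 <= 4 * norm (?f x) powr p" for x
 proof (cases "?f x = 0")
  case False
  have "norm (?f x) <= 2" using norm_triangle_ineq4[of "rademacher m x :: 'k" "rademacher n x"]
    norm_rademacher_le[of m x, where 'k = 'k] norm_rademacher_le[of n x, where 'k = 'k] by linarith
  then have "norm (?f x) powr (2 - p) <= 2 powr (2 - p)" using p by (intro powr_mono2) auto
  also have "... <= 2 powr 2" using p by (intro powr_mono) auto
  finally have "norm (?f x) powr p * norm (?f x) powr (2 - p) <= norm (?f x) powr p * 4" by (intro mult_left_mono) auto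
  moreover have "norm (?f x) powr p * norm (?f x) powr (2 - p) = (norm (?f x))\<^sup>2" using False by (simp flip: powr_add)
  ultimately show ?thesis by simp
 qed simp
 have "2 <= (LINT x|leb01. 4 * norm (?f x) powr p)"
  unfolding int(2)[symmetric] by (rule integral_mono[OF int(1)]) (use Lpf_integrable[OF f] pt in auto)
 then have "1 / 2 <= Lpn p leb01 ?f powr p" using p by (simp add: Lpn_powr)
 moreover have "(1 / 2) powr p <= (1 / 2 :: real) powr 1" using p by (intro powr_mono') auto
 ultimately have "(1 / 2) powr p <= Lpn p leb01 ?f powr p" by simp
 then show ?thesis by (rule powr_le_cancel) (use p in simp_all)
qed

section \<open>Strictly singular operators on L^1\<close>

lemma Lpn_1: "Lpn 1 M f = (LINT x|M. norm (f x))"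
 by (simp add: Lpn_def integral_nonneg_AE)

lemma integral_tail_small:
 fixes f :: "'a => 'b::{banach, second_countable_topology}"
 assumes f: "integrable M f" and e: "0 < e"
 shows "EX L :: nat. (LINT x|M. indicator {y. real L < norm y} (f x) * norm (f x)) < e"
proof -
 have [measurable]: "f \<in> borel_measurable M" using f by simp
 have "(%n :: nat. \<integral>x. indicator {y. real n < norm y} (f x) * norm (f x) \<partial>M) ----> (LINT x|M. 0)"
 proof (rule integral_dominated_convergence[where w = "%x. norm (f x)"])
  show "AE x in M. (%n :: nat. indicator {y. real n < norm y} (f x) * norm (f x)) ----> 0"
  proof (rule AE_I2)
   fix x
   obtain k :: nat where k: "norm (f x) <= real k" using real_arch_simple by blast
   have "\<forall>\<^sub>F n in sequentially. indicator {y. real n < norm y} (f x) * norm (f x) = 0"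
    using eventually_ge_at_top[of k] by eventually_elim (use k in \<open>auto simp: indicator_def\<close>)
   then show "(%n :: nat. indicator {y. real n < norm y} (f x) * norm (f x)) ----> 0"
    by (rule tendsto_eventually)
  qed
  show "AE x in M. norm (indicator {y. real n < norm y} (f x) * norm (f x)) <= norm (f x)" for n
   by (rule AE_I2) (auto simp: indicator_def)
 qed (use f in auto)
 from order_tendstoD(2)[OF this, of e] e show ?thesis by (auto dest!: eventually_happens)
qed

text \<open>Above a high level \<open>f\<close> has little mass, and below that level a small set
  carries little.\<close>

lemma (in finite_measure) integral_small_sets:
 fixes f :: "'a => 'b::{banach, second_countable_topology}"
 assumes f: "integrable M f" and A: "!!n. A n \<in> sets M" "(%n. measure M (A n)) ----> 0"
 shows "(%n. \<integral>x. indicator (A n) x * norm (f x) \<partial>M) ----> 0"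
proof (rule LIMSEQ_I)
 fix e :: real assume e: "0 < e"
 have [measurable]: "f \<in> borel_measurable M" "!!n. A n \<in> sets M" using f A by simp_all
 obtain L :: nat where L: "(LINT x|M. indicator {y. real L < norm y} (f x) * norm (f x)) < e / 2"
  using integral_tail_small[OF f, of "e / 2"] e by auto
 have int: "integrable M (%x. indicator {y. real L < norm y} (f x) * norm (f x))"
  by (rule integrable_bound[OF integrable_norm[OF f]]) (auto simp: indicator_def)
 have intA: "integrable M (%x. indicator (A n) x * norm (f x))" for n
  by (rule integrable_bound[OF integrable_norm[OF f]]) (auto simp: indicator_def)
 have indA: "integrable M (%x. real L * indicator (A n) x)" for n
  by (rule integrable_mult_right) (use A in \<open>simp add: integrable_indicator_iff less_top[symmetric]\<close>)
 have le: "(LINT x|M. indicator (A n) x * norm (f x)) <= real L * measure M (A n) + (LINT x|M. indicator {y. real L < norm y} (f x) * norm (f x))" for n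
 proof -
  have "(LINT x|M. indicator (A n) x * norm (f x)) <= (LINT x|M. real L * indicator (A n) x + indicator {y. real L < norm y} (f x) * norm (f x))"
   by (rule integral_mono[OF intA integrable_add[OF indA int]]) (auto simp: indicator_def)
  also have "... = real L * measure M (A n) + (LINT x|M. indicator {y. real L < norm y} (f x) * norm (f x))"
   using A(1)[of n] by (subst integral_add[OF indA int]) (simp add: sets.Int_space_eq2)
  finally show ?thesis .
 qed
 have "0 < e / 2 / (real L + 1)" using e by simp
 from LIMSEQ_D[OF A(2) this] obtain n0 where n0: "!!n. n0 <= n ==> measure M (A n) < e / 2 / (real L + 1)" by auto
 show "EX n0. ALL n>=n0. norm ((LINT x|M. indicator (A n) x * norm (f x)) - 0) < e"
 proof (intro exI[of _ n0] allI impI)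
  fix n assume "n0 <= n"
  have "real L * measure M (A n) <= (real L + 1) * measure M (A n)" by (intro mult_right_mono) auto
  also have "... < e / 2" using n0[OF \<open>n0 <= n\<close>] by (subst (asm) pos_less_divide_eq) (auto simp: mult.commute)
  finally have "(LINT x|M. indicator (A n) x * norm (f x)) < e" using le[of n] L by linarith
  moreover have "0 <= (LINT x|M. indicator (A n) x * norm (f x))" by (rule integral_nonneg_AE) simp
  ultimately show "norm ((LINT x|M. indicator (A n) x * norm (f x)) - 0) < e" by simp
 qed
qed

lemma Lp1_norm_rep:
 assumes "A \<in> nsp_carrier (Lp_space 1 :: ((real => 'k::{real_normed_field, banach, second_countable_topology}) set, 'k) nspace)"
 shows "integrable leb01 (lp_rep A)" "nsp_norm (Lp_space 1) A = (LINT x|leb01. norm (lp_rep A x))"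
proof -
 have f: "lp_rep A \<in> Lpf 1 leb01" "A = lp_class (lp_rep A)" using Lp_carrierD[OF order_refl assms] by simp_all
 show "integrable leb01 (lp_rep A)" by (rule F_integrable[OF order_refl f(1)])
 have "nsp_norm (Lp_space 1) (lp_class (lp_rep A)) = Lpn 1 leb01 (lp_rep A)" by (rule Lp_norm[OF order_refl f(1)])
 then show "nsp_norm (Lp_space 1) A = (LINT x|leb01. norm (lp_rep A x))" using f(2) by (simp add: Lpn_1)
qed

text \<open>Otherwise mass concentrates on disjoint sets $B_i$, and integration over the $B_i$
 (against unimodular functions) gives functionals with a 1-estimate that do not vanish along \<open>U\<close>.\<close>
lemma SS_ops_L1_equi_integrable:
 fixes U :: "(real => 'k::{real_normed_field, banach, second_countable_topology}) set => (real => 'k) set"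
 assumes U: "U \<in> SS_ops (Lp_space 1)" and \<eta>: "0 < \<eta>"
 shows "EX m :: nat. \<forall>x\<in>nsp_carrier (Lp_space 1). nsp_norm (Lp_space 1) x <= 1 -->
  (LINT t|leb01. indicator {y. real m < norm y} (lp_rep (U x) t) * norm (lp_rep (U x) t)) <= \<eta>"
proof (rule ccontr)
 interpret X: normed_nspace "Lp_space 1 :: ((real => 'k) set, 'k) nspace" Lp_iota by (rule normed_nspace_Lp) simp
 assume neg: "\<not> ?thesis"
 have UL: "U \<in> Lops (Lp_space 1)" using U by (rule X.SS_ops_Lops)
 obtain D where D: "0 < D" "!!x. x \<in> X.V ==> X.N (U x) <= D * X.N x" using X.Lops_bounded[OF UL] by blast
 \<comment> \<open>The level is \<open>Suc m\<close>, a positive number, so that Chebyshev's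
   inequality bounds the measure of the sets \<open>A m\<close>.\<close>
 have "ALL m. EX x. x \<in> X.V \<and> X.N x <= 1 \<and>
   \<eta> < (LINT t|leb01. indicator {y. real (Suc m) < norm y} (lp_rep (U x) t) * norm (lp_rep (U x) t))"
 proof
  fix m
  from neg have "\<not> (\<forall>x\<in>X.V. X.N x <= 1 -->
    (LINT t|leb01. indicator {y. real (Suc m) < norm y} (lp_rep (U x) t) * norm (lp_rep (U x) t)) <= \<eta>)"
   by (rule contrapos_nn) (rule exI[of _ "Suc m"])
  then show "EX x. x \<in> X.V \<and> X.N x <= 1 \<and>
   \<eta> < (LINT t|leb01. indicator {y. real (Suc m) < norm y} (lp_rep (U x) t) * norm (lp_rep (U x) t))"
   by (simp only: Ball_def not_all not_imp not_le)
 qed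
 from choice[OF this] obtain x where x: "!!m. x m \<in> X.V" "!!m. X.N (x m) <= 1"
  and big: "!!m. \<eta> < (LINT t|leb01. indicator {y. real (Suc m) < norm y} (lp_rep (U (x m)) t) * norm (lp_rep (U (x m)) t))"
  by auto
 have UV: "U (x m) \<in> X.V" for m using x(1) by (rule X.Lops_closed[OF UL])
 define y where "y m = lp_rep (U (x m))" for m
 have y: "integrable leb01 (y m)" for m unfolding y_def by (rule Lp1_norm_rep(1)[OF UV])
 have [measurable]: "y m \<in> borel_measurable borel" for m using y[of m] by (auto dest: borel_measurable_integrable)
 have yD: "(LINT t|leb01. norm (y m t)) <= D" for m
 proof -
  have "(LINT t|leb01. norm (y m t)) = X.N (U (x m))" unfolding y_def by (rule Lp1_norm_rep(2)[OF UV, symmetric])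
  also have "... <= D * X.N (x m)" by (rule D(2)[OF x(1)])
  also have "... <= D * 1" using D(1) x(2) by (intro mult_left_mono) auto
  finally show ?thesis by simp
 qed
 define A where "A m = {t. real (Suc m) < norm (y m t)}" for m
 have A [measurable]: "A m \<in> sets borel" for m unfolding A_def by measurable
 have intA: "integrable leb01 (%t. indicator S t * norm (y m t))" if "S \<in> sets borel" for S m
  by (rule integrable_bound[OF integrable_norm[OF y[of m]]]) (use that in \<open>auto simp: indicator_def\<close>)
 have bigA: "\<eta> < (LINT t|leb01. indicator (A m) t * norm (y m t))" for m
  using big[of m] unfolding y_def[symmetric] A_def by (simp add: indicator_def)
 have Am: "measure leb01 (A m) <= D * inverse (real (Suc m))" for m
 proof -
  have "real (Suc m) * measure leb01 (A m) = (LINT t|leb01. real (Suc m) * indicator (A m) t)" by simp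
  also have "... <= (LINT t|leb01. norm (y m t))"
  proof (rule integral_mono[OF _ integrable_norm[OF y]])
   show "integrable leb01 (%t. real (Suc m) * indicator (A m) t)"
    by (rule integrable_mult_right) (simp add: integrable_indicator_iff less_top[symmetric])
  qed (auto simp: A_def indicator_def)
  also have "... <= D" by (rule yD)
  finally show ?thesis by (simp add: field_simps)
 qed
 have "(%m. D * inverse (real (Suc m))) ----> D * 0" by (intro tendsto_mult_left LIMSEQ_inverse_real_of_nat)
 then have lim0: "(%m. D * inverse (real (Suc m))) ----> 0" by simp
 have A0: "(%m. measure leb01 (A m)) ----> 0"
 proof (rule tendsto_sandwich[OF _ _ tendsto_const lim0])
  show "\<forall>\<^sub>F m in sequentially. 0 <= measure leb01 (A m)" by simp
  show "\<forall>\<^sub>F m in sequentially. measure leb01 (A m) <= D * inverse (real (Suc m))"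
   by (intro always_eventually allI Am)
 qed
 \<comment> \<open>Only masses over later sets matter, since only later sets will be removed; the
   value 0 in the other entries makes the columns null.\<close>
 define \<alpha> where "\<alpha> k n = (if k < n then (LINT t|leb01. indicator (A n) t * norm (y k t)) else 0)" for k n
 have \<alpha>0: "0 <= (LINT t|leb01. indicator S t * norm (y k t))" for S k by (rule integral_nonneg_AE) simp
 have row: "(%n. \<alpha> k n) ----> 0" for k
 proof (rule tendsto_sandwich[OF _ _ tendsto_const])
  show "(%n. \<integral>t. indicator (A n) t * norm (y k t) \<partial>leb01) ----> 0"
   by (rule unit.integral_small_sets[OF y _ A0]) simp
 qed (use \<alpha>0 in \<open>auto simp: \<alpha>_def\<close>)
 have col: "(%k. \<alpha> k n) ----> 0" for n
  by (rule tendsto_eventually) (use eventually_ge_at_top[of n] in eventually_elim, auto simp: \<alpha>_def)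
 have "0 < \<eta> / 4" using \<eta> by simp
 from matrix_extraction[of \<alpha>, OF row col this]
 obtain \<sigma> where \<sigma>: "strict_mono \<sigma>" and off: "ALL i j. i ~= j --> norm (\<alpha> (\<sigma> i) (\<sigma> j)) <= \<eta> / 4 / 2 ^ (i + j)" by (elim exE conjE)
 \<comment> \<open>The later sets are removed from the i-th one. Their union takes at most half of
   \<eta>, and what is left is pairwise disjoint.\<close>
 define A' where "A' i j = (if i < j then A (\<sigma> j) else {})" for i j
 have A's [measurable]: "A' i j \<in> sets borel" for i j by (simp add: A'_def)
 define W where "W i = (\<Union>j. A' i j)" for i
 have [measurable]: "W i \<in> sets borel" for i unfolding W_def by measurable
 have A'le: "(LINT t|leb01. indicator (A' i j) t * norm (y (\<sigma> i) t)) <= \<eta> / 4 * (1/2) ^ j" for i j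
 proof (cases "i < j")
  case True
  then have "(LINT t|leb01. indicator (A' i j) t * norm (y (\<sigma> i) t)) = \<alpha> (\<sigma> i) (\<sigma> j)"
   using \<sigma> by (simp add: A'_def \<alpha>_def strict_mono_less)
  also have "... <= \<eta> / 4 / 2 ^ (i + j)" using off[rule_format, of i j] True by simp
  also have "... <= \<eta> / 4 / 2 ^ j" using \<eta> by (intro divide_left_mono power_increasing) auto
  finally show ?thesis by (simp add: power_divide)
 qed (use \<eta> in \<open>simp add: A'_def\<close>)
 have Wle: "(LINT t|leb01. indicator (W i) t * norm (y (\<sigma> i) t)) <= \<eta> / 2" for i
 proof (rule LIMSEQ_le_const2)
  show "(%k. \<integral>t. indicator (\<Union>j<k. A' i j) t * norm (y (\<sigma> i) t) \<partial>leb01) ----> (LINT t|leb01. indicator (W i) t * norm (y (\<sigma> i) t))"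
  proof (rule integral_dominated_convergence[where w = "%t. norm (y (\<sigma> i) t)"])
   show "AE t in leb01. (%k. indicator (\<Union>j<k. A' i j) t * norm (y (\<sigma> i) t)) ----> indicator (W i) t * norm (y (\<sigma> i) t)"
    unfolding W_def by (intro AE_I2 tendsto_mult_right LIMSEQ_indicator_UN)
   show "AE t in leb01. norm (indicator (\<Union>j<k. A' i j) t * norm (y (\<sigma> i) t)) <= norm (y (\<sigma> i) t)" for k
    by (rule AE_I2) (auto simp: indicator_def)
  qed (use integrable_norm[OF y] in auto)
  show "EX k0. ALL k>=k0. (LINT t|leb01. indicator (\<Union>j<k. A' i j) t * norm (y (\<sigma> i) t)) <= \<eta> / 2"
  proof (intro exI allI impI)
   fix k
   have "(LINT t|leb01. indicator (\<Union>j<k. A' i j) t * norm (y (\<sigma> i) t)) <=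
     (LINT t|leb01. (\<Sum>j<k. indicator (A' i j) t * norm (y (\<sigma> i) t)))"
   proof (rule integral_mono[OF intA integrable_sum[OF intA]])
    fix t
    show "indicator (\<Union>j<k. A' i j) t * norm (y (\<sigma> i) t) <= (\<Sum>j<k. indicator (A' i j) t * norm (y (\<sigma> i) t))"
    proof (cases "t \<in> (\<Union>j<k. A' i j)")
     case True
     then obtain j where j: "j < k" "t \<in> A' i j" by blast
     have "indicator (A' i j) t * norm (y (\<sigma> i) t) <= (\<Sum>j<k. indicator (A' i j) t * norm (y (\<sigma> i) t))"
      by (rule member_le_sum) (use j in auto)
     then show ?thesis using True j by simp
    next
     case False
     then show ?thesis by (simp add: sum_nonneg)
    qed
   qed (auto intro!: A's sets.finite_UN)
   also have "... = (\<Sum>j<k. \<integral>t. indicator (A' i j) t * norm (y (\<sigma> i) t) \<partial>leb01)"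
    by (intro integral_sum intA) simp
   also have "... <= (\<Sum>j<k. \<eta> / 4 * (1/2) ^ j)" by (intro sum_mono A'le)
   also have "... = \<eta> / 4 * (\<Sum>j<k. (1/2) ^ j)" by (simp add: sum_distrib_left)
   also have "... <= \<eta> / 4 * 2" using \<eta> by (intro mult_left_mono sum_halves) auto
   finally show "(LINT t|leb01. indicator (\<Union>j<k. A' i j) t * norm (y (\<sigma> i) t)) <= \<eta> / 2" by simp
  qed
 qed
 define B where "B i = A (\<sigma> i) - W i" for i
 have B [measurable]: "B i \<in> sets borel" for i by (simp add: B_def)
 have disj: "disjoint_family_on B I" for I
 proof -
  have "B i \<inter> B j = {}" if "i < j" for i j
  proof -
   have "A (\<sigma> j) \<subseteq> W i" using that unfolding W_def A'_def by fastforce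
   then show ?thesis by (auto simp: B_def)
  qed
  then show ?thesis unfolding disjoint_family_on_def by (metis Int_commute linorder_neqE_nat)
 qed
 have bigB: "\<eta> / 2 <= (LINT t|leb01. indicator (B i) t * norm (y (\<sigma> i) t))" for i
 proof -
  have "(LINT t|leb01. indicator (A (\<sigma> i)) t * norm (y (\<sigma> i) t)) <=
    (LINT t|leb01. indicator (B i) t * norm (y (\<sigma> i) t) + indicator (W i) t * norm (y (\<sigma> i) t))"
   by (intro integral_mono intA integrable_add) (auto simp: B_def indicator_def)
  also have "... = (LINT t|leb01. indicator (B i) t * norm (y (\<sigma> i) t)) + (LINT t|leb01. indicator (W i) t * norm (y (\<sigma> i) t))"
   by (intro integral_add intA) simp_all
  finally show ?thesis using bigA[of "\<sigma> i"] Wle[of i] by linarith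
 qed
 \<comment> \<open>Integration of \<open>y (\<sigma> i)\<close> against this function gives the mass
   of \<open>y (\<sigma> i)\<close> on \<open>B i\<close>.\<close>
 define g where "g i t = indicator (B i) t * (of_real (norm (y (\<sigma> i) t)) / y (\<sigma> i) t)" for i t
 have [measurable]: "g i \<in> borel_measurable borel" for i unfolding g_def[abs_def] by measurable
 have ng: "norm (g i t) <= indicator (B i) t" for i t by (simp add: g_def norm_mult norm_divide indicator_def)
 have gbf: "bounded_functional (Lp_space 1) (Lp_pair (g i))" for i
  by (rule bounded_functional_Lp_bounded[where D = 1]) (auto intro: order_trans[OF ng] simp: indicator_def)
 have coef: "X.coef_est 1 1 (%i. Lp_pair (g i))"
  unfolding X.coef_est_def
 proof (intro conjI allI ballI gbf)
  fix m v assume v: "v \<in> X.V"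
  have f: "integrable leb01 (lp_rep v)" by (rule Lp1_norm_rep(1)[OF v])
  then have [measurable]: "lp_rep v \<in> borel_measurable borel" by (auto dest: borel_measurable_integrable)
  have intB: "integrable leb01 (%t. indicator (B i) t * norm (lp_rep v t))" for i
   by (rule integrable_bound[OF integrable_norm[OF f]]) (auto simp: indicator_def)
  have "norm (Lp_pair (g i) v) <= (LINT t|leb01. indicator (B i) t * norm (lp_rep v t))" for i
  proof -
   have pt: "norm (lp_rep v t * g i t) <= indicator (B i) t * norm (lp_rep v t)" for t
    using mult_right_mono[OF ng[of i t], of "norm (lp_rep v t)"] by (simp add: norm_mult mult.commute)
   have int: "integrable leb01 (%t. lp_rep v t * g i t)"
   proof (rule integrable_bound[OF intB[of i]])
    show "AE t in leb01. norm (lp_rep v t * g i t) <= norm (indicator (B i) t * norm (lp_rep v t))"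
     using pt by (intro AE_I2) (simp add: abs_mult)
   qed measurable
   have "norm (Lp_pair (g i) v) <= (LINT t|leb01. norm (lp_rep v t * g i t))"
    unfolding Lp_pair_def by (rule integral_norm_bound)
   also have "... <= (LINT t|leb01. indicator (B i) t * norm (lp_rep v t))"
    by (rule integral_mono[OF integrable_norm[OF int] intB pt])
   finally show ?thesis .
  qed
  then have "(\<Sum>i<m. norm (Lp_pair (g i) v)) <= (\<Sum>i<m. \<integral>t. indicator (B i) t * norm (lp_rep v t) \<partial>leb01)"
   by (intro sum_mono)
  also have "... = (LINT t|leb01. (\<Sum>i<m. indicator (B i) t * norm (lp_rep v t)))"
   by (rule integral_sum[symmetric]) (rule intB)
  also have "... <= (LINT t|leb01. norm (lp_rep v t))"
  proof (rule integral_mono[OF integrable_sum[OF intB] integrable_norm[OF f]])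
   fix t
   have "(\<Sum>i<m. indicator (B i) t * norm (lp_rep v t)) = indicator (\<Union>i<m. B i) t * norm (lp_rep v t)"
    unfolding sum_distrib_right[symmetric] indicator_UN_disjoint[OF finite_lessThan disj] ..
   also have "... <= 1 * norm (lp_rep v t)" by (rule mult_right_mono) (simp_all add: indicator_def)
   finally show "(\<Sum>i<m. indicator (B i) t * norm (lp_rep v t)) <= norm (lp_rep v t)" by simp
  qed
  also have "... = X.N v" by (rule Lp1_norm_rep(2)[OF v, symmetric])
  finally show "(\<Sum>i<m. norm (Lp_pair (g i) v) powr 1) <= (1 * X.N v) powr 1" using v by simp
 qed simp
 have val: "\<eta> / 2 <= norm (Lp_pair (g i) (U (x (\<sigma> i))))" for i
 proof -
  have "Lp_pair (g i) (U (x (\<sigma> i))) = (LINT t|leb01. of_real (indicator (B i) t * norm (y (\<sigma> i) t)))"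
   unfolding Lp_pair_def y_def[symmetric] by (intro integral_cong) (auto simp: g_def indicator_def)
  also have "... = of_real (LINT t|leb01. indicator (B i) t * norm (y (\<sigma> i) t))"
   by (rule integral_bounded_linear[OF bounded_linear_of_real intA]) simp
  finally show ?thesis using bigB[of i] by simp
 qed
 have "0 < \<eta> / 4" using \<eta> by simp
 from SS_ops_coefficients_vanish[OF order_refl _ coef U this] obtain m
  where m: "ALL i>=m. \<forall>x\<in>X.V. norm (Lp_pair (g i) (U x)) <= \<eta> / 4 * X.N x" by auto
 have "norm (Lp_pair (g m) (U (x (\<sigma> m)))) <= \<eta> / 4 * X.N (x (\<sigma> m))" using m x(1) by blast
 also have "... <= \<eta> / 4 * 1" using \<eta> x(2) by (intro mult_left_mono) auto
 finally show False using val[of m] \<eta> by simp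
qed

text \<open>The images of the normalised dyadic indicators form a bush. The increments of the bounded
 sequence $E_n$ of averages of \<open>sqrt (1 + |x|\<^sup>2)\<close> control its splitting, up to equi-integrability.\<close>
lemma SS_ops_L1_rademacher:
 fixes U :: "(real => 'k::{real_normed_field, banach, second_countable_topology}) set => (real => 'k) set"
 assumes U: "U \<in> SS_ops (Lp_space 1)"
 shows "(%n. nsp_norm (Lp_space 1) (U (lp_class (rademacher n)))) ----> 0"
proof -
 have p1: "1 <= (1::real)" by simp
 interpret X: normed_nspace "Lp_space 1 :: ((real => 'k) set, 'k) nspace" Lp_iota by (rule normed_nspace_Lp) simp
 have UL: "U \<in> Lops (Lp_space 1)" using U by (rule X.SS_ops_Lops)
 obtain D where D: "0 < D" "!!x. x \<in> X.V ==> X.N (U x) <= D * X.N x" using X.Lops_bounded[OF UL] by blast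
 define f :: "nat => nat => real => 'k" where "f n j x = 2 ^ n * indicator (dyadic n j) x" for n j x
 have [measurable]: "f n j \<in> borel_measurable borel" for n j unfolding f_def[abs_def] by measurable
 have f: "f n j \<in> Lpf 1 leb01" for n j
  by (rule unit.Lpf_bounded[where C = "2 ^ n"]) (auto simp: f_def norm_mult norm_power indicator_def)
 define d where "d n j = lp_class (f n j)" for n j
 have dV: "d n j \<in> X.V" for n j unfolding d_def by (rule Lp_carrierI[OF p1 f])
 have dN: "X.N (d n j) <= 1" if "j < 2 ^ n" for n j
 proof -
  have "X.N (d n j) = (LINT x|leb01. norm (f n j x))" unfolding d_def Lp_norm[OF p1 f] Lpn_1 ..
  also have "... = (LINT x|leb01. 2 ^ n * indicator (dyadic n j) x)"
   by (intro integral_cong) (auto simp: f_def norm_mult norm_power indicator_def)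
  also have "... = 1" using that by (simp add: measure_dyadic)
  finally show ?thesis by simp
 qed
 have UdV: "U (d n j) \<in> X.V" for n j using dV by (rule X.Lops_closed[OF UL])
 define G where "G n j = lp_rep (U (d n j))" for n j
 have G: "G n j \<in> Lpf 1 leb01" "U (d n j) = lp_class (G n j)" for n j
  using Lp_carrierD[OF p1 UdV] by (simp_all add: G_def)
 have Gi: "integrable leb01 (G n j)" for n j unfolding G_def by (rule Lp1_norm_rep(1)[OF UdV])
 then have [measurable]: "G n j \<in> borel_measurable borel" for n j by (auto dest: borel_measurable_integrable[of _ "G n j"])
 have GD: "(LINT x|leb01. norm (G n j x)) <= D" if "j < 2 ^ n" for n j
 proof -
  have "(LINT x|leb01. norm (G n j x)) = X.N (U (d n j))" unfolding G_def by (rule Lp1_norm_rep(2)[OF UdV, symmetric])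
  also have "... <= D * X.N (d n j)" by (rule D(2)[OF dV])
  also have "... <= D * 1" using D(1) dN[OF that] by (intro mult_left_mono) auto
  finally show ?thesis by simp
 qed
 define \<phi> where "\<phi> x = sqrt (1 + (norm x)\<^sup>2)" for x :: 'k
 have \<phi>_le: "\<phi> x <= 1 + norm x" for x unfolding \<phi>_def by (rule real_le_lsqrt) (auto simp: power2_sum)
 have \<phi>0: "0 <= \<phi> x" for x by (simp add: \<phi>_def)
 have [measurable]: "\<phi> \<in> borel_measurable borel" unfolding \<phi>_def[abs_def] by measurable
 have \<phi>i: "integrable leb01 (%x. \<phi> (h x))" if h: "integrable leb01 h" for h
 proof (rule integrable_bound[of _ "%x. 1 + norm (h x)"])
  show "integrable leb01 (%x. 1 + norm (h x))" using h by simp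
  have "h \<in> borel_measurable leb01" using h by simp
  then show "(%x. \<phi> (h x)) \<in> borel_measurable leb01" by measurable
  show "AE x in leb01. norm (\<phi> (h x)) <= norm (1 + norm (h x))"
   using \<phi>_le \<phi>0 by (intro AE_I2) (simp add: abs_of_nonneg)
 qed
 have avg: "AE x in leb01. G n j x = (1/2) * (G (Suc n) (2 * j) x + G (Suc n) (2 * j + 1) x)" for n j
 proof -
  have "f n j = (%x. (1/2) * (f (Suc n) (2 * j) x + f (Suc n) (2 * j + 1) x))"
   unfolding f_def indicator_dyadic_split[of n j] by (simp add: fun_eq_iff algebra_simps)
  then have "d n j = nsp_smul (Lp_space 1) (1/2) (nsp_add (Lp_space 1) (d (Suc n) (2 * j)) (d (Suc n) (2 * j + 1)))"
   unfolding d_def Lp_add[OF p1 f f] Lp_smul[OF p1 Lpf_add[OF f f p1]] by simp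
  then have "U (d n j) = nsp_smul (Lp_space 1) (1/2) (nsp_add (Lp_space 1) (U (d (Suc n) (2 * j))) (U (d (Suc n) (2 * j + 1))))"
   using dV by (simp add: X.Lops_smul[OF UL] X.Lops_add[OF UL])
  also have "... = lp_class (%x. (1/2) * (G (Suc n) (2 * j) x + G (Suc n) (2 * j + 1) x))"
   unfolding G(2) Lp_add[OF p1 G(1) G(1)] Lp_smul[OF p1 Lpf_add[OF G(1) G(1) p1]] ..
  finally have "G n j = lp_rep (lp_class (%x. (1/2) * (G (Suc n) (2 * j) x + G (Suc n) (2 * j + 1) x)))"
   by (simp add: G_def)
  then show ?thesis using lp_rep_class(2)[of "%x. (1/2) * (G (Suc n) (2 * j) x + G (Suc n) (2 * j + 1) x)"] by simp
 qed
 define E where "E n = (\<Sum>j<2 ^ n. \<integral>x. \<phi> (G n j x) \<partial>leb01) / 2 ^ n" for n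
 define gap where "gap n j x = \<phi> (G (Suc n) (2 * j) x) + \<phi> (G (Suc n) (2 * j + 1) x)
  - 2 * \<phi> ((1/2) * (G (Suc n) (2 * j) x + G (Suc n) (2 * j + 1) x))" for n j x
 have gap_i: "integrable leb01 (gap n j)" for n j
  unfolding gap_def[abs_def] by (intro integrable_diff integrable_add integrable_mult_right \<phi>i Gi)
 have gap_int: "(LINT x|leb01. gap n j x) = (LINT x|leb01. \<phi> (G (Suc n) (2 * j) x))
   + (LINT x|leb01. \<phi> (G (Suc n) (2 * j + 1) x)) - 2 * (LINT x|leb01. \<phi> (G n j x))" for n j
 proof -
  have "(LINT x|leb01. gap n j x) = (LINT x|leb01. \<phi> (G (Suc n) (2 * j) x) + \<phi> (G (Suc n) (2 * j + 1) x) - 2 * \<phi> (G n j x))"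
  proof (rule integral_cong_AE)
   show "AE x in leb01. gap n j x = \<phi> (G (Suc n) (2 * j) x) + \<phi> (G (Suc n) (2 * j + 1) x) - 2 * \<phi> (G n j x)"
    by (rule eventually_mono[OF avg[of n j]]) (simp only: gap_def)
  qed (simp_all add: gap_def[abs_def])
  then show ?thesis using \<phi>i[OF Gi] by simp
 qed
 \<comment> \<open>The image at a node is the mean of the images at its two children, so the average
   gap is the increment of \<open>E\<close> between consecutive levels.\<close>
 have gap_sum: "(\<Sum>j<2 ^ n. \<integral>x. gap n j x \<partial>leb01) / 2 ^ Suc n = E (Suc n) - E n" for n
 proof -
  have "(\<Sum>j<2 ^ n. \<integral>x. gap n j x \<partial>leb01) = (\<Sum>j<2 ^ Suc n. \<integral>x. \<phi> (G (Suc n) j x) \<partial>leb01) - 2 * (\<Sum>j<2 ^ n. \<integral>x. \<phi> (G n j x) \<partial>leb01)"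
   unfolding gap_int power_Suc sum_lessThan_double by (simp add: sum_subtractf sum_distrib_left)
  then show ?thesis by (simp add: E_def diff_divide_distrib)
 qed
 have gap0: "0 <= gap n j x" for n j x
  using sqrt_norm_gap(2)[of "G (Suc n) (2 * j) x" "G (Suc n) (2 * j + 1) x"] by (simp add: gap_def \<phi>_def)
 have Emono: "E n <= E (Suc n)" for n
 proof -
  have "0 <= (\<Sum>j<2 ^ n. \<integral>x. gap n j x \<partial>leb01) / 2 ^ Suc n"
   by (intro divide_nonneg_pos sum_nonneg integral_nonneg_AE) (auto simp: gap0)
  then show ?thesis unfolding gap_sum by simp
 qed
 have Ebd: "E n <= 1 + D" for n
 proof -
  have "(LINT x|leb01. \<phi> (G n j x)) <= 1 + D" if "j < 2 ^ n" for j
  proof -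
   have "(LINT x|leb01. \<phi> (G n j x)) <= (LINT x|leb01. 1 + norm (G n j x))"
    by (rule integral_mono[OF \<phi>i[OF Gi]]) (use Gi \<phi>_le in auto)
   also have "... = 1 + (LINT x|leb01. norm (G n j x))" using Gi[of n j] by simp
   finally show ?thesis using GD[OF that] by linarith
  qed
  then have "(\<Sum>j<2 ^ n. \<integral>x. \<phi> (G n j x) \<partial>leb01) <= (\<Sum>j<(2::nat) ^ n. 1 + D)" by (intro sum_mono) auto
  then show ?thesis by (simp add: E_def pos_divide_le_eq mult.commute)
 qed
 have "incseq E" by (rule incseq_SucI) (rule Emono)
 then obtain L where "E ----> L" by (rule incseq_convergent[of E "1 + D"]) (use Ebd in blast)+
 then have "convergent E" by (rule convergentI)
 then have E0: "(%n. E (Suc n) - E n) ----> 0" by (rule convergent_diff_null) (simp add: strict_mono_Suc_iff)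
 \<comment> \<open>A Rademacher function is half the average of the differences between siblings at
   the next level, being 1 on even and -1 on odd intervals.\<close>
 have r_eq: "lp_class (rademacher n) = lsum (Lp_space 1) (%_. 1 / 2 ^ Suc n) (%j. nsp_minus (Lp_space 1) (d (Suc n) (2 * j)) (d (Suc n) (2 * j + 1))) (2 ^ n)" for n
 proof -
  have "rademacher n = (%x. \<Sum>j<2 ^ n. (1 / 2 ^ Suc n) * (f (Suc n) (2 * j) x - f (Suc n) (2 * j + 1) x) :: 'k)"
   unfolding rademacher_def dyadic_step_def power_Suc sum_lessThan_double f_def
   by (simp add: fun_eq_iff algebra_simps)
  then show ?thesis unfolding d_def Lp_minus[OF p1 f f] Lp_lsum[OF p1 Lpf_diff[OF f f p1]] by simp
 qed
 show ?thesis
 proof (rule LIMSEQ_I)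
  fix e :: real assume e: "0 < e"
  \<comment> \<open>The two doubled tails cost e / 2, and \<open>norm_diff_le_gap\<close> costs
    another e / 2. So each pair of siblings costs e besides its gap, and the weights 1 / 2^(n+1)
    over 2^n pairs halve this.\<close>
  then have e8: "0 < e / 8" by simp
  from SS_ops_L1_equi_integrable[OF U e8] obtain m :: nat where m: "\<forall>x\<in>X.V. X.N x <= 1 -->
   (LINT t|leb01. indicator {y. real m < norm y} (lp_rep (U x) t) * norm (lp_rep (U x) t)) <= e / 8" by (elim exE)
  have tail: "(LINT t|leb01. indicator {y. real m < norm y} (G n j t) * norm (G n j t)) <= e / 8" if "j < 2 ^ n" for n j
   using m dV dN[OF that] unfolding G_def by blast
  have tail_i: "integrable leb01 (%t. indicator {y. real m < norm y} (G n j t) * norm (G n j t))" for n j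
   by (rule integrable_bound[OF integrable_norm[OF Gi[of n j]]]) (auto simp: indicator_def)
  define K where "K = 4 * (1 + real m) ^ 3 / (e / 2)"
  have K: "0 <= K" using e by (simp add: K_def)
  have diff: "X.N (nsp_minus (Lp_space 1) (U (d (Suc n) (2 * j))) (U (d (Suc n) (2 * j + 1)))) <= e + K * (LINT x|leb01. gap n j x)"
   if j: "j < 2 ^ n" for n j
  proof -
   let ?b = "G (Suc n) (2 * j)" and ?c = "G (Suc n) (2 * j + 1)"
   let ?t = "%h x. indicator {y. real m < norm y} (h x) * norm (h x) :: real"
   have "X.N (nsp_minus (Lp_space 1) (U (d (Suc n) (2 * j))) (U (d (Suc n) (2 * j + 1)))) = (LINT x|leb01. norm (?b x - ?c x))"
    unfolding G(2) Lp_minus[OF p1 G(1) G(1)] Lp_norm[OF p1 Lpf_diff[OF G(1) G(1) p1]] Lpn_1 ..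
   also have "... <= (LINT x|leb01. e / 2 + K * gap n j x + 2 * ?t ?b x + 2 * ?t ?c x)"
   proof (rule integral_mono)
    show "integrable leb01 (%x. norm (?b x - ?c x))" using Gi by auto
    show "integrable leb01 (%x. e / 2 + K * gap n j x + 2 * ?t ?b x + 2 * ?t ?c x)"
     by (intro integrable_add integrable_mult_right gap_i tail_i) simp
    show "norm (?b x - ?c x) <= e / 2 + K * gap n j x + 2 * ?t ?b x + 2 * ?t ?c x" for x
     using norm_diff_le_gap[of "e / 2" "real m" "?b x" "?c x"] e unfolding K_def gap_def \<phi>_def by simp
   qed
   also have "... = e / 2 + K * (LINT x|leb01. gap n j x) + 2 * (LINT x|leb01. ?t ?b x) + 2 * (LINT x|leb01. ?t ?c x)"
    using gap_i[of n j] tail_i[of "Suc n" "2 * j"] tail_i[of "Suc n" "2 * j + 1"] by simp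
   also have "... <= e + K * (LINT x|leb01. gap n j x)"
    using tail[of "2 * j" "Suc n"] tail[of "2 * j + 1" "Suc n"] j by simp
   finally show ?thesis .
  qed
  have main: "X.N (U (lp_class (rademacher n))) <= e / 2 + K * (E (Suc n) - E n)" for n
  proof -
   have "U (lp_class (rademacher n)) = lsum (Lp_space 1) (%_. 1 / 2 ^ Suc n) (%j. nsp_minus (Lp_space 1) (U (d (Suc n) (2 * j))) (U (d (Suc n) (2 * j + 1)))) (2 ^ n)"
    unfolding r_eq using dV by (simp add: X.Lops_lsum[OF UL] X.Lops_minus[OF UL])
   then have "X.N (U (lp_class (rademacher n))) <= (\<Sum>j<2 ^ n. norm (1 / 2 ^ Suc n :: 'k) * X.N (nsp_minus (Lp_space 1) (U (d (Suc n) (2 * j))) (U (d (Suc n) (2 * j + 1)))))"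
    using UdV by (simp only:) (rule X.norm_lsum, simp)
   also have "... <= (\<Sum>j<2 ^ n. 1 / 2 ^ Suc n * (e + K * (LINT x|leb01. gap n j x)))"
   proof (rule sum_mono)
    fix j :: nat assume "j \<in> {..<2 ^ n}"
    moreover have "norm (1 / 2 ^ Suc n :: 'k) = 1 / 2 ^ Suc n" by (simp add: norm_divide norm_mult norm_power)
    ultimately show "norm (1 / 2 ^ Suc n :: 'k) * X.N (nsp_minus (Lp_space 1) (U (d (Suc n) (2 * j))) (U (d (Suc n) (2 * j + 1)))) <=
      1 / 2 ^ Suc n * (e + K * (LINT x|leb01. gap n j x))"
     using diff[of j n] by (simp only:) (intro mult_left_mono, auto)
   qed
   also have "... = e / 2 + K * ((\<Sum>j<2 ^ n. \<integral>x. gap n j x \<partial>leb01) / 2 ^ Suc n)"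
   proof -
    have "(\<Sum>j<2 ^ n. 1 / 2 ^ Suc n * (e + K * (LINT x|leb01. gap n j x))) =
      (\<Sum>j<(2::nat) ^ n. 1 / 2 ^ Suc n * e) + 1 / 2 ^ Suc n * K * (\<Sum>j<2 ^ n. \<integral>x. gap n j x \<partial>leb01)"
     unfolding distrib_left sum.distrib by (simp add: sum_distrib_left mult.assoc)
    then show ?thesis by simp
   qed
   finally show ?thesis unfolding gap_sum .
  qed
  have "0 < e / 2 / (K + 1)" using e K by simp
  from LIMSEQ_D[OF E0 this] obtain n0 where n0: "!!n. n0 <= n ==> norm (E (Suc n) - E n - 0) < e / 2 / (K + 1)" by blast
  show "EX n0. ALL n>=n0. norm (X.N (U (lp_class (rademacher n))) - 0) < e"
  proof (intro exI[of _ n0] allI impI)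
   fix n assume "n0 <= n"
   have d0: "0 <= E (Suc n) - E n" using Emono[of n] by simp
   have "K * (E (Suc n) - E n) <= (K + 1) * (E (Suc n) - E n)" using d0 by (intro mult_right_mono) auto
   also have "... < e / 2"
   proof -
    have "E (Suc n) - E n < e / 2 / (K + 1)" using n0[OF \<open>n0 <= n\<close>] d0 by simp
    then show ?thesis using K by (subst (asm) pos_less_divide_eq) (auto simp: mult.commute)
   qed
   finally have "X.N (U (lp_class (rademacher n))) < e" using main[of n] by linarith
   moreover have "0 <= X.N (U (lp_class (rademacher n)))"
    by (intro X.norm_nonneg X.Lops_closed[OF UL] Lp_carrierI[OF p1] rademacher_Lpf p1)
   ultimately show "norm (X.N (U (lp_class (rademacher n))) - 0) < e" by simp
  qed
 qed
qed

section \<open>Assembly: weighted series operators on the direct sum\<close>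

text \<open>The indicator of the indices \<open>prod_encode (k, j)\<close>; for varying k these sets
  are disjoint and infinite.\<close>

definition block :: "nat => nat => 'k::real_normed_field" where
 "block k i = (if fst (prod_decode i) = k then 1 else 0)"

definition dsum_functionals :: "(nat => 'a => 'k) => nat => 'a \<times> 'a => 'k" where
 "dsum_functionals \<psi> m = (if even m then (%z. \<psi> (m div 2) (fst z)) else (%z. \<psi> (m div 2) (snd z)))"

context normed_nspace
begin

lemma series_op_at:
 assumes cp: "nsp_complete E" and rs: "0 < s" "s < r" and a: "coef_est s Ca a" and u: "upper_est r Cu u"
  and x: "x \<in> V" and ax: "!!i. a i x = (if i = n then t else 0)"
 shows "series_op a u x = t \<odot> u n"
proof (rule series_op_eqI[OF cp rs a u x])
 have V: "u n \<in> V" for n using u by (rule upper_est_in)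
 have "lsum E (%i. a i x) u m = t \<odot> u n" if "n < m" for m
 proof (rule iota_inject)
  fix b
  show "\<iota> (lsum E (%i. a i x) u m) b = \<iota> (t \<odot> u n) b"
   using V that by (simp add: ax if_distrib[of "%y. y * _"] cong: if_cong)
 qed (use V in auto)
 then have "\<forall>\<^sub>F m in sequentially. N (lsum E (%i. a i x) u m \<ominus> t \<odot> u n) = 0"
  using V by (intro eventually_sequentiallyI[of "Suc n"]) simp
 then show "nsp_lim E (%m. lsum E (%i. a i x) u m) (t \<odot> u n)"
  using V unfolding nsp_lim_def by (auto intro: tendsto_eventually)
qed

lemma coef_est_weight:
 assumes a: "coef_est s C a" and s: "0 < s" and \<theta>: "!!i. norm (\<theta> i) <= L" and L: "0 < L"
 shows "coef_est s (L * C) (%i x. \<theta> i * a i x)"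
 unfolding coef_est_def
proof (intro conjI allI ballI)
 have C: "0 < C" using a by (simp add: coef_est_def)
 then show "0 < L * C" using L by simp
 show "bounded_functional E (%x. \<theta> n * a n x)" for n
 proof -
  have b: "bounded_functional E (a n)" using a by (rule coef_est_bfun)
  obtain K where K: "0 < K" "!!x. x \<in> V ==> norm (a n x) <= K * N x" using bfun_bound[OF b] by blast
  have "norm (\<theta> n * a n x) <= (norm (\<theta> n) * K) * N x" if "x \<in> V" for x
   using mult_left_mono[OF K(2)[OF that], of "norm (\<theta> n)"] by (simp add: norm_mult mult.assoc)
  then show ?thesis unfolding bounded_functional_def
   by (auto simp: bfun_add[OF b] bfun_smul[OF b] distrib_left mult.left_commute intro!: exI[of _ "norm (\<theta> n) * K"])
 qed
 fix m x assume x: "x \<in> V"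
 have "(\<Sum>i<m. norm (\<theta> i * a i x) powr s) <= (\<Sum>i<m. L powr s * norm (a i x) powr s)"
 proof (rule sum_mono)
  fix i
  have "norm (\<theta> i * a i x) powr s = norm (\<theta> i) powr s * norm (a i x) powr s" by (simp add: norm_mult powr_mult)
  also have "... <= L powr s * norm (a i x) powr s" using \<theta> s by (intro mult_right_mono powr_mono2) auto
  finally show "norm (\<theta> i * a i x) powr s <= L powr s * norm (a i x) powr s" .
 qed
 also have "... <= L powr s * (C * N x) powr s"
  unfolding sum_distrib_left[symmetric] using a x by (intro mult_left_mono) (auto simp: coef_est_def)
 also have "... = (L * C * N x) powr s" using L C x by (simp add: powr_mult mult.assoc)
 finally show "(\<Sum>i<m. norm (\<theta> i * a i x) powr s) <= (L * C * N x) powr s" .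
qed

lemma series_op_linear:
 assumes cp: "nsp_complete E" and rs: "0 < s" "s < r" and u: "upper_est r Cu u"
  and a: "coef_est s Ca a" and b: "coef_est s Cb b" and ab: "coef_est s Cab (%i x. a i x + c * b i x)"
 shows "series_op (%i x. a i x + c * b i x) u = op_add E (series_op a u) (op_smul E c (series_op b u))"
proof (rule Lops_eqI)
 have V: "u n \<in> V" for n using u by (rule upper_est_in)
 show "series_op (%i x. a i x + c * b i x) u \<in> Lops E" by (rule series_op_Lops[OF cp rs ab u])
 show "op_add E (series_op a u) (op_smul E c (series_op b u)) \<in> Lops E"
  by (intro op_add_in op_smul_in series_op_Lops[OF cp rs a u] series_op_Lops[OF cp rs b u])
 fix x assume x: "x \<in> V"
 have eq: "lsum E (%i. a i x + c * b i x) u m = lsum E (%i. a i x) u m \<oplus> c \<odot> lsum E (%i. b i x) u m" for m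
  using V by (simp add: lsum_add lsum_smul)
 have "nsp_lim E (%m. lsum E (%i. a i x + c * b i x) u m) (series_op a u x \<oplus> c \<odot> series_op b u x)"
  unfolding eq using V
  by (intro nsp_lim_add nsp_lim_smul series_op_lim[OF cp rs a u x] series_op_lim[OF cp rs b u x]) auto
 then have "series_op (%i x. a i x + c * b i x) u x = series_op a u x \<oplus> c \<odot> series_op b u x"
  by (rule series_op_eqI[OF cp rs ab u x])
 then show "series_op (%i x. a i x + c * b i x) u x = op_add E (series_op a u) (op_smul E c (series_op b u)) x"
  using x by simp
qed

text \<open>The inclusion \<open>e\<close> is isometric and \<open>P\<close> is a contraction, so a
  subspace on which the entry is bounded below is carried to one on which \<open>U\<close> is.
  Completeness of \<open>E\<close> keeps the image closed.\<close>

lemma SS_ops_component: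
 fixes U :: "'a \<times> 'a => 'a \<times> 'a"
 assumes cp: "nsp_complete E" and U: "U \<in> SS_ops (dsum E)"
  and e: "e = (%x. (x, \<zero>)) \<or> e = (%x. (\<zero>, x))" and P: "P = fst \<or> P = snd"
 shows "restrict (%x. P (U (e x))) V \<in> SS_ops E"
proof -
 interpret Z: normed_nspace "dsum E" "dsum_iota \<iota>" by (rule normed_nspace_dsum)
 have UL: "U \<in> Lops (dsum E)" using U by (rule Z.SS_ops_Lops)
 have eV: "x \<in> V ==> e x \<in> Z.V" for x using e by auto
 have e_add: "x \<in> V ==> y \<in> V ==> e (x \<oplus> y) = nsp_add (dsum E) (e x) (e y)" for x y using e by auto
 have e_smul: "x \<in> V ==> e (c \<odot> x) = nsp_smul (dsum E) c (e x)" for x c using e by auto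
 have e_minus: "x \<in> V ==> y \<in> V ==> e (x \<ominus> y) = nsp_minus (dsum E) (e x) (e y)" for x y using e by auto
 have e_norm: "x \<in> V ==> Z.N (e x) = N x" for x using e by auto
 have e_zero: "e \<zero> = nsp_zero (dsum E)" using e by auto
 have e_lsum: "lsum (dsum E) c (%i. e (f i)) n = e (lsum E c f n)" if "!!i. i < n ==> f i \<in> V" for c f n
  using that by (induction n) (simp_all add: e_zero e_add e_smul)
 have PV: "z \<in> Z.V ==> P z \<in> V" for z using P by auto
 have P_add: "z \<in> Z.V ==> w \<in> Z.V ==> P (nsp_add (dsum E) z w) = P z \<oplus> P w" for z w using P by (cases z; cases w) auto
 have P_smul: "z \<in> Z.V ==> P (nsp_smul (dsum E) c z) = c \<odot> P z" for z c using P by (cases z) auto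
 have P_norm: "z \<in> Z.V ==> N (P z) <= Z.N z" for z using P by (cases z) auto
 obtain C where C: "0 < C" "!!z. z \<in> Z.V ==> Z.N (U z) <= C * Z.N z" using Z.Lops_bounded[OF UL] by blast
 have UeV: "x \<in> V ==> U (e x) \<in> Z.V" for x by (rule Z.Lops_closed[OF UL eV])
 have L: "restrict (%x. P (U (e x))) V \<in> Lops E"
 proof (rule LopsI[where C = C])
  fix x assume x: "x \<in> V"
  show "P (U (e x)) \<in> V" by (intro PV Z.Lops_closed[OF UL] eV x)
  show "P (U (e (x \<oplus> y))) = P (U (e x)) \<oplus> P (U (e y))" if y: "y \<in> V" for y
   using x y by (simp add: e_add Z.Lops_add[OF UL eV eV] P_add[OF UeV UeV])
  show "P (U (e (c \<odot> x))) = c \<odot> P (U (e x))" for c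
   using x by (simp add: e_smul Z.Lops_smul[OF UL eV] P_smul[OF UeV])
  have "N (P (U (e x))) <= Z.N (U (e x))" by (intro P_norm Z.Lops_closed[OF UL] eV x)
  also have "... <= C * Z.N (e x)" by (intro C(2) eV x)
  finally show "N (P (U (e x))) <= C * N x" by (simp add: e_norm x)
 qed
 have "\<not> (EX \<delta>>0. \<forall>x\<in>M. \<delta> * N x <= N (restrict (%x. P (U (e x))) V x))"
  if M: "lin_subspace E M" "closed_in_nsp E M" "inf_dim E M" for M
 proof
  have MV: "x \<in> M ==> x \<in> V" for x using M(1) by (auto simp: lin_subspace_def)
  assume "EX \<delta>>0. \<forall>x\<in>M. \<delta> * N x <= N (restrict (%x. P (U (e x))) V x)"
  then obtain \<delta> where \<delta>: "0 < \<delta>" "!!x. x \<in> M ==> \<delta> * N x <= N (P (U (e x)))" using MV by auto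
  have lin: "lin_subspace (dsum E) (e ` M)"
   unfolding lin_subspace_def
  proof (intro conjI ballI allI)
   show "e ` M \<subseteq> Z.V" using MV eV by blast
   show "nsp_zero (dsum E) \<in> e ` M" using M(1) e_zero[symmetric] by (auto simp: lin_subspace_def)
   fix z assume "z \<in> e ` M"
   then obtain x where x: "x \<in> M" "z = e x" by blast
   show "nsp_smul (dsum E) c z \<in> e ` M" for c
    using M(1) x MV by (auto simp: lin_subspace_def e_smul[symmetric])
   fix w assume "w \<in> e ` M"
   then obtain y where y: "y \<in> M" "w = e y" by blast
   show "nsp_add (dsum E) z w \<in> e ` M"
    using M(1) x y MV by (auto simp: lin_subspace_def e_add[symmetric])
  qed
  have cl: "closed_in_nsp (dsum E) (e ` M)"
   unfolding closed_in_nsp_def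
  proof (intro allI impI)
   fix z y assume z: "ALL n. z n \<in> e ` M" and y: "y \<in> Z.V" and lim: "(%n. Z.N (nsp_minus (dsum E) (z n) y)) ----> 0"
   from z have "ALL n. EX x. x \<in> M \<and> z n = e x" by blast
   from choice[OF this] obtain x where x: "!!n. x n \<in> M" "!!n. z n = e (x n)" by auto
   have xV: "x n \<in> V" for n using x(1) MV by blast
   have "nsp_cauchy E x"
    unfolding nsp_cauchy_def
   proof (intro allI impI)
    fix eps :: real assume "0 < eps"
    then have "0 < eps / 2" by simp
    from LIMSEQ_D[OF lim this] obtain k where k: "!!n. k <= n ==> norm (Z.N (nsp_minus (dsum E) (z n) y) - 0) < eps / 2" by blast
    show "EX k. ALL m>=k. ALL n>=k. N (x m \<ominus> x n) < eps"
    proof (intro exI[of _ k] allI impI)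
     fix m n assume mn: "k <= m" "k <= n"
     have zV: "z n \<in> Z.V" for n unfolding x(2) by (rule eV[OF xV])
     have "N (x m \<ominus> x n) = Z.N (nsp_minus (dsum E) (z m) (z n))"
      unfolding x(2) using xV by (simp add: e_norm flip: e_minus)
     also have "... <= Z.N (nsp_minus (dsum E) (z m) y) + Z.N (nsp_minus (dsum E) y (z n))"
      by (intro Z.norm_minus_triangle zV y)
     also have "Z.N (nsp_minus (dsum E) y (z n)) = Z.N (nsp_minus (dsum E) (z n) y)"
      by (intro Z.norm_minus_commute zV y)
     finally show "N (x m \<ominus> x n) < eps" using k[OF mn(1)] k[OF mn(2)] by (simp del: dsum_simps)
    qed
   qed
   from nsp_completeD[OF cp xV this] obtain l where l: "nsp_lim E x l" by blast
   have lM: "l \<in> M" by (rule closed_in_nspD[OF M(2) l x(1)])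
   have "nsp_lim (dsum E) z (e l)"
    using l lM MV xV unfolding nsp_lim_def x(2) by (auto simp: e_minus[symmetric] e_norm intro: eV simp del: dsum_simps)
   moreover have "nsp_lim (dsum E) z y" using y lim by (simp add: nsp_lim_def del: dsum_simps)
   ultimately have "e l = y" by (rule Z.nsp_lim_unique) (simp add: x(2) eV xV del: dsum_simps)
   then show "y \<in> e ` M" using lM by blast
  qed
  have "inf_dim (dsum E) (e ` M)"
   unfolding inf_dim_def
  proof
   fix n
   from M(3)[unfolded inf_dim_def, rule_format, of n]
   obtain f where f0: "ALL i<n. f i \<in> M" "ALL c. lsum E c f n = \<zero> --> (ALL i<n. c i = 0)" by (elim exE conjE)
   then have f: "!!i. i < n ==> f i \<in> M" "!!c. lsum E c f n = \<zero> ==> ALL i<n. c i = 0" by simp_all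
   show "EX f. (ALL i<n. f i \<in> e ` M) \<and> (ALL c. lsum (dsum E) c f n = nsp_zero (dsum E) --> (ALL i<n. c i = 0))"
   proof (intro exI[of _ "%i. e (f i)"] conjI)
    show "ALL i<n. e (f i) \<in> e ` M" using f(1) by blast
    show "ALL c. lsum (dsum E) c (%i. e (f i)) n = nsp_zero (dsum E) --> (ALL i<n. c i = 0)"
    proof (intro allI impI)
     fix c i assume c: "lsum (dsum E) c (%i. e (f i)) n = nsp_zero (dsum E)" and i: "i < n"
     have "e (lsum E c f n) = nsp_zero (dsum E)" using c f(1) MV by (subst (asm) e_lsum) auto
     then have "lsum E c f n = \<zero>" using e by auto
     then show "c i = 0" using f(2) i by blast
    qed
   qed
  qed
  moreover have "\<forall>z\<in>e ` M. \<delta> * Z.N z <= Z.N (U z)"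
  proof
   fix z assume "z \<in> e ` M"
   then obtain x where x: "x \<in> M" "z = e x" by blast
   have "\<delta> * Z.N z = \<delta> * N x" using x MV by (simp add: e_norm)
   also have "... <= N (P (U (e x)))" by (rule \<delta>(2)[OF x(1)])
   also have "... <= Z.N (U z)" unfolding x(2) by (intro P_norm Z.Lops_closed[OF UL] eV MV x)
   finally show "\<delta> * Z.N z <= Z.N (U z)" .
  qed
  ultimately show False using U lin cl \<delta>(1) unfolding SS_ops_def by blast
 qed
 with L show ?thesis unfolding SS_ops_def by blast
qed

lemma upper_est_Lops:
 assumes u: "upper_est r C u" and U: "U \<in> Lops E" and D: "0 < D" "!!x. x \<in> V ==> N (U x) <= D * N x"
 shows "upper_est r (D * C) (%i. U (u i))"
 unfolding upper_est_def
proof (intro conjI allI)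
 have V: "u n \<in> V" for n using u by (rule upper_est_in)
 show "0 <= D * C" using u D(1) by (simp add: upper_est_def)
 show "U (u n) \<in> V" for n using V by (rule Lops_closed[OF U])
 fix m c
 have "N (lsum E c (%i. U (u i)) m) = N (U (lsum E c u m))" using V by (simp add: Lops_lsum[OF U])
 also have "... <= D * N (lsum E c u m)" using V by (intro D(2)) simp
 also have "... <= D * (C * (\<Sum>i<m. norm (c i) powr r) powr (1 / r))"
  using u D(1) unfolding upper_est_def by (intro mult_left_mono) auto
 finally show "N (lsum E c (%i. U (u i)) m) <= D * C * (\<Sum>i<m. norm (c i) powr r) powr (1 / r)" by (simp add: mult.assoc)
qed

lemma coef_est_Lops:
 assumes a: "coef_est s C a" and s: "0 < s" and U: "U \<in> Lops E" and D: "0 < D" "!!x. x \<in> V ==> N (U x) <= D * N x"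
 shows "coef_est s (C * D) (%i x. a i (U x))"
 unfolding coef_est_def
proof (intro conjI allI ballI)
 have C: "0 < C" using a by (simp add: coef_est_def)
 then show "0 < C * D" using D(1) by simp
 show "bounded_functional E (%x. a n (U x))" for n by (rule bounded_functional_comp[OF coef_est_bfun[OF a] U])
 fix m x assume x: "x \<in> V"
 have UV: "U x \<in> V" using x by (rule Lops_closed[OF U])
 have "(\<Sum>i<m. norm (a i (U x)) powr s) <= (C * N (U x)) powr s" using a UV by (simp add: coef_est_def)
 also have "... <= (C * (D * N x)) powr s" using C s UV D(2)[OF x] by (intro powr_mono2 mult_left_mono) auto
 finally show "(\<Sum>i<m. norm (a i (U x)) powr s) <= (C * D * N x) powr s" by (simp add: mult.assoc)
qed

text \<open>\<open>U\<close> is moved to the vectors or to the functionals, so that compactness of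
  the products becomes smallness of one of the two sequences.\<close>

lemma op_comp_series_op:
 assumes cp: "nsp_complete E" and rs: "0 < s" "s < r" and a: "coef_est s Ca a" and u: "upper_est r Cu u" and U: "U \<in> Lops E"
 shows "op_comp E U (series_op a u) = series_op a (%i. U (u i))"
  and "op_comp E (series_op a u) U = series_op (%i x. a i (U x)) u"
proof -
 obtain D where D: "0 < D" "!!x. x \<in> V ==> N (U x) <= D * N x" using Lops_bounded[OF U] by blast
 note u' = upper_est_Lops[OF u U D] and a' = coef_est_Lops[OF a rs(1) U D]
 have V: "u n \<in> V" for n using u by (rule upper_est_in)
 note S = series_op_Lops[OF cp rs a u]
 show "op_comp E U (series_op a u) = series_op a (%i. U (u i))"
 proof (rule Lops_eqI[OF op_comp_in[OF U S] series_op_Lops[OF cp rs a u']])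
  fix x assume x: "x \<in> V"
  have "nsp_lim E (%m. U (lsum E (%i. a i x) u m)) (U (series_op a u x))"
   using V by (intro nsp_lim_Lops[OF U] series_op_lim[OF cp rs a u x]) simp
  then have "nsp_lim E (%m. lsum E (%i. a i x) (%i. U (u i)) m) (U (series_op a u x))" using V by (simp add: Lops_lsum[OF U])
  from series_op_eqI[OF cp rs a u' x this] show "op_comp E U (series_op a u) x = series_op a (%i. U (u i)) x" using x by simp
 qed
 show "op_comp E (series_op a u) U = series_op (%i x. a i (U x)) u"
 proof (rule Lops_eqI[OF op_comp_in[OF S U] series_op_Lops[OF cp rs a' u]])
  fix x assume x: "x \<in> V"
  from series_op_eqI[OF cp rs a' u x series_op_lim[OF cp rs a u Lops_closed[OF U x]]]
  show "op_comp E (series_op a u) U x = series_op (%i x. a i (U x)) u x" using x by simp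
 qed
qed

text \<open>The tool for reading off a coefficient modulo compact operators: if c were non-zero, the
  images of the bounded \<open>z j\<close> would be separated.\<close>

lemma K_ops_separated_multiples:
 assumes R: "R \<in> K_ops E" and z: "!!j. z j \<in> V" "!!j. N (z j) <= B" and y: "!!j. y j \<in> V"
  and d: "0 < d" "!!i j. i ~= j ==> d <= N (y i \<ominus> y j)" and Rz: "!!j :: nat. R (z j) = c \<odot> y j"
 shows "c = 0"
proof (rule ccontr)
 assume "c ~= 0"
 then have "0 < norm c * d" using d(1) by simp
 then show False
 proof (rule K_ops_separated[OF R z])
  fix i j :: nat assume "i ~= j"
  have "c \<odot> y i \<ominus> c \<odot> y j = c \<odot> (y i \<ominus> y j)" using y by (intro iota_inject) (auto simp: algebra_simps)
  then have "N (R (z i) \<ominus> R (z j)) = norm c * N (y i \<ominus> y j)" using y by (simp add: Rz)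
  then show "norm c * d <= N (R (z i) \<ominus> R (z j))" using d(2)[OF \<open>i ~= j\<close>] by (simp add: mult_left_mono)
 qed
qed

section \<open>The abstract system behind the cases p < 2 and p > 2\<close>

context
 fixes s r Ca Cu B d :: real and a :: "nat => 'a => 'k" and u w :: "nat => 'a" and \<psi> :: "nat => 'a => 'k"
 assumes cp: "nsp_complete E" and rs: "0 < s" "s < r" and a: "coef_est s Ca a" and u: "upper_est r Cu u"
  and psi: "!!m. bounded_functional E (\<psi> m)" and psep: "!!x. x \<in> V ==> (!!m. \<psi> m x = 0) ==> x = \<zero>"
  and w: "!!n. w n \<in> V" "!!n. N (w n) <= B" and aw: "!!m n. a m (w n) = (if m = n then 1 else 0)"
  and d: "0 < d" "!!m n. m ~= n ==> d <= N (u m \<ominus> u n)"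
  and vec: "!!U. U \<in> SS_ops E ==> (%n. N (U (u n))) ----> 0"
  and coefv: "!!U \<eta>. U \<in> SS_ops E ==> 0 < \<eta> ==> EX m. ALL i>=m. \<forall>x\<in>V. norm (a i (U x)) <= \<eta> * N x"
begin

interpretation Z: normed_nspace "dsum E" "dsum_iota \<iota>" by (rule normed_nspace_dsum)

abbreviation "u' \<equiv> %i. (u i, \<zero>)"
abbreviation "SX \<theta> \<equiv> series_op (%i x. \<theta> i * a i x) u"
abbreviation "SZ \<theta> \<equiv> Z.series_op (%i z. \<theta> i * a i (fst z)) u'"
abbreviation "S \<equiv> %k. corner E (SX (block k))"

lemma uV: "u n \<in> V" using u by (rule upper_est_in)

lemma lsum_zeros: "lsum E c (%_. \<zero>) n = \<zero>"
 by (rule iota_inject) auto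

lemma lsum_u': "lsum (dsum E) c u' n = (lsum E c u n, \<zero>)"
 by (simp add: lsum_dsum lsum_zeros)

lemma cpZ: "nsp_complete (dsum E)" by (rule dsum_complete[OF cp])

lemma uZ: "Z.upper_est r Cu u'"
 using u unfolding upper_est_def Z.upper_est_def by (simp add: lsum_u' del: lsum.simps)

lemma aZ: "Z.coef_est s Ca (%i z. a i (fst z))"
 unfolding Z.coef_est_def
proof (intro conjI allI ballI)
 show C: "0 < Ca" using a by (simp add: coef_est_def)
 show "bounded_functional (dsum E) (%z. a n (fst z))" for n by (rule bounded_functional_fst[OF coef_est_bfun[OF a]])
 fix m z assume "z \<in> Z.V"
 then obtain x y where z: "z = (x, y)" "x \<in> V" "y \<in> V" by auto
 have "(\<Sum>i<m. norm (a i x) powr s) <= (Ca * N x) powr s" using a z by (simp add: coef_est_def)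
 also have "... <= (Ca * (N x + N y)) powr s" using rs C z by (intro powr_mono2 mult_left_mono) auto
 finally show "(\<Sum>i<m. norm (a i (fst z)) powr s) <= (Ca * Z.N z) powr s" by (simp add: z)
qed

lemma weight: "(!!i. norm (\<theta> i) <= L) ==> 0 < L ==> Z.coef_est s (L * Ca) (%i z. \<theta> i * a i (fst z))"
 using Z.coef_est_weight[OF aZ rs(1)] by blast

lemma weightX: "(!!i. norm (\<theta> i) <= L) ==> 0 < L ==> coef_est s (L * Ca) (%i x. \<theta> i * a i x)"
 using coef_est_weight[OF a rs(1)] by blast

lemma norm_block: "norm (block k i) <= 1" by (simp add: block_def)

text \<open>The zero second component passes through the series. Off the carrier both sides are
  \<open>undefined\<close>, so they agree as functions.\<close>

lemma corner_SX:
 assumes \<theta>: "!!i. norm (\<theta> i) <= L" "0 < L"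
 shows "corner E (SX \<theta>) = SZ \<theta>"
proof
 note aX = weightX[OF \<theta>] and aZ' = weight[OF \<theta>]
 fix z :: "'a \<times> 'a"
 obtain x y where z: "z = (x, y)" by fastforce
 show "corner E (SX \<theta>) z = SZ \<theta> z"
 proof (cases "z \<in> Z.V")
  case True
  then have xy: "x \<in> V" "y \<in> V" by (simp_all add: z)
  have "nsp_lim (dsum E) (%m. (lsum E (%i. \<theta> i * a i x) u m, \<zero>)) (SX \<theta> x, \<zero>)"
  proof (rule nsp_lim_dsumI)
   show "nsp_lim E (%m. lsum E (%i. \<theta> i * a i x) u m) (SX \<theta> x)" by (rule series_op_lim[OF cp rs aX u xy(1)])
   show "nsp_lim E (%m. \<zero>) \<zero>" by (simp add: nsp_lim_def)
  qed (use uV in auto)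
  then have "nsp_lim (dsum E) (%m. lsum (dsum E) (%i. \<theta> i * a i (fst z)) u' m) (SX \<theta> x, \<zero>)"
   by (simp add: lsum_u' z del: lsum.simps)
  from Z.series_op_eqI[OF cpZ rs aZ' uZ True this] have "SZ \<theta> z = (SX \<theta> x, \<zero>)" .
  then show ?thesis using xy by (simp add: corner_def z)
 next
  case False
  then have "SZ \<theta> z = undefined" by (simp add: Z.series_op_def)
  then show ?thesis using False by (auto simp: corner_def z)
 qed
qed

lemma S_eq: "S k = SZ (block k)"
 by (rule corner_SX[OF norm_block]) simp

lemma SZ_at:
 assumes \<theta>: "!!i. norm (\<theta> i) <= L" "0 < L" and y: "y \<in> V"
 shows "SZ \<theta> (w n, y) = (\<theta> n \<odot> u n, \<zero>)" "SZ \<theta> (\<zero>, y) = (\<zero>, \<zero>)"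
proof -
 have "SZ \<theta> (w n, y) = nsp_smul (dsum E) (\<theta> n) (u n, \<zero>)"
  by (rule Z.series_op_at[OF cpZ rs weight[OF \<theta>] uZ]) (use w y in \<open>auto simp: aw\<close>)
 then show "SZ \<theta> (w n, y) = (\<theta> n \<odot> u n, \<zero>)" by simp
 have "SZ \<theta> (\<zero>, y) = nsp_smul (dsum E) 0 (u 0, \<zero>)"
  by (rule Z.series_op_at[OF cpZ rs weight[OF \<theta>] uZ]) (use y in \<open>auto simp: bfun_zero[OF coef_est_bfun[OF a]]\<close>)
 then show "SZ \<theta> (\<zero>, y) = (\<zero>, \<zero>)" using uV by simp
qed

lemma SX_at:
 assumes \<theta>: "!!i. norm (\<theta> i) <= L" "0 < L" shows "SX \<theta> (w n) = \<theta> n \<odot> u n"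
 by (rule series_op_at[OF cp rs weightX[OF \<theta>] u w(1)]) (simp add: aw)

lemma S_Lops: "S k \<in> Lops (dsum E)"
 unfolding S_eq by (rule Z.series_op_Lops[OF cpZ rs weight[OF norm_block] uZ]) simp

text \<open>A combination of generators is again one series operator, with weight \<open>c j\<close>
  on the j-th block, so finite strict singularity and non-compactness can be read off. The
  \<open>+ 1\<close> keeps the bound for the weights positive.\<close>

lemma lsum_S: "lsum (opsp (dsum E)) c S n = SZ (%i. \<Sum>j<n. c j * block j i)"
 and lsum_S_bound: "norm (\<Sum>j<n. c j * block j i) <= (\<Sum>j<n. norm (c j)) + 1"
proof -
 have bd: "norm (\<Sum>j<n. c j * block j i) <= (\<Sum>j<n. norm (c j)) + 1" for n i
 proof -
  have "norm (\<Sum>j<n. c j * block j i) <= (\<Sum>j<n. norm (c j))"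
   by (rule sum_norm_le) (simp add: norm_mult mult_left_le norm_block)
  then show ?thesis by simp
 qed
 then show "norm (\<Sum>j<n. c j * block j i) <= (\<Sum>j<n. norm (c j)) + 1" .
 have pos: "0 < (\<Sum>j<n. norm (c j)) + 1" for n by (simp add: add_nonneg_pos sum_nonneg)
 show "lsum (opsp (dsum E)) c S n = SZ (%i. \<Sum>j<n. c j * block j i)"
 proof (induction n)
  case 0
  have z: "norm ((%_. 0::'k) i) <= 1" for i :: nat by simp
  have "op_zero (dsum E) = SZ (%_. 0)"
  proof (rule Z.Lops_eqI[OF Z.op_zero_in Z.series_op_Lops[OF cpZ rs weight[OF z] uZ]])
   fix x assume x: "x \<in> Z.V"
   have "SZ (%_. 0) x = nsp_smul (dsum E) 0 (u 0, \<zero>)"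
    by (rule Z.series_op_at[OF cpZ rs weight[OF z] uZ x]) simp_all
   then show "op_zero (dsum E) x = SZ (%_. 0) x" using uV x by (simp add: Z.op_zero_apply[OF x])
  qed simp
  then show ?case by simp
 next
  case (Suc n)
  have eq: "(%i z. (\<Sum>j<Suc n. c j * block j i) * a i (fst z)) =
    (%i z. (\<Sum>j<n. c j * block j i) * a i (fst z) + c n * (block n i * a i (fst z)))"
   by (simp add: algebra_simps)
  have "Z.coef_est s (((\<Sum>j<Suc n. norm (c j)) + 1) * Ca) (%i z. (\<Sum>j<Suc n. c j * block j i) * a i (fst z))"
   by (rule weight[OF bd pos])
  note ab = this[unfolded eq]
  have "Z.series_op (%i z. (\<Sum>j<n. c j * block j i) * a i (fst z) + c n * (block n i * a i (fst z))) u' =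
    op_add (dsum E) (SZ (%i. \<Sum>j<n. c j * block j i)) (op_smul (dsum E) (c n) (SZ (block n)))"
   by (rule Z.series_op_linear[OF cpZ rs uZ weight[OF bd pos] weight[OF norm_block zero_less_one] ab])
  also have "... = op_add (dsum E) (lsum (opsp (dsum E)) c S n) (op_smul (dsum E) (c n) (S n))"
   unfolding Suc S_eq[of n] ..
  also have "... = lsum (opsp (dsum E)) c S (Suc n)" by simp
  finally show ?case unfolding eq by (rule sym)
 qed
qed

lemma block_sum: "fst (prod_decode i) = j ==> j < n ==> (\<Sum>l<n. c l * block l i) = c j"
 by (simp add: block_def if_distrib[of "%y. _ * y"] cong: if_cong)

lemma inj_block: "i ~= j ==> d <= N (u (prod_encode (k, i)) \<ominus> u (prod_encode (k, j)))"
 by (rule d(2)) (simp add: prod_encode_eq)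

text \<open>On the vectors \<open>w n\<close> with n in the i-th block the combination acts as
  \<open>c i\<close> times \<open>u n\<close>, and the \<open>u n\<close> are separated.\<close>

lemma S_indep:
 assumes K: "lsum (opsp (dsum E)) c S (Suc k) \<in> K_ops (dsum E)" and i: "i <= k"
 shows "c i = 0"
proof (rule Z.K_ops_separated_multiples[OF K, where z = "%j. (w (prod_encode (i, j)), \<zero>)" and y = "%j. (u (prod_encode (i, j)), \<zero>)", OF _ _ _ d(1)])
 have pos: "0 < (\<Sum>j<Suc k. norm (c j)) + 1" by (simp add: add_nonneg_pos sum_nonneg del: sum.lessThan_Suc)
 show "lsum (opsp (dsum E)) c S (Suc k) (w (prod_encode (i, j)), \<zero>) = nsp_smul (dsum E) (c i) (u (prod_encode (i, j)), \<zero>)" for j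
  unfolding lsum_S SZ_at(1)[OF lsum_S_bound pos zero_closed] using i by (simp add: block_sum del: sum.lessThan_Suc)
 show "Z.N (w (prod_encode (i, j)), \<zero>) <= B" for j using w(2) by simp
qed (use w uV inj_block in auto)

abbreviation "chainZ \<equiv> subideal_chain (dsum E) (K_ops (dsum E)) S"

lemma bounded_functional_dsum: "bounded_functional (dsum E) (dsum_functionals \<psi> m)"
 by (simp add: dsum_functionals_def bounded_functional_fst bounded_functional_snd psi)

lemma dsum_functionals_separating:
 assumes z: "z \<in> Z.V" and 0: "!!m. dsum_functionals \<psi> m z = 0" shows "z = nsp_zero (dsum E)"
proof -
 obtain x y where xy: "z = (x, y)" "x \<in> V" "y \<in> V" using z by auto
 have "\<psi> m x = 0" "\<psi> m y = 0" for m
  using 0[of "2 * m"] 0[of "2 * m + 1"] by (simp_all add: dsum_functionals_def xy)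
 then have "x = \<zero>" "y = \<zero>" using psep xy by blast+
 then show ?thesis using xy by simp
qed

text \<open>Modulo a compact operator a member is a weighted series operator, hence finitely
  strictly singular, and adding a compact operator keeps it strictly singular.\<close>

lemma chain_SS:
 assumes "T \<in> chainZ k" shows "T \<in> SS_ops (dsum E)"
proof -
 obtain c R where R: "R \<in> K_ops (dsum E)" "T = op_add (dsum E) (lsum (opsp (dsum E)) c S (Suc k)) R"
  by (rule Z.chain_decompose[OF S_Lops assms])
 have pos: "0 < (\<Sum>j<Suc k. norm (c j)) + 1" by (simp add: add_nonneg_pos sum_nonneg del: sum.lessThan_Suc)
 have "Z.fss (lsum (opsp (dsum E)) c S (Suc k))"
  unfolding lsum_S by (rule Z.series_op_fss[OF cpZ rs weight[OF lsum_S_bound pos] uZ])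
 from Z.fss_add_compact_SS[OF cpZ bounded_functional_dsum dsum_functionals_separating this R(1)]
 show ?thesis unfolding R(2) .
qed

text \<open>With \<open>U\<close> moved into the series, the vectors tend to 0 and the functionals
  shrink uniformly, because the entries of the operator matrix of \<open>U\<close> are strictly
  singular on \<open>E\<close>.\<close>

lemma S_absorb:
 assumes U: "U \<in> SS_ops (dsum E)"
 shows "op_comp (dsum E) U (S j) \<in> K_ops (dsum E) \<and> op_comp (dsum E) (S j) U \<in> K_ops (dsum E)"
proof
 have UL: "U \<in> Lops (dsum E)" using U by (rule Z.SS_ops_Lops)
 obtain D where D: "0 < D" "!!z. z \<in> Z.V ==> Z.N (U z) <= D * Z.N z" using Z.Lops_bounded[OF UL] by blast
 note wt = weight[OF norm_block zero_less_one]
 have comp: "restrict (%x. P (U (e x))) V \<in> SS_ops E"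
  if "e = (%x. (x, \<zero>)) \<or> e = (%x. (\<zero>, x))" "P = fst \<or> P = snd" for e P
  by (rule SS_ops_component[OF cp U that])
 show "op_comp (dsum E) U (S j) \<in> K_ops (dsum E)"
  unfolding S_eq Z.op_comp_series_op(1)[OF cpZ rs wt uZ UL]
 proof (rule Z.series_op_compact_vec[OF cpZ rs wt Z.upper_est_Lops[OF uZ UL D]])
  have "(%n. N (fst (U (u n, \<zero>))) + N (snd (U (u n, \<zero>)))) ----> 0 + 0"
   using vec[OF comp[of "%x. (x, \<zero>)" fst]] vec[OF comp[of "%x. (x, \<zero>)" snd]] uV
   by (intro tendsto_add) simp_all
  moreover have "Z.N z = N (fst z) + N (snd z)" for z by (cases z) simp
  ultimately show "(%n. Z.N (U (u n, \<zero>))) ----> 0" by simp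
 qed
 show "op_comp (dsum E) (S j) U \<in> K_ops (dsum E)"
  unfolding S_eq Z.op_comp_series_op(2)[OF cpZ rs wt uZ UL]
 proof (rule Z.series_op_compact_coef[OF cpZ rs Z.coef_est_Lops[OF wt rs(1) UL D] uZ])
  fix \<eta> :: real assume \<eta>: "0 < \<eta>"
  obtain m1 where m1: "ALL i>=m1. \<forall>x\<in>V. norm (a i (restrict (%x. fst (U (x, \<zero>))) V x)) <= \<eta> * N x"
   using coefv[OF comp[of "%x. (x, \<zero>)" fst] \<eta>] by auto
  obtain m2 where m2: "ALL i>=m2. \<forall>x\<in>V. norm (a i (restrict (%x. fst (U (\<zero>, x))) V x)) <= \<eta> * N x"
   using coefv[OF comp[of "%x. (\<zero>, x)" fst] \<eta>] by auto
  show "EX m. ALL i>=m. \<forall>z\<in>Z.V. norm (block j i * a i (fst (U z))) <= \<eta> * Z.N z"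
  proof (intro exI[of _ "max m1 m2"] allI impI ballI)
   fix i z assume i: "max m1 m2 <= i" and "z \<in> Z.V"
   then obtain x y where z: "z = (x, y)" "x \<in> V" "y \<in> V" by auto
   have UV: "U (x, \<zero>) \<in> Z.V" "U (\<zero>, y) \<in> Z.V" by (rule Z.Lops_closed[OF UL], use z in simp)+
   have "U z = nsp_add (dsum E) (U (x, \<zero>)) (U (\<zero>, y))"
    using z Z.Lops_add[OF UL, of "(x, \<zero>)" "(\<zero>, y)"] by simp
   then have "fst (U z) = fst (U (x, \<zero>)) \<oplus> fst (U (\<zero>, y))"
    by (cases "U (x, \<zero>)"; cases "U (\<zero>, y)") simp
   then have "a i (fst (U z)) = a i (fst (U (x, \<zero>))) + a i (fst (U (\<zero>, y)))"
    using UV by (simp add: bfun_add[OF coef_est_bfun[OF a]] mem_Times_iff)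
   moreover have "norm (a i (fst (U (x, \<zero>)))) <= \<eta> * N x" "norm (a i (fst (U (\<zero>, y)))) <= \<eta> * N y"
    using m1 m2 i z by auto
   ultimately have le: "norm (a i (fst (U z))) <= \<eta> * Z.N z"
    using norm_triangle_ineq[of "a i (fst (U (x, \<zero>)))" "a i (fst (U (\<zero>, y)))"] by (simp add: z distrib_left)
   have "norm (block j i * a i (fst (U z))) <= 1 * norm (a i (fst (U z)))"
    unfolding norm_mult by (intro mult_right_mono norm_block) simp
   then show "norm (block j i * a i (fst (U z))) <= \<eta> * Z.N z" using le by linarith
  qed
 qed
qed

lemma SX_SS: "SX (block k) \<in> SS_ops E"
 by (rule fss_SS[OF cp psi psep series_op_fss[OF cp rs weightX[OF norm_block zero_less_one] u]])

lemma SX_not_K: "SX (block k) \<notin> K_ops E"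
proof
 assume K: "SX (block k) \<in> K_ops E"
 have "(1::'k) = 0"
 proof (rule K_ops_separated_multiples[OF K, where z = "%j. w (prod_encode (k, j))" and y = "%j. u (prod_encode (k, j))", OF w(1) w(2) uV d(1) inj_block])
  show "SX (block k) (w (prod_encode (k, j))) = 1 \<odot> u (prod_encode (k, j))" for j
   unfolding SX_at[OF norm_block zero_less_one] by (simp add: block_def)
 qed
 then show False by simp
qed

text \<open>The witness \<open>J\<close> sends (x, y) to (y, 0). On vectors (0, y) all generators
  vanish, so a member of the chain acts there as a compact operator; but \<open>S 0\<close> after
  \<open>J\<close> sends (0, \<open>w n\<close>) to the separated vectors (\<open>u n\<close>, 0)
  for n in block 0.\<close>

lemma chain_not_ideal: "\<not> is_ideal (dsum E) (chainZ k)"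
proof
 assume ideal: "is_ideal (dsum E) (chainZ k)"
 define J where "J = restrict (%(x, y). (y, \<zero>)) Z.V"
 have J: "J \<in> Lops (dsum E)" unfolding J_def
  by (rule Z.LopsI[where C = 1]) auto
 have "S 0 \<in> chainZ k" by (rule Z.chain_contains[OF S_Lops]) simp
 then have "op_comp (dsum E) (S 0) J \<in> chainZ k" using ideal J by (simp add: is_ideal_def)
 then obtain c R where R: "R \<in> K_ops (dsum E)" "op_comp (dsum E) (S 0) J = op_add (dsum E) (lsum (opsp (dsum E)) c S (Suc k)) R"
  by (rule Z.chain_decompose[OF S_Lops])
 have pos: "0 < (\<Sum>j<Suc k. norm (c j)) + 1" by (simp add: add_nonneg_pos sum_nonneg del: sum.lessThan_Suc)
 have "(1::'k) = 0"
 proof (rule Z.K_ops_separated_multiples[OF R(1), where z = "%j. (\<zero>, w (prod_encode (0, j)))" and y = "%j. (u (prod_encode (0, j)), \<zero>)", OF _ _ _ d(1)])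
  fix j
  let ?w = "w (prod_encode (0, j))" and ?u = "u (prod_encode (0, j))"
  have wV: "(\<zero>, ?w) \<in> Z.V" using w by simp
  have RV: "R (\<zero>, ?w) \<in> Z.V" by (rule Z.Lops_closed[OF Z.K_ops_Lops[OF R(1)] wV])
  have J': "J (\<zero>, ?w) = (?w, \<zero>)" using wV by (simp add: J_def)
  have "S 0 (J (\<zero>, ?w)) = (?u, \<zero>)"
   unfolding S_eq J' SZ_at(1)[OF norm_block zero_less_one zero_closed] using uV by (simp add: block_def)
  moreover have "op_comp (dsum E) (S 0) J (\<zero>, ?w) = nsp_add (dsum E) (lsum (opsp (dsum E)) c S (Suc k) (\<zero>, ?w)) (R (\<zero>, ?w))"
   unfolding R(2) by (rule Z.op_add_apply[OF wV])
  moreover have "lsum (opsp (dsum E)) c S (Suc k) (\<zero>, ?w) = (\<zero>, \<zero>)"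
   unfolding lsum_S by (rule SZ_at(2)[OF lsum_S_bound pos w(1)])
  moreover have "nsp_add (dsum E) (\<zero>, \<zero>) (R (\<zero>, ?w)) = R (\<zero>, ?w)" using RV by (cases "R (\<zero>, ?w)") simp
  ultimately have "R (\<zero>, ?w) = (?u, \<zero>)" by (simp only: Z.op_comp_apply[OF wV])
  then show "R (\<zero>, ?w) = nsp_smul (dsum E) 1 (?u, \<zero>)" using uV by simp
  show "Z.N (\<zero>, ?w) <= B" using w(2) by simp
 qed (use w uV inj_block in auto)
 then show False by simp
qed

lemma chain_iso:
 assumes iso: "banach_alg_iso (dsum E) (chainZ k) (chainZ l) \<phi>" shows "k = l"
proof (rule Z.chain_not_iso[where S = S and k = k and r = l and ?z0.0 = "(w 0, \<zero>)" and \<phi> = \<phi>])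
 show "S k \<in> Lops (dsum E)" for k by (rule S_Lops)
 show "lsum (opsp (dsum E)) c S (Suc k) \<in> K_ops (dsum E) ==> i <= k ==> c i = 0" for k c i by (rule S_indep)
 show "banach_alg_iso (dsum E) (chainZ k) (chainZ l) \<phi>" by (rule iso)
next
 fix k A B' assume A: "A \<in> chainZ k" and B': "B' \<in> chainZ k"
 \<comment> \<open>The first factor is itself strictly singular, so multiplication inside the chain
   produces compact operators.\<close>
 have "op_comp (dsum E) A B' \<in> K_ops (dsum E)"
  using Z.chain_absorbs[OF S_Lops _ _ _ B', of A] S_absorb[OF chain_SS[OF A]] Z.chain_Lops[OF S_Lops A] by blast
 then show "op_comp (dsum E) A B' \<in> chainZ k" by (rule subsetD[OF Z.K_ops_chain[of S, OF S_Lops]])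
next
 show "(w 0, \<zero>) \<in> Z.V" using w by simp
 show "(w 0, \<zero>) ~= nsp_zero (dsum E)"
 proof
  assume "(w 0, \<zero>) = nsp_zero (dsum E)"
  then have "a 0 (w 0) = 0" using bfun_zero[OF coef_est_bfun[OF a]] by simp
  then show False by (simp add: aw)
 qed
 fix x assume "x \<in> Z.V" "x ~= nsp_zero (dsum E)"
 then show "EX f. bounded_functional (dsum E) f \<and> f x ~= 0"
  using dsum_functionals_separating bounded_functional_dsum by blast
qed

theorem subideal_chain_system:
 "EX T :: nat => 'a => 'a.
  (ALL k. T k \<in> SS_ops E \<and> T k \<notin> K_ops E) \<and>
  (ALL k. corner E (T k) \<in> SS_ops (dsum E)) \<and>
  (ALL k. subideal_chain (dsum E) (K_ops (dsum E)) (%j. corner E (T j)) k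
     \<subseteq> subideal_chain (dsum E) (K_ops (dsum E)) (%j. corner E (T j)) (Suc k)) \<and>
  (ALL k. closed_subideal (dsum E) (SS_ops (dsum E)) (subideal_chain (dsum E) (K_ops (dsum E)) (%j. corner E (T j)) k) \<and>
     \<not> is_ideal (dsum E) (subideal_chain (dsum E) (K_ops (dsum E)) (%j. corner E (T j)) k)) \<and>
  (ALL k r. k ~= r --> \<not> (EX \<phi>. banach_alg_iso (dsum E)
      (subideal_chain (dsum E) (K_ops (dsum E)) (%j. corner E (T j)) k)
      (subideal_chain (dsum E) (K_ops (dsum E)) (%j. corner E (T j)) r) \<phi>))"
proof (rule exI[of _ "%k. SX (block k)"], intro conjI allI)
 show "SX (block k) \<in> SS_ops E" "SX (block k) \<notin> K_ops E" for k by (rule SX_SS, rule SX_not_K)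
 show "S k \<in> SS_ops (dsum E)" for k by (rule chain_SS[OF Z.chain_contains[OF S_Lops order_refl]])
 show "chainZ k \<subseteq> chainZ (Suc k)" for k by (rule Z.chain_mono[OF S_Lops])
 show "closed_subideal (dsum E) (SS_ops (dsum E)) (chainZ k)" for k
  by (rule Z.closed_subideal_chain[OF S_Lops chain_SS S_absorb])
 show "\<not> is_ideal (dsum E) (chainZ k)" for k by (rule chain_not_ideal)
 show "k ~= r --> \<not> (EX \<phi>. banach_alg_iso (dsum E) (chainZ k) (chainZ r) \<phi>)" for k r using chain_iso by blast
qed

end

end

section \<open>Disjoint normalised indicators and the two concrete systems\<close>

text \<open>The half-open interval from 2^(-n-1) to 2^(-n).\<close>

definition bump_set :: "nat => real set" where "bump_set n = dyadic (Suc n) 1"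

definition bump :: "real => nat => real => 'k::real_normed_field" where
 "bump p n x = of_real ((2 ^ Suc n) powr (1 / p)) * indicator (bump_set n) x"

lemma bump_set_sets [measurable]: "bump_set n \<in> sets borel" by (simp add: bump_set_def)

lemma measure_bump_set: "measure leb01 (bump_set n) = 1 / 2 ^ Suc n"
 unfolding bump_set_def by (rule measure_dyadic) (rule one_less_power, simp_all)

lemma bump_set_disjoint: "m ~= n ==> bump_set m \<inter> bump_set n = {}"
proof -
 have "bump_set m \<inter> bump_set n = {}" if "m < n" for m n
 proof -
  have "real (Suc 1) / 2 ^ Suc n <= real 1 / 2 ^ Suc m"
  proof -
   have "(2::real) * 2 ^ Suc m <= 2 ^ Suc n"
    using power_increasing[of "Suc (Suc m)" "Suc n" "2::real"] that by simp
   then show ?thesis by (simp add: field_simps)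
  qed
  then show ?thesis by (auto simp: bump_set_def dyadic_def)
 qed
 then show "m ~= n ==> bump_set m \<inter> bump_set n = {}" by (metis Int_commute linorder_neqE_nat)
qed

lemma bump_measurable [measurable]:
 "(bump p n :: real => 'k::{real_normed_field, second_countable_topology}) \<in> borel_measurable borel"
 unfolding bump_def[abs_def] by measurable

lemma bump_Lpf:
 "1 <= p ==> 0 < p' ==> (bump p n :: real => 'k::{real_normed_field, banach, second_countable_topology}) \<in> Lpf p' leb01"
 by (rule unit.Lpf_bounded[where C = "(2 ^ Suc n) powr (1 / p)"]) (auto simp: bump_def norm_mult indicator_def)

text \<open>At each point at most one summand is non-zero, so the p-th power may be taken term by
  term.\<close>

lemma norm_sum_bump:
 fixes c :: "nat => 'k::real_normed_field"
 assumes p: "0 < p"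
 shows "norm (\<Sum>i<m. c i * bump p i x) powr p = (\<Sum>i<m. norm (c i) powr p * (2 ^ Suc i * indicator (bump_set i) x))"
proof (cases "EX k<m. x \<in> bump_set k")
 case True
 then obtain k where k: "k < m" "x \<in> bump_set k" by blast
 have ind: "i ~= k ==> x \<notin> bump_set i" for i using bump_set_disjoint[of i k] k(2) by blast
 have "(\<Sum>i<m. c i * bump p i x) = (\<Sum>i\<in>{k}. c i * bump p i x)"
  using k ind by (intro sum.mono_neutral_right) (auto simp: bump_def)
 moreover have "(\<Sum>i<m. norm (c i) powr p * (2 ^ Suc i * indicator (bump_set i) x)) = (\<Sum>i\<in>{k}. norm (c i) powr p * (2 ^ Suc i * indicator (bump_set i) x))"
  using k ind by (intro sum.mono_neutral_right) (auto simp: indicator_def)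
 moreover have "((2 ^ Suc k) powr (1 / p)) powr p = (2::real) ^ Suc k" using p by (simp only: powr_powr) simp
 ultimately show ?thesis using k by (simp add: bump_def norm_mult powr_mult del: power_Suc)
next
 case False
 then have "(\<Sum>i<m. c i * bump p i x) = 0" "(\<Sum>i<m. norm (c i) powr p * (2 ^ Suc i * indicator (bump_set i) x)) = 0"
  by (auto simp: bump_def intro!: sum.neutral)
 then show ?thesis using p by simp
qed

lemma Lpn_sum_bump:
 fixes c :: "nat => 'k::{real_normed_field, banach, second_countable_topology}"
 assumes p: "1 <= p"
 shows "Lpn p leb01 (%x. \<Sum>i<m. c i * bump p i x) = (\<Sum>i<m. norm (c i) powr p) powr (1 / p)"
proof -
 have int: "integrable leb01 (%x. norm (c i) powr p * (2 ^ Suc i * indicator (bump_set i) x))" for i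
  by (intro integrable_mult_right unit.integrable_const_bound[of _ 1]) (auto simp: indicator_def)
 have "(LINT x|leb01. norm (\<Sum>i<m. c i * bump p i x) powr p) = (\<Sum>i<m. \<integral>x. norm (c i) powr p * (2 ^ Suc i * indicator (bump_set i) x) \<partial>leb01)"
  using p by (subst norm_sum_bump) (simp_all add: integral_sum[OF int] del: power_Suc)
 also have "... = (\<Sum>i<m. norm (c i) powr p)" by (rule sum.cong) (simp_all add: measure_bump_set)
 finally show ?thesis by (simp add: Lpn_def)
qed

lemma integral_bump:
 "(LINT x|leb01. bump p n x * (of_real ((2 ^ Suc m) powr (1 - 1 / p)) * indicator (bump_set m) x))
  = (if m = n then 1 else (0::'k::{real_normed_field, banach, second_countable_topology}))"
proof (cases "m = n")
 case True
 have "(2 ^ Suc n) powr (1 / p) * (2 ^ Suc n) powr (1 - 1 / p) = (2::real) ^ Suc n"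
  unfolding powr_add[symmetric] by simp
 then have "bump p n x * (of_real ((2 ^ Suc n) powr (1 - 1 / p)) * indicator (bump_set n) x)
   = (of_real (2 ^ Suc n * indicator (bump_set n) x) :: 'k)" for x
  by (auto simp: bump_def indicator_def simp del: power_Suc simp flip: of_real_mult)
 moreover have "(LINT x|leb01. (of_real (2 ^ Suc n * indicator (bump_set n) x) :: 'k)) = of_real (LINT x|leb01. 2 ^ Suc n * indicator (bump_set n) x)"
  by (rule integral_bounded_linear[OF bounded_linear_of_real])
   (intro integrable_mult_right unit.integrable_const_bound[of _ 1]; auto simp: indicator_def)
 ultimately show ?thesis using True by (simp add: measure_bump_set)
next
 case False
 have z: "bump p n x * (of_real ((2 ^ Suc m) powr (1 - 1 / p)) * indicator (bump_set m) x) = (0::'k)" for x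
  using bump_set_disjoint[OF False] by (auto simp: bump_def indicator_def)
 show ?thesis unfolding z using False by simp
qed

text \<open>The functional sees only the restriction to \<open>bump_set n\<close>, and the Jensen
  type estimate \<open>Lpf_set_integral\<close> bounds it by 2 times the local L^p norm.
  Disjointness adds up the local p-th powers.\<close>

lemma coef_est_bump:
 assumes p: "1 <= p"
 shows "normed_nspace.coef_est (Lp_space p) p 2
  (%n. Lp_pair (%x. of_real ((2 ^ Suc n) powr (1 - 1 / p)) * indicator (bump_set n) x :: 'k::{real_normed_field, banach, second_countable_topology}))"
proof -
 interpret X: normed_nspace "Lp_space p :: ((real => 'k) set, 'k) nspace" Lp_iota by (rule normed_nspace_Lp[OF p])
 let ?g = "%n x. of_real ((2 ^ Suc n) powr (1 - 1 / p)) * indicator (bump_set n) x :: 'k"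
 show ?thesis unfolding X.coef_est_def
 proof (intro conjI allI ballI)
  show "bounded_functional (Lp_space p) (Lp_pair (?g n))" for n
   by (rule bounded_functional_Lp_bounded[OF p, where D = "(2 ^ Suc n) powr (1 - 1 / p)"])
    (auto simp: norm_mult indicator_def simp del: power_Suc)
  fix m A assume A: "A \<in> X.V"
  have f: "lp_rep A \<in> Lpf p leb01" "A = lp_class (lp_rep A)" using Lp_carrierD[OF p A] by simp_all
  have [measurable]: "lp_rep A \<in> borel_measurable borel" using Lpf_measurable[OF f(1)] by simp
  define I where "I n = (LINT x|leb01. indicator (bump_set n) x * norm (lp_rep A x) powr p)" for n
  have Ii: "integrable leb01 (%x. indicator (bump_set n) x * norm (lp_rep A x) powr p)" for n
   by (rule integrable_bound[OF Lpf_integrable[OF f(1)]]) (auto simp: indicator_def)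
  have I0: "0 <= I n" for n unfolding I_def by (rule integral_nonneg_AE) simp
  have an: "norm (Lp_pair (?g n) A) powr p <= 2 powr p * I n" for n
  proof -
   have pos: "0 < measure leb01 (bump_set n)" by (simp add: measure_bump_set)
   have "(LINT x|leb01. indicator (bump_set n) x * norm (lp_rep A x) powr p) <= (I n powr (1 / p)) powr p"
    using I0[of n] p by (simp add: powr_powr I_def)
   from unit.Lpf_set_integral[OF f(1) p _ pos this]
   have le: "(LINT x|leb01. indicator (bump_set n) x * norm (lp_rep A x)) <= 2 * measure leb01 (bump_set n) powr (1 - 1 / p) * I n powr (1 / p)"
    by simp
   have "norm (Lp_pair (?g n) A) <= (LINT x|leb01. norm (lp_rep A x * ?g n x))"
    unfolding Lp_pair_def by (rule integral_norm_bound)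
   also have "... = (LINT x|leb01. (2 ^ Suc n) powr (1 - 1 / p) * (indicator (bump_set n) x * norm (lp_rep A x)))"
    by (intro integral_cong) (auto simp: norm_mult indicator_def simp del: power_Suc)
   also have "... = (2 ^ Suc n) powr (1 - 1 / p) * (LINT x|leb01. indicator (bump_set n) x * norm (lp_rep A x))"
    by (simp del: power_Suc)
   also have "... <= (2 ^ Suc n) powr (1 - 1 / p) * (2 * measure leb01 (bump_set n) powr (1 - 1 / p) * I n powr (1 / p))"
    by (rule mult_left_mono[OF le]) simp
   also have "... = ((2 ^ Suc n) powr (1 - 1 / p) * (1 / 2 ^ Suc n) powr (1 - 1 / p)) * (2 * I n powr (1 / p))"
    by (simp add: measure_bump_set del: power_Suc)
   also have "(2 ^ Suc n) powr (1 - 1 / p) * (1 / 2 ^ Suc n) powr (1 - 1 / p) = (1::real)"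
    by (simp add: powr_divide del: power_Suc)
   finally have "norm (Lp_pair (?g n) A) powr p <= (2 * I n powr (1 / p)) powr p" using p by (intro powr_mono2) auto
   then show ?thesis using p I0[of n] by (simp add: powr_mult powr_powr)
  qed
  have "(\<Sum>i<m. norm (Lp_pair (?g i) A) powr p) <= (\<Sum>i<m. 2 powr p * I i)" by (intro sum_mono an)
  also have "... = 2 powr p * (\<Sum>i<m. I i)" by (simp add: sum_distrib_left)
  also have "(\<Sum>i<m. I i) = (LINT x|leb01. (\<Sum>i<m. indicator (bump_set i) x * norm (lp_rep A x) powr p))"
   unfolding I_def by (rule integral_sum[symmetric]) (rule Ii)
  also have "... <= (LINT x|leb01. norm (lp_rep A x) powr p)"
  proof (rule integral_mono[OF integrable_sum[OF Ii] Lpf_integrable[OF f(1)]])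
   fix x
   have disj: "disjoint_family_on bump_set {..<m}" using bump_set_disjoint by (auto simp: disjoint_family_on_def)
   have "(\<Sum>i<m. indicator (bump_set i) x * norm (lp_rep A x) powr p) = indicator (\<Union>i<m. bump_set i) x * norm (lp_rep A x) powr p"
    unfolding sum_distrib_right[symmetric] indicator_UN_disjoint[OF finite_lessThan disj] ..
   also have "... <= 1 * norm (lp_rep A x) powr p" by (rule mult_right_mono) (simp_all add: indicator_def)
   finally show "(\<Sum>i<m. indicator (bump_set i) x * norm (lp_rep A x) powr p) <= norm (lp_rep A x) powr p" by simp
  qed
  also have "... = X.N A powr p"
   using p Lp_norm[OF p f(1)] f(2) by (metis Lpn_powr less_le_trans zero_less_one)
  finally show "(\<Sum>i<m. norm (Lp_pair (?g i) A) powr p) <= (2 * X.N A) powr p" using A by (simp add: powr_mult mult_left_mono)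
 qed simp
qed

lemma upper_est_Lp_class:
 fixes f :: "nat => real => 'k::{real_normed_field, banach, second_countable_topology}"
 assumes p: "1 <= p" and f: "!!n. f n \<in> Lpf p leb01" and C: "0 <= C"
  and le: "!!m c. Lpn p leb01 (%x. \<Sum>i<m. c i * f i x) <= C * (\<Sum>i<m. norm (c i) powr r) powr (1 / r)"
 shows "normed_nspace.upper_est (Lp_space p) r C (%n. lp_class (f n))"
proof -
 interpret X: normed_nspace "Lp_space p :: ((real => 'k) set, 'k) nspace" Lp_iota by (rule normed_nspace_Lp[OF p])
 have "X.N (lsum (Lp_space p) c (%n. lp_class (f n)) m) = Lpn p leb01 (%x. \<Sum>i<m. c i * f i x)" for c m
  unfolding Lp_lsum[OF p f] by (rule Lp_norm[OF p]) (intro Lpf_sum Lpf_cmult f p; use p in simp)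
 then show ?thesis unfolding X.upper_est_def using C le Lp_carrierI[OF p f] by simp
qed

lemma Lp_norm_minus:
 assumes "1 <= p" "f \<in> Lpf p leb01" "g \<in> Lpf p leb01"
 shows "nsp_norm (Lp_space p) (nsp_minus (Lp_space p) (lp_class f) (lp_class g)) = Lpn p leb01 (%x. f x - g x)"
 using assms by (simp add: Lp_minus Lp_norm Lpf_diff)

theorem theorem3p4:
  fixes p :: real
  assumes "1 \<le> p" and "p \<noteq> 2"
  shows "\<exists>T :: nat \<Rightarrow> ((real \<Rightarrow> 'k::{real_normed_field,banach,second_countable_topology}) set
                        \<Rightarrow> (real \<Rightarrow> 'k) set).
    (\<forall>k. T k \<in> SS_ops (Lp_space p) \<and> T k \<notin> K_ops (Lp_space p)) \<and>
    (\<forall>k. corner (Lp_space p) (T k) \<in> SS_ops (dsum (Lp_space p))) \<and>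
    (\<forall>k. subideal_chain (dsum (Lp_space p)) (K_ops (dsum (Lp_space p))) (\<lambda>j. corner (Lp_space p) (T j)) k
         \<subseteq> subideal_chain (dsum (Lp_space p)) (K_ops (dsum (Lp_space p))) (\<lambda>j. corner (Lp_space p) (T j)) (Suc k)) \<and>
    (\<forall>k. closed_subideal (dsum (Lp_space p)) (SS_ops (dsum (Lp_space p)))
           (subideal_chain (dsum (Lp_space p)) (K_ops (dsum (Lp_space p))) (\<lambda>j. corner (Lp_space p) (T j)) k) \<and>
         \<not> is_ideal (dsum (Lp_space p))
           (subideal_chain (dsum (Lp_space p)) (K_ops (dsum (Lp_space p))) (\<lambda>j. corner (Lp_space p) (T j)) k)) \<and>
    (\<forall>k r. k \<noteq> r \<longrightarrow> \<not> (\<exists>\<phi>. banach_alg_iso (dsum (Lp_space p))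
           (subideal_chain (dsum (Lp_space p)) (K_ops (dsum (Lp_space p))) (\<lambda>j. corner (Lp_space p) (T j)) k)
           (subideal_chain (dsum (Lp_space p)) (K_ops (dsum (Lp_space p))) (\<lambda>j. corner (Lp_space p) (T j)) r)
           \<phi>))"
proof -
 note p = \<open>1 <= p\<close>
 interpret X: normed_nspace "Lp_space p :: ((real => 'k) set, 'k) nspace" Lp_iota by (rule normed_nspace_Lp[OF p])
 let ?b = "%n. lp_class (bump p n :: real => 'k)" and ?r = "%n. lp_class (rademacher n :: real => 'k)"
 have bF: "bump p n \<in> (Lpf p leb01 :: (real => 'k) set)" for n using p by (intro bump_Lpf) simp_all
 have rF: "rademacher n \<in> (Lpf p leb01 :: (real => 'k) set)" for n by (rule rademacher_Lpf[OF p])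
 have bV: "?b n \<in> X.V" and rV: "?r n \<in> X.V" for n by (rule Lp_carrierI[OF p bF], rule Lp_carrierI[OF p rF])
 have upb: "X.upper_est p 1 ?b"
  by (rule upper_est_Lp_class[OF p bF]) (simp_all add: Lpn_sum_bump[OF p])
 note psi = bounded_functional_Lp_test[OF p]
 have psep: "x = nsp_zero (Lp_space p)" if "x \<in> X.V" "!!m. Lp_test m x = 0" for x
  by (rule Lp_test_separating[OF p that])
 note cp = Lp_complete[OF p]
 have half: "0 < (1 / 2 :: real)" by simp
 consider "p < 2" | "2 < p" using \<open>p ~= 2\<close> by linarith
 then show ?thesis
 proof cases
  case 1
  have s: "p = min p 2" and r: "2 = max p 2" using 1 by simp_all
  have upr: "X.upper_est 2 2 ?r" by (rule upper_est_Lp_class[OF p rF _ rademacher_Lpn[OF p]]) (use 1 in simp_all)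
  have vec: "(%n. X.N (U (?r n))) ----> 0" if U: "U \<in> SS_ops (Lp_space p)" for U
  \<comment> \<open>At p = 1 there is no finite conjugate exponent, and the martingale argument
    takes over.\<close>
  proof (cases "p = 1")
   case True
   then show ?thesis using SS_ops_L1_rademacher U by blast
  next
   case False
   then have "1 < p" using p by simp
   from SS_ops_vectors_vanish[OF this r upr U] show ?thesis .
  qed
  show ?thesis
  \<comment> \<open>The bounded vectors biorthogonal to the functionals are the normalised
    indicators.\<close>
  proof (rule X.subideal_chain_system[OF cp _ 1 coef_est_bump[OF p] upr psi psep bV _ _ half _ vec SS_ops_coefficients_vanish[OF p s coef_est_bump[OF p]]])
   show "X.N (?b n) <= 1" for n by (rule X.upper_est_norm[OF upb])
   show "Lp_pair (%x. of_real ((2 ^ Suc m) powr (1 - 1 / p)) * indicator (bump_set m) x) (?b n) = (if m = n then 1 else 0)" for m n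
    using integral_bump[of p n m, where 'k = 'k] by (subst Lp_pair_class[OF p bF]) simp_all
   show "1 / 2 <= X.N (nsp_minus (Lp_space p) (?r m) (?r n))" if "m ~= n" for m n
    unfolding Lp_norm_minus[OF p rF rF] by (rule rademacher_separated[OF p _ that]) (use 1 in simp)
  qed (use p in simp_all)
 next
  case 2
  have p1: "1 < p" using 2 by simp
  have s: "2 = min p 2" and r: "p = max p 2" using 2 by simp_all
  define q where "q = p / (p - 1)"
  have q: "1 < q" "1 / p + 1 / q = 1" "q <= 2" using 2 by (simp_all add: q_def field_simps)
  have rbf: "bounded_functional (Lp_space p) (Lp_pair (rademacher n :: real => 'k))" for n
   by (rule bounded_functional_Lp_bounded[OF p, where D = 1]) (simp_all add: norm_rademacher_le)
  have coef: "X.coef_est 2 2 (%n. Lp_pair (rademacher n))"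
  \<comment> \<open>The lower 2-estimate in L^p is dual to the upper 2-estimate of Rademacher sums
    in L^q, where q is at most 2.\<close>
  proof (rule X.coef_est_of_dual_upper[OF rbf, of 2 2 2])
   fix m and b :: "nat => 'k" and A assume A: "A \<in> X.V"
   have f: "lp_rep A \<in> Lpf p leb01" "A = lp_class (lp_rep A)" using Lp_carrierD[OF p A] by simp_all
   have q1: "1 <= q" using q by simp
   note rq = rademacher_Lpf[OF q1, where 'k = 'k]
   have sd: "(%x. \<Sum>i<m. b i * rademacher i x) \<in> Lpf q leb01"
    by (intro Lpf_sum Lpf_cmult rq q1; use q1 in simp)
   have "(\<Sum>i<m. b i * Lp_pair (rademacher i) A) = (LINT x|leb01. lp_rep A x * (\<Sum>i<m. b i * rademacher i x))"
    unfolding Lp_pair_def sum_distrib_left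
    using holder(1)[OF f(1) rq p1 q(1,2)]
    by (subst integral_sum) (simp_all add: mult.left_commute[of _ "b _"])
   also have "norm ... <= Lpn p leb01 (lp_rep A) * Lpn q leb01 (%x. \<Sum>i<m. b i * rademacher i x)"
    by (rule holder(2)[OF f(1) sd p1 q(1,2)])
   also have "... <= Lpn p leb01 (lp_rep A) * (2 * (\<Sum>i<m. norm (b i) powr 2) powr (1 / 2))"
    by (intro mult_left_mono rademacher_Lpn q1 q(3)) simp
   also have "Lpn p leb01 (lp_rep A) = X.N A" using Lp_norm[OF p f(1)] f(2) by metis
   finally show "norm (\<Sum>i<m. b i * Lp_pair (rademacher i) A) <= 2 * (\<Sum>i<m. norm (b i) powr 2) powr (1 / 2) * X.N A"
    by (simp only: mult_ac)
  qed simp_all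
  show ?thesis
  \<comment> \<open>Here orthonormality makes the Rademacher functions biorthogonal to their own
    coefficient functionals.\<close>
  proof (rule X.subideal_chain_system[OF cp _ 2 coef upb psi psep rV _ _ half _ SS_ops_vectors_vanish[OF p1 r upb] SS_ops_coefficients_vanish[OF p s coef]])
   show "X.N (?r n) <= 1" for n
   proof -
    have "Lpn p leb01 (rademacher n :: real => 'k) <= 1"
    proof (rule Lpn_leI)
     have "(LINT x|leb01. norm (rademacher n x :: 'k) powr p) <= (LINT x|leb01. 1)"
      by (rule integral_mono[OF Lpf_integrable[OF rF]]) (use p in \<open>simp_all add: norm_rademacher_le powr_le1\<close>)
     then show "(LINT x|leb01. norm (rademacher n x :: 'k) powr p) <= 1 powr p" by simp
    qed (use p in simp_all)
    then show ?thesis by (simp add: Lp_norm[OF p rF])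
   qed
   show "Lp_pair (rademacher m) (?r n) = (if m = n then 1 else 0)" for m n
    using rademacher_orthonormal[of n m, where 'k = 'k] by (subst Lp_pair_class[OF p rF]) auto
   show "1 / 2 <= X.N (nsp_minus (Lp_space p) (?b m) (?b n))" if mn: "m ~= n" for m n
   proof -
    let ?c = "%i. if i = m then 1 else if i = n then -1 else (0::'k)"
    let ?N = "Suc (max m n)"
    have "(\<Sum>i<?N. ?c i * bump p i x) = (\<Sum>i\<in>{m, n}. ?c i * bump p i x)" for x
     by (rule sum.mono_neutral_cong_right) auto
    then have s: "(\<Sum>i<?N. ?c i * bump p i x) = bump p m x - bump p n x" for x using mn by simp
    have "(\<Sum>i<?N. norm (?c i) powr p) = (\<Sum>i\<in>{m, n}. 1)" by (rule sum.mono_neutral_cong_right) auto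
    then have "Lpn p leb01 (%x. bump p m x - bump p n x :: 'k) = 2 powr (1 / p)"
     using Lpn_sum_bump[OF p, of ?c ?N] mn unfolding s by simp
    moreover have "1 <= (2::real) powr (1 / p)" using p by (intro ge_one_powr_ge_zero) simp_all
    ultimately show ?thesis unfolding Lp_norm_minus[OF p bF bF] by simp
   qed
  qed simp_all
 qed
qed

end
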